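(* Let $\overline u\in U_{ad}$ be a local optimal control, with associated state $\overline y=\mathcal{S}(\overline u)$. Then the first-order optimality conditions hold: $\overline y\in Y$ satisfies the state equation $$-\operatorname{div}\frac{\nabla\overline y}{\mathcal{Q}(\overline y)}=\overline u\quad\text{in }\Omega,$$ there is an adjoint state $\overline\varphi$ satisfying the adjoint equation $$-\operatorname{div}\big(A[\overline y]\nabla\overline\varphi\big)=\overline y-y_d\ \text{ in }\Omega,\qquad\overline\varphi=0\ \text{ on }\partial\Omega,$$ where $$A[\overline y]=\frac{1}{\mathcal{Q}(\overline y)}\Big(I-\frac{\nabla\overline y\nabla\overline y^T}{\mathcal{Q}(\overline y)^2}\Big),$$ and the control satisfies $$\int_\Omega(\overline\varphi+\alpha\overline u)(u-\overline u)\ge0\quad\text{for all }u\in U_{ad}.$$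
   Context: Let $n\ge 1$, $\Omega\subset\mathbb{R}^n$ open and bounded with $C^{1,1}$ boundary, and fix a finite $p>n$. $\mathring{W}^1_r(\Omega)$ is the subspace of $W^1_r(\Omega)$ of functions with zero trace. The boundary datum $v\in W^2_p(\Omega)$ is fixed; $\mathcal{Q}(y)=(1+|\nabla y|^2)^{1/2}$; $Y:=\{y\in W^2_p(\Omega): y-v\in\mathring W^1_\infty(\Omega)\}$. The desired state is $y_d\in L^2(\Omega)$ and $\alpha>0$. $U_3\subset L^p(\Omega)$ is an open set containing $0$ on which the control-to-state map $\mathcal{S}:U_3\to Y$ is defined as the unique, twice continuously Fréchet differentiable map such that $y=\mathcal{S}(u)$ solves the state equation $-\operatorname{div}(\nabla y/\mathcal{Q}(y))=u$ in $\Omega$; its derivative is $D_u\mathcal S(u)=-[D_y\mathcal N(y,u)]^{-1}\circ D_u\mathcal N(y,u)$ with $\mathcal N(y,u)=-\operatorname{div}(\nabla y/\mathcal Q(y))-u$, $y=\mathcal S(u)$. Fix $B_1>1$ and $\mathbb{B}:=\{y\in Y:\|y\|_{W^2_p(\Omega)}\le B_1\}$; $C_S$ is the embedding constant of $W^2_p(\Omega)$ into $W^1_\infty(\Omega)$. For $y\in\mathbb{B}$, $T(y)=\tilde y\in Y$ solves $-(\mathcal{Q}(y)^2I-\nabla y\nabla y^T):D^2\tilde y=u\mathcal{Q}(y)^3$ in $\Omega$. $C_\Omega,B_2,B_3>0$ are fixed constants such that, whenever (a) $C_\Omega(\|v\|_{W^2_p}+B_2\|u\|_{L^p})\le B_1$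 and (b) $B_3(2\|u\|_{L^p}+\|v\|_{W^2_p})<1$, $T$ is a contraction of $\mathbb{B}$ into itself and the solution $y\in\mathbb{B}$ of the state equation satisfies $C_S\|y\|_{W^2_p(\Omega)}\le \frac{1}{B_1(1+C_S^2B_1^2)^{1/2}}$. $U:=\{u\in L^p(\Omega):\text{(a) and (b) hold}\}\cap U_3$, regarded as an open subset of $L^p(\Omega)$. $U_{ad}:=\{u\in L^2(\Omega):\|u\|_{L^p(\Omega)}\le\theta\}$, where $\theta>0$ is chosen such that $U_{ad}\subset U$. The reduced cost is $\mathcal{J}(u)=\frac12\|\mathcal{S}(u)-y_d\|_{L^2(\Omega)}^2+\frac{\alpha}{2}\|u\|_{L^2(\Omega)}^2$. A control $\overline u\in U_{ad}$ is a local optimal control (in the sense of $L^p(\Omega)$) if there is $\epsilon>0$ with $\mathcal{J}(u)\ge\mathcal{J}(\overline u)$ for all $u\in U_{ad}$ with $\|u-\overline u\|_{L^p(\Omega)}\le\epsilon$. *)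

theory Defs
  imports "HOL-Analysis.Analysis" "HOL-Probability.Essential_Supremum" "HOL-Library.Function_Algebras"
begin

text \<open>
  Elements of function spaces over \<open>\<Omega>\<close> are represented by functions on the whole of \<open>real^'n\<close>,
  considered up to equality almost everywhere on \<open>\<Omega>\<close>; the "norms" below are therefore seminorms
  on representatives, and equality in a function space means that the seminorm of the
  difference is zero.
\<close>

section \<open>Lebesgue spaces\<close>

definition Lspace :: "ennreal \<Rightarrow> 'a measure \<Rightarrow> ('a \<Rightarrow> 'b::euclidean_space) set" where
  "Lspace r M = {f \<in> borel_measurable M.
     if r = \<infinity> then esssup M (\<lambda>x. ennreal (norm (f x))) < \<infinity>
     else integrable M (\<lambda>x. norm (f x) powr enn2real r)}"

definition Lnorm :: "ennreal \<Rightarrow> 'a measure \<Rightarrow> ('a \<Rightarrow> 'b::euclidean_space) \<Rightarrow> real" where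
  "Lnorm r M f =
     (if r = \<infinity> then enn2real (esssup M (\<lambda>x. ennreal (norm (f x))))
      else (\<integral>x. norm (f x) powr enn2real r \<partial>M) powr (1 / enn2real r))"


section \<open>Weak derivatives and Sobolev spaces\<close>

primrec Ck :: "nat \<Rightarrow> (real^'n \<Rightarrow> real) \<Rightarrow> bool" where
  "Ck 0 f \<longleftrightarrow> continuous_on UNIV f"
| "Ck (Suc k) f \<longleftrightarrow> (\<forall>x. f differentiable (at x)) \<and>
     (\<forall>i. Ck k (\<lambda>x. frechet_derivative f (at x) (axis i 1)))"

definition grad :: "(real^'n \<Rightarrow> real) \<Rightarrow> real^'n \<Rightarrow> real^'n" where
  "grad f x = (\<chi> i. frechet_derivative f (at x) (axis i 1))"

definition test_functions :: "(real^'n) set \<Rightarrow> (real^'n \<Rightarrow> real) set" where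
  "test_functions \<Omega> = {\<psi>. (\<forall>k. Ck k \<psi>) \<and>
     compact (closure {x. \<psi> x \<noteq> 0}) \<and> closure {x. \<psi> x \<noteq> 0} \<subseteq> \<Omega>}"

definition loc_integrable :: "(real^'n) set \<Rightarrow> (real^'n \<Rightarrow> 'b::euclidean_space) \<Rightarrow> bool" where
  "loc_integrable \<Omega> f \<longleftrightarrow> (\<forall>K. compact K \<and> K \<subseteq> \<Omega> \<longrightarrow> integrable (lebesgue_on K) f)"

definition has_weak_grad ::
  "(real^'n) set \<Rightarrow> (real^'n \<Rightarrow> real) \<Rightarrow> (real^'n \<Rightarrow> real^'n) \<Rightarrow> bool" where
  "has_weak_grad \<Omega> f F \<longleftrightarrow> loc_integrable \<Omega> f \<and> loc_integrable \<Omega> F \<and>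
     (\<forall>\<psi>\<in>test_functions \<Omega>.
        (\<integral>x. f x *\<^sub>R grad \<psi> x \<partial>lebesgue_on \<Omega>) = - (\<integral>x. \<psi> x *\<^sub>R F x \<partial>lebesgue_on \<Omega>))"

definition has_weak_div ::
  "(real^'n) set \<Rightarrow> (real^'n \<Rightarrow> real^'n) \<Rightarrow> (real^'n \<Rightarrow> real) \<Rightarrow> bool" where
  "has_weak_div \<Omega> F g \<longleftrightarrow> loc_integrable \<Omega> F \<and> loc_integrable \<Omega> g \<and>
     (\<forall>\<psi>\<in>test_functions \<Omega>.
        (\<integral>x. F x \<bullet> grad \<psi> x \<partial>lebesgue_on \<Omega>) = - (\<integral>x. g x * \<psi> x \<partial>lebesgue_on \<Omega>))"

text \<open>
  Weak gradient and weak divergence are unique almost everywhere in \<open>\<Omega>\<close>; the following choose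
  representatives, and nothing below depends on the choice.
\<close>

definition wgrad :: "(real^'n) set \<Rightarrow> (real^'n \<Rightarrow> real) \<Rightarrow> real^'n \<Rightarrow> real^'n" where
  "wgrad \<Omega> f = (SOME F. has_weak_grad \<Omega> f F)"

definition wdiv :: "(real^'n) set \<Rightarrow> (real^'n \<Rightarrow> real^'n) \<Rightarrow> real^'n \<Rightarrow> real" where
  "wdiv \<Omega> F = (SOME g. has_weak_div \<Omega> F g)"

definition whess :: "(real^'n) set \<Rightarrow> (real^'n \<Rightarrow> real) \<Rightarrow> real^'n \<Rightarrow> real^'n^'n" where
  "whess \<Omega> f x = (\<chi> i. wgrad \<Omega> (\<lambda>z. wgrad \<Omega> f z $ i) x)"

definition W1 :: "(real^'n) set \<Rightarrow> ennreal \<Rightarrow> (real^'n \<Rightarrow> real) set" where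
  "W1 \<Omega> r = {f \<in> Lspace r (lebesgue_on \<Omega>).
     (\<exists>F. has_weak_grad \<Omega> f F) \<and> wgrad \<Omega> f \<in> Lspace r (lebesgue_on \<Omega>)}"

definition W2 :: "(real^'n) set \<Rightarrow> ennreal \<Rightarrow> (real^'n \<Rightarrow> real) set" where
  "W2 \<Omega> r = {f \<in> W1 \<Omega> r. \<forall>i. (\<lambda>x. wgrad \<Omega> f x $ i) \<in> W1 \<Omega> r}"

definition W1_norm :: "(real^'n) set \<Rightarrow> ennreal \<Rightarrow> (real^'n \<Rightarrow> real) \<Rightarrow> real" where
  "W1_norm \<Omega> r f = Lnorm r (lebesgue_on \<Omega>) f + Lnorm r (lebesgue_on \<Omega>) (wgrad \<Omega> f)"

definition W2_norm :: "(real^'n) set \<Rightarrow> ennreal \<Rightarrow> (real^'n \<Rightarrow> real) \<Rightarrow> real" where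
  "W2_norm \<Omega> r f = W1_norm \<Omega> r f + Lnorm r (lebesgue_on \<Omega>) (whess \<Omega> f)"


section \<open>Boundary regularity, surface measure and trace\<close>

text \<open>
  Near each boundary point \<open>\<Omega>\<close> is the set above the graph, in direction \<open>\<nu>\<close>, of a
  \<open>C\<^sup>1\<^sup>,\<^sup>1\<close> function of the coordinates orthogonal to \<open>\<nu>\<close>. Only the restriction of
  \<open>\<gamma>\<close> to the hyperplane orthogonal to \<open>\<nu>\<close> matters.
\<close>

definition C11_boundary :: "(real^'n) set \<Rightarrow> bool" where
  "C11_boundary \<Omega> \<longleftrightarrow> (\<forall>x0\<in>frontier \<Omega>. \<exists>r>0. \<exists>\<nu> \<gamma> G L.
     norm \<nu> = 1 \<and>
     (\<forall>x. (\<gamma> has_derivative (\<lambda>h. G x \<bullet> h)) (at x)) \<and> L-lipschitz_on UNIV G \<and>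
     \<Omega> \<inter> ball x0 r = {x \<in> ball x0 r. x \<bullet> \<nu> > \<gamma> (x - (x \<bullet> \<nu>) *\<^sub>R \<nu>)})"

text \<open>
  The \<open>s\<close>-dimensional Hausdorff measure. The empty set is treated separately so that
  it has weight \<open>0\<close> also for \<open>s = 0\<close> (where the result is the counting measure).
  Being a metric outer measure, \<open>hausdorff_outer s\<close> is countably additive on Borel sets, so that
  \<open>measure_of\<close> does not fall back to the zero measure.
\<close>

definition hausdorff_weight :: "nat \<Rightarrow> (real^'n) set \<Rightarrow> ennreal" where
  "hausdorff_weight s C =
     (if C = {} then 0 else ennreal (unit_ball_vol (real s) * (diameter C / 2) ^ s))"

definition hausdorff_outer :: "nat \<Rightarrow> (real^'n) set \<Rightarrow> ennreal" where
  "hausdorff_outer s E = (SUP \<delta>\<in>{0<..}.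
     INF C\<in>{C :: nat \<Rightarrow> (real^'n) set.
               E \<subseteq> (\<Union>i. C i) \<and> (\<forall>i. bounded (C i) \<and> diameter (C i) \<le> \<delta>)}.
       (\<Sum>i. hausdorff_weight s (C i)))"

definition hausdorff_measure :: "nat \<Rightarrow> (real^'n) measure" where
  "hausdorff_measure s = measure_of UNIV (sets borel) (hausdorff_outer s)"

definition surface_measure :: "(real^'n) set \<Rightarrow> (real^'n) measure" where
  "surface_measure \<Omega> = restrict_space (hausdorff_measure (CARD('n) - 1)) (frontier \<Omega>)"

text \<open>
  The trace is the continuous extension to \<open>W\<^sup>1\<^sub>r\<close>, with values in \<open>L\<^sup>r(\<partial>\<Omega>)\<close>, of the restriction
  to \<open>\<partial>\<Omega>\<close> of functions of \<open>W\<^sup>1\<^sub>r\<close> that are continuous on the closure of \<open>\<Omega>\<close>. Formulated with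
  continuous (rather than smooth) functions, this covers \<open>r = \<infinity>\<close> as well.
\<close>

definition has_trace ::
  "(real^'n) set \<Rightarrow> ennreal \<Rightarrow> (real^'n \<Rightarrow> real) \<Rightarrow> (real^'n \<Rightarrow> real) \<Rightarrow> bool" where
  "has_trace \<Omega> r f g \<longleftrightarrow> (\<exists>F :: nat \<Rightarrow> real^'n \<Rightarrow> real.
     (\<forall>k. F k \<in> W1 \<Omega> r \<and> continuous_on (closure \<Omega>) (F k) \<and>
          F k - g \<in> Lspace r (surface_measure \<Omega>)) \<and>
     (\<lambda>k. W1_norm \<Omega> r (F k - f)) \<longlonglongrightarrow> 0 \<and>
     (\<lambda>k. Lnorm r (surface_measure \<Omega>) (F k - g)) \<longlonglongrightarrow> 0)"

definition W1_0 :: "(real^'n) set \<Rightarrow> ennreal \<Rightarrow> (real^'n \<Rightarrow> real) set" where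
  "W1_0 \<Omega> r = {f \<in> W1 \<Omega> r. has_trace \<Omega> r f (\<lambda>x. 0)}"


section \<open>Differential calculus in function spaces\<close>

text \<open>
  A function space is given by its set of representatives \<open>X\<close> and a seminorm \<open>nX\<close>.
\<close>

definition bounded_lin_op ::
  "('a \<Rightarrow> real) set \<Rightarrow> (('a \<Rightarrow> real) \<Rightarrow> real) \<Rightarrow> ('b \<Rightarrow> real) set \<Rightarrow> (('b \<Rightarrow> real) \<Rightarrow> real)
    \<Rightarrow> (('a \<Rightarrow> real) \<Rightarrow> 'b \<Rightarrow> real) \<Rightarrow> bool" where
  "bounded_lin_op X nX Z nZ D \<longleftrightarrow>
     (\<forall>h\<in>X. D h \<in> Z) \<and>
     (\<forall>h\<in>X. \<forall>k\<in>X. nZ (D (h + k) - (D h + D k)) = 0) \<and>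
     (\<forall>h\<in>X. \<forall>c. nZ (D (\<lambda>x. c * h x) - (\<lambda>x. c * D h x)) = 0) \<and>
     (\<exists>C. \<forall>h\<in>X. nZ (D h) \<le> C * nX h)"

text \<open>
  \<open>A\<close> is an affine space with direction space \<open>X\<close>, or an open subset of one, and \<open>F\<close> is a map
  from \<open>A\<close> to an affine space with direction space \<open>Z\<close>.
\<close>

definition has_fderiv_at ::
  "('a \<Rightarrow> real) set \<Rightarrow> ('a \<Rightarrow> real) set \<Rightarrow> (('a \<Rightarrow> real) \<Rightarrow> real)
    \<Rightarrow> ('b \<Rightarrow> real) set \<Rightarrow> (('b \<Rightarrow> real) \<Rightarrow> real)
    \<Rightarrow> (('a \<Rightarrow> real) \<Rightarrow> 'b \<Rightarrow> real) \<Rightarrow> ('a \<Rightarrow> real) \<Rightarrow> (('a \<Rightarrow> real) \<Rightarrow> 'b \<Rightarrow> real) \<Rightarrow> bool" where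
  "has_fderiv_at A X nX Z nZ F u D \<longleftrightarrow>
     bounded_lin_op X nX Z nZ D \<and>
     (\<forall>\<epsilon>>0. \<exists>\<delta>>0. \<forall>w\<in>A. nX (w - u) < \<delta> \<longrightarrow>
        nZ (F w - F u - D (w - u)) \<le> \<epsilon> * nX (w - u))"

text \<open>
  \<open>D2\<close> is the derivative of \<open>D\<close> at \<open>u\<close> with respect to the operator norm; \<open>D2 k h\<close> is the
  second derivative in the directions \<open>k\<close> and \<open>h\<close>.
\<close>

definition has_second_fderiv_at ::
  "('a \<Rightarrow> real) set \<Rightarrow> ('a \<Rightarrow> real) set \<Rightarrow> (('a \<Rightarrow> real) \<Rightarrow> real)
    \<Rightarrow> ('b \<Rightarrow> real) set \<Rightarrow> (('b \<Rightarrow> real) \<Rightarrow> real)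
    \<Rightarrow> (('a \<Rightarrow> real) \<Rightarrow> ('a \<Rightarrow> real) \<Rightarrow> 'b \<Rightarrow> real) \<Rightarrow> ('a \<Rightarrow> real)
    \<Rightarrow> (('a \<Rightarrow> real) \<Rightarrow> ('a \<Rightarrow> real) \<Rightarrow> 'b \<Rightarrow> real) \<Rightarrow> bool" where
  "has_second_fderiv_at A X nX Z nZ D u D2 \<longleftrightarrow>
     (\<forall>k\<in>X. bounded_lin_op X nX Z nZ (D2 k)) \<and>
     (\<forall>h\<in>X. bounded_lin_op X nX Z nZ (\<lambda>k. D2 k h)) \<and>
     (\<exists>C. \<forall>k\<in>X. \<forall>h\<in>X. nZ (D2 k h) \<le> C * nX k * nX h) \<and>
     (\<forall>\<epsilon>>0. \<exists>\<delta>>0. \<forall>w\<in>A. nX (w - u) < \<delta> \<longrightarrow>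
        (\<forall>h\<in>X. nZ (D w h - D u h - D2 (w - u) h) \<le> \<epsilon> * nX (w - u) * nX h))"

definition C2_map ::
  "('a \<Rightarrow> real) set \<Rightarrow> ('a \<Rightarrow> real) set \<Rightarrow> (('a \<Rightarrow> real) \<Rightarrow> real)
    \<Rightarrow> ('b \<Rightarrow> real) set \<Rightarrow> (('b \<Rightarrow> real) \<Rightarrow> real)
    \<Rightarrow> (('a \<Rightarrow> real) \<Rightarrow> 'b \<Rightarrow> real) \<Rightarrow> (('a \<Rightarrow> real) \<Rightarrow> ('a \<Rightarrow> real) \<Rightarrow> 'b \<Rightarrow> real) \<Rightarrow> bool" where
  "C2_map A X nX Z nZ F DF \<longleftrightarrow>
     (\<forall>u\<in>A. has_fderiv_at A X nX Z nZ F u (DF u)) \<and>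
     (\<exists>D2F. (\<forall>u\<in>A. has_second_fderiv_at A X nX Z nZ DF u (D2F u)) \<and>
        (\<forall>u\<in>A. \<forall>\<epsilon>>0. \<exists>\<delta>>0. \<forall>w\<in>A. nX (w - u) < \<delta> \<longrightarrow>
           (\<forall>k\<in>X. \<forall>h\<in>X. nZ (D2F w k h - D2F u k h) \<le> \<epsilon> * nX k * nX h)))"

definition is_inverse_op ::
  "('a \<Rightarrow> real) set \<Rightarrow> (('a \<Rightarrow> real) \<Rightarrow> real) \<Rightarrow> ('b \<Rightarrow> real) set \<Rightarrow> (('b \<Rightarrow> real) \<Rightarrow> real)
    \<Rightarrow> (('a \<Rightarrow> real) \<Rightarrow> 'b \<Rightarrow> real) \<Rightarrow> (('b \<Rightarrow> real) \<Rightarrow> 'a \<Rightarrow> real) \<Rightarrow> bool" where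
  "is_inverse_op X nX Z nZ D E \<longleftrightarrow>
     bounded_lin_op Z nZ X nX E \<and>
     (\<forall>h\<in>X. nX (E (D h) - h) = 0) \<and> (\<forall>g\<in>Z. nZ (D (E g) - g) = 0)"

definition open_subset_of :: "('a \<Rightarrow> real) set \<Rightarrow> (('a \<Rightarrow> real) \<Rightarrow> real) \<Rightarrow> ('a \<Rightarrow> real) set \<Rightarrow> bool" where
  "open_subset_of X nX A \<longleftrightarrow> A \<subseteq> X \<and>
     (\<forall>u\<in>A. \<exists>\<delta>>0. \<forall>w\<in>X. nX (w - u) < \<delta> \<longrightarrow> w \<in> A)"


section \<open>The control problem\<close>

abbreviation Lp :: "(real^'n) set \<Rightarrow> real \<Rightarrow> (real^'n \<Rightarrow> real) set" where
  "Lp \<Omega> p \<equiv> Lspace (ennreal p) (lebesgue_on \<Omega>)"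

abbreviation Lp_norm :: "(real^'n) set \<Rightarrow> real \<Rightarrow> (real^'n \<Rightarrow> real) \<Rightarrow> real" where
  "Lp_norm \<Omega> p \<equiv> Lnorm (ennreal p) (lebesgue_on \<Omega>)"

abbreviation W2p :: "(real^'n) set \<Rightarrow> real \<Rightarrow> (real^'n \<Rightarrow> real) set" where
  "W2p \<Omega> p \<equiv> W2 \<Omega> (ennreal p)"

abbreviation W2p_norm :: "(real^'n) set \<Rightarrow> real \<Rightarrow> (real^'n \<Rightarrow> real) \<Rightarrow> real" where
  "W2p_norm \<Omega> p \<equiv> W2_norm \<Omega> (ennreal p)"

definition Q :: "(real^'n) set \<Rightarrow> (real^'n \<Rightarrow> real) \<Rightarrow> real^'n \<Rightarrow> real" where
  "Q \<Omega> y x = sqrt (1 + (norm (wgrad \<Omega> y x))\<^sup>2)"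

definition outer :: "real^'n \<Rightarrow> real^'n \<Rightarrow> real^'n^'n" where
  "outer a b = (\<chi> i j. a $ i * b $ j)"

definition A_coeff :: "(real^'n) set \<Rightarrow> (real^'n \<Rightarrow> real) \<Rightarrow> real^'n \<Rightarrow> real^'n^'n" where
  "A_coeff \<Omega> y x = (1 / Q \<Omega> y x) *\<^sub>R
     (mat 1 - (1 / (Q \<Omega> y x)\<^sup>2) *\<^sub>R outer (wgrad \<Omega> y x) (wgrad \<Omega> y x))"

definition Y :: "(real^'n) set \<Rightarrow> real \<Rightarrow> (real^'n \<Rightarrow> real) \<Rightarrow> (real^'n \<Rightarrow> real) set" where
  "Y \<Omega> p v = {y \<in> W2p \<Omega> p. y - v \<in> W1_0 \<Omega> \<infinity>}"

text \<open>The direction space of the affine space \<open>Y\<close>.\<close>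

definition Y_dir :: "(real^'n) set \<Rightarrow> real \<Rightarrow> (real^'n \<Rightarrow> real) set" where
  "Y_dir \<Omega> p = W2p \<Omega> p \<inter> W1_0 \<Omega> \<infinity>"

definition state_equation :: "(real^'n) set \<Rightarrow> (real^'n \<Rightarrow> real) \<Rightarrow> (real^'n \<Rightarrow> real) \<Rightarrow> bool" where
  "state_equation \<Omega> u y \<longleftrightarrow>
     has_weak_div \<Omega> (\<lambda>x. (1 / Q \<Omega> y x) *\<^sub>R wgrad \<Omega> y x) (\<lambda>x. - u x)"

definition N_op :: "(real^'n) set \<Rightarrow> (real^'n \<Rightarrow> real) \<Rightarrow> (real^'n \<Rightarrow> real) \<Rightarrow> real^'n \<Rightarrow> real" where
  "N_op \<Omega> y u = (\<lambda>x. - wdiv \<Omega> (\<lambda>z. (1 / Q \<Omega> y z) *\<^sub>R wgrad \<Omega> y z) x - u x)"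

text \<open>
  The equation is understood weakly, that is, tested against smooth functions with compact
  support in \<open>\<Omega>\<close>; the boundary condition is imposed separately by \<open>\<phi> \<in> W1_0 \<Omega> 2\<close>.
\<close>

definition adjoint_equation ::
  "(real^'n) set \<Rightarrow> (real^'n \<Rightarrow> real) \<Rightarrow> (real^'n \<Rightarrow> real) \<Rightarrow> (real^'n \<Rightarrow> real) \<Rightarrow> bool" where
  "adjoint_equation \<Omega> y yd \<phi> \<longleftrightarrow>
     has_weak_div \<Omega> (\<lambda>x. A_coeff \<Omega> y x *v wgrad \<Omega> \<phi> x) (\<lambda>x. - (y x - yd x))"

definition control_to_state ::
  "(real^'n) set \<Rightarrow> real \<Rightarrow> (real^'n \<Rightarrow> real) \<Rightarrow> (real^'n \<Rightarrow> real) set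
    \<Rightarrow> ((real^'n \<Rightarrow> real) \<Rightarrow> real^'n \<Rightarrow> real)
    \<Rightarrow> ((real^'n \<Rightarrow> real) \<Rightarrow> (real^'n \<Rightarrow> real) \<Rightarrow> real^'n \<Rightarrow> real) \<Rightarrow> bool" where
  "control_to_state \<Omega> p v U3 S DS \<longleftrightarrow>
     (\<forall>u\<in>U3. S u \<in> Y \<Omega> p v \<and> state_equation \<Omega> u (S u)) \<and>
     C2_map U3 (Lp \<Omega> p) (Lp_norm \<Omega> p) (Y_dir \<Omega> p) (W2p_norm \<Omega> p) S DS"

text \<open>\<open>D_uS(u) = - [D_yN(y,u)]\<^sup>-\<^sup>1 \<circ> D_uN(y,u)\<close> with \<open>y = S u\<close>.\<close>

definition implicit_derivative ::
  "(real^'n) set \<Rightarrow> real \<Rightarrow> (real^'n \<Rightarrow> real) \<Rightarrow> (real^'n \<Rightarrow> real)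
    \<Rightarrow> (real^'n \<Rightarrow> real) \<Rightarrow> ((real^'n \<Rightarrow> real) \<Rightarrow> real^'n \<Rightarrow> real) \<Rightarrow> bool" where
  "implicit_derivative \<Omega> p v u y D \<longleftrightarrow> (\<exists>DyN DuN DyN_inv.
     has_fderiv_at (Y \<Omega> p v) (Y_dir \<Omega> p) (W2p_norm \<Omega> p) (Lp \<Omega> p) (Lp_norm \<Omega> p)
       (\<lambda>z. N_op \<Omega> z u) y DyN \<and>
     has_fderiv_at (Lp \<Omega> p) (Lp \<Omega> p) (Lp_norm \<Omega> p) (Lp \<Omega> p) (Lp_norm \<Omega> p)
       (\<lambda>w. N_op \<Omega> y w) u DuN \<and>
     is_inverse_op (Y_dir \<Omega> p) (W2p_norm \<Omega> p) (Lp \<Omega> p) (Lp_norm \<Omega> p) DyN DyN_inv \<and>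
     (\<forall>h\<in>Lp \<Omega> p. W2p_norm \<Omega> p (D h - (- DyN_inv (DuN h))) = 0))"

definition BB :: "(real^'n) set \<Rightarrow> real \<Rightarrow> (real^'n \<Rightarrow> real) \<Rightarrow> real \<Rightarrow> (real^'n \<Rightarrow> real) set" where
  "BB \<Omega> p v B1 = {y \<in> Y \<Omega> p v. W2p_norm \<Omega> p y \<le> B1}"

text \<open>The product of matrices \<open>M : H\<close> is the inner product \<open>M \<bullet> H\<close> of \<open>real^'n^'n\<close>.\<close>

definition T_equation ::
  "(real^'n) set \<Rightarrow> (real^'n \<Rightarrow> real) \<Rightarrow> (real^'n \<Rightarrow> real) \<Rightarrow> (real^'n \<Rightarrow> real) \<Rightarrow> bool" where
  "T_equation \<Omega> u y y' \<longleftrightarrow> (AE x in lebesgue_on \<Omega>.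
     - (((Q \<Omega> y x)\<^sup>2 *\<^sub>R mat 1 - outer (wgrad \<Omega> y x) (wgrad \<Omega> y x)) \<bullet> whess \<Omega> y' x)
       = u x * (Q \<Omega> y x) ^ 3)"

definition contraction_of_BB ::
  "(real^'n) set \<Rightarrow> real \<Rightarrow> (real^'n \<Rightarrow> real) \<Rightarrow> real
    \<Rightarrow> ((real^'n \<Rightarrow> real) \<Rightarrow> real^'n \<Rightarrow> real) \<Rightarrow> bool" where
  "contraction_of_BB \<Omega> p v B1 T \<longleftrightarrow> T ` BB \<Omega> p v B1 \<subseteq> BB \<Omega> p v B1 \<and>
     (\<exists>\<kappa><1. \<forall>y\<in>BB \<Omega> p v B1. \<forall>z\<in>BB \<Omega> p v B1.
        W2p_norm \<Omega> p (T y - T z) \<le> \<kappa> * W2p_norm \<Omega> p (y - z))"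

definition cond_a ::
  "(real^'n) set \<Rightarrow> real \<Rightarrow> (real^'n \<Rightarrow> real) \<Rightarrow> real \<Rightarrow> real \<Rightarrow> real \<Rightarrow> (real^'n \<Rightarrow> real) \<Rightarrow> bool" where
  "cond_a \<Omega> p v B1 C\<Omega> B2 u \<longleftrightarrow> C\<Omega> * (W2p_norm \<Omega> p v + B2 * Lp_norm \<Omega> p u) \<le> B1"

definition cond_b ::
  "(real^'n) set \<Rightarrow> real \<Rightarrow> (real^'n \<Rightarrow> real) \<Rightarrow> real \<Rightarrow> (real^'n \<Rightarrow> real) \<Rightarrow> bool" where
  "cond_b \<Omega> p v B3 u \<longleftrightarrow> B3 * (2 * Lp_norm \<Omega> p u + W2p_norm \<Omega> p v) < 1"

text \<open>
  The conjunct \<open>u \<in> Lp \<Omega> p\<close> expresses that the \<open>L\<^sup>p\<close> norm is finite, since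
  \<open>Lp_norm\<close> is a total real-valued function.
\<close>

definition U_ad :: "(real^'n) set \<Rightarrow> real \<Rightarrow> real \<Rightarrow> (real^'n \<Rightarrow> real) set" where
  "U_ad \<Omega> p \<theta> = {u \<in> Lp \<Omega> 2. u \<in> Lp \<Omega> p \<and> Lp_norm \<Omega> p u \<le> \<theta>}"

definition J ::
  "(real^'n) set \<Rightarrow> ((real^'n \<Rightarrow> real) \<Rightarrow> real^'n \<Rightarrow> real) \<Rightarrow> (real^'n \<Rightarrow> real) \<Rightarrow> real
    \<Rightarrow> (real^'n \<Rightarrow> real) \<Rightarrow> real" where
  "J \<Omega> S yd \<alpha> u = 1 / 2 * (Lp_norm \<Omega> 2 (S u - yd))\<^sup>2 + \<alpha> / 2 * (Lp_norm \<Omega> 2 u)\<^sup>2"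

definition local_optimal ::
  "(real^'n) set \<Rightarrow> real \<Rightarrow> ((real^'n \<Rightarrow> real) \<Rightarrow> real^'n \<Rightarrow> real) \<Rightarrow> (real^'n \<Rightarrow> real)
    \<Rightarrow> real \<Rightarrow> real \<Rightarrow> (real^'n \<Rightarrow> real) \<Rightarrow> bool" where
  "local_optimal \<Omega> p S yd \<alpha> \<theta> ub \<longleftrightarrow> ub \<in> U_ad \<Omega> p \<theta> \<and>
     (\<exists>\<epsilon>>0. \<forall>u\<in>U_ad \<Omega> p \<theta>. Lp_norm \<Omega> p (u - ub) \<le> \<epsilon> \<longrightarrow> J \<Omega> S yd \<alpha> u \<ge> J \<Omega> S yd \<alpha> ub)"

end

theory Submission
  imports Defs
begin

text \<open>
  The derivative \<open>z\<close> of the control-to-state map in a direction \<open>h\<close> solves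
  \<open>- div (A \<nabla>z) = h\<close>, as one sees by differentiating the weak state equation along
  \<open>u + t h\<close>. Since \<open>A\<close> is symmetric and uniformly elliptic, this also provides the
  adjoint states for bounded right-hand sides; truncating \<open>S ub - yd\<close>, the energy estimate and
  the Poincare inequality make the corresponding solutions converge in \<open>H\<^sup>1\<close> to the adjoint
  state. Symmetry then turns the derivative of the tracking term into \<open>\<integral> \<phi> h\<close>, and the
  variational inequality is the first-order condition on the convex set of admissible controls.

  These steps require solutions themselves as test functions. A function of zero trace in
  \<open>W\<^sup>1\<^sub>\<infinity>\<close> is a uniform limit of continuous functions that are small almost everywhere on the
  boundary; as the surface measure charges every relatively open piece of the boundary, the limit
  vanishes there and extends by zero to a Lipschitz function on the whole space. Such a function
  is a uniform limit of test functions with bounded gradients.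
\<close>

section \<open>Smooth functions and test functions\<close>

text \<open>No Hilbert space theory is used for the linearized equation: the derivative of the
  control-to-state map is itself a solution operator, on all of \<open>L\<^sup>p\<close>. The
  adjoint right-hand side lies only in \<open>L\<^sup>2\<close>, which for \<open>p > 2\<close> is
  too rough for this operator; bounded functions are admissible for every \<open>p\<close>, and the
  energy estimate involves nothing but \<open>L\<^sup>2\<close> norms of the data. In dimension one
  \<open>p\<close> may lie below 2, so the duality relation is restricted to directions that are
  also square integrable, as differences of admissible controls are.

  The weak equations are tested with smooth functions only. For Lipschitz limits of test functions
  the gradients converge weakly but need not converge strongly, and every passage to the limit is
  arranged so that this suffices. Bounded gradients of the states, from the embedding into
  \<open>W\<^sup>1\<^sub>\<infinity>\<close>, give uniform ellipticity.

  Zero trace is expressed through the surface measure alone. A set function that is not countably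
  additive would make \<open>measure_of\<close> return the zero measure and the condition empty, so
  Caratheodory's theorem comes before any use of the trace.\<close>

lemma frechet_derivative_grad:
  fixes f :: "real^'n \<Rightarrow> real"
  assumes "f differentiable (at x)"
  shows "(f has_derivative (\<lambda>h. grad f x \<bullet> h)) (at x)"
proof -
  have d: "(f has_derivative frechet_derivative f (at x)) (at x)"
    using assms frechet_derivative_works by blast
  then interpret bounded_linear "frechet_derivative f (at x)"
    by (rule has_derivative_bounded_linear)
  have "frechet_derivative f (at x) h = grad f x \<bullet> h" for h
  proof -
    have "frechet_derivative f (at x) h = frechet_derivative f (at x) (\<Sum>i\<in>UNIV. h $ i *\<^sub>R axis i 1)"
      by (simp add: basis_expansion flip: scalar_mult_eq_scaleR)
    also have "\<dots> = (\<Sum>i\<in>UNIV. h $ i * grad f x $ i)"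
      by (simp add: sum scaleR grad_def)
    also have "\<dots> = grad f x \<bullet> h"
      by (simp add: inner_vec_def mult.commute)
    finally show ?thesis .
  qed
  then show ?thesis using d by (metis (no_types, lifting) ext)
qed

lemma grad_eqI:
  fixes f :: "real^'n \<Rightarrow> real"
  assumes "(f has_derivative (\<lambda>h. g \<bullet> h)) (at x)"
  shows "grad f x = g"
proof -
  have "frechet_derivative f (at x) = (\<lambda>h. g \<bullet> h)"
    using assms frechet_derivative_at by metis
  then show ?thesis by (simp add: grad_def vec_eq_iff inner_axis)
qed

text \<open>Scalar partial derivatives let the recursion in \<open>Ck\<close> and the vector-valued
  integral identities be handled one coordinate at a time.\<close>

definition pd :: "'n \<Rightarrow> (real^'n \<Rightarrow> real) \<Rightarrow> real^'n \<Rightarrow> real" where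
  "pd i f x = grad f x $ i"

lemma Ck_Suc_iff: "Ck (Suc k) f \<longleftrightarrow> (\<forall>x. f differentiable (at x)) \<and> (\<forall>i. Ck k (pd i f))"
  by (simp add: pd_def[abs_def] grad_def)

declare Ck.simps(2)[simp del]

lemma pd_eqI:
  assumes "\<And>x. (f has_derivative (\<lambda>h. g x \<bullet> h)) (at x)"
  shows "pd i f = (\<lambda>x. g x $ i)"
  using grad_eqI[OF assms] by (auto simp: pd_def)

text \<open>The inductive step of the smoothness proofs below: an exhibited gradient replaces
  computations with \<open>frechet_derivative\<close>.\<close>

lemma Ck_SucI:
  assumes "\<And>x. (f has_derivative (\<lambda>h. g x \<bullet> h)) (at x)" "\<And>i. Ck k (\<lambda>x. g x $ i)"
  shows "Ck (Suc k) f"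
  using assms pd_eqI[OF assms(1)] unfolding Ck_Suc_iff by (auto simp: differentiable_def)

lemma Ck_Suc_imp: "Ck (Suc k) f \<Longrightarrow> Ck k f"
proof (induction k arbitrary: f)
  case 0
  then show ?case
    by (auto simp: Ck_Suc_iff intro!: continuous_at_imp_continuous_on differentiable_imp_continuous_within)
next
  case (Suc k)
  then show ?case by (metis Ck_Suc_iff)
qed

lemma Ck_Suc_has_derivative:
  "Ck (Suc k) f \<Longrightarrow> (f has_derivative (\<lambda>h. grad f x \<bullet> h)) (at x)"
  by (simp add: Ck_Suc_iff frechet_derivative_grad)

lemma Ck_Suc_pd: "Ck (Suc k) f \<Longrightarrow> Ck k (pd i f)"
  by (simp add: Ck_Suc_iff)

lemma Ck_const: "Ck k (\<lambda>x. c)"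
proof (induction k arbitrary: c)
  case (Suc k)
  show ?case by (rule Ck_SucI[where g = "\<lambda>x. 0"]) (auto simp: Suc)
qed simp

lemma Ck_add: "Ck k f \<Longrightarrow> Ck k g \<Longrightarrow> Ck k (\<lambda>x. f x + g x)"
proof (induction k arbitrary: f g)
  case 0
  then show ?case by (auto intro!: continuous_intros)
next
  case (Suc k)
  show ?case
  proof (rule Ck_SucI[where g = "\<lambda>x. grad f x + grad g x"])
    show "((\<lambda>x. f x + g x) has_derivative (\<lambda>h. (grad f x + grad g x) \<bullet> h)) (at x)" for x
      using Suc.prems[THEN Ck_Suc_has_derivative, of x] by (auto intro!: derivative_eq_intros simp: inner_add_left)
    show "Ck k (\<lambda>x. (grad f x + grad g x) $ i)" for i
      using Suc.IH[OF Ck_Suc_pd[OF Suc.prems(1)] Ck_Suc_pd[OF Suc.prems(2)], of i i] by (simp add: pd_def)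
  qed
qed

lemma Ck_mult: "Ck k f \<Longrightarrow> Ck k g \<Longrightarrow> Ck k (\<lambda>x. f x * g x)"
proof (induction k arbitrary: f g)
  case 0
  then show ?case by (auto intro!: continuous_intros)
next
  case (Suc k)
  show ?case
  proof (rule Ck_SucI[where g = "\<lambda>x. f x *\<^sub>R grad g x + g x *\<^sub>R grad f x"])
    show "((\<lambda>x. f x * g x) has_derivative (\<lambda>h. (f x *\<^sub>R grad g x + g x *\<^sub>R grad f x) \<bullet> h)) (at x)" for x
      using Suc.prems[THEN Ck_Suc_has_derivative, of x]
      by (auto intro!: derivative_eq_intros simp: inner_add_left)
    show "Ck k (\<lambda>x. (f x *\<^sub>R grad g x + g x *\<^sub>R grad f x) $ i)" for i
      using Ck_add[OF Suc.IH[OF Ck_Suc_imp[OF Suc.prems(1)] Ck_Suc_pd[OF Suc.prems(2), of i]]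
            Suc.IH[OF Ck_Suc_imp[OF Suc.prems(2)] Ck_Suc_pd[OF Suc.prems(1), of i]]]
      by (simp add: pd_def)
  qed
qed

text \<open>A convolution at \<open>x\<close> tests its first factor with the function of
  \<open>y\<close> given by \<open>\<rho> (x - y)\<close>, which therefore has to be smooth.\<close>

lemma Ck_reflect: "Ck k f \<Longrightarrow> Ck k (\<lambda>y. f (x - y))"
proof (induction k arbitrary: f)
  case 0
  then have "continuous_on UNIV f" by simp
  then have "continuous_on UNIV (\<lambda>y. f (x - y))"
    by (rule continuous_on_compose2) (auto intro!: continuous_intros)
  then show ?case by simp
next
  case (Suc k)
  show ?case
  proof (rule Ck_SucI[where g = "\<lambda>y. - grad f (x - y)"])
    fix y
    have "((\<lambda>y. x - y) has_derivative (\<lambda>h. - h)) (at y)"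
      by (auto intro!: derivative_eq_intros)
    from has_derivative_compose[OF this Ck_Suc_has_derivative[OF Suc.prems]]
    show "((\<lambda>y. f (x - y)) has_derivative (\<lambda>h. - grad f (x - y) \<bullet> h)) (at y)" by simp
  next
    fix i
    have "Ck k (\<lambda>y. (-1) * pd i f (x - y))"
      by (intro Ck_mult Ck_const Suc.IH Ck_Suc_pd[OF Suc.prems])
    then show "Ck k (\<lambda>y. (- grad f (x - y)) $ i)" by (simp add: pd_def)
  qed
qed

lemma pd_reflect: "Ck (Suc 0) f \<Longrightarrow> pd i (\<lambda>y. f (x - y)) y = - pd i f (x - y)"
proof -
  assume f: "Ck (Suc 0) f"
  have "((\<lambda>y. x - y) has_derivative (\<lambda>h. - h)) (at y)"
    by (auto intro!: derivative_eq_intros)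
  from has_derivative_compose[OF this Ck_Suc_has_derivative[OF f]]
  have "((\<lambda>y. f (x - y)) has_derivative (\<lambda>h. - grad f (x - y) \<bullet> h)) (at y)" by simp
  from grad_eqI[OF this] show ?thesis by (simp add: pd_def)
qed

lemma Ck_component: "Ck k (\<lambda>x. x $ i)"
proof (cases k)
  case (Suc k')
  then show ?thesis
    by (auto intro!: Ck_SucI[where g = "\<lambda>x. axis i 1"] Ck_const bounded_linear_imp_has_derivative
        bounded_linear_vec_nth simp: inner_axis')
qed (auto intro!: continuous_intros)

text \<open>The functions \<open>t ^ (- m) * exp (- 1 / t)\<close> form a family closed under differentiation,
  which contains the flat function used to build bump functions.\<close>

definition flat :: "nat \<Rightarrow> real \<Rightarrow> real" where
  "flat m t = (if t > 0 then exp (- (1 / t)) / t ^ m else 0)"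

text \<open>The substitution \<open>s = 1 / t\<close> turns the limit from the right into that of
  \<open>s ^ m / exp s\<close> at infinity; on the left the function vanishes.\<close>

lemma flat_tendsto_0: "((\<lambda>t. flat m t) \<longlongrightarrow> 0) (at 0)"
proof -
  have "((\<lambda>s. s ^ m / exp s) \<longlongrightarrow> (0::real)) at_top"
    by (rule tendsto_power_div_exp_0)
  then have "((\<lambda>t. (inverse t) ^ m / exp (inverse t)) \<longlongrightarrow> (0::real)) (at_right 0)"
    by (rule filterlim_compose[OF _ filterlim_inverse_at_top_right])
  then have r: "(flat m \<longlongrightarrow> 0) (at_right 0)"
  proof (rule Lim_transform_eventually)
    show "\<forall>\<^sub>F t in at_right 0. inverse t ^ m / exp (inverse t) = flat m t"
      by (rule eventually_at_rightI[of 0 1]) (auto simp: flat_def exp_minus field_simps)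
  qed
  have l: "(flat m \<longlongrightarrow> 0) (at_left 0)"
    by (rule tendsto_eventually) (rule eventually_at_leftI[of "-1"], auto simp: flat_def)
  from l r show ?thesis by (simp add: filterlim_split_at)
qed

lemma DERIV_flat:
  "(flat m has_real_derivative (flat (m + 2) t - real m * flat (m + 1) t)) (at t)"
proof -
  consider "t > 0" | "t < 0" | "t = 0" by linarith
  then show ?thesis
  proof cases
    case 1
    have "((\<lambda>t. exp (- (1 / t)) / t ^ m) has_real_derivative (flat (m + 2) t - real m * flat (m + 1) t)) (at t)"
    proof -
      have pk: "t * t ^ (k - Suc 0) = t ^ k \<or> k = 0" for k by (cases k) auto
      show ?thesis
        using 1 by (auto intro!: derivative_eq_intros simp: flat_def field_simps power2_eq_square)
          (metis pk)
    qed
    then show ?thesis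
      by (rule has_field_derivative_transform_within_open[OF _ open_greaterThan[of 0]])
        (use 1 in \<open>auto simp: flat_def\<close>)
  next
    case 2
    have "((\<lambda>t. 0) has_real_derivative (flat (m + 2) t - real m * flat (m + 1) t)) (at t)"
      using 2 by (auto intro!: derivative_eq_intros simp: flat_def)
    then show ?thesis
      by (rule has_field_derivative_transform_within_open[OF _ open_lessThan[of 0]])
        (use 2 in \<open>auto simp: flat_def\<close>)
  next
    case 3
    \<comment> \<open>At 0 the difference quotient of \<open>flat m\<close> is
      \<open>flat (Suc m)\<close>, whose limit is already known.\<close>
    have "(\<lambda>h. (flat m (0 + h) - flat m 0) / h) \<midarrow>0\<rightarrow> 0"
      by (rule Lim_transform_eventually[OF flat_tendsto_0[of "Suc m"]])
        (auto simp: flat_def eventually_at_filter)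
    then show ?thesis
      using 3 by (simp add: DERIV_def flat_def)
  qed
qed

text \<open>Each derivative trades \<open>flat m\<close> for \<open>flat (m + 1)\<close> and
  \<open>flat (m + 2)\<close>, so the induction needs all \<open>m\<close> at once. With
  \<open>e\<close> a squared radius, \<open>m = 0\<close> is the usual bump function on a
  ball.\<close>

lemma Ck_flat_ball: "Ck k (\<lambda>x::real^'n. flat m (e - x \<bullet> x))"
proof (induction k arbitrary: m)
  case 0
  have "continuous_on UNIV (flat m)"
    by (rule DERIV_continuous_on) (use DERIV_flat has_field_derivative_at_within in blast)
  then have "continuous_on UNIV (\<lambda>x::real^'n. flat m (e - x \<bullet> x))"
    by (rule continuous_on_compose2) (auto intro!: continuous_intros)
  then show ?case by simp
next
  case (Suc k)
  let ?d = "\<lambda>x::real^'n. flat (m + 2) (e - x \<bullet> x) + (- real m) * flat (m + 1) (e - x \<bullet> x)"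
  show ?case
  proof (rule Ck_SucI[where g = "\<lambda>x. ?d x *\<^sub>R ((-2) *\<^sub>R x)"])
    show "((\<lambda>x. flat m (e - x \<bullet> x)) has_derivative (\<lambda>h. (?d x *\<^sub>R ((-2) *\<^sub>R x)) \<bullet> h)) (at x)" for x :: "real^'n"
    proof -
      have 1: "((\<lambda>x::real^'n. e - x \<bullet> x) has_derivative (\<lambda>h. - 2 * (x \<bullet> h))) (at x)"
        by (auto intro!: derivative_eq_intros simp: inner_commute)
      show ?thesis
        using has_derivative_compose[OF 1 DERIV_flat[of m "e - x \<bullet> x", unfolded has_field_derivative_def]]
        by (simp add: algebra_simps)
    qed
    show "Ck k (\<lambda>x. (?d x *\<^sub>R ((-2) *\<^sub>R x)) $ i)" for i :: 'n
      using Ck_mult[OF Ck_add[OF Suc[of "m+2"] Ck_mult[OF Ck_const[of k "- real m"] Suc[of "m+1"]]]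
          Ck_mult[OF Ck_const[of k "-2"] Ck_component[of k i]]]
      by (simp add: algebra_simps)
  qed
qed

text \<open>Constructions produce some compact set outside of which a function vanishes; in this
  form the closed support need not be computed.\<close>

lemma test_functions_iff:
  "\<psi> \<in> test_functions \<Omega> \<longleftrightarrow> (\<forall>k. Ck k \<psi>) \<and> (\<exists>K. compact K \<and> K \<subseteq> \<Omega> \<and> (\<forall>x. x \<notin> K \<longrightarrow> \<psi> x = 0))"
proof
  assume "\<psi> \<in> test_functions \<Omega>"
  then show "(\<forall>k. Ck k \<psi>) \<and> (\<exists>K. compact K \<and> K \<subseteq> \<Omega> \<and> (\<forall>x. x \<notin> K \<longrightarrow> \<psi> x = 0))"
    unfolding test_functions_def using closure_subset[of "{x. \<psi> x \<noteq> 0}"]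
    by (auto intro!: exI[of _ "closure {x. \<psi> x \<noteq> 0}"])
next
  assume *: "(\<forall>k. Ck k \<psi>) \<and> (\<exists>K. compact K \<and> K \<subseteq> \<Omega> \<and> (\<forall>x. x \<notin> K \<longrightarrow> \<psi> x = 0))"
  then obtain K where K: "compact K" "K \<subseteq> \<Omega>" "\<And>x. x \<notin> K \<Longrightarrow> \<psi> x = 0" by blast
  then have sub: "closure {x. \<psi> x \<noteq> 0} \<subseteq> K"
    by (intro closure_minimal) (auto simp: compact_imp_closed)
  then have "compact (closure {x. \<psi> x \<noteq> 0})"
    by (meson K(1) bounded_subset closed_closure compact_eq_bounded_closed)
  then show "\<psi> \<in> test_functions \<Omega>"
    using * sub K(2) by (auto simp: test_functions_def)
qed

lemma test_functions_mono: "\<Omega> \<subseteq> \<Omega>' \<Longrightarrow> test_functions \<Omega> \<subseteq> test_functions \<Omega>'"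
  by (auto simp: test_functions_def)

lemma test_functions_Ck: "\<psi> \<in> test_functions \<Omega> \<Longrightarrow> Ck k \<psi>"
  by (simp add: test_functions_def)

lemma test_functions_support:
  assumes "\<psi> \<in> test_functions \<Omega>"
  obtains K where "compact K" "K \<subseteq> \<Omega>" "\<And>x. x \<notin> K \<Longrightarrow> \<psi> x = 0" "\<And>x. x \<notin> K \<Longrightarrow> grad \<psi> x = 0"
proof -
  from assms obtain K where K: "compact K" "K \<subseteq> \<Omega>" "\<And>x. x \<notin> K \<Longrightarrow> \<psi> x = 0"
    by (auto simp: test_functions_iff)
  have "grad \<psi> x = 0" if "x \<notin> K" for x
  proof (rule grad_eqI)
    have "((\<lambda>x. 0) has_derivative (\<lambda>h. 0 \<bullet> h)) (at x)" by simp
    then show "(\<psi> has_derivative (\<lambda>h. 0 \<bullet> h)) (at x)"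
      by (rule has_derivative_transform_within_open[where s = "- K"])
        (use K that in \<open>auto simp: compact_imp_closed open_Compl\<close>)
  qed
  with K that show ?thesis by blast
qed

lemma test_functions_pd:
  assumes "\<psi> \<in> test_functions \<Omega>"
  shows "pd i \<psi> \<in> test_functions \<Omega>"
proof -
  obtain K where "compact K" "K \<subseteq> \<Omega>" "\<And>x. x \<notin> K \<Longrightarrow> grad \<psi> x = 0"
    using test_functions_support[OF assms] by metis
  then show ?thesis
    unfolding test_functions_iff
    using Ck_Suc_pd[OF test_functions_Ck[OF assms]] by (auto simp: pd_def)
qed

lemma test_functions_has_derivative:
  "\<psi> \<in> test_functions \<Omega> \<Longrightarrow> (\<psi> has_derivative (\<lambda>h. grad \<psi> x \<bullet> h)) (at x)"
  using Ck_Suc_has_derivative test_functions_Ck by blast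

lemma test_functions_continuous: "\<psi> \<in> test_functions \<Omega> \<Longrightarrow> continuous_on A \<psi>"
  using test_functions_Ck[of \<psi> \<Omega> 0] continuous_on_subset by auto

lemma test_functions_grad_continuous: "\<psi> \<in> test_functions \<Omega> \<Longrightarrow> continuous_on A (grad \<psi>)"
  using test_functions_continuous[OF test_functions_pd, of \<psi> \<Omega> A]
    continuous_on_vec_lambda[of A "\<lambda>i x. grad \<psi> x $ i"]
  by (simp add: pd_def[abs_def])

lemma test_functions_bounded:
  assumes "\<psi> \<in> test_functions \<Omega>"
  obtains B where "B > 0" "\<And>x. \<bar>\<psi> x\<bar> \<le> B" "\<And>x. norm (grad \<psi> x) \<le> B"
proof -
  obtain K where K: "compact K" "\<And>x. x \<notin> K \<Longrightarrow> \<psi> x = 0" "\<And>x. x \<notin> K \<Longrightarrow> grad \<psi> x = 0"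
    using test_functions_support[OF assms] by metis
  have "bounded (\<psi> ` K)" "bounded (grad \<psi> ` K)"
    using K(1) assms by (auto intro!: compact_imp_bounded compact_continuous_image
        test_functions_continuous test_functions_grad_continuous)
  then obtain b1 b2 where b: "b1 > 0" "b2 > 0" "\<And>x. x \<in> K \<Longrightarrow> norm (\<psi> x) \<le> b1" "\<And>x. x \<in> K \<Longrightarrow> norm (grad \<psi> x) \<le> b2"
    unfolding bounded_pos by auto
  show ?thesis
  proof (rule that[of "b1 + b2"])
    show "\<bar>\<psi> x\<bar> \<le> b1 + b2" for x
      using b(1,2) b(3)[of x] K(2)[of x] by (cases "x \<in> K") auto
    show "norm (grad \<psi> x) \<le> b1 + b2" for x
      using b(1,2) b(4)[of x] K(3)[of x] by (cases "x \<in> K") auto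
  qed (use b in auto)
qed

lemma test_functions_mult:
  assumes "\<psi> \<in> test_functions \<Omega>" "\<And>k. Ck k f"
  shows "(\<lambda>x. f x * \<psi> x) \<in> test_functions \<Omega>"
proof -
  obtain K where "compact K" "K \<subseteq> \<Omega>" "\<And>x. x \<notin> K \<Longrightarrow> \<psi> x = 0"
    using test_functions_support[OF assms(1)] by metis
  moreover have "Ck k (\<lambda>x. f x * \<psi> x)" for k
    using Ck_mult assms(2) test_functions_Ck[OF assms(1)] by blast
  ultimately show ?thesis
    unfolding test_functions_iff by auto
qed

lemma test_functions_add:
  assumes "\<psi> \<in> test_functions \<Omega>" "\<phi> \<in> test_functions \<Omega>"
  shows "(\<lambda>x. \<psi> x + \<phi> x) \<in> test_functions \<Omega>"
proof -
  obtain K where "compact K" "K \<subseteq> \<Omega>" "\<And>x. x \<notin> K \<Longrightarrow> \<psi> x = 0"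
    using test_functions_support[OF assms(1)] by metis
  moreover obtain L where "compact L" "L \<subseteq> \<Omega>" "\<And>x. x \<notin> L \<Longrightarrow> \<phi> x = 0"
    using test_functions_support[OF assms(2)] by metis
  moreover have "Ck k (\<lambda>x. \<psi> x + \<phi> x)" for k
    using Ck_add assms[THEN test_functions_Ck] by blast
  moreover have "\<psi> x + \<phi> x = 0" if "x \<notin> K \<union> L" for x
    using that calculation by simp
  ultimately show ?thesis
    unfolding test_functions_iff by (intro conjI allI exI[of _ "K \<union> L"]) auto
qed

lemma test_functions_lipschitz:
  assumes "\<psi> \<in> test_functions \<Omega>" "\<And>x. norm (grad \<psi> x) \<le> B"
  shows "\<bar>\<psi> x - \<psi> y\<bar> \<le> B * norm (x - y)"
proof -
  have "norm (\<psi> x - \<psi> y) \<le> B * norm (x - y)"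
  proof (rule differentiable_bound[of UNIV])
    show "(\<psi> has_derivative (\<lambda>h. grad \<psi> z \<bullet> h)) (at z within UNIV)" for z
      using test_functions_has_derivative[OF assms(1)] by simp
    show "onorm (\<lambda>h. grad \<psi> z \<bullet> h) \<le> B" for z
      by (rule order_trans[OF _ assms(2)[of z]]) 
        (metis norm_ge_zero Cauchy_Schwarz_ineq2 onorm_bound real_norm_def)
  qed auto
  then show ?thesis by simp
qed

text \<open>The quadratic remainder is uniform in the base point, which is what allows
  differentiation under the convolution integral.\<close>

lemma test_functions_taylor:
  assumes "\<psi> \<in> test_functions \<Omega>"
  obtains C where "C > 0" "\<And>u h. \<bar>\<psi> (u + h) - \<psi> u - grad \<psi> u \<bullet> h\<bar> \<le> C * (norm h)\<^sup>2"
proof -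
  have "\<exists>B>0. \<forall>x. norm (grad (pd i \<psi>) x) \<le> B" for i
    using test_functions_bounded[OF test_functions_pd[OF assms, of i]] by metis
  then obtain B where B: "\<And>i. B i > 0" "\<And>i x. norm (grad (pd i \<psi>) x) \<le> B i" by metis
  \<comment> \<open>The gradient is Lipschitz with the sum of the constants of its components,
    because the norm is bounded by the sum of the coordinates.\<close>
  define C where "C = sum B UNIV"
  have lip: "norm (grad \<psi> x - grad \<psi> y) \<le> C * norm (x - y)" for x y
  proof -
    have "norm (grad \<psi> x - grad \<psi> y) \<le> (\<Sum>i\<in>UNIV. \<bar>(grad \<psi> x - grad \<psi> y) $ i\<bar>)"
      by (rule norm_le_l1_cart)
    also have "\<dots> \<le> (\<Sum>i\<in>UNIV. B i * norm (x - y))"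
      using test_functions_lipschitz[OF test_functions_pd[OF assms] B(2)]
      by (intro sum_mono) (simp add: pd_def)
    finally show ?thesis by (simp add: C_def sum_distrib_right)
  qed
  have "C > 0" using B(1) by (auto simp: C_def intro!: sum_pos)
  moreover have "\<bar>\<psi> (u + h) - \<psi> u - grad \<psi> u \<bullet> h\<bar> \<le> C * (norm h)\<^sup>2" for u h
  proof -
    \<comment> \<open>Subtracting the linear part at \<open>u\<close> leaves a function whose
      gradient on the segment is at most \<open>C * norm h\<close>.\<close>
    let ?f = "\<lambda>v. \<psi> v - grad \<psi> u \<bullet> v"
    have "norm (?f (u + h) - ?f u) \<le> (C * norm h) * norm ((u + h) - u)"
    proof (rule differentiable_bound[of "closed_segment u (u + h)"])
      show "(?f has_derivative (\<lambda>k. (grad \<psi> z - grad \<psi> u) \<bullet> k)) (at z within closed_segment u (u+h))" for z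
        by (auto intro!: derivative_eq_intros has_derivative_at_withinI[OF test_functions_has_derivative[OF assms]]
            simp: inner_diff_left)
      show "onorm (\<lambda>k. (grad \<psi> z - grad \<psi> u) \<bullet> k) \<le> C * norm h" if "z \<in> closed_segment u (u+h)" for z
      proof -
        have "norm (grad \<psi> z - grad \<psi> u) \<le> C * norm (z - u)" by (rule lip)
        also have "\<dots> \<le> C * norm h"
          using segment_bound1[OF that] \<open>C > 0\<close> by simp
        finally have "norm (grad \<psi> z - grad \<psi> u) \<le> C * norm h" .
        moreover have "onorm (\<lambda>k. (grad \<psi> z - grad \<psi> u) \<bullet> k) \<le> norm (grad \<psi> z - grad \<psi> u)"
          by (metis norm_ge_zero Cauchy_Schwarz_ineq2 onorm_bound real_norm_def)
        ultimately show ?thesis by linarith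
      qed
    qed auto
    then show ?thesis by (simp add: inner_add_right power2_eq_square algebra_simps)
  qed
  ultimately show ?thesis using that by blast
qed

section \<open>Mollification\<close>

lemma integrable_scaleR_bounded:
  fixes F :: "'a \<Rightarrow> 'b::{banach, second_countable_topology}"
  assumes "integrable M F" "g \<in> borel_measurable M" "AE x in M. \<bar>g x\<bar> \<le> B"
  shows "integrable M (\<lambda>x. g x *\<^sub>R F x)"
proof (rule Bochner_Integration.integrable_bound[OF integrable_scaleR_right[OF integrable_norm[OF assms(1)], of "B"]])
  show "(\<lambda>x. g x *\<^sub>R F x) \<in> borel_measurable M" using assms by simp
  show "AE x in M. norm (g x *\<^sub>R F x) \<le> norm (B *\<^sub>R norm (F x))"
    using assms(3) by eventually_elim (auto intro!: mult_mono)
qed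

lemma integrable_mult_bounded:
  fixes F g :: "'a \<Rightarrow> real"
  assumes "integrable M F" "g \<in> borel_measurable M" "AE x in M. \<bar>g x\<bar> \<le> B"
  shows "integrable M (\<lambda>x. F x * g x)"
  using integrable_scaleR_bounded[OF assms] by (simp add: mult.commute)

lemma continuous_measurable_lebesgue:
  fixes g :: "'a::euclidean_space \<Rightarrow> 'b::euclidean_space"
  assumes "continuous_on UNIV g"
  shows "g \<in> borel_measurable (lebesgue_on S)"
proof -
  have "g \<in> borel_measurable lborel"
    using assms by (simp add: borel_measurable_continuous_onI)
  then show ?thesis
    by (intro measurable_restrict_space1 measurable_completion)
qed

text \<open>The reason why local integrability suffices in every integral against a test function:
  only a compact piece of \<open>\<Omega>\<close> contributes.\<close>

lemma loc_integrable_dominated: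
  fixes f :: "real^'n \<Rightarrow> 'b::euclidean_space" and h :: "real^'n \<Rightarrow> 'c::euclidean_space"
  assumes f: "loc_integrable \<Omega> f" and K: "compact K" "K \<subseteq> \<Omega>" and \<Omega>: "open \<Omega>"
    and h: "h \<in> borel_measurable (lebesgue_on K)" "\<And>x. x \<in> K \<Longrightarrow> norm (h x) \<le> B * norm (f x)"
      "\<And>x. x \<notin> K \<Longrightarrow> h x = 0"
  shows "integrable (lebesgue_on \<Omega>) h"
proof -
  have [measurable]: "K \<in> sets lebesgue"
    using K lmeasurable_compact by blast
  have "integrable (lebesgue_on K) f" using f K by (simp add: loc_integrable_def)
  then have "integrable (lebesgue_on K) (\<lambda>x. B * norm (f x))" by simp
  then have "integrable (lebesgue_on K) h"
    by (rule Bochner_Integration.integrable_bound[OF _ h(1)])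
      (auto intro!: AE_I2 order_trans[OF h(2)])
  then have "integrable lebesgue (\<lambda>x. indicator K x *\<^sub>R h x)"
    using K by (subst (asm) integrable_restrict_space) auto
  also have "(\<lambda>x. indicator K x *\<^sub>R h x) = (\<lambda>x. indicator \<Omega> x *\<^sub>R h x)"
    using h(3) K(2) by (auto simp: fun_eq_iff indicator_def)
  finally show ?thesis using \<Omega> by (subst integrable_restrict_space) auto
qed

lemma open_compact_exhaustion:
  fixes S :: "'a::euclidean_space set"
  assumes "open S"
  shows "\<exists>C :: nat \<Rightarrow> 'a set. (\<forall>n. compact (C n) \<and> C n \<subseteq> S) \<and> \<Union>(range C) = S"
proof (rule open_Union_compact_subsets[OF assms])
  fix C :: "nat \<Rightarrow> 'a set"
  assume "\<And>n. compact (C n)" "\<And>n. C n \<subseteq> S" "\<Union>(range C) = S"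
  then show ?thesis by (intro exI[of _ C]) simp
qed

text \<open>Measurability is known on each compact subset; a countable exhaustion glues the
  restrictions together.\<close>

lemma loc_integrable_measurable:
  fixes f :: "real^'n \<Rightarrow> 'b::euclidean_space"
  assumes "loc_integrable \<Omega> f" "open \<Omega>"
  shows "f \<in> borel_measurable (lebesgue_on \<Omega>)"
proof -
  from open_compact_exhaustion[OF assms(2)]
  obtain C :: "nat \<Rightarrow> (real^'n) set" where "(\<forall>n. compact (C n) \<and> C n \<subseteq> \<Omega>) \<and> \<Union>(range C) = \<Omega>"
    by (rule exE)
  then have C: "\<And>n. compact (C n)" "\<And>n. C n \<subseteq> \<Omega>" "\<Union>(range C) = \<Omega>" by simp_all
  show ?thesis
  proof (rule measurable_piecewise_restrict[of "range C"])
    show "D \<inter> space (lebesgue_on \<Omega>) \<in> sets (lebesgue_on \<Omega>)" if "D \<in> range C" for D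
    proof -
      have "D \<in> sets lebesgue" using that C(1) lmeasurable_compact by blast
      moreover have \<Omega>: "\<Omega> \<in> sets lebesgue"
        using assms(2) by (intro sets_completionI_sets) simp
      ultimately have "D \<inter> \<Omega> \<in> sets lebesgue" by (rule sets.Int)
      then show ?thesis using \<Omega> by (simp add: sets_restrict_space_iff)
    qed
    show "f \<in> borel_measurable (restrict_space (lebesgue_on \<Omega>) D)" if "D \<in> range C" for D
    proof -
      have D: "compact D" "D \<subseteq> \<Omega>" using that C(1,2) by auto
      then have "integrable (lebesgue_on D) f" using assms by (simp add: loc_integrable_def)
      moreover have "restrict_space (lebesgue_on \<Omega>) D = lebesgue_on D"
        using D lmeasurable_compact assms(2) by (subst restrict_restrict_space) (auto simp: Int_absorb1)
      ultimately show ?thesis by simp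
    qed
  qed (use C(3) in auto)
qed

lemma compact_in_lebesgue: "compact K \<Longrightarrow> K \<in> sets lebesgue"
  by (rule fmeasurableD[OF lmeasurable_compact])

lemma open_in_lebesgue: "open S \<Longrightarrow> S \<in> sets lebesgue"
  by (intro sets_completionI_sets) simp

lemma loc_integrable_continuous_on:
  fixes f :: "real^'n \<Rightarrow> 'b::euclidean_space"
  assumes f: "continuous_on \<Omega> f"
  shows "loc_integrable \<Omega> f"
  unfolding loc_integrable_def
proof (intro allI impI)
  fix K :: "(real^'n) set" assume K: "compact K \<and> K \<subseteq> \<Omega>"
  then have fK: "continuous_on K f" using f continuous_on_subset by blast
  then have "bounded (f ` K)"
    using K compact_continuous_image compact_imp_bounded by blast
  then obtain B where B: "\<And>x. x \<in> K \<Longrightarrow> norm (f x) \<le> B"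
    unfolding bounded_iff by auto
  interpret finite_measure "lebesgue_on K"
    using K by (intro finite_measure_lebesgue_on) (auto simp: lmeasurable_compact)
  show "integrable (lebesgue_on K) f"
  proof (rule integrable_const_bound[where B = B])
    show "f \<in> borel_measurable (lebesgue_on K)"
      by (rule continuous_imp_measurable_on_sets_lebesgue[OF fK compact_in_lebesgue]) (use K in blast)
  qed (use B in \<open>auto intro!: AE_I2\<close>)
qed

lemma loc_integrable_continuous:
  fixes f :: "real^'n \<Rightarrow> 'b::euclidean_space"
  assumes "continuous_on UNIV f"
  shows "loc_integrable \<Omega> f"
  by (rule loc_integrable_continuous_on[OF continuous_on_subset[OF assms subset_UNIV]])

lemma test_functions_integrable:
  fixes f :: "real^'n \<Rightarrow> 'b::euclidean_space"
  assumes \<psi>: "\<psi> \<in> test_functions \<Omega>" and \<Omega>: "open \<Omega>" and f: "loc_integrable \<Omega> f"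
  shows "integrable (lebesgue_on \<Omega>) (\<lambda>x. \<psi> x *\<^sub>R f x)"
proof -
  obtain K where K: "compact K" "K \<subseteq> \<Omega>" "\<And>x. x \<notin> K \<Longrightarrow> \<psi> x = 0" "\<And>x. x \<notin> K \<Longrightarrow> grad \<psi> x = 0"
    using test_functions_support[OF \<psi>] by metis
  obtain B where B: "\<And>x. \<bar>\<psi> x\<bar> \<le> B" "\<And>x. norm (grad \<psi> x) \<le> B"
    using test_functions_bounded[OF \<psi>] by metis
  have [measurable]: "f \<in> borel_measurable (lebesgue_on K)"
    using f K by (auto simp: loc_integrable_def)
  have [measurable]: "\<psi> \<in> borel_measurable (lebesgue_on K)" "grad \<psi> \<in> borel_measurable (lebesgue_on K)"
    using \<psi> by (auto intro: continuous_measurable_lebesgue test_functions_continuous test_functions_grad_continuous)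
  show ?thesis
  proof (rule loc_integrable_dominated[OF f K(1,2) \<Omega>, where B = B])
    show "norm (\<psi> x *\<^sub>R f x) \<le> B * norm (f x)" for x
      using B(1)[of x] by (simp add: mult_right_mono)
  qed (use K in auto)
qed

lemma test_functions_integrable_grad:
  fixes f :: "real^'n \<Rightarrow> real"
  assumes \<psi>: "\<psi> \<in> test_functions \<Omega>" and \<Omega>: "open \<Omega>" and f: "loc_integrable \<Omega> f"
  shows "integrable (lebesgue_on \<Omega>) (\<lambda>x. f x *\<^sub>R grad \<psi> x)"
proof -
  obtain K where K: "compact K" "K \<subseteq> \<Omega>" "\<And>x. x \<notin> K \<Longrightarrow> \<psi> x = 0" "\<And>x. x \<notin> K \<Longrightarrow> grad \<psi> x = 0"
    using test_functions_support[OF \<psi>] by metis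
  obtain B where B: "\<And>x. \<bar>\<psi> x\<bar> \<le> B" "\<And>x. norm (grad \<psi> x) \<le> B"
    using test_functions_bounded[OF \<psi>] by metis
  have [measurable]: "f \<in> borel_measurable (lebesgue_on K)"
    using f K by (auto simp: loc_integrable_def)
  have [measurable]: "\<psi> \<in> borel_measurable (lebesgue_on K)" "grad \<psi> \<in> borel_measurable (lebesgue_on K)"
    using \<psi> by (auto intro: continuous_measurable_lebesgue test_functions_continuous test_functions_grad_continuous)
  show ?thesis
  proof (rule loc_integrable_dominated[OF f K(1,2) \<Omega>, where B = B])
    show "norm (f x *\<^sub>R grad \<psi> x) \<le> B * norm (f x)" for x
      using mult_left_mono[OF B(2)[of x], of "\<bar>f x\<bar>"] by (simp add: mult.commute)
  qed (use K in auto)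
qed

lemma test_functions_integrable_inner:
  fixes f :: "real^'n \<Rightarrow> real^'n"
  assumes \<psi>: "\<psi> \<in> test_functions \<Omega>" and \<Omega>: "open \<Omega>" and f: "loc_integrable \<Omega> f"
  shows "integrable (lebesgue_on \<Omega>) (\<lambda>x. f x \<bullet> grad \<psi> x)"
proof -
  obtain K where K: "compact K" "K \<subseteq> \<Omega>" "\<And>x. x \<notin> K \<Longrightarrow> \<psi> x = 0" "\<And>x. x \<notin> K \<Longrightarrow> grad \<psi> x = 0"
    using test_functions_support[OF \<psi>] by metis
  obtain B where B: "\<And>x. \<bar>\<psi> x\<bar> \<le> B" "\<And>x. norm (grad \<psi> x) \<le> B"
    using test_functions_bounded[OF \<psi>] by metis
  have [measurable]: "f \<in> borel_measurable (lebesgue_on K)"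
    using f K by (auto simp: loc_integrable_def)
  have [measurable]: "\<psi> \<in> borel_measurable (lebesgue_on K)" "grad \<psi> \<in> borel_measurable (lebesgue_on K)"
    using \<psi> by (auto intro: continuous_measurable_lebesgue test_functions_continuous test_functions_grad_continuous)
  show ?thesis
  proof (rule loc_integrable_dominated[OF f K(1,2) \<Omega>, where B = B])
    show "norm (f x \<bullet> grad \<psi> x) \<le> B * norm (f x)" for x
      using Cauchy_Schwarz_ineq2[of "f x" "grad \<psi> x"] mult_left_mono[OF B(2)[of x] norm_ge_zero[of "f x"]] by (simp add: mult.commute)
  qed (use K in auto)
qed

section \<open>Mollifiers and convolution\<close>

lemma lebesgue_integral_reflect:
  fixes f :: "'a::euclidean_space \<Rightarrow> real"
  assumes [measurable]: "f \<in> borel_measurable borel"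
  shows "(\<integral>y. f (x - y) \<partial>lebesgue) = (\<integral>y. f y \<partial>lebesgue)"
proof -
  \<comment> \<open>The affine map with factor -1 has Jacobian factor 1.\<close>
  have "(lborel :: 'a measure) = density (distr lborel borel (\<lambda>y. x + (-1) *\<^sub>R y)) (\<lambda>_. ennreal (\<bar>-1\<bar> ^ DIM('a)))"
    by (rule lborel_affine) simp
  then have "(\<integral>y. f y \<partial>lborel) = (\<integral>y. f y \<partial>distr lborel borel (\<lambda>y. x + (-1) *\<^sub>R y))"
    by (simp add: density_1)
  also have "\<dots> = (\<integral>y. f (x - y) \<partial>lborel)"
    by (subst integral_distr) auto
  finally show ?thesis
    by (simp add: integral_completion)
qed

text \<open>The bump \<open>b\<close> is positive exactly on the open ball of radius
  \<open>e\<close>. An open ball is not a null set, so the integral is positive and can be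
  normalised to one.\<close>

lemma mollifier_exists:
  assumes e: "e > 0"
  obtains \<rho> :: "real^'n \<Rightarrow> real" where "\<rho> \<in> test_functions UNIV" "\<And>x. \<rho> x \<ge> 0"
    "\<And>x. norm x \<ge> e \<Longrightarrow> \<rho> x = 0" "(\<integral>x. \<rho> x \<partial>lebesgue) = 1" "integrable lebesgue \<rho>"
proof -
  define b where "b x = flat 0 (e\<^sup>2 - x \<bullet> x)" for x :: "real^'n"
  have b0: "b x = 0" if "norm x \<ge> e" for x
    using that e power_mono[of e "norm x" 2] by (simp add: b_def flat_def dot_square_norm not_less)
  have b1: "b x > 0" if "norm x < e" for x
    using that power_strict_mono[of "norm x" e 2] by (auto simp: b_def flat_def dot_square_norm)
  have bt: "b \<in> test_functions UNIV"
    unfolding test_functions_iff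
  proof (intro conjI exI[of _ "cball 0 e"])
    show "\<forall>k. Ck k b" unfolding b_def using Ck_flat_ball by blast
  qed (use b0 in auto)
  have int: "integrable lebesgue b"
    using test_functions_integrable[OF bt open_UNIV loc_integrable_continuous[of "\<lambda>x. 1::real"]]
    by (simp add: lebesgue_on_UNIV_eq)
  have bnn: "b x \<ge> 0" for x using b0[of x] b1[of x] by fastforce
  have pos: "(\<integral>x. b x \<partial>lebesgue) > 0"
  proof (rule ccontr)
    assume "\<not> ?thesis"
    then have "(\<integral>x. b x \<partial>lebesgue) = 0"
      using bnn by (smt (verit) Bochner_Integration.integral_nonneg)
    then have ae: "AE x in lebesgue. b x = 0"
      using integral_nonneg_eq_0_iff_AE[OF int] bnn by auto
    then have "AE x in lebesgue. x \<notin> ball (0::real^'n) e"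
      by (rule eventually_mono) (use b1 in force)
    then have "ball (0::real^'n) e \<in> null_sets lebesgue"
      by (subst (asm) AE_iff_null_sets[symmetric]) auto
    then show False
      using e negligible_iff_null_sets open_not_negligible[of "ball (0::real^'n) e"] by auto
  qed
  show ?thesis
  proof (rule that[of "\<lambda>x. (1 / (\<integral>x. b x \<partial>lebesgue)) * b x"])
    show "(\<lambda>x. (1 / (\<integral>x. b x \<partial>lebesgue)) * b x) \<in> test_functions UNIV"
      by (rule test_functions_mult[OF bt Ck_const])
  qed (use pos bnn b0 int in auto)
qed

definition conv :: "(real^'n \<Rightarrow> real) \<Rightarrow> (real^'n \<Rightarrow> real) \<Rightarrow> real^'n \<Rightarrow> real" where
  "conv F \<rho> x = (\<integral>y. F y * \<rho> (x - y) \<partial>lebesgue)"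

lemma integrable_conv:
  assumes "integrable lebesgue F" "\<rho> \<in> test_functions \<Omega>"
  shows "integrable lebesgue (\<lambda>y. F y * \<rho> (x - y))"
proof -
  obtain B where "\<And>x. \<bar>\<rho> x\<bar> \<le> B" using test_functions_bounded[OF assms(2)] by metis
  moreover have "continuous_on UNIV (\<lambda>y. \<rho> (x - y))"
    by (rule continuous_on_compose2[OF test_functions_continuous[OF assms(2), of UNIV]])
      (auto intro!: continuous_intros)
  ultimately show ?thesis
    using continuous_measurable_lebesgue[of "\<lambda>y. \<rho> (x - y)" UNIV]
    by (intro integrable_mult_bounded[OF assms(1), where B = B]) (auto simp: lebesgue_on_UNIV_eq)
qed

text \<open>The Taylor remainder of \<open>\<rho>\<close> is quadratic uniformly in
  \<open>y\<close>; multiplied by \<open>F y\<close> and integrated it leaves an error of order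
  \<open>(norm (z - x))\<^sup>2\<close>. All regularity comes from \<open>\<rho>\<close>, while
  \<open>F\<close> is merely integrable.\<close>

lemma conv_has_derivative:
  assumes F: "integrable lebesgue F" and \<rho>: "\<rho> \<in> test_functions UNIV"
  shows "(conv F \<rho> has_derivative (\<lambda>h. (\<chi> i. conv F (pd i \<rho>) x) \<bullet> h)) (at x)"
proof -
  obtain C where C: "C > 0" "\<And>u h. \<bar>\<rho> (u + h) - \<rho> u - grad \<rho> u \<bullet> h\<bar> \<le> C * (norm h)\<^sup>2"
    using test_functions_taylor[OF \<rho>] by metis
  define I where "I = (\<integral>y. \<bar>F y\<bar> \<partial>lebesgue)"
  let ?D = "\<lambda>h. (\<chi> i. conv F (pd i \<rho>) x) \<bullet> h"
  have intpd: "integrable lebesgue (\<lambda>y. F y * pd i \<rho> (x - y))" for i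
    by (rule integrable_conv[OF F test_functions_pd[OF \<rho>]])
  have D: "?D h = (\<integral>y. F y * (grad \<rho> (x - y) \<bullet> h) \<partial>lebesgue)"
    and Dint: "integrable lebesgue (\<lambda>y. F y * (grad \<rho> (x - y) \<bullet> h))" for h
  proof -
    have eq: "F y * (grad \<rho> (x - y) \<bullet> h) = (\<Sum>i\<in>UNIV. F y * pd i \<rho> (x - y) * h $ i)" for y
      by (simp add: inner_vec_def pd_def sum_distrib_left algebra_simps)
    show "integrable lebesgue (\<lambda>y. F y * (grad \<rho> (x - y) \<bullet> h))"
      unfolding eq using intpd by (intro Bochner_Integration.integrable_sum integrable_mult_left) 
    have "(\<integral>y. F y * (grad \<rho> (x - y) \<bullet> h) \<partial>lebesgue) = (\<Sum>i\<in>UNIV. conv F (pd i \<rho>) x * h $ i)"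
      unfolding eq conv_def using intpd by (simp add: Bochner_Integration.integral_sum)
    then show "?D h = (\<integral>y. F y * (grad \<rho> (x - y) \<bullet> h) \<partial>lebesgue)"
      by (simp add: inner_vec_def)
  qed
  have est: "\<bar>conv F \<rho> z - conv F \<rho> x - ?D (z - x)\<bar> \<le> C * I * (norm (z - x))\<^sup>2" for z
  proof -
    have i1: "integrable lebesgue (\<lambda>y. F y * \<rho> (w - y))" for w
      by (rule integrable_conv[OF F \<rho>])
    have "conv F \<rho> z - conv F \<rho> x - ?D (z - x)
      = (\<integral>y. F y * \<rho> (z - y) - F y * \<rho> (x - y) - F y * (grad \<rho> (x - y) \<bullet> (z - x)) \<partial>lebesgue)"
      unfolding D unfolding conv_def
      by (simp only: Bochner_Integration.integral_diff i1 Dint Bochner_Integration.integrable_diff)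
    also have "\<bar>\<dots>\<bar> \<le> (\<integral>y. \<bar>F y\<bar> * (C * (norm (z - x))\<^sup>2) \<partial>lebesgue)"
    proof (rule integral_abs_bound_integral)
      show "\<bar>F y * \<rho> (z - y) - F y * \<rho> (x - y) - F y * (grad \<rho> (x - y) \<bullet> (z - x))\<bar> \<le> \<bar>F y\<bar> * (C * (norm (z - x))\<^sup>2)" for y
      proof -
        have "F y * \<rho> (z - y) - F y * \<rho> (x - y) - F y * (grad \<rho> (x - y) \<bullet> (z - x))
          = F y * (\<rho> ((x - y) + (z - x)) - \<rho> (x - y) - grad \<rho> (x - y) \<bullet> (z - x))"
          by (simp add: right_diff_distrib)
        then show ?thesis
          using mult_left_mono[OF C(2)[of "x - y" "z - x"] abs_ge_zero[of "F y"]] by (simp add: abs_mult)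
      qed
    qed (use i1 Dint F in auto)
    also have "\<dots> = C * I * (norm (z - x))\<^sup>2"
      by (simp add: I_def)
    finally show ?thesis .
  qed
  show ?thesis
  proof (rule has_derivativeI_sandwich[where e = 1 and H = "\<lambda>z. C * I * norm (z - x)"])
    show "bounded_linear ?D" by (rule bounded_linear_inner_right)
    show "norm (conv F \<rho> z - conv F \<rho> x - ?D (z - x)) / norm (z - x) \<le> C * I * norm (z - x)"
      if "z \<noteq> x" for z
      using est[of z] that by (simp add: field_simps power2_eq_square)
    show "((\<lambda>z. C * I * norm (z - x)) \<longlongrightarrow> 0) (at x)"
      by (auto intro!: tendsto_eq_intros)
  qed auto
qed

lemma grad_conv:
  assumes "integrable lebesgue F" "\<rho> \<in> test_functions UNIV"
  shows "grad (conv F \<rho>) x = (\<chi> i. conv F (pd i \<rho>) x)"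
  by (rule grad_eqI[OF conv_has_derivative[OF assms]])

lemma Ck_conv:
  assumes "integrable lebesgue F" "\<rho> \<in> test_functions UNIV"
  shows "Ck k (conv F \<rho>)"
  using assms(2)
proof (induction k arbitrary: \<rho>)
  case 0
  show ?case
    using has_derivative_continuous[OF conv_has_derivative[OF assms(1) 0]]
    by (simp add: continuous_at_imp_continuous_on)
next
  case (Suc k)
  show ?case
    by (rule Ck_SucI[OF conv_has_derivative[OF assms(1) Suc.prems]])
      (simp add: Suc.IH[OF test_functions_pd[OF Suc.prems]])
qed

text \<open>The neighbourhood is the Minkowski sum of \<open>K\<close> and a closed ball.\<close>

lemma compact_UN_cball:
  fixes K :: "'a::euclidean_space set"
  assumes "compact K"
  shows "compact (\<Union>x\<in>K. cball x e)"
proof -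
  have eq: "(\<Union>x\<in>K. cball x e) = {x + y | x y. x \<in> K \<and> y \<in> cball 0 e}"
  proof safe
    fix x z assume "x \<in> K" "z \<in> cball x e"
    then show "\<exists>x' y. z = x' + y \<and> x' \<in> K \<and> y \<in> cball 0 e"
      by (intro exI[of _ x] exI[of _ "z - x"]) (auto simp: dist_norm norm_minus_commute)
  next
    fix x y :: "'a" assume "x \<in> K" "y \<in> cball 0 e"
    then show "x + y \<in> (\<Union>x\<in>K. cball x e)"
      by (intro UN_I[of x]) (auto simp: dist_norm)
  qed
  show ?thesis
    unfolding eq by (rule compact_sums[OF assms compact_cball])
qed

lemma conv_test_function:
  fixes \<Omega> :: "(real^'n) set"
  assumes F: "integrable lebesgue F" and \<rho>: "\<rho> \<in> test_functions UNIV"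
    and K: "compact K" "\<And>x. x \<notin> K \<Longrightarrow> F x = 0"
    and \<rho>0: "\<And>x. norm x \<ge> e \<Longrightarrow> \<rho> x = 0"
    and sub: "(\<Union>x\<in>K. cball x e) \<subseteq> \<Omega>"
  shows "conv F \<rho> \<in> test_functions \<Omega>" "\<And>x. x \<notin> (\<Union>x\<in>K. cball x e) \<Longrightarrow> conv F \<rho> x = 0"
proof -
  have co: "compact (\<Union>x\<in>K. cball x e)"
    by (rule compact_UN_cball[OF K(1)])
  show z: "conv F \<rho> x = 0" if "x \<notin> (\<Union>x\<in>K. cball x e)" for x
  proof -
    have *: "F y * \<rho> (x - y) = 0" for y
      using K(2)[of y] \<rho>0[of "x - y"] that by (cases "y \<in> K") (auto simp: dist_norm norm_minus_commute)
    show ?thesis unfolding conv_def * by simp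
  qed
  show "conv F \<rho> \<in> test_functions \<Omega>"
    unfolding test_functions_iff using Ck_conv[OF F \<rho>] co z sub by blast
qed

text \<open>Since \<open>\<rho>\<close> has mass one and lives within distance \<open>e\<close>, the
  convolution is an average of values of \<open>F\<close> near \<open>x\<close>. The free constant
  \<open>c\<close> makes the estimate usable for continuity as well as for bounds on the
  range.\<close>

lemma conv_close:
  assumes F: "integrable lebesgue F" and \<rho>: "\<rho> \<in> test_functions UNIV" "\<And>x. \<rho> x \<ge> 0"
    "\<And>x. norm x \<ge> e \<Longrightarrow> \<rho> x = 0" "(\<integral>x. \<rho> x \<partial>lebesgue) = 1" "integrable lebesgue \<rho>"
    and close: "\<And>y. dist x y < e \<Longrightarrow> \<bar>F y - c\<bar> \<le> \<eta>"
  shows "\<bar>conv F \<rho> x - c\<bar> \<le> \<eta>"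
proof -
  have [measurable]: "\<rho> \<in> borel_measurable borel"
    using test_functions_continuous[OF \<rho>(1), of UNIV] by (simp add: borel_measurable_continuous_onI)
  have i1: "(\<integral>y. \<rho> (x - y) \<partial>lebesgue) = 1"
    using lebesgue_integral_reflect[of \<rho> x] \<rho> by simp
  \<comment> \<open>The integral of a non-integrable function would be the default 0, not 1.\<close>
  have i2: "integrable lebesgue (\<lambda>y. \<rho> (x - y))"
    using i1 not_integrable_integral_eq by fastforce
  have "conv F \<rho> x - c = (\<integral>y. F y * \<rho> (x - y) - c * \<rho> (x - y) \<partial>lebesgue)"
    using i1 i2 integrable_conv[OF F \<rho>(1), of x] by (simp add: conv_def)
  also have "\<bar>\<dots>\<bar> \<le> (\<integral>y. \<eta> * \<rho> (x - y) \<partial>lebesgue)"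
  proof (rule integral_abs_bound_integral)
    show "\<bar>F y * \<rho> (x - y) - c * \<rho> (x - y)\<bar> \<le> \<eta> * \<rho> (x - y)" for y
      using close[of y] \<rho>(2)[of "x - y"] \<rho>(3)[of "x - y"]
      by (cases "dist x y < e")
        (auto simp: dist_norm abs_mult mult_right_mono simp flip: left_diff_distrib)
  qed (use i2 integrable_conv[OF F \<rho>(1), of x] in auto)
  also have "\<dots> = \<eta>" using i1 by simp
  finally show ?thesis .
qed

text \<open>The convolution with the indicator of a large ball is constant near the origin.\<close>

lemma integral_pd_test_function:
  fixes \<psi> :: "real^'n \<Rightarrow> real"
  assumes \<psi>: "\<psi> \<in> test_functions UNIV"
  shows "(\<integral>x. pd i \<psi> x \<partial>lebesgue) = 0"
proof -
  obtain R where R: "R > 0" "\<And>x. norm x > R \<Longrightarrow> \<psi> x = 0" "\<And>x. norm x > R \<Longrightarrow> grad \<psi> x = 0"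
  proof -
    obtain K where "compact K" "\<And>x. x \<notin> K \<Longrightarrow> \<psi> x = 0" "\<And>x. x \<notin> K \<Longrightarrow> grad \<psi> x = 0"
      using test_functions_support[OF \<psi>] by metis
    moreover then obtain R where "R > 0" "\<And>x. x \<in> K \<Longrightarrow> norm x \<le> R"
      using compact_imp_bounded bounded_pos by metis
    ultimately show ?thesis using that by (metis not_le)
  qed
  \<comment> \<open>The margin 1 keeps \<open>\<psi> (x - y)\<close>, as a function of
    \<open>y\<close>, supported in this ball for every \<open>x\<close> of norm below 1.\<close>
  define F :: "real^'n \<Rightarrow> real" where "F = indicator (cball 0 (R + 1))"
  have F: "integrable lebesgue F"
    unfolding F_def by (rule integrable_real_indicator) (use emeasure_bounded_finite[of "cball (0::real^'n) (R + 1)"] in auto)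
  have [measurable]: "\<psi> \<in> borel_measurable borel" "pd i \<psi> \<in> borel_measurable borel"
    using test_functions_continuous[OF \<psi>, of UNIV] test_functions_continuous[OF test_functions_pd[OF \<psi>], of UNIV]
    by (simp_all add: borel_measurable_continuous_onI)
  have c: "conv F \<phi> x = (\<integral>y. \<phi> y \<partial>lebesgue)" 
    if x: "norm x < 1" and \<phi>: "\<And>x. norm x > R \<Longrightarrow> \<phi> x = 0" "\<phi> \<in> borel_measurable borel" for \<phi> x
  proof -
    have *: "F y * \<phi> (x - y) = \<phi> (x - y)" for y
    proof (cases "norm y \<le> R + 1")
      case False
      then have "norm (x - y) > R" using x norm_triangle_ineq2[of y x] by (simp add: norm_minus_commute)
      then show ?thesis using \<phi> by simp
    qed (simp add: F_def)
    show ?thesis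
      unfolding conv_def * using lebesgue_integral_reflect \<phi>(2) by blast
  qed
  have "(conv F \<psi> has_derivative (\<lambda>h. (0::real^'n) \<bullet> h)) (at 0)"
    by (rule has_derivative_transform_within_open[where s = "ball 0 1" and f = "\<lambda>x. (\<integral>y. \<psi> y \<partial>lebesgue)"])
      (auto simp: c R(2))
  from grad_eqI[OF this] grad_conv[OF F \<psi>] have "conv F (pd i \<psi>) 0 = 0"
    by (simp add: vec_eq_iff)
  then show ?thesis
    using c[of 0 "pd i \<psi>"] R(3) by (simp add: pd_def)
qed

section \<open>Density of test functions\<close>

text \<open>The indicator of the closed \<open>d n\<close>-neighbourhood \<open>S n\<close> of
  \<open>K\<close> is mollified at the same scale \<open>d n\<close>. Thickening beforehand makes
  the result equal to 1 on all of \<open>K\<close>, while at a point off \<open>K\<close> it is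
  eventually 0. The common support \<open>L\<close> later supplies an integrable majorant.\<close>

lemma test_approx_compact:
  fixes K :: "(real^'n) set"
  assumes K: "compact K" "K \<subseteq> \<Omega>" and \<Omega>: "open \<Omega>"
  shows "\<exists>(\<psi> :: nat \<Rightarrow> real^'n \<Rightarrow> real) L. (\<forall>n. \<psi> n \<in> test_functions \<Omega>) \<and> (\<forall>n x. 0 \<le> \<psi> n x) \<and> (\<forall>n x. \<psi> n x \<le> 1) \<and>
    (\<forall>x. (\<lambda>n. \<psi> n x) \<longlonglongrightarrow> indicator K x) \<and> compact L \<and> L \<subseteq> \<Omega> \<and> (\<forall>n x. x \<notin> L \<longrightarrow> \<psi> n x = 0)"
proof -
  obtain e where e: "e > 0" "(\<Union>x\<in>K. cball x e) \<subseteq> \<Omega>"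
    using compact_subset_open_imp_cball_epsilon_subset[OF K(1) \<Omega> K(2)] by metis
  \<comment> \<open>Thickening and mollifying each widen the support by \<open>d n\<close>; the
    factor 1/2 keeps the total within \<open>e\<close>.\<close>
  define d where "d n = e / 2 / real (Suc n)" for n
  have d: "d n > 0" "2 * d n \<le> e" for n
    using e by (auto simp: d_def field_simps)
  have dlim: "d \<longlonglongrightarrow> 0"
    unfolding d_def by (rule LIMSEQ_Suc[OF lim_const_over_n])
  have "\<exists>\<rho> :: real^'n \<Rightarrow> real. \<rho> \<in> test_functions UNIV \<and> (\<forall>x. \<rho> x \<ge> 0) \<and>
    (\<forall>x. norm x \<ge> d n \<longrightarrow> \<rho> x = 0) \<and> (\<integral>x. \<rho> x \<partial>lebesgue) = 1 \<and> integrable lebesgue \<rho>" for n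
    using mollifier_exists[OF d(1)[of n]] by metis
  then obtain \<rho> :: "nat \<Rightarrow> real^'n \<Rightarrow> real" where \<rho>: "\<And>n. \<rho> n \<in> test_functions UNIV" "\<And>n x. \<rho> n x \<ge> 0"
    "\<And>n x. norm x \<ge> d n \<Longrightarrow> \<rho> n x = 0" "\<And>n. (\<integral>x. \<rho> n x \<partial>lebesgue) = 1" "\<And>n. integrable lebesgue (\<rho> n)"
    by metis
  define S where "S n = (\<Union>x\<in>K. cball x (d n))" for n
  have S: "compact (S n)" for n unfolding S_def by (rule compact_UN_cball[OF K(1)])
  define F :: "nat \<Rightarrow> real^'n \<Rightarrow> real" where "F n = indicator (S n)" for n
  have F: "integrable lebesgue (F n)" for n
    unfolding F_def
  proof (rule integrable_real_indicator)
    have "S n \<in> lmeasurable" using S by (rule lmeasurable_compact)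
    then show "S n \<in> sets lebesgue" "emeasure lebesgue (S n) < \<infinity>"
      by (rule fmeasurableD) (metis \<open>S n \<in> lmeasurable\<close> fmeasurableD2 infinity_ennreal_def top.not_eq_extremum)
  qed
  define \<psi> where "\<psi> n = conv (F n) (\<rho> n)" for n
  have sub: "(\<Union>x\<in>S n. cball x (d n)) \<subseteq> (\<Union>x\<in>K. cball x (2 * d n))" for n
  proof safe
    fix x z assume "x \<in> S n" "z \<in> cball x (d n)"
    then obtain y where "y \<in> K" "dist y x \<le> d n" "dist x z \<le> d n" by (auto simp: S_def)
    then show "z \<in> (\<Union>x\<in>K. cball x (2 * d n))"
      using dist_triangle[of y z x] by (intro UN_I[of y]) auto
  qed
  have subL: "(\<Union>x\<in>S n. cball x (d n)) \<subseteq> (\<Union>x\<in>K. cball x e)" for n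
    using sub[of n] subset_cball[OF d(2)[of n]] by blast
  have F0: "F n x = 0" if "x \<notin> S n" for n x using that by (simp add: F_def)
  have ct1: "\<psi> n \<in> test_functions \<Omega>" for n
    unfolding \<psi>_def
    by (rule conv_test_function(1)[OF F \<rho>(1) S F0 \<rho>(3)]) (use subL[of n] e(2) in auto)
  have ct2: "\<psi> n x = 0" if "x \<notin> (\<Union>x\<in>S n. cball x (d n))" for n x
    unfolding \<psi>_def
    by (rule conv_test_function(2)[where \<Omega> = UNIV, OF F \<rho>(1) S F0 \<rho>(3) _ that]) auto
  \<comment> \<open>An indicator stays within 1/2 of 1/2, so both range bounds come out of one
    estimate.\<close>
  have 1: "\<bar>\<psi> n x - 1 / 2\<bar> \<le> 1 / 2" for n x
    unfolding \<psi>_def by (rule conv_close[OF F \<rho>(1) \<rho>(2) \<rho>(3) \<rho>(4,5)]) (auto simp: F_def indicator_def)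
  have 2: "\<psi> n x = 1" if "x \<in> K" for n x
  proof -
    have "F n y = 1" if "dist x y < d n" for y
    proof -
      have "y \<in> S n" unfolding S_def using that \<open>x \<in> K\<close> by (intro UN_I[of x]) auto
      then show ?thesis by (simp add: F_def)
    qed
    then have "\<bar>\<psi> n x - 1\<bar> \<le> 0"
      unfolding \<psi>_def by (intro conv_close[OF F \<rho>(1) \<rho>(2) \<rho>(3) \<rho>(4,5)]) auto
    then show ?thesis by simp
  qed
  show ?thesis
  proof (intro exI[of _ \<psi>] exI[of _ "\<Union>x\<in>K. cball x e"] conjI allI impI)
    show "\<psi> n \<in> test_functions \<Omega>" for n
      by (rule ct1)
    show "0 \<le> \<psi> n x" "\<psi> n x \<le> 1" for n x using 1[of n x] by linarith+
    show "compact (\<Union>x\<in>K. cball x e)" by (rule compact_UN_cball[OF K(1)])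
    show "\<psi> n x = 0" if "x \<notin> (\<Union>x\<in>K. cball x e)" for n x
      using ct2[of x n] subL[of n] that by blast
    show "(\<lambda>n. \<psi> n x) \<longlonglongrightarrow> indicator K x" for x
    proof (cases "x \<in> K")
      case False
      then obtain r where r: "r > 0" "ball x r \<inter> K = {}"
        using K(1) compact_imp_closed[THEN open_Compl] by (metis Compl_iff disjoint_eq_subset_Compl openE)
      have "\<forall>\<^sub>F n in sequentially. 2 * d n < r"
        using order_tendstoD(2)[OF tendsto_mult_right_zero[OF dlim, of 2] r(1)] .
      then have "\<forall>\<^sub>F n in sequentially. \<psi> n x = 0"
      proof eventually_elim
        case (elim n)
        then have "x \<notin> (\<Union>x\<in>K. cball x (2 * d n))"
          using r(2) by (force simp: dist_commute)
        then show ?case using ct2[of x n] sub[of n] by blast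
      qed
      then show ?thesis using False by (simp add: tendsto_eventually)
    qed (simp add: 2)
  qed (use e in auto)
qed

text \<open>Dominated convergence along smooth approximations of the indicator of \<open>K\<close>;
  on their common support \<open>L\<close> the function \<open>f\<close> is integrable and serves as
  majorant.\<close>

lemma integral_test_compact:
  fixes f :: "real^'n \<Rightarrow> real"
  assumes \<Omega>: "open \<Omega>" and f: "loc_integrable \<Omega> f"
    and 0: "\<And>\<psi>. \<psi> \<in> test_functions \<Omega> \<Longrightarrow> (\<integral>x. \<psi> x * f x \<partial>lebesgue_on \<Omega>) = 0"
    and K: "compact K" "K \<subseteq> \<Omega>"
  shows "(\<integral>x. f x \<partial>lebesgue_on K) = 0"
proof -
  obtain \<psi> :: "nat \<Rightarrow> real^'n \<Rightarrow> real" and L where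
    "(\<forall>n. \<psi> n \<in> test_functions \<Omega>) \<and> (\<forall>n x. 0 \<le> \<psi> n x) \<and> (\<forall>n x. \<psi> n x \<le> 1) \<and>
    (\<forall>x. (\<lambda>n. \<psi> n x) \<longlonglongrightarrow> indicator K x) \<and> compact L \<and> L \<subseteq> \<Omega> \<and> (\<forall>n x. x \<notin> L \<longrightarrow> \<psi> n x = 0)"
    using test_approx_compact[OF K \<Omega>] by (elim exE)
  then have \<psi>: "\<And>n. \<psi> n \<in> test_functions \<Omega>" "\<And>n x. 0 \<le> \<psi> n x" "\<And>n x. \<psi> n x \<le> 1"
    "\<And>x. (\<lambda>n. \<psi> n x) \<longlonglongrightarrow> indicator K x" "compact L" "L \<subseteq> \<Omega>" "\<And>n x. x \<notin> L \<Longrightarrow> \<psi> n x = 0"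
    by simp_all
  have [measurable]: "K \<in> sets lebesgue" "L \<in> sets lebesgue" "\<Omega> \<in> sets lebesgue"
    by (simp_all add: compact_in_lebesgue open_in_lebesgue K(1) \<psi>(5) \<Omega>)
  have [measurable]: "f \<in> borel_measurable (lebesgue_on \<Omega>)"
    by (rule loc_integrable_measurable[OF f \<Omega>])
  have "(\<lambda>n. \<integral>x. \<psi> n x * f x \<partial>lebesgue_on \<Omega>) \<longlonglongrightarrow> (\<integral>x. indicator K x * f x \<partial>lebesgue_on \<Omega>)"
  proof (rule integral_dominated_convergence)
    have "L \<inter> space (lebesgue_on \<Omega>) \<in> sets (lebesgue_on \<Omega>)"
      by (auto simp: sets_restrict_space)
    moreover have "restrict_space (lebesgue_on \<Omega>) L = lebesgue_on L"
      using \<psi>(6) by (subst restrict_restrict_space) (auto simp: Int_absorb1)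
    moreover have "integrable (lebesgue_on L) f"
      using f \<psi>(5,6) by (simp add: loc_integrable_def)
    ultimately have "integrable (lebesgue_on \<Omega>) (\<lambda>x. indicator L x *\<^sub>R f x)"
      by (metis integrable_restrict_space)
    then show "integrable (lebesgue_on \<Omega>) (\<lambda>x. norm (indicator L x *\<^sub>R f x))"
      by (rule integrable_norm)
    have [measurable]: "K \<inter> \<Omega> \<in> sets lebesgue" by simp
    show "(\<lambda>x. indicator K x * f x) \<in> borel_measurable (lebesgue_on \<Omega>)"
      by (rule borel_measurable_times) (auto intro!: measurable_restrict_space1)
    show "(\<lambda>x. \<psi> n x * f x) \<in> borel_measurable (lebesgue_on \<Omega>)" for n
      using test_functions_integrable[OF \<psi>(1) \<Omega> f] by (simp add: borel_measurable_integrable)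
    show "AE x in lebesgue_on \<Omega>. norm (\<psi> n x * f x) \<le> norm (indicator L x *\<^sub>R f x)" for n
      using \<psi>(2,3,7) by (auto intro!: AE_I2 simp: indicator_def abs_mult mult_left_le_one_le)
    show "AE x in lebesgue_on \<Omega>. (\<lambda>n. \<psi> n x * f x) \<longlonglongrightarrow> indicator K x * f x"
      by (intro AE_I2 tendsto_mult \<psi>(4) tendsto_const)
  qed
  then have "(\<integral>x. indicator K x * f x \<partial>lebesgue_on \<Omega>) = 0"
    using 0[OF \<psi>(1)] by (simp add: LIMSEQ_const_iff)
  also have "(\<integral>x. indicator K x * f x \<partial>lebesgue_on \<Omega>) = (\<integral>x. indicator \<Omega> x *\<^sub>R (indicator K x * f x) \<partial>lebesgue)"
    by (subst integral_restrict_space) auto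
  also have "(\<lambda>x. indicator \<Omega> x *\<^sub>R (indicator K x * f x)) = (\<lambda>x. indicator K x *\<^sub>R f x)"
    using K(2) by (auto simp: indicator_def fun_eq_iff)
  also have "(\<integral>x. indicator K x *\<^sub>R f x \<partial>lebesgue) = (\<integral>x. f x \<partial>lebesgue_on K)"
    by (subst integral_restrict_space) auto
  finally show ?thesis .
qed

text \<open>Inner regularity replaces the set \<open>E\<close> where \<open>f\<close> is positive by
  a closed subset \<open>T\<close>, up to arbitrarily small measure. On \<open>T\<close> a positive
  function has integral zero, so \<open>T\<close> is null and only the small remainder is
  left.\<close>

lemma nonpos_AE_of_integral_compact:
  fixes f :: "real^'n \<Rightarrow> real"
  assumes K: "compact K" and f: "integrable (lebesgue_on K) f"
    and 0: "\<And>L. compact L \<Longrightarrow> L \<subseteq> K \<Longrightarrow> (\<integral>x. f x \<partial>lebesgue_on L) = 0"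
  shows "AE x in lebesgue. x \<in> K \<longrightarrow> f x \<le> 0"
proof -
  define E where "E = {x \<in> K. f x > 0}"
  have [measurable]: "K \<in> sets lebesgue"
    using K by (rule compact_in_lebesgue)
  have [measurable]: "f \<in> borel_measurable (lebesgue_on K)" using f by auto
  have "{x \<in> space (lebesgue_on K). f x > 0} \<in> sets (lebesgue_on K)"
    by measurable
  then have E: "E \<in> sets lebesgue"
    by (simp add: E_def sets_restrict_space_iff)
  have "emeasure lebesgue E \<le> ennreal e" if "e > 0" for e
  proof -
    obtain T where T: "closed T" "T \<subseteq> E" "E - T \<in> lmeasurable" "emeasure lebesgue (E - T) < ennreal e"
      using sets_lebesgue_inner_closed[OF E \<open>e > 0\<close>] by metis
    have TK: "T \<subseteq> K" using T(2) by (auto simp: E_def)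
    then have cT: "compact T" using T(1) K by (meson bounded_subset compact_eq_bounded_closed)
    then have [measurable]: "T \<in> sets lebesgue" using lmeasurable_compact by blast
    have "integrable lebesgue (\<lambda>x. indicator K x *\<^sub>R f x)"
      using f by (subst (asm) integrable_restrict_space) auto
    from integrable_mult_indicator[OF _ this, of T]
    have "integrable lebesgue (\<lambda>x. indicator T x *\<^sub>R indicator K x *\<^sub>R f x)"
      by simp
    also have "(\<lambda>x. indicator T x *\<^sub>R indicator K x *\<^sub>R f x) = (\<lambda>x. indicator T x *\<^sub>R f x)"
      using TK by (auto simp: fun_eq_iff indicator_def)
    finally have i: "integrable (lebesgue_on T) f"
      by (subst integrable_restrict_space) auto
    have "AE x in lebesgue_on T. 0 \<le> f x"
      using T(2) by (intro AE_I2) (auto simp: E_def less_imp_le)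
    then have "AE x in lebesgue_on T. f x = 0"
      using integral_nonneg_eq_0_iff_AE[OF i] 0[OF cT TK] by blast
    then have "AE x in lebesgue. x \<notin> T"
      by (subst (asm) AE_restrict_space_iff) (use T(2) in \<open>auto simp: E_def elim!: eventually_mono\<close>)
    then have "T \<in> null_sets lebesgue"
      by (subst (asm) AE_iff_null_sets[symmetric]) auto
    moreover have "E = T \<union> (E - T)" using T(2) by auto
    ultimately have "emeasure lebesgue E \<le> emeasure lebesgue (E - T)"
      using E by (metis emeasure_Un_null_set eq_refl Un_commute Diff_disjoint fmeasurableD T(3))
    then show ?thesis using T(4) by simp
  qed
  then have "emeasure lebesgue E \<le> 0"
    by (metis ennreal_le_epsilon add_0)
  then have "E \<in> null_sets lebesgue" using E by (simp add: null_sets_def)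
  then have "AE x in lebesgue. x \<notin> E" by (rule AE_not_in)
  then show ?thesis by (rule eventually_mono) (auto simp: E_def)
qed

text \<open>The fundamental lemma of the calculus of variations: the one-sided statement is applied
  to \<open>f\<close> and to its negative on each member of a compact exhaustion.\<close>

lemma fundamental_lemma:
  fixes f :: "real^'n \<Rightarrow> real"
  assumes \<Omega>: "open \<Omega>" and f: "loc_integrable \<Omega> f"
    and 0: "\<And>\<psi>. \<psi> \<in> test_functions \<Omega> \<Longrightarrow> (\<integral>x. \<psi> x * f x \<partial>lebesgue_on \<Omega>) = 0"
  shows "AE x in lebesgue_on \<Omega>. f x = 0"
proof -
  from open_compact_exhaustion[OF \<Omega>]
  obtain C :: "nat \<Rightarrow> (real^'n) set" where "(\<forall>n. compact (C n) \<and> C n \<subseteq> \<Omega>) \<and> \<Union>(range C) = \<Omega>"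
    by (rule exE)
  then have C: "\<And>n. compact (C n)" "\<And>n. C n \<subseteq> \<Omega>" "\<Union>(range C) = \<Omega>" by simp_all
  have "AE x in lebesgue. x \<in> C n \<longrightarrow> f x = 0" for n
  proof -
    have i: "integrable (lebesgue_on (C n)) f" using f C(1,2) by (simp add: loc_integrable_def)
    have *: "(\<integral>x. f x \<partial>lebesgue_on L) = 0" if "compact L" "L \<subseteq> C n" for L
      using integral_test_compact[OF \<Omega> f 0 that(1)] that(2) C(2) by blast
    have "AE x in lebesgue. x \<in> C n \<longrightarrow> f x \<le> 0"
      by (rule nonpos_AE_of_integral_compact[OF C(1) i *])
    moreover have "AE x in lebesgue. x \<in> C n \<longrightarrow> - f x \<le> 0"
      by (rule nonpos_AE_of_integral_compact[OF C(1)]) (use i * in auto)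
    ultimately show ?thesis by eventually_elim auto
  qed
  then have "AE x in lebesgue. \<forall>n. x \<in> C n \<longrightarrow> f x = 0"
    by (intro AE_all_countable[THEN iffD2] allI)
  then have "AE x in lebesgue. x \<in> \<Omega> \<longrightarrow> f x = 0"
    by (rule eventually_mono) (use C(3) in blast)
  then show ?thesis using \<Omega> by (subst AE_restrict_space_iff) auto
qed

text \<open>In the base case of the induction a measurable set is approximated from inside by a
  compact set, whose indicator is then smoothed.\<close>

lemma test_functions_dense_L1:
  fixes f :: "real^'n \<Rightarrow> real"
  assumes \<Omega>: "open \<Omega>" "bounded \<Omega>" and f: "integrable (lebesgue_on \<Omega>) f" and e: "e > 0"
  shows "\<exists>\<psi>\<in>test_functions \<Omega>. (\<integral>x. \<bar>f x - \<psi> x\<bar> \<partial>lebesgue_on \<Omega>) < e"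
  using f e
proof (induction f arbitrary: e rule: integrable_induct)
  case (base A c)
  have [measurable]: "\<Omega> \<in> sets lebesgue" using \<Omega>(1) by (rule open_in_lebesgue)
  have A: "A \<in> sets lebesgue" "A \<subseteq> \<Omega>" using base(1) by (auto simp: sets_restrict_space_iff)
  \<comment> \<open>Two errors of size \<open>d\<close> arise, from \<open>A - T\<close> and from
    smoothing the indicator of \<open>T\<close>; the summand 1 avoids division by zero.\<close>
  define d where "d = e / (2 * (\<bar>c\<bar> + 1))"
  have d: "d > 0" "\<bar>c\<bar> * (d + d) < e"
  proof -
    show d: "d > 0" using base(3) by (auto simp: d_def)
    have "\<bar>c\<bar> * (d + d) < (\<bar>c\<bar> + 1) * (d + d)" using d by simp
    also have "\<dots> = (2 * (\<bar>c\<bar> + 1)) * d" by simp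
    also have "\<dots> = e"
    proof -
      have "2 * (\<bar>c\<bar> + 1) \<noteq> 0" by (simp add: add_nonneg_eq_0_iff)
      then show ?thesis unfolding d_def by (metis nonzero_mult_div_cancel_left times_divide_eq_right)
    qed
    finally show "\<bar>c\<bar> * (d + d) < e" .
  qed
  obtain T where T: "closed T" "T \<subseteq> A" "A - T \<in> lmeasurable" "emeasure lebesgue (A - T) < ennreal d"
    using sets_lebesgue_inner_closed[OF A(1) d(1)] by metis
  have cT: "compact T" using T(1,2) A(2) \<Omega>(2) by (meson bounded_subset compact_eq_bounded_closed order_trans)
  have T\<Omega>: "T \<subseteq> \<Omega>" using T A by auto
  have [measurable]: "T \<in> sets lebesgue" using cT by (rule compact_in_lebesgue)
  have m[measurable]: "T \<in> sets (lebesgue_on \<Omega>)" using T\<Omega> by (auto simp: sets_restrict_space_iff)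
  interpret finite_measure "lebesgue_on \<Omega>"
    using \<Omega> by (intro finite_measure_lebesgue_on lmeasurable_open)
  obtain \<psi> :: "nat \<Rightarrow> real^'n \<Rightarrow> real" and L where
    "(\<forall>n. \<psi> n \<in> test_functions \<Omega>) \<and> (\<forall>n x. 0 \<le> \<psi> n x) \<and> (\<forall>n x. \<psi> n x \<le> 1) \<and>
    (\<forall>x. (\<lambda>n. \<psi> n x) \<longlonglongrightarrow> indicator T x) \<and> compact L \<and> L \<subseteq> \<Omega> \<and> (\<forall>n x. x \<notin> L \<longrightarrow> \<psi> n x = 0)"
    using test_approx_compact[OF cT T\<Omega> \<Omega>(1)] by (elim exE)
  then have \<psi>: "\<And>n. \<psi> n \<in> test_functions \<Omega>" "\<And>n x. 0 \<le> \<psi> n x" "\<And>n x. \<psi> n x \<le> 1"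
    "\<And>x. (\<lambda>n. \<psi> n x) \<longlonglongrightarrow> indicator T x"
    by simp_all
  have \<psi>m[measurable]: "\<psi> n \<in> borel_measurable (lebesgue_on \<Omega>)" for n
    using \<psi>(1) by (intro continuous_measurable_lebesgue test_functions_continuous)
  have bnd: "\<bar>indicator T x - \<psi> n x\<bar> \<le> 2" for n x
    using \<psi>(2)[of n x] \<psi>(3)[of n x] by (cases "x \<in> T") auto
  have "(\<lambda>n. \<integral>x. \<bar>indicator T x - \<psi> n x\<bar> \<partial>lebesgue_on \<Omega>) \<longlonglongrightarrow> (\<integral>x. 0 \<partial>lebesgue_on \<Omega>)"
  proof (rule integral_dominated_convergence[where w = "\<lambda>x. 2"])
    show "AE x in lebesgue_on \<Omega>. norm \<bar>indicator T x - \<psi> n x\<bar> \<le> 2" for n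
      using bnd by simp
    show "AE x in lebesgue_on \<Omega>. (\<lambda>n. \<bar>indicator T x - \<psi> n x\<bar>) \<longlonglongrightarrow> 0"
    proof (rule AE_I2)
      fix x
      have "(\<lambda>n. \<bar>indicator T x - \<psi> n x\<bar>) \<longlonglongrightarrow> \<bar>indicator T x - indicator T x\<bar>"
        by (intro tendsto_intros \<psi>(4))
      then show "(\<lambda>n. \<bar>indicator T x - \<psi> n x\<bar>) \<longlonglongrightarrow> 0" by simp
    qed
  qed auto
  then have "\<forall>\<^sub>F n in sequentially. (\<integral>x. \<bar>indicator T x - \<psi> n x\<bar> \<partial>lebesgue_on \<Omega>) < d"
    using d(1) by (intro order_tendstoD(2)) auto
  then obtain n where n: "(\<integral>x. \<bar>indicator T x - \<psi> n x\<bar> \<partial>lebesgue_on \<Omega>) < d"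
    using eventually_happens trivial_limit_sequentially by blast
  have ATm: "A - T \<in> sets (lebesgue_on \<Omega>)" using base(1) m by auto
  have i1: "integrable (lebesgue_on \<Omega>) (indicat_real (A - T))"
    using ATm by (intro integrable_real_indicator) (auto simp: emeasure_eq_measure)
  have i2: "integrable (lebesgue_on \<Omega>) (\<lambda>x. \<bar>indicator T x - \<psi> n x\<bar>)"
    by (rule integrable_const_bound[where B = 2])
      (use bnd in auto)
  have "emeasure (lebesgue_on \<Omega>) (A - T) < ennreal d"
    using T(4) A(2) by (subst emeasure_restrict_space) auto
  then have mAT: "(\<integral>x. indicator (A - T) x \<partial>lebesgue_on \<Omega>) < d"
    using ATm d(1) A(2) by (simp add: emeasure_eq_measure ennreal_less_iff Int_absorb2 subset_iff)
  have "(\<integral>x. \<bar>indicator A x *\<^sub>R c - c * \<psi> n x\<bar> \<partial>lebesgue_on \<Omega>)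
      \<le> (\<integral>x. \<bar>c\<bar> * (indicator (A - T) x + \<bar>indicator T x - \<psi> n x\<bar>) \<partial>lebesgue_on \<Omega>)"
  proof (rule integral_mono)
    fix x
    have "indicator A x *\<^sub>R c - c * \<psi> n x = c * (indicator (A - T) x + (indicator T x - \<psi> n x))"
      using T(2) by (auto simp: indicator_def algebra_simps)
    also have "\<bar>\<dots>\<bar> \<le> \<bar>c\<bar> * (indicator (A - T) x + \<bar>indicator T x - \<psi> n x\<bar>)"
      unfolding abs_mult by (intro mult_left_mono) (auto simp: indicator_def)
    finally show "\<bar>indicator A x *\<^sub>R c - c * \<psi> n x\<bar> \<le> \<bar>c\<bar> * (indicator (A - T) x + \<bar>indicator T x - \<psi> n x\<bar>)" .
  next
    have "integrable (lebesgue_on \<Omega>) (indicat_real A)"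
      using base(1) by (intro integrable_real_indicator) (auto simp: emeasure_eq_measure)
    moreover have "integrable (lebesgue_on \<Omega>) (\<psi> n)"
      by (rule integrable_const_bound[where B = 1]) (use \<psi>(2,3) in auto)
    ultimately show "integrable (lebesgue_on \<Omega>) (\<lambda>x. \<bar>indicator A x *\<^sub>R c - c * \<psi> n x\<bar>)"
      by simp
  qed (use i1 i2 in auto)
  also have "\<dots> = \<bar>c\<bar> * ((\<integral>x. indicator (A - T) x \<partial>lebesgue_on \<Omega>) + (\<integral>x. \<bar>indicator T x - \<psi> n x\<bar> \<partial>lebesgue_on \<Omega>))"
    using i1 i2 by (simp add: Bochner_Integration.integral_add)
  also have "\<dots> \<le> \<bar>c\<bar> * (d + d)"
    using n mAT by (intro mult_left_mono) auto
  also have "\<dots> < e" by (rule d(2))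
  finally show ?case
    by (intro bexI[of _ "\<lambda>x. c * \<psi> n x"] test_functions_mult[OF \<psi>(1) Ck_const]) auto
next
  case (add f g)
  obtain \<psi> \<phi> where *: "\<psi> \<in> test_functions \<Omega>" "\<phi> \<in> test_functions \<Omega>"
    "(\<integral>x. \<bar>f x - \<psi> x\<bar> \<partial>lebesgue_on \<Omega>) < e / 2" "(\<integral>x. \<bar>g x - \<phi> x\<bar> \<partial>lebesgue_on \<Omega>) < e / 2"
    using add.IH[of "e / 2"] add.prems by auto
  have i: "integrable (lebesgue_on \<Omega>) \<psi>" "integrable (lebesgue_on \<Omega>) \<phi>"
    using test_functions_integrable[OF _ \<Omega>(1) loc_integrable_continuous[of "\<lambda>x. 1::real"]] *(1,2) by auto
  have "(\<integral>x. \<bar>f x + g x - (\<psi> x + \<phi> x)\<bar> \<partial>lebesgue_on \<Omega>)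
    \<le> (\<integral>x. \<bar>f x - \<psi> x\<bar> + \<bar>g x - \<phi> x\<bar> \<partial>lebesgue_on \<Omega>)"
    using i add.hyps by (intro integral_mono) auto
  also have "\<dots> < e"
    using i add.hyps *(3,4) by (simp add: Bochner_Integration.integral_add)
  finally show ?case
    by (intro bexI[of _ "\<lambda>x. \<psi> x + \<phi> x"] test_functions_add *)
next
  case (lim f s)
  have "(\<lambda>n. \<integral>x. \<bar>f x - s n x\<bar> \<partial>lebesgue_on \<Omega>) \<longlonglongrightarrow> (\<integral>x. 0 \<partial>lebesgue_on \<Omega>)"
  \<comment> \<open>The approximants in \<open>integrable_induct\<close> satisfy
    \<open>norm (s n x) \<le> 2 * norm (f x)\<close>, whence the factor 3.\<close>
  proof (rule integral_dominated_convergence[where w = "\<lambda>x. 3 * norm (f x)"])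
    show "AE x in lebesgue_on \<Omega>. norm \<bar>f x - s n x\<bar> \<le> 3 * norm (f x)" for n
      using lim.hyps(3)[of _ n] by (intro AE_I2) (smt (verit) real_norm_def)
    show "AE x in lebesgue_on \<Omega>. (\<lambda>n. \<bar>f x - s n x\<bar>) \<longlonglongrightarrow> 0"
    proof (rule AE_I2)
      fix x assume "x \<in> space (lebesgue_on \<Omega>)"
      from lim.hyps(2)[OF this] have "(\<lambda>n. \<bar>f x - s n x\<bar>) \<longlonglongrightarrow> \<bar>f x - f x\<bar>"
        by (intro tendsto_intros)
      then show "(\<lambda>n. \<bar>f x - s n x\<bar>) \<longlonglongrightarrow> 0" by simp
    qed
  qed (use lim.hyps(1,4) in auto)
  then have "\<forall>\<^sub>F n in sequentially. (\<integral>x. \<bar>f x - s n x\<bar> \<partial>lebesgue_on \<Omega>) < e / 2"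
    using lim.prems by (intro order_tendstoD(2)) auto
  then obtain n where n: "(\<integral>x. \<bar>f x - s n x\<bar> \<partial>lebesgue_on \<Omega>) < e / 2"
    using eventually_happens trivial_limit_sequentially by blast
  obtain \<psi> where \<psi>: "\<psi> \<in> test_functions \<Omega>" "(\<integral>x. \<bar>s n x - \<psi> x\<bar> \<partial>lebesgue_on \<Omega>) < e / 2"
    using lim.IH[of "e / 2" n] lim.prems by auto
  have i: "integrable (lebesgue_on \<Omega>) \<psi>"
    using test_functions_integrable[OF \<psi>(1) \<Omega>(1) loc_integrable_continuous[of "\<lambda>x. 1::real"]] by auto
  have "(\<integral>x. \<bar>f x - \<psi> x\<bar> \<partial>lebesgue_on \<Omega>)
    \<le> (\<integral>x. \<bar>f x - s n x\<bar> + \<bar>s n x - \<psi> x\<bar> \<partial>lebesgue_on \<Omega>)"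
    using i lim.hyps(1,4) by (intro integral_mono) auto
  also have "\<dots> < e"
    using i lim.hyps(1,4) n \<psi>(2) by (simp add: Bochner_Integration.integral_add)
  finally show ?case using \<psi>(1) by blast
qed

section \<open>Weak gradients\<close>

lemma loc_integrable_add:
  "loc_integrable \<Omega> f \<Longrightarrow> loc_integrable \<Omega> g \<Longrightarrow> loc_integrable \<Omega> (\<lambda>x. f x + g x)"
  by (simp add: loc_integrable_def)

lemma loc_integrable_scale:
  "loc_integrable \<Omega> f \<Longrightarrow> loc_integrable \<Omega> (\<lambda>x. c *\<^sub>R f x)"
  by (simp add: loc_integrable_def)

lemma loc_integrable_component:
  fixes F :: "real^'n \<Rightarrow> real^'n"
  shows "loc_integrable \<Omega> F \<Longrightarrow> loc_integrable \<Omega> (\<lambda>x. F x $ i)"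
  unfolding loc_integrable_def
  using integrable_bounded_linear[OF bounded_linear_vec_nth] by blast

lemma loc_integrable_integrable:
  assumes "integrable (lebesgue_on \<Omega>) f" "open \<Omega>"
  shows "loc_integrable \<Omega> f"
  unfolding loc_integrable_def
proof (intro allI impI)
  fix K assume K: "compact K \<and> K \<subseteq> \<Omega>"
  have [simp]: "K \<in> sets lebesgue" "\<Omega> \<in> sets lebesgue"
    using K assms by (auto intro: compact_in_lebesgue open_in_lebesgue)
  have "integrable lebesgue (\<lambda>x. indicator \<Omega> x *\<^sub>R f x)"
    using assms(1) by (subst (asm) integrable_restrict_space) auto
  from integrable_mult_indicator[OF _ this, of K]
  have "integrable lebesgue (\<lambda>x. indicator K x *\<^sub>R indicator \<Omega> x *\<^sub>R f x)" by simp
  also have "(\<lambda>x. indicator K x *\<^sub>R indicator \<Omega> x *\<^sub>R f x) = (\<lambda>x. indicator K x *\<^sub>R f x)"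
    using K by (auto simp: fun_eq_iff indicator_def)
  finally show "integrable (lebesgue_on K) f"
    by (subst integrable_restrict_space) auto
qed

lemma has_weak_grad_component:
  assumes "open \<Omega>" "has_weak_grad \<Omega> f F" "\<psi> \<in> test_functions \<Omega>"
  shows "(\<integral>x. f x * pd i \<psi> x \<partial>lebesgue_on \<Omega>) = - (\<integral>x. \<psi> x * F x $ i \<partial>lebesgue_on \<Omega>)"
proof -
  have l: "loc_integrable \<Omega> f" "loc_integrable \<Omega> F"
    and eq: "(\<integral>x. f x *\<^sub>R grad \<psi> x \<partial>lebesgue_on \<Omega>) = - (\<integral>x. \<psi> x *\<^sub>R F x \<partial>lebesgue_on \<Omega>)"
    using assms by (auto simp: has_weak_grad_def)
  have "(\<integral>x. f x *\<^sub>R grad \<psi> x \<partial>lebesgue_on \<Omega>) $ i = (\<integral>x. (f x *\<^sub>R grad \<psi> x) $ i \<partial>lebesgue_on \<Omega>)"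
    by (rule integral_bounded_linear[symmetric, OF bounded_linear_vec_nth
          test_functions_integrable_grad[OF assms(3,1) l(1)]])
  moreover have "(\<integral>x. \<psi> x *\<^sub>R F x \<partial>lebesgue_on \<Omega>) $ i = (\<integral>x. (\<psi> x *\<^sub>R F x) $ i \<partial>lebesgue_on \<Omega>)"
    by (rule integral_bounded_linear[symmetric, OF bounded_linear_vec_nth
          test_functions_integrable[OF assms(3,1) l(2)]])
  ultimately show ?thesis
    using arg_cong[OF eq, of "\<lambda>v. v $ i"] by (simp add: pd_def)
qed

lemma has_weak_gradI_component:
  assumes \<Omega>: "open \<Omega>" and l: "loc_integrable \<Omega> f" "loc_integrable \<Omega> F"
    and eq: "\<And>\<psi> i. \<psi> \<in> test_functions \<Omega> \<Longrightarrow>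
      (\<integral>x. f x * pd i \<psi> x \<partial>lebesgue_on \<Omega>) = - (\<integral>x. \<psi> x * F x $ i \<partial>lebesgue_on \<Omega>)"
  shows "has_weak_grad \<Omega> f F"
  unfolding has_weak_grad_def
proof (intro conjI l ballI)
  fix \<psi> assume \<psi>: "\<psi> \<in> test_functions \<Omega>"
  have "(\<integral>x. f x *\<^sub>R grad \<psi> x \<partial>lebesgue_on \<Omega>) $ i = - (\<integral>x. \<psi> x *\<^sub>R F x \<partial>lebesgue_on \<Omega>) $ i" for i
  proof -
    have "(\<integral>x. f x *\<^sub>R grad \<psi> x \<partial>lebesgue_on \<Omega>) $ i = (\<integral>x. (f x *\<^sub>R grad \<psi> x) $ i \<partial>lebesgue_on \<Omega>)"
      by (rule integral_bounded_linear[symmetric, OF bounded_linear_vec_nth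
            test_functions_integrable_grad[OF \<psi> \<Omega> l(1)]])
    moreover have "(\<integral>x. \<psi> x *\<^sub>R F x \<partial>lebesgue_on \<Omega>) $ i = (\<integral>x. (\<psi> x *\<^sub>R F x) $ i \<partial>lebesgue_on \<Omega>)"
      by (rule integral_bounded_linear[symmetric, OF bounded_linear_vec_nth
            test_functions_integrable[OF \<psi> \<Omega> l(2)]])
    ultimately show ?thesis using eq[OF \<psi>, of i] by (simp add: pd_def)
  qed
  then show "(\<integral>x. f x *\<^sub>R grad \<psi> x \<partial>lebesgue_on \<Omega>) = - (\<integral>x. \<psi> x *\<^sub>R F x \<partial>lebesgue_on \<Omega>)"
    by (simp add: vec_eq_iff)
qed

text \<open>Justifies working with any known weak gradient instead of the representative chosen by
  \<open>wgrad\<close>: each component of the difference is annihilated by all test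
  functions.\<close>

lemma has_weak_grad_unique:
  assumes "open \<Omega>" "has_weak_grad \<Omega> f F" "has_weak_grad \<Omega> f G"
  shows "AE x in lebesgue_on \<Omega>. F x = G x"
proof -
  have l: "loc_integrable \<Omega> F" "loc_integrable \<Omega> G"
    using assms by (auto simp: has_weak_grad_def)
  have "AE x in lebesgue_on \<Omega>. F x $ i + (-1) *\<^sub>R G x $ i = 0" for i
  proof (rule fundamental_lemma[OF assms(1)])
    show "loc_integrable \<Omega> (\<lambda>x. F x $ i + (-1) *\<^sub>R G x $ i)"
      by (intro loc_integrable_add loc_integrable_scale loc_integrable_component l)
    fix \<psi> assume \<psi>: "\<psi> \<in> test_functions \<Omega>"
    have i: "integrable (lebesgue_on \<Omega>) (\<lambda>x. \<psi> x * F x $ i)" "integrable (lebesgue_on \<Omega>) (\<lambda>x. \<psi> x * G x $ i)"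
      using test_functions_integrable[OF \<psi> assms(1) loc_integrable_component[OF l(1)], of i]
        test_functions_integrable[OF \<psi> assms(1) loc_integrable_component[OF l(2)], of i] by simp_all
    have "(\<integral>x. \<psi> x * (F x $ i + (-1) *\<^sub>R G x $ i) \<partial>lebesgue_on \<Omega>)
      = (\<integral>x. \<psi> x * F x $ i - \<psi> x * G x $ i \<partial>lebesgue_on \<Omega>)"
      by (simp add: algebra_simps)
    also have "\<dots> = 0"
      using has_weak_grad_component[OF assms(1,2) \<psi>, of i] has_weak_grad_component[OF assms(1,3) \<psi>, of i] i
      by (simp add: Bochner_Integration.integral_diff)
    finally show "(\<integral>x. \<psi> x * (F x $ i + (-1) *\<^sub>R G x $ i) \<partial>lebesgue_on \<Omega>) = 0" .
  qed
  then have "AE x in lebesgue_on \<Omega>. \<forall>i\<in>UNIV. F x $ i + (-1) *\<^sub>R G x $ i = 0"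
    by (intro AE_finite_allI) auto
  then show ?thesis by eventually_elim (simp add: vec_eq_iff)
qed

lemma has_weak_grad_cong_AE:
  assumes "open \<Omega>" "has_weak_grad \<Omega> f F" "AE x in lebesgue_on \<Omega>. f x = g x" "loc_integrable \<Omega> g"
  shows "has_weak_grad \<Omega> g F"
  unfolding has_weak_grad_def
proof (intro conjI ballI)
  fix \<psi> assume \<psi>: "\<psi> \<in> test_functions \<Omega>"
  have l: "loc_integrable \<Omega> f" using assms(2) by (simp add: has_weak_grad_def)
  have "(\<integral>x. f x *\<^sub>R grad \<psi> x \<partial>lebesgue_on \<Omega>) = (\<integral>x. g x *\<^sub>R grad \<psi> x \<partial>lebesgue_on \<Omega>)"
  proof (rule integral_cong_AE)
    show "(\<lambda>x. f x *\<^sub>R grad \<psi> x) \<in> borel_measurable (lebesgue_on \<Omega>)"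
      using test_functions_integrable_grad[OF \<psi> assms(1) l] by (rule borel_measurable_integrable)
    show "(\<lambda>x. g x *\<^sub>R grad \<psi> x) \<in> borel_measurable (lebesgue_on \<Omega>)"
      using test_functions_integrable_grad[OF \<psi> assms(1,4)] by (rule borel_measurable_integrable)
    show "AE x in lebesgue_on \<Omega>. f x *\<^sub>R grad \<psi> x = g x *\<^sub>R grad \<psi> x"
      using assms(3) by eventually_elim simp
  qed
  then show "(\<integral>x. g x *\<^sub>R grad \<psi> x \<partial>lebesgue_on \<Omega>) = - (\<integral>x. \<psi> x *\<^sub>R F x \<partial>lebesgue_on \<Omega>)"
    using assms(2) \<psi> by (simp add: has_weak_grad_def)
qed (use assms in \<open>auto simp: has_weak_grad_def\<close>)

lemma has_weak_grad_lincomb: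
  assumes "open \<Omega>" "has_weak_grad \<Omega> f F" "has_weak_grad \<Omega> g G"
  shows "has_weak_grad \<Omega> (\<lambda>x. a * f x + b * g x) (\<lambda>x. a *\<^sub>R F x + b *\<^sub>R G x)"
  unfolding has_weak_grad_def
proof (intro conjI ballI)
  have l: "loc_integrable \<Omega> f" "loc_integrable \<Omega> F" "loc_integrable \<Omega> g" "loc_integrable \<Omega> G"
    using assms by (auto simp: has_weak_grad_def)
  show "loc_integrable \<Omega> (\<lambda>x. a * f x + b * g x)" "loc_integrable \<Omega> (\<lambda>x. a *\<^sub>R F x + b *\<^sub>R G x)"
    using l by (auto simp: loc_integrable_def)
  fix \<psi> assume \<psi>: "\<psi> \<in> test_functions \<Omega>"
  note i = test_functions_integrable_grad[OF \<psi> assms(1) l(1)] test_functions_integrable_grad[OF \<psi> assms(1) l(3)]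
    test_functions_integrable[OF \<psi> assms(1) l(2)] test_functions_integrable[OF \<psi> assms(1) l(4)]
  have "(\<integral>x. (a * f x + b * g x) *\<^sub>R grad \<psi> x \<partial>lebesgue_on \<Omega>)
    = (\<integral>x. a *\<^sub>R (f x *\<^sub>R grad \<psi> x) + b *\<^sub>R (g x *\<^sub>R grad \<psi> x) \<partial>lebesgue_on \<Omega>)"
    by (simp add: scaleR_add_left)
  also have "\<dots> = a *\<^sub>R (\<integral>x. f x *\<^sub>R grad \<psi> x \<partial>lebesgue_on \<Omega>) + b *\<^sub>R (\<integral>x. g x *\<^sub>R grad \<psi> x \<partial>lebesgue_on \<Omega>)"
    using i by (simp add: Bochner_Integration.integral_add del: scaleR_scaleR)
  also have "\<dots> = - (a *\<^sub>R (\<integral>x. \<psi> x *\<^sub>R F x \<partial>lebesgue_on \<Omega>) + b *\<^sub>R (\<integral>x. \<psi> x *\<^sub>R G x \<partial>lebesgue_on \<Omega>))"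
    using assms(2,3) \<psi> by (simp add: has_weak_grad_def)
  also have "\<dots> = - (\<integral>x. a *\<^sub>R (\<psi> x *\<^sub>R F x) + b *\<^sub>R (\<psi> x *\<^sub>R G x) \<partial>lebesgue_on \<Omega>)"
    using i by (simp add: Bochner_Integration.integral_add del: scaleR_scaleR)
  also have "(\<lambda>x. a *\<^sub>R (\<psi> x *\<^sub>R F x) + b *\<^sub>R (\<psi> x *\<^sub>R G x)) = (\<lambda>x. \<psi> x *\<^sub>R (a *\<^sub>R F x + b *\<^sub>R G x))"
    by (simp add: fun_eq_iff scaleR_add_right mult.commute)
  finally show "(\<integral>x. (a * f x + b * g x) *\<^sub>R grad \<psi> x \<partial>lebesgue_on \<Omega>)
    = - (\<integral>x. \<psi> x *\<^sub>R (a *\<^sub>R F x + b *\<^sub>R G x) \<partial>lebesgue_on \<Omega>)" .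
qed

lemma has_weak_grad_wgrad: "has_weak_grad \<Omega> f F \<Longrightarrow> has_weak_grad \<Omega> f (wgrad \<Omega> f)"
  unfolding wgrad_def by (rule someI[of "has_weak_grad \<Omega> f"])

lemma wgrad_AE_eq:
  assumes "open \<Omega>" "has_weak_grad \<Omega> f F"
  shows "AE x in lebesgue_on \<Omega>. wgrad \<Omega> f x = F x"
  using has_weak_grad_unique[OF assms(1) has_weak_grad_wgrad[OF assms(2)] assms(2)] .

lemma has_weak_grad_measurable:
  assumes "open \<Omega>" "has_weak_grad \<Omega> f F"
  shows "f \<in> borel_measurable (lebesgue_on \<Omega>)" "F \<in> borel_measurable (lebesgue_on \<Omega>)"
  using assms loc_integrable_measurable by (auto simp: has_weak_grad_def)

lemma W1_has_weak_grad: "f \<in> W1 \<Omega> r \<Longrightarrow> has_weak_grad \<Omega> f (wgrad \<Omega> f)"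
  unfolding W1_def using has_weak_grad_wgrad by blast

section \<open>Lebesgue spaces and linear combinations in Sobolev spaces\<close>

lemma Lspace_measurable: "f \<in> Lspace r M \<Longrightarrow> f \<in> borel_measurable M"
  by (simp add: Lspace_def)

lemma W1_wgrad_measurable: "f \<in> W1 \<Omega> r \<Longrightarrow> wgrad \<Omega> f \<in> borel_measurable (lebesgue_on \<Omega>)"
  unfolding W1_def using Lspace_measurable by blast

text \<open>Bounds almost everywhere take the place of the essential supremum in the estimates that
  follow.\<close>

lemma Lspace_infty_iff:
  "f \<in> Lspace \<infinity> M \<longleftrightarrow> f \<in> borel_measurable M \<and> (\<exists>B. AE x in M. norm (f x) \<le> B)"
proof (cases "f \<in> borel_measurable M")
  case True
  have m: "(\<lambda>x. ennreal (norm (f x))) \<in> borel_measurable M" using True by measurable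
  have "(\<exists>B. AE x in M. norm (f x) \<le> B)" if "esssup M (\<lambda>x. ennreal (norm (f x))) < \<infinity>"
  proof -
    have "AE x in M. norm (f x) \<le> enn2real (esssup M (\<lambda>x. ennreal (norm (f x))))"
      using esssup_AE[of "\<lambda>x. ennreal (norm (f x))" M]
    proof eventually_elim
      case (elim x)
      then show ?case using that by (metis enn2real_ennreal enn2real_mono infinity_ennreal_def norm_ge_zero)
    qed
    then show ?thesis by blast
  qed
  moreover have "esssup M (\<lambda>x. ennreal (norm (f x))) < \<infinity>" if B: "AE x in M. norm (f x) \<le> B" for B
  proof -
    have "AE x in M. ennreal (norm (f x)) \<le> ennreal B"
      using B by eventually_elim (rule ennreal_leI)
    then have "esssup M (\<lambda>x. ennreal (norm (f x))) \<le> ennreal B"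
      using esssup_I[OF m] by blast
    then show ?thesis using le_less_trans by fastforce
  qed
  ultimately show ?thesis using True by (auto simp: Lspace_def)
qed (simp add: Lspace_def)

lemma Lnorm_infty_AE:
  assumes "f \<in> Lspace \<infinity> M"
  shows "AE x in M. norm (f x) \<le> Lnorm \<infinity> M f"
  using esssup_AE[of "\<lambda>x. ennreal (norm (f x))" M]
proof eventually_elim
  case (elim x)
  have "esssup M (\<lambda>x. ennreal (norm (f x))) < \<infinity>" using assms by (simp add: Lspace_def)
  then show ?case using elim
    by (simp add: Lnorm_def) (metis enn2real_ennreal enn2real_mono infinity_ennreal_def norm_ge_zero)
qed

lemma Lnorm_nonneg: "Lnorm r M f \<ge> 0"
  by (simp add: Lnorm_def)

lemma Lspace_finite_iff:
  "p \<ge> 0 \<Longrightarrow> f \<in> Lspace (ennreal p) M \<longleftrightarrow> f \<in> borel_measurable M \<and> integrable M (\<lambda>x. norm (f x) powr p)"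
  by (simp add: Lspace_def)

lemma Lnorm_finite: "p \<ge> 0 \<Longrightarrow> Lnorm (ennreal p) M f = (\<integral>x. norm (f x) powr p \<partial>M) powr (1 / p)"
  by (simp add: Lnorm_def)

lemma Lspace_2_iff:
  "f \<in> Lspace 2 M \<longleftrightarrow> f \<in> borel_measurable M \<and> integrable M (\<lambda>x. (norm (f x))\<^sup>2)"
  by (simp add: Lspace_def powr_numeral)

lemma Lnorm_2: "Lnorm 2 M f = sqrt (\<integral>x. (norm (f x))\<^sup>2 \<partial>M)"
  by (simp add: Lnorm_def powr_numeral powr_half_sqrt)

lemma Lnorm_scale:
  fixes f :: "'a \<Rightarrow> real"
  assumes "p > 0"
  shows "Lnorm (ennreal p) M (\<lambda>x. t * f x) = \<bar>t\<bar> * Lnorm (ennreal p) M f"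
proof -
  have "(\<integral>x. norm (t * f x) powr p \<partial>M) = \<bar>t\<bar> powr p * (\<integral>x. norm (f x) powr p \<partial>M)"
    by (simp add: abs_mult powr_mult)
  then show ?thesis
    using assms by (simp add: Lnorm_finite powr_mult powr_powr)
qed

lemma Lspace_cong_AE:
  assumes "f \<in> Lspace r M" "AE x in M. f x = g x" "g \<in> borel_measurable M"
  shows "g \<in> Lspace r M"
proof (cases "r = \<infinity>")
  case True
  obtain B where "AE x in M. norm (f x) \<le> B"
    using assms(1) unfolding True Lspace_infty_iff by blast
  then have "AE x in M. norm (g x) \<le> B"
    using assms(2) by eventually_elim simp
  then show ?thesis
    using assms(3) unfolding True Lspace_infty_iff by blast
next
  case False
  have "integrable M (\<lambda>x. norm (f x) powr enn2real r)" and [measurable]: "f \<in> borel_measurable M"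
    using assms(1) False by (auto simp: Lspace_def)
  then have "integrable M (\<lambda>x. norm (g x) powr enn2real r)"
    by (rule_tac integrable_cong_AE_imp[of M "\<lambda>x. norm (f x) powr enn2real r"])
      (use assms(2,3) in \<open>auto elim: eventually_mono\<close>)
  then show ?thesis using False assms(3) by (simp add: Lspace_def)
qed

lemma Lspace_lincomb:
  fixes f g :: "'a \<Rightarrow> 'b::euclidean_space"
  assumes "f \<in> Lspace r M" "g \<in> Lspace r M"
  shows "(\<lambda>x. a *\<^sub>R f x + b *\<^sub>R g x) \<in> Lspace r M"
proof (cases "r = \<infinity>")
  case True
  obtain B1 B2 where "AE x in M. norm (f x) \<le> B1" "AE x in M. norm (g x) \<le> B2"
    using assms unfolding True Lspace_infty_iff by blast
  then have "AE x in M. norm (a *\<^sub>R f x + b *\<^sub>R g x) \<le> \<bar>a\<bar> * B1 + \<bar>b\<bar> * B2"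
  proof eventually_elim
    case (elim x)
    then show ?case
      using norm_triangle_ineq[of "a *\<^sub>R f x" "b *\<^sub>R g x"] mult_left_mono[OF elim(1) abs_ge_zero[of a]]
        mult_left_mono[OF elim(2) abs_ge_zero[of b]] by simp
  qed
  moreover have "(\<lambda>x. a *\<^sub>R f x + b *\<^sub>R g x) \<in> borel_measurable M"
    using assms[THEN Lspace_measurable] by measurable
  ultimately show ?thesis unfolding True Lspace_infty_iff by blast
next
  case False
  define q where "q = enn2real r"
  have q: "q \<ge> 0" by (simp add: q_def)
  have i: "integrable M (\<lambda>x. norm (f x) powr q)" "integrable M (\<lambda>x. norm (g x) powr q)"
    and [measurable]: "f \<in> borel_measurable M" "g \<in> borel_measurable M"
    using assms False by (auto simp: Lspace_def q_def)
  define c where "c = \<bar>a\<bar> + \<bar>b\<bar>"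
  have "integrable M (\<lambda>x. norm (a *\<^sub>R f x + b *\<^sub>R g x) powr q)"
  proof (rule Bochner_Integration.integrable_bound[of M "\<lambda>x. c powr q * (norm (f x) powr q + norm (g x) powr q)"])
    show "AE x in M. norm (norm (a *\<^sub>R f x + b *\<^sub>R g x) powr q) \<le> norm (c powr q * (norm (f x) powr q + norm (g x) powr q))"
    proof (rule AE_I2)
      fix x
      have "norm (a *\<^sub>R f x + b *\<^sub>R g x) \<le> \<bar>a\<bar> * norm (f x) + \<bar>b\<bar> * norm (g x)"
        using norm_triangle_ineq[of "a *\<^sub>R f x" "b *\<^sub>R g x"] by simp
      \<comment> \<open>Comparing with the maximum instead of using Minkowski's inequality covers
        every exponent \<open>q \<ge> 0\<close>, including those below one.\<close>
      also have "\<dots> \<le> c * max (norm (f x)) (norm (g x))"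
        unfolding c_def distrib_right by (intro add_mono mult_left_mono) auto
      finally have "norm (a *\<^sub>R f x + b *\<^sub>R g x) powr q \<le> (c * max (norm (f x)) (norm (g x))) powr q"
        by (intro powr_mono2 q) auto
      also have "\<dots> = c powr q * max (norm (f x)) (norm (g x)) powr q"
        by (rule powr_mult)
      also have "\<dots> \<le> c powr q * (norm (f x) powr q + norm (g x) powr q)"
        by (intro mult_left_mono) (auto simp: max_def)
      finally show "norm (norm (a *\<^sub>R f x + b *\<^sub>R g x) powr q) \<le> norm (c powr q * (norm (f x) powr q + norm (g x) powr q))"
        by simp
    qed
  qed (use i in auto)
  then show ?thesis using False by (simp add: Lspace_def q_def)
qed

lemma Lspace_infty_subset:
  fixes f :: "'a \<Rightarrow> 'b::euclidean_space"
  assumes "finite_measure M" "f \<in> Lspace \<infinity> M"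
  shows "f \<in> Lspace r M"
proof (cases "r = \<infinity>")
  case False
  interpret finite_measure M by fact
  obtain B where B: "AE x in M. norm (f x) \<le> B" and [measurable]: "f \<in> borel_measurable M"
    using assms(2) unfolding Lspace_infty_iff by blast
  have "integrable M (\<lambda>x. norm (f x) powr enn2real r)"
  proof (rule integrable_const_bound)
    show "AE x in M. norm (norm (f x) powr enn2real r) \<le> B powr enn2real r"
      using B by eventually_elim (auto intro!: powr_mono2)
  qed simp
  then show ?thesis using False by (simp add: Lspace_def)
qed (use assms in simp)

text \<open>On a finite measure space the constant 1 covers the points where
  \<open>norm (f x) \<le> 1\<close>, and the \<open>p\<close>-th power covers the others.\<close>

lemma Lspace_integrable:
  fixes f :: "'a \<Rightarrow> 'b::euclidean_space"
  assumes "finite_measure M" "p \<ge> 1" "f \<in> Lspace (ennreal p) M"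
  shows "integrable M f"
proof -
  interpret finite_measure M by fact
  have i: "integrable M (\<lambda>x. norm (f x) powr p)" and [measurable]: "f \<in> borel_measurable M"
    using assms by (auto simp: Lspace_finite_iff)
  show ?thesis
  proof (rule Bochner_Integration.integrable_bound[of M "\<lambda>x. 1 + norm (f x) powr p"])
    show "AE x in M. norm (f x) \<le> norm (1 + norm (f x) powr p)"
    proof (rule AE_I2)
      fix x
      show "norm (f x) \<le> norm (1 + norm (f x) powr p)"
      proof (cases "norm (f x) \<le> 1")
        case True
        moreover have "0 \<le> norm (f x) powr p" by simp
        ultimately show ?thesis unfolding real_norm_def by linarith
      next
        case False
        then have "norm (f x) powr 1 \<le> norm (f x) powr p" using assms(2) by (intro powr_mono) auto
        then show ?thesis using False by simp
      qed
    qed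
  qed (use i in auto)
qed

text \<open>As a chosen representative, \<open>wgrad\<close> is linear only almost everywhere;
  membership in \<open>W1\<close> has to be transferred along this equality.\<close>

lemma W1_lincomb:
  assumes "open \<Omega>" "f \<in> W1 \<Omega> r" "g \<in> W1 \<Omega> r"
  shows "(\<lambda>x. a * f x + b * g x) \<in> W1 \<Omega> r"
    and "AE x in lebesgue_on \<Omega>. wgrad \<Omega> (\<lambda>x. a * f x + b * g x) x = a *\<^sub>R wgrad \<Omega> f x + b *\<^sub>R wgrad \<Omega> g x"
proof -
  let ?h = "\<lambda>x. a * f x + b * g x"
  have w: "has_weak_grad \<Omega> ?h (\<lambda>x. a *\<^sub>R wgrad \<Omega> f x + b *\<^sub>R wgrad \<Omega> g x)"
    using assms by (intro has_weak_grad_lincomb W1_has_weak_grad)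
  show ae: "AE x in lebesgue_on \<Omega>. wgrad \<Omega> ?h x = a *\<^sub>R wgrad \<Omega> f x + b *\<^sub>R wgrad \<Omega> g x"
    by (rule wgrad_AE_eq[OF assms(1) w])
  have "wgrad \<Omega> ?h \<in> Lspace r (lebesgue_on \<Omega>)"
  proof (rule Lspace_cong_AE)
    show "(\<lambda>x. a *\<^sub>R wgrad \<Omega> f x + b *\<^sub>R wgrad \<Omega> g x) \<in> Lspace r (lebesgue_on \<Omega>)"
      using assms(2,3) by (intro Lspace_lincomb) (auto simp: W1_def)
    show "wgrad \<Omega> ?h \<in> borel_measurable (lebesgue_on \<Omega>)"
      using has_weak_grad_measurable(2)[OF assms(1) has_weak_grad_wgrad[OF w]] .
  qed (use ae in \<open>auto elim: eventually_mono\<close>)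
  moreover have "?h \<in> Lspace r (lebesgue_on \<Omega>)"
    using Lspace_lincomb[of f r "lebesgue_on \<Omega>" g a b] assms(2,3) by (simp add: W1_def)
  ultimately show "?h \<in> W1 \<Omega> r" using w by (auto simp: W1_def)
qed

text \<open>Used for second derivatives: the components of \<open>wgrad\<close> of a combination
  agree only almost everywhere with functions already known to lie in \<open>W1\<close>.\<close>

lemma W1_cong_AE:
  assumes "open \<Omega>" "f \<in> W1 \<Omega> r" "AE x in lebesgue_on \<Omega>. f x = g x" "loc_integrable \<Omega> g"
  shows "g \<in> W1 \<Omega> r" and "AE x in lebesgue_on \<Omega>. wgrad \<Omega> g x = wgrad \<Omega> f x"
proof -
  have w: "has_weak_grad \<Omega> g (wgrad \<Omega> f)"
    by (rule has_weak_grad_cong_AE[OF assms(1) W1_has_weak_grad[OF assms(2)] assms(3,4)])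
  show ae: "AE x in lebesgue_on \<Omega>. wgrad \<Omega> g x = wgrad \<Omega> f x"
    by (rule wgrad_AE_eq[OF assms(1) w])
  have "wgrad \<Omega> g \<in> Lspace r (lebesgue_on \<Omega>)"
    by (rule Lspace_cong_AE[of "wgrad \<Omega> f"])
      (use assms(2) ae has_weak_grad_measurable(2)[OF assms(1) has_weak_grad_wgrad[OF w]] in
        \<open>auto simp: W1_def elim: eventually_mono\<close>)
  moreover have "g \<in> Lspace r (lebesgue_on \<Omega>)"
    by (rule Lspace_cong_AE[of f])
      (use assms loc_integrable_measurable in \<open>auto simp: W1_def\<close>)
  ultimately show "g \<in> W1 \<Omega> r" using w by (auto simp: W1_def)
qed

lemma W2_lincomb:
  assumes "open \<Omega>" "f \<in> W2 \<Omega> r" "g \<in> W2 \<Omega> r"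
  shows "(\<lambda>x. a * f x + b * g x) \<in> W2 \<Omega> r"
proof -
  let ?h = "\<lambda>x. a * f x + b * g x"
  have fg: "f \<in> W1 \<Omega> r" "g \<in> W1 \<Omega> r" using assms by (auto simp: W2_def)
  note h = W1_lincomb[OF assms(1) fg, of a b]
  have "(\<lambda>x. wgrad \<Omega> ?h x $ i) \<in> W1 \<Omega> r" for i
  proof (rule W1_cong_AE(1)[OF assms(1)])
    show "(\<lambda>x. a * wgrad \<Omega> f x $ i + b * wgrad \<Omega> g x $ i) \<in> W1 \<Omega> r"
      using assms by (intro W1_lincomb) (auto simp: W2_def)
    show "AE x in lebesgue_on \<Omega>. a * wgrad \<Omega> f x $ i + b * wgrad \<Omega> g x $ i = wgrad \<Omega> ?h x $ i"
      using h(2) by eventually_elim simp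
    show "loc_integrable \<Omega> (\<lambda>x. wgrad \<Omega> ?h x $ i)"
      using W1_has_weak_grad[OF h(1)] by (intro loc_integrable_component) (simp add: has_weak_grad_def)
  qed
  then show ?thesis using h(1) by (simp add: W2_def)
qed

lemma W1_norm_nonneg: "W1_norm \<Omega> r f \<ge> 0"
  by (simp add: W1_norm_def Lnorm_nonneg)

lemma W2_norm_nonneg: "W2_norm \<Omega> r f \<ge> 0"
  by (simp add: W2_norm_def W1_norm_nonneg Lnorm_nonneg)

lemma W1_infty_AE_le:
  assumes "f \<in> W1 \<Omega> \<infinity>"
  shows "AE x in lebesgue_on \<Omega>. \<bar>f x\<bar> \<le> W1_norm \<Omega> \<infinity> f"
    and "AE x in lebesgue_on \<Omega>. norm (wgrad \<Omega> f x) \<le> W1_norm \<Omega> \<infinity> f"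
proof -
  have *: "f \<in> Lspace \<infinity> (lebesgue_on \<Omega>)" "wgrad \<Omega> f \<in> Lspace \<infinity> (lebesgue_on \<Omega>)"
    using assms by (auto simp: W1_def)
  have n: "Lnorm \<infinity> (lebesgue_on \<Omega>) f \<ge> 0" "Lnorm \<infinity> (lebesgue_on \<Omega>) (wgrad \<Omega> f) \<ge> 0"
    by (rule Lnorm_nonneg)+
  show "AE x in lebesgue_on \<Omega>. \<bar>f x\<bar> \<le> W1_norm \<Omega> \<infinity> f"
    using Lnorm_infty_AE[OF *(1)] by eventually_elim (use n in \<open>simp add: W1_norm_def\<close>)
  show "AE x in lebesgue_on \<Omega>. norm (wgrad \<Omega> f x) \<le> W1_norm \<Omega> \<infinity> f"
    using Lnorm_infty_AE[OF *(2)] by eventually_elim (use n in \<open>simp add: W1_norm_def\<close>)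
qed

section \<open>Hausdorff measure\<close>

text \<open>The content at scale \<open>\<delta>\<close> in Caratheodory's construction.
  Subadditivity and splitting are proved at a fixed scale, before the supremum over
  \<open>\<delta>\<close> is taken.\<close>

definition hausdorff_pre :: "nat \<Rightarrow> real \<Rightarrow> (real^'n) set \<Rightarrow> ennreal" where
  "hausdorff_pre s \<delta> E = (INF C\<in>{C :: nat \<Rightarrow> (real^'n) set.
     E \<subseteq> (\<Union>i. C i) \<and> (\<forall>i. bounded (C i) \<and> diameter (C i) \<le> \<delta>)}. (\<Sum>i. hausdorff_weight s (C i)))"

lemma hausdorff_outer_eq: "hausdorff_outer s E = (SUP \<delta>\<in>{0<..}. hausdorff_pre s \<delta> E)"
  by (simp add: hausdorff_outer_def hausdorff_pre_def)

lemma hausdorff_pre_mono: "E \<subseteq> F \<Longrightarrow> hausdorff_pre s \<delta> E \<le> hausdorff_pre s \<delta> F"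
  unfolding hausdorff_pre_def by (rule INF_superset_mono) auto

lemma hausdorff_pre_antimono: "\<delta> \<le> \<delta>' \<Longrightarrow> hausdorff_pre s \<delta>' E \<le> hausdorff_pre s \<delta> E"
  unfolding hausdorff_pre_def by (rule INF_superset_mono) (auto intro: order_trans)

lemma hausdorff_pre_le:
  assumes "E \<subseteq> (\<Union>i. C i)" "\<And>i. bounded (C i)" "\<And>i. diameter (C i) \<le> \<delta>"
  shows "hausdorff_pre s \<delta> E \<le> (\<Sum>i. hausdorff_weight s (C i))"
  unfolding hausdorff_pre_def by (rule INF_lower) (use assms in auto)

lemma hausdorff_pre_less:
  fixes E :: "(real^'n) set"
  assumes "hausdorff_pre s \<delta> E < b"
  shows "\<exists>C :: nat \<Rightarrow> (real^'n) set. (E \<subseteq> (\<Union>i. C i) \<and> (\<forall>i. bounded (C i) \<and> diameter (C i) \<le> \<delta>)) \<and>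
    (\<Sum>i. hausdorff_weight s (C i)) < b"
  using assms unfolding hausdorff_pre_def INF_less_iff by blast

lemma hausdorff_pre_empty: "\<delta> \<ge> 0 \<Longrightarrow> hausdorff_pre s \<delta> {} = 0"
  using hausdorff_pre_le[of "{}" "\<lambda>i. {}" \<delta> s] by (simp add: hausdorff_weight_def)

text \<open>Near-optimal covers of the pieces are merged into one sequence by the pairing of natural
  numbers.\<close>

lemma hausdorff_pre_subadditive:
  fixes A :: "nat \<Rightarrow> (real^'n) set"
  shows "hausdorff_pre s \<delta> (\<Union>i. A i) \<le> (\<Sum>i. hausdorff_pre s \<delta> (A i))"
proof (rule ennreal_le_epsilon)
  fix e :: real assume fin: "(\<Sum>i. hausdorff_pre s \<delta> (A i)) < top" and e: "0 < e"
  \<comment> \<open>Strictness needs a finite content, which \<open>fin\<close> provides; the added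
    errors form a geometric series with sum \<open>e\<close>.\<close>
  have "hausdorff_pre s \<delta> (A n) < hausdorff_pre s \<delta> (A n) + ennreal (e * (1/2) ^ Suc n)" for n
  proof -
    have "hausdorff_pre s \<delta> (A n) \<noteq> top"
      using ennreal_suminf_lessD[OF fin, of n] by simp
    then show ?thesis using e
      by (metis add.right_neutral ennreal_add_left_cancel_less ennreal_less_zero_iff mult_pos_pos zero_less_power half_gt_zero_iff zero_less_one infinity_ennreal_def)
  qed
  from hausdorff_pre_less[OF this]
  have "\<forall>n. \<exists>C :: nat \<Rightarrow> (real^'n) set. (A n \<subseteq> (\<Union>i. C i) \<and> (\<forall>i. bounded (C i) \<and> diameter (C i) \<le> \<delta>)) \<and>
    (\<Sum>i. hausdorff_weight s (C i)) < hausdorff_pre s \<delta> (A n) + ennreal (e * (1/2) ^ Suc n)"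
    by blast
  from choice[OF this] obtain C :: "nat \<Rightarrow> nat \<Rightarrow> (real^'n) set" where
    C: "\<forall>n. (A n \<subseteq> (\<Union>i. C n i) \<and> (\<forall>i. bounded (C n i) \<and> diameter (C n i) \<le> \<delta>)) \<and>
    (\<Sum>i. hausdorff_weight s (C n i)) < hausdorff_pre s \<delta> (A n) + ennreal (e * (1/2) ^ Suc n)"
    by (rule exE)
  define D where "D k = (case prod_decode k of (n, i) \<Rightarrow> C n i)" for k
  have "hausdorff_pre s \<delta> (\<Union>i. A i) \<le> (\<Sum>k. hausdorff_weight s (D k))"
  proof (rule hausdorff_pre_le)
    show "(\<Union>i. A i) \<subseteq> (\<Union>k. D k)"
    proof
      fix x assume "x \<in> (\<Union>i. A i)"
      then obtain n where "x \<in> A n" by blast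
      then obtain i where "x \<in> C n i" using C by blast
      then have "x \<in> D (prod_encode (n, i))" by (simp add: D_def)
      then show "x \<in> (\<Union>k. D k)" by blast
    qed
    show "bounded (D k)" "diameter (D k) \<le> \<delta>" for k
      using C by (auto simp: D_def split: prod.split)
  qed
  also have "\<dots> = (\<Sum>k. (\<lambda>(n, i). hausdorff_weight s (C n i)) (prod_decode k))"
    by (simp add: D_def case_prod_beta)
  also have "\<dots> = (\<Sum>n. \<Sum>i. hausdorff_weight s (C n i))"
    by (rule suminf_ennreal_2dimen) simp
  also have "\<dots> \<le> (\<Sum>n. hausdorff_pre s \<delta> (A n) + ennreal (e * (1/2) ^ Suc n))"
    using C by (intro suminf_le summableI less_imp_le) blast
  also have "\<dots> = (\<Sum>n. hausdorff_pre s \<delta> (A n)) + (\<Sum>n. ennreal (e * (1/2) ^ Suc n))"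
    by (intro suminf_add[symmetric] summableI)
  also have "(\<Sum>n. ennreal (e * (1/2) ^ Suc n)) = ennreal e"
  proof -
    have "(\<lambda>n. e * (1/2) ^ Suc n) sums (e * 1)" by (rule sums_mult[OF power_half_series])
    then show ?thesis using e by (intro suminf_ennreal_eq) auto
  qed
  finally show "hausdorff_pre s \<delta> (\<Union>i. A i) \<le> (\<Sum>i. hausdorff_pre s \<delta> (A i)) + ennreal e" .
qed

lemma hausdorff_outer_mono: "E \<subseteq> F \<Longrightarrow> hausdorff_outer s E \<le> hausdorff_outer s F"
  unfolding hausdorff_outer_eq by (intro SUP_mono) (use hausdorff_pre_mono in blast)

lemma hausdorff_pre_le_outer: "\<delta> > 0 \<Longrightarrow> hausdorff_pre s \<delta> E \<le> hausdorff_outer s E"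
  unfolding hausdorff_outer_eq by (rule SUP_upper) simp

lemma hausdorff_outer_subadditive:
  "hausdorff_outer s (\<Union>i. A i) \<le> (\<Sum>i::nat. hausdorff_outer s (A i))"
  unfolding hausdorff_outer_eq[of s "\<Union>i. A i"]
proof (rule SUP_least)
  fix \<delta> :: real assume "\<delta> \<in> {0<..}"
  then have "(\<Sum>i. hausdorff_pre s \<delta> (A i)) \<le> (\<Sum>i. hausdorff_outer s (A i))"
    by (intro suminf_le summableI hausdorff_pre_le_outer) auto
  then show "hausdorff_pre s \<delta> (\<Union>i. A i) \<le> (\<Sum>i. hausdorff_outer s (A i))"
    using hausdorff_pre_subadditive order_trans by blast
qed

lemma hausdorff_outer_empty: "hausdorff_outer s {} = 0"
  unfolding hausdorff_outer_eq by (simp add: hausdorff_pre_empty)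

lemma hausdorff_outer_Un_le: "hausdorff_outer s (A \<union> B) \<le> hausdorff_outer s A + hausdorff_outer s B"
proof -
  have "hausdorff_outer s (A \<union> B) = hausdorff_outer s (\<Union>i. binaryset A B i)"
    by (simp add: UN_binaryset_eq)
  also have "\<dots> \<le> (\<Sum>i. hausdorff_outer s (binaryset A B i))"
    by (rule hausdorff_outer_subadditive)
  also have "\<dots> = hausdorff_outer s A + hausdorff_outer s B"
    by (rule suminf_binaryset_eq) (rule hausdorff_outer_empty)
  finally show ?thesis .
qed

text \<open>A set of diameter at most \<open>\<delta>\<close> cannot meet both \<open>A\<close> and
  \<open>B\<close>, so every cover splits into the sets that meet \<open>A\<close> and the others.
  Vacated indices are filled with the empty set, whose weight is 0 even for
  \<open>s = 0\<close>.\<close>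

lemma hausdorff_pre_separated:
  fixes A B :: "(real^'n) set"
  assumes "\<And>x y. x \<in> A \<Longrightarrow> y \<in> B \<Longrightarrow> dist x y > \<delta>"
  shows "hausdorff_pre s \<delta> A + hausdorff_pre s \<delta> B \<le> hausdorff_pre s \<delta> (A \<union> B)"
  unfolding hausdorff_pre_def[of s \<delta> "A \<union> B"]
proof (rule INF_greatest)
  fix C :: "nat \<Rightarrow> (real^'n) set"
  assume "C \<in> {C. A \<union> B \<subseteq> (\<Union>i. C i) \<and> (\<forall>i. bounded (C i) \<and> diameter (C i) \<le> \<delta>)}"
  then have C: "A \<union> B \<subseteq> (\<Union>i. C i)" "\<And>i. bounded (C i)" "\<And>i. diameter (C i) \<le> \<delta>" by blast+
  define P where "P i = (if C i \<inter> A = {} then {} else C i)" for i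
  define R where "R i = (if C i \<inter> A = {} then C i else {})" for i
  have "\<delta> \<ge> 0" using C(2,3)[of 0] diameter_ge_0[of "C 0"] by linarith
  have "hausdorff_pre s \<delta> A \<le> (\<Sum>i. hausdorff_weight s (P i))"
  proof (rule hausdorff_pre_le)
    show "A \<subseteq> (\<Union>i. P i)"
    proof
      fix x assume "x \<in> A"
      then obtain i where "x \<in> C i" using C(1) by blast
      then have "x \<in> P i" using \<open>x \<in> A\<close> by (auto simp: P_def)
      then show "x \<in> (\<Union>i. P i)" by blast
    qed
    show "bounded (P i)" "diameter (P i) \<le> \<delta>" for i
      using C(2,3)[of i] \<open>\<delta> \<ge> 0\<close> by (auto simp: P_def)
  qed
  moreover have "hausdorff_pre s \<delta> B \<le> (\<Sum>i. hausdorff_weight s (R i))"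
  proof (rule hausdorff_pre_le)
    show "B \<subseteq> (\<Union>i. R i)"
    proof
      fix x assume "x \<in> B"
      then obtain i where i: "x \<in> C i" using C(1) by blast
      have "C i \<inter> A = {}"
      proof (rule ccontr)
        assume "C i \<inter> A \<noteq> {}"
        then obtain y where y: "y \<in> C i" "y \<in> A" by blast
        have "dist y x \<le> \<delta>" using diameter_bounded_bound[OF C(2) y(1) i] C(3)[of i] by linarith
        then show False using assms[OF y(2) \<open>x \<in> B\<close>] by linarith
      qed
      then have "x \<in> R i" using i by (simp add: R_def)
      then show "x \<in> (\<Union>i. R i)" by blast
    qed
    show "bounded (R i)" "diameter (R i) \<le> \<delta>" for i
      using C(2,3)[of i] \<open>\<delta> \<ge> 0\<close> by (auto simp: R_def)
  qed
  ultimately have "hausdorff_pre s \<delta> A + hausdorff_pre s \<delta> B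
    \<le> (\<Sum>i. hausdorff_weight s (P i)) + (\<Sum>i. hausdorff_weight s (R i))"
    by (rule add_mono)
  also have "\<dots> = (\<Sum>i. hausdorff_weight s (P i) + hausdorff_weight s (R i))"
    by (intro suminf_add summableI)
  also have "(\<lambda>i. hausdorff_weight s (P i) + hausdorff_weight s (R i)) = (\<lambda>i. hausdorff_weight s (C i))"
    by (auto simp: fun_eq_iff P_def R_def hausdorff_weight_def)
  finally show "hausdorff_pre s \<delta> A + hausdorff_pre s \<delta> B \<le> (\<Sum>i. hausdorff_weight s (C i))" .
qed

text \<open>The defining property of a metric outer measure. Below the distance \<open>r\<close> the
  contents split, and the suprema over the two scales are taken one at a time.\<close>

lemma hausdorff_outer_separated:
  fixes A B :: "(real^'n) set"
  assumes r: "r > 0" "\<And>x y. x \<in> A \<Longrightarrow> y \<in> B \<Longrightarrow> dist x y \<ge> r"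
  shows "hausdorff_outer s A + hausdorff_outer s B \<le> hausdorff_outer s (A \<union> B)"
proof -
  have le: "hausdorff_pre s \<delta>1 A + hausdorff_pre s \<delta>2 B \<le> hausdorff_outer s (A \<union> B)"
    if "\<delta>1 > 0" "\<delta>2 > 0" for \<delta>1 \<delta>2
  proof -
    define \<delta> where "\<delta> = min (r / 2) (min \<delta>1 \<delta>2)"
    have d: "\<delta> > 0" "\<delta> < r" "\<delta> \<le> \<delta>1" "\<delta> \<le> \<delta>2" using that r(1) by (auto simp: \<delta>_def)
    have "hausdorff_pre s \<delta>1 A + hausdorff_pre s \<delta>2 B \<le> hausdorff_pre s \<delta> A + hausdorff_pre s \<delta> B"
      using d by (intro add_mono hausdorff_pre_antimono)
    also have "\<dots> \<le> hausdorff_pre s \<delta> (A \<union> B)"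
      by (rule hausdorff_pre_separated) (use r(2) d(2) in \<open>blast intro: less_le_trans\<close>)
    also have "\<dots> \<le> hausdorff_outer s (A \<union> B)" using d(1) by (rule hausdorff_pre_le_outer)
    finally show ?thesis .
  qed
  have "hausdorff_pre s \<delta>1 A + hausdorff_outer s B \<le> hausdorff_outer s (A \<union> B)" if "\<delta>1 > 0" for \<delta>1
  proof -
    have "hausdorff_pre s \<delta>1 A + hausdorff_outer s B = (SUP \<delta>\<in>{0<..}. hausdorff_pre s \<delta>1 A + hausdorff_pre s \<delta> B)"
      unfolding hausdorff_outer_eq by (subst ennreal_SUP_add_right) auto
    also have "\<dots> \<le> hausdorff_outer s (A \<union> B)"
      by (rule SUP_least) (use le that in auto)
    finally show ?thesis .
  qed
  then have "(SUP \<delta>\<in>{0<..}. hausdorff_pre s \<delta> A + hausdorff_outer s B) \<le> hausdorff_outer s (A \<union> B)"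
    by (intro SUP_least) auto
  also have "(SUP \<delta>\<in>{0<..}. hausdorff_pre s \<delta> A + hausdorff_outer s B) = hausdorff_outer s A + hausdorff_outer s B"
    unfolding hausdorff_outer_eq[of s A] by (subst ennreal_SUP_add_left) auto
  finally show ?thesis .
qed

text \<open>Caratheodory's criterion: the shells \<open>R k\<close> of the complement of \<open>C\<close> have positive distance
  from each other once their indices differ by two, so that their outer measures are summable.\<close>

lemma closed_in_lambda_system:
  fixes C :: "(real^'n) set"
  assumes C: "closed C"
  shows "hausdorff_outer s (T \<inter> C) + hausdorff_outer s (T - C) \<le> hausdorff_outer s T"
proof (cases "C = {} \<or> hausdorff_outer s T = top")
  case True
  then show ?thesis by (auto simp: hausdorff_outer_empty)
next
  case False
  then have ne: "C \<noteq> {}" and fin: "hausdorff_outer s T < top" by (auto simp: less_top)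
  let ?H = "hausdorff_outer s"
  define g where "g x = infdist x C" for x
  have gC: "g x = 0 \<longleftrightarrow> x \<in> C" for x
    unfolding g_def using in_closed_iff_infdist_zero[OF C ne] by blast
  have glip: "\<bar>g x - g y\<bar> \<le> dist x y" for x y
    unfolding g_def by (rule infdist_triangle_abs)
  have g0: "g x \<ge> 0" for x unfolding g_def by (rule infdist_nonneg)
  define a where "a k = 1 / real (Suc k)" for k
  have a: "a k > 0" "j < k \<Longrightarrow> a k < a j" "j \<le> k \<Longrightarrow> a k \<le> a j" for j k
    by (auto simp: a_def field_simps)
  define R where "R k = {x \<in> T. a (Suc k) \<le> g x \<and> g x < a k}" for k
  \<comment> \<open>Only shells of equal parity are added here; \<open>c\<close> will be 0 or
    1.\<close>
  have sumR: "(\<Sum>k<m. ?H (R (2 * k + c))) \<le> ?H (\<Union>k<m. R (2 * k + c))" for m c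
  proof (induction m)
    case (Suc m)
    have "(\<Sum>k<Suc m. ?H (R (2 * k + c))) \<le> ?H (\<Union>k<m. R (2 * k + c)) + ?H (R (2 * m + c))"
      using Suc by (simp add: add_right_mono)
    also have "\<dots> \<le> ?H ((\<Union>k<m. R (2 * k + c)) \<union> R (2 * m + c))"
    proof (cases m)
      case 0
      then show ?thesis by (simp add: hausdorff_outer_empty)
    next
      case (Suc m')
      \<comment> \<open>Earlier shells of this parity have \<open>g\<close> at least
        \<open>a (2 * m + c - 1)\<close>, the new one has \<open>g\<close> below
        \<open>a (2 * m + c)\<close>. The skipped index leaves exactly this gap, and
        \<open>g\<close> is 1-Lipschitz.\<close>
      let ?r = "a (2 * m + c - 1) - a (2 * m + c)"
      show ?thesis
      proof (rule hausdorff_outer_separated[of ?r])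
        show "?r > 0" using a(2)[of "2 * m + c - 1" "2 * m + c"] Suc by simp
        fix x y assume x: "x \<in> (\<Union>k<m. R (2 * k + c))" and y: "y \<in> R (2 * m + c)"
        then obtain k where "k < m" "x \<in> R (2 * k + c)" by blast
        then have "a (Suc (2 * k + c)) \<le> g x" by (simp add: R_def)
        moreover have "a (2 * m + c - 1) \<le> a (Suc (2 * k + c))" using \<open>k < m\<close> by (intro a(3)) simp
        moreover have "g y < a (2 * m + c)" using y by (simp add: R_def)
        ultimately show "?r \<le> dist x y" using glip[of x y] by linarith
      qed
    qed
    also have "(\<Union>k<m. R (2 * k + c)) \<union> R (2 * m + c) = (\<Union>k<Suc m. R (2 * k + c))"
      by (auto simp: lessThan_Suc)
    finally show ?case .
  qed (simp add: hausdorff_outer_empty)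
  have bnd: "(\<Sum>k<m. ?H (R (2 * k + c))) \<le> ?H T" for m c
    by (rule order_trans[OF sumR hausdorff_outer_mono]) (auto simp: R_def)
  have "(\<Sum>k. ?H (R (2 * k + c))) \<le> ?H T" for c
    by (rule suminf_le_const[OF summableI bnd])
  \<comment> \<open>Even and odd shells are bounded separately, which costs a factor 2 but gives a
    finite series.\<close>
  have total: "(\<Sum>k<m. ?H (R k)) \<le> ?H T + ?H T" for m
  proof -
    have "(\<Sum>k<m. ?H (R k)) \<le> (\<Sum>k<2 * m. ?H (R k))"
      by (rule sum_mono2) auto
    also have "\<dots> = (\<Sum>k<m. ?H (R (2 * k + 0))) + (\<Sum>k<m. ?H (R (2 * k + 1)))"
      by (induction m) (simp_all add: algebra_simps)
    also have "\<dots> \<le> ?H T + ?H T" by (intro add_mono bnd)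
    finally show ?thesis .
  qed
  have tot: "(\<Sum>k. ?H (R k)) \<le> ?H T + ?H T"
    by (rule suminf_le_const[OF summableI total])
  then have totfin: "(\<Sum>k. ?H (R k)) < top" using fin by (metis ennreal_add_less_top le_less_trans)
  \<comment> \<open>\<open>T - C\<close> consists of \<open>S\<close>, which keeps distance
    \<open>a n\<close> from \<open>C\<close>, and of the shells from index \<open>n\<close> on. The
    outer measure is superadditive on \<open>T \<inter> C\<close> and \<open>S\<close>, and the
    shells contribute the tail of a convergent series.\<close>
  have part: "?H (T \<inter> C) + ?H (T - C) \<le> ?H T + (\<Sum>k. ?H (R (k + n)))" for n
  proof -
    define S where "S = {x \<in> T. a n \<le> g x}"
    have sub: "T - C \<subseteq> S \<union> (\<Union>k. R (k + n))"
    proof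
      fix x assume x: "x \<in> T - C"
      show "x \<in> S \<union> (\<Union>k. R (k + n))"
      proof (cases "a n \<le> g x")
        case False
        have pos: "g x > 0" using x gC[of x] g0[of x] by force
        obtain N where N: "a N < g x" unfolding a_def using reals_Archimedean[OF pos] by (auto simp: inverse_eq_divide)
        \<comment> \<open>The first threshold not exceeding \<open>g x\<close> identifies the shell
          containing \<open>x\<close>.\<close>
        define M where "M = (LEAST N. a N \<le> g x)"
        have M1: "a M \<le> g x" unfolding M_def by (rule LeastI[of _ N]) (use N in simp)
        have M2: "\<not> a j \<le> g x" if "j < M" for j using that unfolding M_def by (rule not_less_Least)
        have "M > n"
        proof (rule ccontr)
          assume "\<not> M > n"
          then show False using a(3)[of M n] M1 False by linarith
        qed
        then obtain M' where M': "M = Suc M'" "n \<le> M'" by (cases M) auto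
        have "x \<in> R M'" using x M1 M2[of M'] M' by (auto simp: R_def)
        then have "x \<in> R ((M' - n) + n)" using M' by simp
        then show ?thesis by blast
      qed (use x in \<open>simp add: S_def\<close>)
    qed
    have "?H (T - C) \<le> ?H (S \<union> (\<Union>k. R (k + n)))" by (rule hausdorff_outer_mono[OF sub])
    also have "\<dots> \<le> ?H S + ?H (\<Union>k. R (k + n))" by (rule hausdorff_outer_Un_le)
    also have "\<dots> \<le> ?H S + (\<Sum>k. ?H (R (k + n)))" by (intro add_left_mono hausdorff_outer_subadditive)
    finally have "?H (T \<inter> C) + ?H (T - C) \<le> (?H (T \<inter> C) + ?H S) + (\<Sum>k. ?H (R (k + n)))"
      by (simp add: add.assoc add_left_mono)
    also have "?H (T \<inter> C) + ?H S \<le> ?H ((T \<inter> C) \<union> S)"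
    proof (rule hausdorff_outer_separated[OF a(1)[of n]])
      fix x y assume "x \<in> T \<inter> C" "y \<in> S"
      then have "g x = 0" "a n \<le> g y" using gC by (auto simp: S_def)
      then show "a n \<le> dist x y" using glip[of x y] by linarith
    qed
    also have "\<dots> \<le> ?H T" by (rule hausdorff_outer_mono) (auto simp: S_def)
    finally show ?thesis by (simp add: add_right_mono)
  qed
  have lim: "(\<lambda>n. \<Sum>k. ?H (R (k + n))) \<longlonglongrightarrow> 0"
  proof -
    \<comment> \<open>All terms are finite, so the tail can be treated as that of a summable real
      series.\<close>
    define h where "h k = enn2real (?H (R k))" for k
    have "?H (R k) < top" for k using ennreal_suminf_lessD[OF totfin] .
    then have hH: "?H (R k) = ennreal (h k)" for k by (simp add: h_def less_top)
    have hn: "h k \<ge> 0" for k by (simp add: h_def)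
    have "summable h"
      using totfin unfolding hH by (intro summable_suminf_not_top hn) auto
    have "(\<Sum>k. ?H (R (k + n))) = ennreal (\<Sum>k. h (k + n))" for n
      unfolding hH using \<open>summable h\<close> hn by (intro suminf_ennreal2) (auto simp: summable_iff_shift)
    moreover have "(\<lambda>n. ennreal (\<Sum>k. h (k + n))) \<longlonglongrightarrow> ennreal 0"
      by (intro tendsto_ennrealI suminf_exist_split2 \<open>summable h\<close>)
    ultimately show ?thesis by simp
  qed
  have "(\<lambda>n. ?H T + (\<Sum>k. ?H (R (k + n)))) \<longlonglongrightarrow> ?H T + 0"
    by (intro tendsto_add tendsto_const lim)
  then show ?thesis
    using part by (intro LIMSEQ_le_const[of "\<lambda>n. ?H T + (\<Sum>k. ?H (R (k + n)))"]) auto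
qed

text \<open>\<open>measure_of\<close> keeps its set function only if that is countably additive. The
  Caratheodory measurable sets form a sigma algebra on which it is, and they contain the closed
  sets, hence all Borel sets.\<close>

lemma emeasure_hausdorff_measure:
  assumes "E \<in> sets borel"
  shows "emeasure (hausdorff_measure s) (E :: (real^'n) set) = hausdorff_outer s E"
proof -
  let ?H = "hausdorff_outer s :: (real^'n) set \<Rightarrow> ennreal"
  interpret P: sigma_algebra "UNIV :: (real^'n) set" "Pow UNIV" by (rule sigma_algebra_Pow)
  let ?L = "lambda_system UNIV (Pow UNIV) ?H"
  have om: "outer_measure_space (Pow UNIV) ?H"
    unfolding outer_measure_space_def positive_def increasing_def countably_subadditive_def
    by (simp add: hausdorff_outer_empty hausdorff_outer_mono hausdorff_outer_subadditive)
  have ms: "measure_space UNIV ?L ?H" by (rule P.caratheodory_lemma[OF om])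
  then have sa: "sigma_algebra UNIV ?L" by (simp add: measure_space_def)
  have "Collect closed \<subseteq> ?L"
  proof
    fix C :: "(real^'n) set" assume "C \<in> Collect closed"
    then have C: "closed C" by simp
    show "C \<in> ?L"
      unfolding P.lambda_system_eq
    proof (intro CollectI conjI ballI)
      fix T :: "(real^'n) set"
      have "?H T \<le> ?H (T \<inter> C) + ?H (T - C)"
        using hausdorff_outer_Un_le[of s "T \<inter> C" "T - C"] by (simp add: Int_Diff_Un)
      then show "?H (T \<inter> C) + ?H (T - C) = ?H T"
        using closed_in_lambda_system[OF C, of s T] by (rule antisym[rotated])
    qed simp
  qed
  then have "sigma_sets UNIV (Collect closed) \<subseteq> ?L"
    by (rule sigma_algebra.sigma_sets_subset[OF sa])
  then have sub: "sets borel \<subseteq> ?L"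
    unfolding borel_eq_closed by simp
  have "countably_additive (sets borel) ?H"
    unfolding countably_additive_def
  proof (intro allI impI)
    fix A :: "nat \<Rightarrow> (real^'n) set"
    assume A: "range A \<subseteq> sets borel" "disjoint_family A" "\<Union>(range A) \<in> sets borel"
    have "countably_additive ?L ?H" using ms by (simp add: measure_space_def)
    moreover have "range A \<subseteq> ?L" "\<Union>(range A) \<in> ?L" using A sub by blast+
    ultimately show "(\<Sum>i. ?H (A i)) = ?H (\<Union>(range A))"
      using A(2) unfolding countably_additive_def by simp
  qed
  moreover have "positive (sets borel) ?H"
    by (simp add: positive_def hausdorff_outer_empty)
  ultimately show ?thesis
    unfolding hausdorff_measure_def
    by (intro emeasure_measure_of_sigma assms) (use sets.sigma_algebra_axioms[of borel] in simp)
qed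

lemma sets_hausdorff_measure: "sets (hausdorff_measure s :: (real^'n) measure) = sets borel"
  unfolding hausdorff_measure_def using sets.sets_measure_of_eq[of borel] by simp

lemma space_hausdorff_measure: "space (hausdorff_measure s :: (real^'n) measure) = UNIV"
  unfolding hausdorff_measure_def by (simp add: space_measure_of_conv)

section \<open>The surface measure charges every piece of the boundary\<close>

text \<open>For a unit vector \<open>\<nu>\<close> this is the orthogonal projection onto the
  hyperplane normal to \<open>\<nu>\<close>, the argument of \<open>\<gamma>\<close> in
  \<open>C11_boundary\<close>.\<close>

definition hproj :: "real^'n \<Rightarrow> real^'n \<Rightarrow> real^'n" where
  "hproj \<nu> x = x - (x \<bullet> \<nu>) *\<^sub>R \<nu>"

lemma hproj_diff: "hproj \<nu> (x - y) = hproj \<nu> x - hproj \<nu> y"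
  by (simp add: hproj_def inner_diff_left scaleR_diff_left)

lemma hproj_add_normal: "norm \<nu> = 1 \<Longrightarrow> hproj \<nu> (x + t *\<^sub>R \<nu>) = hproj \<nu> x"
  by (simp add: hproj_def inner_add_left scaleR_add_left dot_square_norm)

lemma norm_hproj_le: "norm \<nu> = 1 \<Longrightarrow> norm (hproj \<nu> x) \<le> norm x"
proof -
  assume n: "norm \<nu> = 1"
  have "hproj \<nu> x \<bullet> hproj \<nu> x = x \<bullet> x - (x \<bullet> \<nu>) * (x \<bullet> \<nu>)"
    using n by (simp add: hproj_def inner_diff_left inner_diff_right inner_commute norm_eq_1)
  also have "\<dots> \<le> x \<bullet> x" by simp
  finally show ?thesis by (simp add: norm_le)
qed

lemma continuous_on_hproj: "continuous_on S (hproj \<nu>)"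
  unfolding hproj_def by (intro continuous_intros)

text \<open>Solid cylinder of radius \<open>d\<close> around the line through \<open>a\<close> in
  direction \<open>\<nu>\<close>, cut at height \<open>\<rho>\<close> above and below
  \<open>x0\<close>. It contains what a set near \<open>a\<close> of diameter \<open>d\<close>
  sweeps out along \<open>\<nu>\<close>.\<close>

definition cylinder :: "real^'n \<Rightarrow> real^'n \<Rightarrow> real \<Rightarrow> real^'n \<Rightarrow> real \<Rightarrow> (real^'n) set" where
  "cylinder \<nu> x0 \<rho> a d = {x. norm (hproj \<nu> (x - a)) \<le> d \<and> \<bar>(x - x0) \<bullet> \<nu>\<bar> \<le> \<rho>}"

lemma closed_cylinder: "closed (cylinder \<nu> x0 \<rho> a d)"
proof -
  have c: "continuous_on UNIV (\<lambda>x. hproj \<nu> (x - a))"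
    unfolding hproj_diff by (intro continuous_intros continuous_on_hproj)
  have "closed {x. norm (hproj \<nu> (x - a)) \<le> d}" "closed {x. \<bar>(x - x0) \<bullet> \<nu>\<bar> \<le> \<rho>}"
    by (intro closed_Collect_le continuous_intros c)+
  then show ?thesis
    unfolding cylinder_def Collect_conj_eq by (rule closed_Int)
qed

text \<open>A cylinder of radius \<open>d\<close> and fixed height is covered by \<open>O(1/d)\<close> balls of radius \<open>2 d\<close>
  centred on its axis, so that its volume is \<open>O(d ^ (n - 1))\<close>.\<close>

lemma emeasure_cylinder_pos_le:
  fixes \<nu> :: "real^'n"
  assumes \<nu>: "norm \<nu> = 1" and t: "0 < t" "t \<le> 1" and \<rho>: "\<rho> > 0"
  shows "emeasure lebesgue (cylinder \<nu> x0 \<rho> a t)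
    \<le> ennreal ((2 * \<rho> + 2) * unit_ball_vol (real CARD('n)) * 2 ^ CARD('n) * t ^ (CARD('n) - 1))"
proof -
  define N where "N = nat \<lceil>2 * \<rho> / t\<rceil>"
  have N: "real N \<le> 2 * \<rho> / t + 1" "2 * \<rho> / t \<le> real N"
    using \<rho> t by (auto simp: N_def; linarith)+
  \<comment> \<open>Centres on the axis, spaced by \<open>t\<close> over the height
    \<open>2 * \<rho>\<close>. A point of the cylinder is within \<open>t\<close> of the axis and
    within \<open>t\<close> in height of some centre, whence balls of radius
    \<open>2 * t\<close>.\<close>
  define c where "c k = hproj \<nu> a + (x0 \<bullet> \<nu> - \<rho> + real k * t) *\<^sub>R \<nu>" for k
  have sub: "cylinder \<nu> x0 \<rho> a t \<subseteq> (\<Union>k\<in>{..N}. cball (c k) (2 * t))"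
  proof
    fix x assume "x \<in> cylinder \<nu> x0 \<rho> a t"
    then have x: "norm (hproj \<nu> (x - a)) \<le> t" "\<bar>(x - x0) \<bullet> \<nu>\<bar> \<le> \<rho>" by (auto simp: cylinder_def)
    define h where "h = (x - x0) \<bullet> \<nu> + \<rho>"
    have h: "0 \<le> h" "h \<le> 2 * \<rho>" using x(2) by (auto simp: h_def)
    define k where "k = nat \<lfloor>h / t\<rfloor>"
    have k: "real k \<le> h / t" "h / t \<le> real k + 1" using h(1) t(1) by (auto simp: k_def; linarith)+
    have kN: "k \<le> N"
    proof -
      have "h / t \<le> 2 * \<rho> / t" using h(2) t(1) by (intro divide_right_mono) auto
      then show ?thesis using k(1) N(2) by linarith
    qed
    have kt: "\<bar>h - real k * t\<bar> \<le> t"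
      using k t(1) by (auto simp: field_simps abs_le_iff)
    have "x = hproj \<nu> x + (x \<bullet> \<nu>) *\<^sub>R \<nu>" by (simp add: hproj_def)
    then have "x - c k = hproj \<nu> (x - a) + (h - real k * t) *\<^sub>R \<nu>"
      unfolding c_def hproj_diff h_def
      by (simp add: inner_diff_left algebra_simps)
    then have "norm (x - c k) \<le> norm (hproj \<nu> (x - a)) + \<bar>h - real k * t\<bar>"
      using norm_triangle_ineq[of "hproj \<nu> (x - a)" "(h - real k * t) *\<^sub>R \<nu>"] \<nu> by simp
    then have "norm (x - c k) \<le> 2 * t" using x(1) kt by linarith
    then have "x \<in> cball (c k) (2 * t)" by (simp add: dist_norm norm_minus_commute)
    then show "x \<in> (\<Union>k\<in>{..N}. cball (c k) (2 * t))" using kN by blast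
  qed
  have ball: "emeasure lebesgue (cball (c k) (2 * t)) = ennreal (unit_ball_vol (real CARD('n)) * (2 * t) ^ CARD('n))" for k
    using t(1) emeasure_cball[of "2 * t" "c k"] by simp
  have "emeasure lebesgue (cylinder \<nu> x0 \<rho> a t) \<le> emeasure lebesgue (\<Union>k\<in>{..N}. cball (c k) (2 * t))"
    by (rule emeasure_mono[OF sub]) (intro sets.finite_UN; simp)
  also have "\<dots> \<le> (\<Sum>k\<in>{..N}. emeasure lebesgue (cball (c k) (2 * t)))"
    by (rule emeasure_subadditive_finite) auto
  also have "\<dots> = of_nat (Suc N) * ennreal (unit_ball_vol (real CARD('n)) * (2 * t) ^ CARD('n))"
    unfolding ball by simp
  also have "\<dots> = ennreal (real (Suc N) * (unit_ball_vol (real CARD('n)) * (2 * t) ^ CARD('n)))"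
    by (simp only: ennreal_of_nat_eq_real_of_nat) (use t in \<open>simp add: ennreal_mult\<close>)
  also have "\<dots> \<le> ennreal ((2 * \<rho> + 2) * unit_ball_vol (real CARD('n)) * 2 ^ CARD('n) * t ^ (CARD('n) - 1))"
  proof (rule ennreal_leI)
    \<comment> \<open>One factor \<open>t\<close> of the ball volume pays for the number of balls,
      which is of order \<open>1 / t\<close>.\<close>
    have "real (Suc N) * t \<le> (2 * \<rho> / t + 2) * t" using N(1) t(1) by (intro mult_right_mono) auto
    also have "\<dots> = 2 * \<rho> + 2 * t" using t(1) by (simp add: field_simps)
    also have "\<dots> \<le> 2 * \<rho> + 2" using t(2) by simp
    finally have *: "real (Suc N) * t \<le> 2 * \<rho> + 2" .
    have tn: "t ^ CARD('n) = t * t ^ (CARD('n) - 1)"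
      by (simp add: power_eq_if)
    have "real (Suc N) * (unit_ball_vol (real CARD('n)) * (2 * t) ^ CARD('n))
      = (real (Suc N) * t) * (unit_ball_vol (real CARD('n)) * 2 ^ CARD('n) * t ^ (CARD('n) - 1))"
      by (simp add: power_mult_distrib tn)
    also have "\<dots> \<le> (2 * \<rho> + 2) * (unit_ball_vol (real CARD('n)) * 2 ^ CARD('n) * t ^ (CARD('n) - 1))"
      using * t(1) by (intro mult_right_mono) auto
    finally show "real (Suc N) * (unit_ball_vol (real CARD('n)) * (2 * t) ^ CARD('n))
      \<le> (2 * \<rho> + 2) * unit_ball_vol (real CARD('n)) * 2 ^ CARD('n) * t ^ (CARD('n) - 1)"
      by (simp add: mult.assoc)
  qed
  finally show ?thesis .
qed

text \<open>Covering sets may be single points, so radius zero has to be included; the bound passes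
  to the limit from larger radii. In dimension one the power at \<open>d = 0\<close> is
  \<open>0 ^ 0 = 1\<close>, as it must be.\<close>

lemma emeasure_cylinder_le:
  fixes \<nu> :: "real^'n"
  assumes \<nu>: "norm \<nu> = 1" and d: "0 \<le> d" "d \<le> 1 / 2" and \<rho>: "\<rho> > 0"
  shows "emeasure lebesgue (cylinder \<nu> x0 \<rho> a d)
    \<le> ennreal ((2 * \<rho> + 2) * unit_ball_vol (real CARD('n)) * 2 ^ CARD('n) * d ^ (CARD('n) - 1))"
proof -
  \<comment> \<open>Starting at 1/2 keeps the radii at most 1, because
    \<open>d \<le> 1 / 2\<close>.\<close>
  define t where "t k = d + 1 / 2 / real (Suc k)" for k
  have t: "0 < t k" "t k \<le> 1" "d \<le> t k" for k
  proof -
    have "1 / 2 / real (Suc k) \<le> 1 / 2" "0 < 1 / 2 / real (Suc k)" by (auto simp: field_simps)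
    then show "0 < t k" "t k \<le> 1" "d \<le> t k" using d unfolding t_def by linarith+
  qed
  have "t \<longlonglongrightarrow> d + 0"
    unfolding t_def by (intro tendsto_add tendsto_const LIMSEQ_Suc[OF lim_const_over_n])
  then have "t \<longlonglongrightarrow> d" by simp
  then have "(\<lambda>k. ennreal ((2 * \<rho> + 2) * unit_ball_vol (real CARD('n)) * 2 ^ CARD('n) * t k ^ (CARD('n) - 1)))
    \<longlonglongrightarrow> ennreal ((2 * \<rho> + 2) * unit_ball_vol (real CARD('n)) * 2 ^ CARD('n) * d ^ (CARD('n) - 1))"
    by (intro tendsto_ennrealI tendsto_intros)
  moreover have "emeasure lebesgue (cylinder \<nu> x0 \<rho> a d)
    \<le> ennreal ((2 * \<rho> + 2) * unit_ball_vol (real CARD('n)) * 2 ^ CARD('n) * t k ^ (CARD('n) - 1))" for k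
  proof -
    have "emeasure lebesgue (cylinder \<nu> x0 \<rho> a d) \<le> emeasure lebesgue (cylinder \<nu> x0 \<rho> a (t k))"
      using closed_cylinder[of \<nu> x0 \<rho> a "t k"] t(3)[of k]
      by (intro emeasure_mono) (auto simp: cylinder_def)
    also have "\<dots> \<le> ennreal ((2 * \<rho> + 2) * unit_ball_vol (real CARD('n)) * 2 ^ CARD('n) * t k ^ (CARD('n) - 1))"
      by (rule emeasure_cylinder_pos_le[OF \<nu> t(1,2) \<rho>])
    finally show ?thesis .
  qed
  ultimately show ?thesis
    by (intro LIMSEQ_le_const) auto
qed

text \<open>Every cover of the boundary piece is swept along \<open>\<nu>\<close> into cylinders
  that cover a fixed ball \<open>K\<close> around \<open>x0\<close>. The volume of such a cylinder
  is at most \<open>M\<close> times the weight of its covering set, so the volume of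
  \<open>K\<close> divided by \<open>M\<close> is a lower bound for all sums of weights.\<close>

lemma hausdorff_outer_frontier_pos:
  fixes \<Omega> :: "(real^'n) set"
  assumes \<Omega>: "open \<Omega>" "C11_boundary \<Omega>" and x0: "x0 \<in> frontier \<Omega>" and r: "r > 0"
  shows "hausdorff_outer (CARD('n) - 1) (frontier \<Omega> \<inter> ball x0 r) > 0"
proof -
  from \<Omega>(2) x0 have "\<exists>r>0. \<exists>\<nu> \<gamma> G L. norm \<nu> = 1 \<and>
     (\<forall>x. (\<gamma> has_derivative (\<lambda>h. G x \<bullet> h)) (at x)) \<and> L-lipschitz_on UNIV G \<and>
     \<Omega> \<inter> ball x0 r = {x \<in> ball x0 r. x \<bullet> \<nu> > \<gamma> (x - (x \<bullet> \<nu>) *\<^sub>R \<nu>)}"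
    unfolding C11_boundary_def by blast
  then obtain r1 \<nu> \<gamma> G where r1: "r1 > 0" and \<nu>: "norm \<nu> = 1"
    and \<gamma>: "\<And>x. (\<gamma> has_derivative (\<lambda>h. G x \<bullet> h)) (at x)"
    and graph: "\<Omega> \<inter> ball x0 r1 = {x \<in> ball x0 r1. x \<bullet> \<nu> > \<gamma> (hproj \<nu> x)}"
    unfolding hproj_def by blast
  have gcont: "continuous_on UNIV \<gamma>"
    using \<gamma> has_derivative_continuous by (blast intro: continuous_at_imp_continuous_on)
  have ghcont: "continuous_on UNIV (\<lambda>x. \<gamma> (hproj \<nu> x))"
    by (rule continuous_on_compose2[OF gcont continuous_on_hproj]) auto
  have fr: "x \<in> frontier \<Omega> \<longleftrightarrow> x \<in> closure \<Omega> \<and> x \<notin> \<Omega>" for x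
    using \<Omega>(1) by (simp add: frontier_def interior_open)
  \<comment> \<open>Points above the graph belong to \<open>\<Omega>\<close>, and a point strictly
    below it has a neighbourhood free of \<open>\<Omega>\<close>; neither can be a frontier point of
    the open set.\<close>
  have on_graph: "x \<bullet> \<nu> = \<gamma> (hproj \<nu> x)" if "x \<in> frontier \<Omega>" "x \<in> ball x0 r1" for x
  proof (rule antisym)
    show "x \<bullet> \<nu> \<le> \<gamma> (hproj \<nu> x)"
      using that graph fr by (metis (mono_tags, lifting) IntI IntD1 mem_Collect_eq not_le)
    show "\<gamma> (hproj \<nu> x) \<le> x \<bullet> \<nu>"
    proof (rule ccontr)
      assume *: "\<not> \<gamma> (hproj \<nu> x) \<le> x \<bullet> \<nu>"
      define W where "W = {x. x \<bullet> \<nu> < \<gamma> (hproj \<nu> x)} \<inter> ball x0 r1"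
      have W: "open W"
        unfolding W_def by (intro open_Int open_ball open_Collect_less continuous_intros ghcont)
      have "x \<in> W \<inter> closure \<Omega>" using * that fr by (simp add: W_def)
      then have "W \<inter> \<Omega> \<noteq> {}" using open_Int_closure_eq_empty[OF W, of \<Omega>] by blast
      then obtain y where "y \<in> W \<inter> \<Omega>" by blast
      then have "y \<in> \<Omega>" "y \<in> ball x0 r1" "y \<bullet> \<nu> < \<gamma> (hproj \<nu> y)" by (simp_all add: W_def)
      then have "y \<in> \<Omega> \<inter> ball x0 r1" "\<not> y \<bullet> \<nu> > \<gamma> (hproj \<nu> y)" by auto
      then show False unfolding graph by blast
    qed
  qed
  define R where "R = min r r1"
  have R: "R > 0" "R \<le> r" "R \<le> r1" using r r1 by (auto simp: R_def)
  have "isCont \<gamma> (hproj \<nu> x0)" using gcont by (simp add: continuous_on_eq_continuous_at)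
  then obtain \<eta> where \<eta>: "\<eta> > 0" "\<And>z. dist z (hproj \<nu> x0) < \<eta> \<Longrightarrow> dist (\<gamma> z) (\<gamma> (hproj \<nu> x0)) < R / 2"
    unfolding continuous_at_eps_delta using R(1) by (metis half_gt_zero)
  \<comment> \<open>Tangential displacement and variation of the graph height each stay below
    \<open>R / 2\<close>, so the graph points over \<open>K\<close> remain in the ball of radius
    \<open>R\<close>.\<close>
  define \<rho> where "\<rho> = min \<eta> (R / 2)"
  have \<rho>: "\<rho> > 0" "\<rho> \<le> \<eta>" "\<rho> \<le> R / 2" using \<eta>(1) R(1) by (auto simp: \<rho>_def)
  define K where "K = ball x0 \<rho>"
  have graph_pt: "hproj \<nu> x + \<gamma> (hproj \<nu> x) *\<^sub>R \<nu> \<in> frontier \<Omega> \<inter> ball x0 r" if "x \<in> K" for x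
  proof -
    let ?p = "hproj \<nu> x + \<gamma> (hproj \<nu> x) *\<^sub>R \<nu>"
    have nx: "norm (hproj \<nu> (x - x0)) < \<rho>"
      using norm_hproj_le[OF \<nu>, of "x - x0"] that by (simp add: K_def dist_norm norm_minus_commute)
    have hh: "hproj \<nu> (hproj \<nu> x) = hproj \<nu> x" "hproj \<nu> x \<bullet> \<nu> = 0"
      using \<nu> by (simp_all add: hproj_def inner_diff_left dot_square_norm)
    have hp: "hproj \<nu> ?p = hproj \<nu> x" using hproj_add_normal[OF \<nu>, of "hproj \<nu> x"] hh(1) by simp
    have pn: "?p \<bullet> \<nu> = \<gamma> (hproj \<nu> x)" using hh(2) \<nu> by (simp add: inner_add_left dot_square_norm)
    have "x0 = hproj \<nu> x0 + \<gamma> (hproj \<nu> x0) *\<^sub>R \<nu>"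
      using on_graph[OF x0] r1 by (simp add: hproj_def)
    then have "?p - x0 = hproj \<nu> (x - x0) + (\<gamma> (hproj \<nu> x) - \<gamma> (hproj \<nu> x0)) *\<^sub>R \<nu>"
      by (simp add: hproj_diff algebra_simps)
    then have "norm (?p - x0) \<le> norm (hproj \<nu> (x - x0)) + \<bar>\<gamma> (hproj \<nu> x) - \<gamma> (hproj \<nu> x0)\<bar>"
      using norm_triangle_ineq[of "hproj \<nu> (x - x0)" "(\<gamma> (hproj \<nu> x) - \<gamma> (hproj \<nu> x0)) *\<^sub>R \<nu>"] \<nu> by simp
    moreover have "dist (hproj \<nu> x) (hproj \<nu> x0) < \<eta>"
      using nx \<rho>(2) by (simp add: dist_norm hproj_diff)
    from \<eta>(2)[OF this] have "\<bar>\<gamma> (hproj \<nu> x) - \<gamma> (hproj \<nu> x0)\<bar> < R / 2" by (simp add: dist_norm)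
    ultimately have "norm (?p - x0) < R" using nx \<rho>(3) by linarith
    then have pb: "?p \<in> ball x0 R" by (simp add: dist_norm norm_minus_commute)
    then have pb1: "?p \<in> ball x0 r1" "?p \<in> ball x0 r" using R by auto
    have "?p \<notin> \<Omega>"
    proof
      assume "?p \<in> \<Omega>"
      then have "?p \<in> \<Omega> \<inter> ball x0 r1" using pb1 by blast
      then have "?p \<bullet> \<nu> > \<gamma> (hproj \<nu> ?p)" unfolding graph by blast
      then show False using hp pn by simp
    qed
    moreover have "?p \<in> closure \<Omega>"
      unfolding closure_approachable
    proof (intro allI impI)
      fix e :: real assume "e > 0"
      \<comment> \<open>A small shift upwards along \<open>\<nu>\<close> enters
        \<open>\<Omega>\<close> without leaving the chart.\<close>
      define t where "t = min (e / 2) ((r1 - dist x0 ?p) / 2)"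
      have t: "t > 0" "t < e" "dist x0 ?p + t < r1"
        using \<open>e > 0\<close> pb1(1) by (auto simp: t_def min_def field_simps)
      let ?q = "?p + t *\<^sub>R \<nu>"
      have dq: "dist ?q ?p = t" using t(1) \<nu> by (simp add: dist_norm)
      have "dist x0 ?q < r1" using dist_triangle[of x0 ?q ?p] dq t(3) by (simp add: dist_commute)
      moreover have "?q \<bullet> \<nu> > \<gamma> (hproj \<nu> ?q)"
        unfolding hproj_add_normal[OF \<nu>, of ?p] hp
        using pn t(1) \<nu> by (simp add: inner_add_left dot_square_norm)
      ultimately have "?q \<in> \<Omega> \<inter> ball x0 r1" unfolding graph by simp
      then show "\<exists>y\<in>\<Omega>. dist y ?p < e" using dq t(2) by (intro bexI[of _ ?q]) auto
    qed
    ultimately show ?thesis using fr pb1(2) by blast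
  qed
  define B where "B = (2 * \<rho> + 2) * unit_ball_vol (real CARD('n)) * 2 ^ CARD('n)"
  have B: "B > 0" using \<rho>(1) by (simp add: B_def)
  define \<omega> where "\<omega> = unit_ball_vol (real (CARD('n) - 1))"
  have \<omega>: "\<omega> > 0" by (simp add: \<omega>_def)
  \<comment> \<open>Ratio of the cylinder volume bound to the Hausdorff weight; the power of 2
    undoes the halving of the diameter in the weight.\<close>
  define M where "M = B * 2 ^ (CARD('n) - 1) / \<omega>"
  have M: "M > 0" using B \<omega> by (simp add: M_def)
  have low: "emeasure lebesgue K / ennreal M \<le> hausdorff_pre (CARD('n) - 1) (1 / 2) (frontier \<Omega> \<inter> ball x0 r)"
    unfolding hausdorff_pre_def
  proof (rule INF_greatest)
    fix C :: "nat \<Rightarrow> (real^'n) set"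
    assume "C \<in> {C. frontier \<Omega> \<inter> ball x0 r \<subseteq> (\<Union>i. C i) \<and> (\<forall>i. bounded (C i) \<and> diameter (C i) \<le> 1 / 2)}"
    then have C: "frontier \<Omega> \<inter> ball x0 r \<subseteq> (\<Union>i. C i)" "\<And>i. bounded (C i)" "\<And>i. diameter (C i) \<le> 1 / 2" by blast+
    \<comment> \<open>Any point of a nonempty \<open>C i\<close> may carry the axis: projection does
      not increase distances, so the diameter is a sufficient radius.\<close>
    define Z where "Z i = (if C i = {} then {} else cylinder \<nu> x0 \<rho> (SOME a. a \<in> C i) (diameter (C i)))" for i
    have Zm: "Z i \<in> sets lebesgue" for i
      using closed_cylinder[of \<nu> x0 \<rho> "SOME a. a \<in> C i" "diameter (C i)"] by (simp add: Z_def)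
    have "K \<subseteq> (\<Union>i. Z i)"
    proof
      fix x assume x: "x \<in> K"
      let ?p = "hproj \<nu> x + \<gamma> (hproj \<nu> x) *\<^sub>R \<nu>"
      obtain i where i: "?p \<in> C i" using graph_pt[OF x] C(1) by blast
      let ?a = "SOME a. a \<in> C i"
      have a: "?a \<in> C i" using i by (rule someI)
      have "hproj \<nu> ?p = hproj \<nu> x"
        using hproj_add_normal[OF \<nu>, of "hproj \<nu> x"] \<nu> by (simp add: hproj_def inner_diff_left dot_square_norm)
      then have "norm (hproj \<nu> (x - ?a)) = norm (hproj \<nu> (?p - ?a))" by (simp only: hproj_diff)
      also have "\<dots> \<le> norm (?p - ?a)" by (rule norm_hproj_le[OF \<nu>])
      also have "\<dots> \<le> diameter (C i)" using diameter_bounded_bound[OF C(2) i a] by (simp add: dist_norm)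
      finally have "norm (hproj \<nu> (x - ?a)) \<le> diameter (C i)" .
      moreover have "\<bar>(x - x0) \<bullet> \<nu>\<bar> \<le> \<rho>"
        using Cauchy_Schwarz_ineq2[of "x - x0" \<nu>] \<nu> x by (simp add: K_def dist_norm norm_minus_commute)
      ultimately have "x \<in> Z i" using i by (auto simp: Z_def cylinder_def)
      then show "x \<in> (\<Union>i. Z i)" by blast
    qed
    then have "emeasure lebesgue K \<le> emeasure lebesgue (\<Union>i. Z i)"
      using Zm by (intro emeasure_mono sets.countable_UN) auto
    also have "\<dots> \<le> (\<Sum>i. emeasure lebesgue (Z i))"
      by (rule emeasure_subadditive_countably) (use Zm in blast)
    also have "\<dots> \<le> (\<Sum>i. ennreal M * hausdorff_weight (CARD('n) - 1) (C i))"
    proof (intro suminf_le summableI)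
      fix i
      show "emeasure lebesgue (Z i) \<le> ennreal M * hausdorff_weight (CARD('n) - 1) (C i)"
      proof (cases "C i = {}")
        case False
        have d0: "0 \<le> diameter (C i)" using C(2) by (rule diameter_ge_0)
        have "emeasure lebesgue (Z i) \<le> ennreal (B * diameter (C i) ^ (CARD('n) - 1))"
          unfolding Z_def B_def using False emeasure_cylinder_le[OF \<nu> d0 C(3) \<rho>(1)] by simp
        also have "B * diameter (C i) ^ (CARD('n) - 1) = M * (\<omega> * (diameter (C i) / 2) ^ (CARD('n) - 1))"
          using \<omega> by (simp add: M_def power_divide)
        also have "ennreal \<dots> = ennreal M * hausdorff_weight (CARD('n) - 1) (C i)"
          using False M \<omega> d0 by (simp add: hausdorff_weight_def \<omega>_def ennreal_mult)
        finally show ?thesis .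
      qed (simp add: Z_def)
    qed
    also have "\<dots> = ennreal M * (\<Sum>i. hausdorff_weight (CARD('n) - 1) (C i))"
      by (rule ennreal_suminf_cmult)
    finally show "emeasure lebesgue K / ennreal M \<le> (\<Sum>i. hausdorff_weight (CARD('n) - 1) (C i))"
      using M by (intro divide_le_posI_ennreal) (auto simp: mult.commute)
  qed
  have "emeasure lebesgue K > 0"
    using \<rho>(1) emeasure_ball[of \<rho> x0] by (simp add: K_def)
  then have "0 < emeasure lebesgue K / ennreal M"
    by (simp add: ennreal_zero_less_divide)
  also have "\<dots> \<le> hausdorff_outer (CARD('n) - 1) (frontier \<Omega> \<inter> ball x0 r)"
    using low hausdorff_pre_le_outer[of "1 / 2" "CARD('n) - 1" "frontier \<Omega> \<inter> ball x0 r"] by simp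
  finally show ?thesis .
qed

text \<open>Turns an essential bound on the boundary into a pointwise one: by continuity a violation
  would spread to a relatively open piece, which has positive measure.\<close>

lemma AE_surface_measure_continuous_le:
  fixes \<Omega> :: "(real^'n) set"
  assumes \<Omega>: "open \<Omega>" "C11_boundary \<Omega>" and f: "continuous_on (closure \<Omega>) f"
    and ae: "AE x in surface_measure \<Omega>. \<bar>f x\<bar> \<le> c" and x0: "x0 \<in> frontier \<Omega>"
  shows "\<bar>f x0\<bar> \<le> (c::real)"
proof (rule ccontr)
  let ?H = "hausdorff_measure (CARD('n) - 1) :: (real^'n) measure"
  assume "\<not> ?thesis"
  then have gt: "\<bar>f x0\<bar> > c" by simp
  have frc: "frontier \<Omega> \<subseteq> closure \<Omega>" by (simp add: frontier_def)
  have "continuous_on (frontier \<Omega>) (\<lambda>x. \<bar>f x\<bar>)"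
    by (intro continuous_on_rabs continuous_on_subset[OF f frc])
  then obtain r where r: "r > 0" "\<And>x. x \<in> frontier \<Omega> \<Longrightarrow> dist x x0 < r \<Longrightarrow> dist \<bar>f x\<bar> \<bar>f x0\<bar> < \<bar>f x0\<bar> - c"
    using x0 gt unfolding continuous_on_iff by (metis diff_gt_0_iff_gt)
  let ?E = "frontier \<Omega> \<inter> ball x0 r"
  have Em: "?E \<in> sets borel" by (intro sets.Int) (auto simp: frontier_closed)
  have frm: "frontier \<Omega> \<inter> space ?H \<in> sets ?H"
    by (simp add: sets_hausdorff_measure space_hausdorff_measure frontier_closed)
  have "AE x in ?H. x \<in> frontier \<Omega> \<longrightarrow> \<bar>f x\<bar> \<le> c"
    using ae unfolding surface_measure_def AE_restrict_space_iff[OF frm] .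
  then have "AE x in ?H. x \<notin> ?E"
  proof (rule eventually_mono)
    fix x assume *: "x \<in> frontier \<Omega> \<longrightarrow> \<bar>f x\<bar> \<le> c"
    show "x \<notin> ?E"
    proof
      assume "x \<in> ?E"
      then have "x \<in> frontier \<Omega>" "dist x x0 < r" by (auto simp: dist_commute)
      then show False using r(2)[of x] * by (auto simp: dist_real_def)
    qed
  qed
  then have "?E \<in> null_sets ?H"
    using Em by (subst AE_iff_null_sets) (auto simp: sets_hausdorff_measure)
  then have "hausdorff_outer (CARD('n) - 1) ?E = 0"
    using emeasure_hausdorff_measure[OF Em] by (simp add: null_sets_def)
  then show False using hausdorff_outer_frontier_pos[OF \<Omega> x0 r(1)] by simp
qed

section \<open>Functions of zero trace are Lipschitz\<close>

lemma onorm_inner_le: "norm v \<le> M \<Longrightarrow> onorm (\<lambda>h::'a::real_inner. v \<bullet> h) \<le> M"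
proof (rule onorm_bound)
  assume *: "norm v \<le> M"
  then show "0 \<le> M" using norm_ge_zero order_trans by blast
  show "norm (v \<bullet> h) \<le> M * norm h" for h
    using Cauchy_Schwarz_ineq2[of v h] mult_right_mono[OF * norm_ge_zero[of h]] by simp
qed

lemma integral_lebesgue_on_support:
  fixes f :: "'a::euclidean_space \<Rightarrow> 'b::euclidean_space"
  assumes "S \<in> sets lebesgue" "\<And>x. x \<notin> S \<Longrightarrow> f x = 0"
  shows "(\<integral>x. f x \<partial>lebesgue_on S) = (\<integral>x. f x \<partial>lebesgue)"
proof -
  have "(\<integral>x. f x \<partial>lebesgue_on S) = (\<integral>x. indicator S x *\<^sub>R f x \<partial>lebesgue)"
    by (rule integral_restrict_space) (use assms(1) in simp)
  also have "(\<lambda>x. indicator S x *\<^sub>R f x) = f"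
    using assms(2) by (auto simp: fun_eq_iff indicator_def)
  finally show ?thesis .
qed

text \<open>Near the segment the gradient of a mollification of \<open>F\<close> is an average of
  \<open>G\<close>, hence at most \<open>M\<close>. The mean value theorem applies to the smooth
  function, and the values of \<open>F\<close> at the endpoints are recovered by continuity.\<close>

lemma weak_grad_bound_imp_lipschitz_segment:
  fixes F :: "real^'n \<Rightarrow> real"
  assumes \<Omega>: "open \<Omega>" and wg: "has_weak_grad \<Omega> F G" and Fc: "continuous_on \<Omega> F"
    and M: "AE x in lebesgue_on \<Omega>. norm (G x) \<le> M" "M \<ge> 0"
    and seg: "closed_segment a b \<subseteq> \<Omega>"
  shows "\<bar>F a - F b\<bar> \<le> M * norm (a - b)"
proof (rule field_le_epsilon)
  fix \<eta>' :: real assume "\<eta>' > 0"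
  define \<eta> where "\<eta> = \<eta>' / 2"
  have \<eta>: "\<eta> > 0" using \<open>\<eta>' > 0\<close> by (simp add: \<eta>_def)
  have \<Omega>m: "\<Omega> \<in> sets lebesgue" by (rule open_in_lebesgue[OF \<Omega>])
  obtain e where e: "e > 0" "(\<Union>x\<in>closed_segment a b. cball x e) \<subseteq> \<Omega>"
    using compact_subset_open_imp_cball_epsilon_subset[OF compact_segment \<Omega> seg] by blast
  have ab: "a \<in> \<Omega>" "b \<in> \<Omega>" using seg by auto
  have cont: "\<exists>d>0. \<forall>y. dist y x < d \<longrightarrow> dist (F y) (F x) < \<eta>" if "x \<in> \<Omega>" for x
  proof -
    have "isCont F x" using Fc that continuous_on_eq_continuous_at[OF \<Omega>] by blast
    then show ?thesis using \<eta> unfolding continuous_at_eps_delta by (simp add: dist_norm)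
  qed
  from cont[OF ab(1)] obtain d1 where d1: "d1 > 0" "\<And>y. dist y a < d1 \<Longrightarrow> dist (F y) (F a) < \<eta>" by blast
  from cont[OF ab(2)] obtain d2 where d2: "d2 > 0" "\<And>y. dist y b < d2 \<Longrightarrow> dist (F y) (F b) < \<eta>" by blast
  note d = d1(1) d2(1) d1(2) d2(2)
  define \<delta> where "\<delta> = min e (min d1 d2)"
  have \<delta>: "\<delta> > 0" "\<delta> \<le> e" "\<delta> \<le> d1" "\<delta> \<le> d2" using d e by (auto simp: \<delta>_def)
  obtain \<rho> :: "real^'n \<Rightarrow> real" where \<rho>: "\<rho> \<in> test_functions UNIV" "\<And>x. \<rho> x \<ge> 0"
    "\<And>x. norm x \<ge> \<delta> \<Longrightarrow> \<rho> x = 0" "(\<integral>x. \<rho> x \<partial>lebesgue) = 1" "integrable lebesgue \<rho>"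
    using mollifier_exists[OF \<delta>(1)] by metis
  define K where "K = (\<Union>x\<in>closed_segment a b. cball x e)"
  have K: "compact K" "K \<subseteq> \<Omega>" unfolding K_def using e(2) by (auto intro: compact_UN_cball)
  have Km: "K \<in> sets lebesgue" by (rule compact_in_lebesgue[OF K(1)])
  have l: "loc_integrable \<Omega> F" "loc_integrable \<Omega> G" using wg by (auto simp: has_weak_grad_def)
  \<comment> \<open>Cutting off outside a compact neighbourhood of the segment makes the function
    globally integrable without changing the convolution on the segment.\<close>
  define Fc where "Fc x = indicator K x * F x" for x
  have "integrable (lebesgue_on K) F" using l(1) K by (simp add: loc_integrable_def)
  then have Fi: "integrable lebesgue Fc"
    using Km unfolding Fc_def[abs_def] by (subst (asm) integrable_restrict_space) auto
  have FcK: "Fc y = F y" if "x \<in> closed_segment a b" "dist x y \<le> e" for x y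
  proof -
    have "y \<in> K" unfolding K_def using that by (intro UN_I[of x]) auto
    then show ?thesis by (simp add: Fc_def)
  qed
  let ?g = "conv Fc \<rho>"
  have gb: "norm (grad ?g x) \<le> M" if x: "x \<in> closed_segment a b" for x
  proof -
    \<comment> \<open>The reflected mollifier is the test function that turns the gradient of the
      convolution at \<open>x\<close> into the weak gradient identity; the sign from the reflection
      cancels that of the integration by parts.\<close>
    define \<psi> where "\<psi> y = \<rho> (x - y)" for y
    have \<psi>0: "\<psi> y = 0" if "y \<notin> cball x \<delta>" for y
      using \<rho>(3)[of "x - y"] that by (simp add: \<psi>_def dist_norm)
    have cb: "cball x \<delta> \<subseteq> K" unfolding K_def using x subset_cball[OF \<delta>(2)] by blast
    have \<psi>t: "\<psi> \<in> test_functions \<Omega>"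
      unfolding test_functions_iff
    proof (intro conjI allI exI[of _ "cball x \<delta>"] impI)
      show "Ck k \<psi>" for k unfolding \<psi>_def by (rule Ck_reflect[OF test_functions_Ck[OF \<rho>(1)]])
      show "cball x \<delta> \<subseteq> \<Omega>" using cb K(2) by blast
    qed (use \<psi>0 in auto)
    have "grad \<psi> y = 0" if "y \<notin> cball x \<delta>" for y
    proof -
      have "\<psi> \<in> test_functions (cball x \<delta>)"
        unfolding test_functions_iff
        by (intro conjI allI exI[of _ "cball x \<delta>"] impI) (simp_all add: test_functions_Ck[OF \<psi>t] \<psi>0)
      then obtain L where "L \<subseteq> cball x \<delta>" "\<And>y. y \<notin> L \<Longrightarrow> grad \<psi> y = 0"
        using test_functions_support by metis
      then show ?thesis using that by blast
    qed
    then have pd0: "pd i \<psi> y = 0" if "y \<notin> cball x \<delta>" for i y using that by (simp add: pd_def)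
    have "grad ?g x $ i = (\<integral>y. \<psi> y *\<^sub>R G y \<partial>lebesgue_on \<Omega>) $ i" for i
    proof -
      have "grad ?g x $ i = (\<integral>y. Fc y * pd i \<rho> (x - y) \<partial>lebesgue)"
        using grad_conv[OF Fi \<rho>(1), of x] by (simp add: conv_def)
      also have "(\<lambda>y. Fc y * pd i \<rho> (x - y)) = (\<lambda>y. - (F y * pd i \<psi> y))"
      proof
        fix y
        have p: "pd i \<psi> y = - pd i \<rho> (x - y)"
          unfolding \<psi>_def by (rule pd_reflect[OF test_functions_Ck[OF \<rho>(1)]])
        show "Fc y * pd i \<rho> (x - y) = - (F y * pd i \<psi> y)"
        proof (cases "y \<in> cball x \<delta>")
          case True
          then have "Fc y = F y" using cb by (auto simp: Fc_def)
          then show ?thesis using p by simp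
        next
          case False
          then show ?thesis using pd0[OF False, of i] p by simp
        qed
      qed
      also have "(\<integral>y. - (F y * pd i \<psi> y) \<partial>lebesgue) = - (\<integral>y. F y * pd i \<psi> y \<partial>lebesgue_on \<Omega>)"
      proof (subst integral_lebesgue_on_support[OF \<Omega>m])
        show "F y * pd i \<psi> y = 0" if "y \<notin> \<Omega>" for y
        proof -
          have "y \<notin> cball x \<delta>" using that cb K(2) by blast
          then show ?thesis using pd0 by simp
        qed
      qed simp
      also have "\<dots> = (\<integral>y. \<psi> y * G y $ i \<partial>lebesgue_on \<Omega>)"
        using has_weak_grad_component[OF \<Omega> wg \<psi>t, of i] by simp
      also have "\<dots> = (\<integral>y. \<psi> y *\<^sub>R G y \<partial>lebesgue_on \<Omega>) $ i"
        using integral_bounded_linear[OF bounded_linear_vec_nth test_functions_integrable[OF \<psi>t \<Omega> l(2)], of i] by simp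
      finally show ?thesis .
    qed
    then have "grad ?g x = (\<integral>y. \<psi> y *\<^sub>R G y \<partial>lebesgue_on \<Omega>)" by (simp add: vec_eq_iff)
    moreover have "norm (\<integral>y. \<psi> y *\<^sub>R G y \<partial>lebesgue_on \<Omega>) \<le> (\<integral>y. M * \<psi> y \<partial>lebesgue_on \<Omega>)"
    proof (rule order_trans[OF integral_norm_bound], rule integral_mono_AE)
      show "integrable (lebesgue_on \<Omega>) (\<lambda>y. norm (\<psi> y *\<^sub>R G y))"
        by (rule integrable_norm[OF test_functions_integrable[OF \<psi>t \<Omega> l(2)]])
      show "integrable (lebesgue_on \<Omega>) (\<lambda>y. M * \<psi> y)"
        using test_functions_integrable[OF \<psi>t \<Omega> loc_integrable_continuous[of "\<lambda>x. M"]] by (simp add: mult.commute)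
      show "AE y in lebesgue_on \<Omega>. norm (\<psi> y *\<^sub>R G y) \<le> M * \<psi> y"
        using M(1)
      proof eventually_elim
        case (elim y)
        then show ?case using mult_right_mono[OF elim, of "\<psi> y"] \<rho>(2)[of "x - y"]
          by (simp add: \<psi>_def mult.commute)
      qed
    qed
    moreover have "(\<integral>y. M * \<psi> y \<partial>lebesgue_on \<Omega>) = M"
    proof -
      have "(\<integral>y. \<psi> y \<partial>lebesgue_on \<Omega>) = (\<integral>y. \<psi> y \<partial>lebesgue)"
        using \<psi>0 cb K(2) by (intro integral_lebesgue_on_support[OF \<Omega>m]) blast
      also have "\<dots> = (\<integral>y. \<rho> y \<partial>lebesgue)"
        unfolding \<psi>_def using test_functions_continuous[OF \<rho>(1), of UNIV]
        by (intro lebesgue_integral_reflect borel_measurable_continuous_onI)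
      finally show ?thesis using \<rho>(4) by simp
    qed
    ultimately show ?thesis by (simp only:)
  qed
  have "norm (?g a - ?g b) \<le> M * norm (a - b)"
  proof (rule differentiable_bound[of "closed_segment a b"])
    show "(?g has_derivative (\<lambda>h. grad ?g z \<bullet> h)) (at z within closed_segment a b)" for z
      unfolding grad_conv[OF Fi \<rho>(1)] by (rule has_derivative_at_withinI[OF conv_has_derivative[OF Fi \<rho>(1)]])
    show "onorm (\<lambda>h. grad ?g z \<bullet> h) \<le> M" if "z \<in> closed_segment a b" for z
      by (rule onorm_inner_le[OF gb[OF that]])
  qed auto
  moreover have "\<bar>?g a - F a\<bar> \<le> \<eta>"
  proof (rule conv_close[OF Fi \<rho>])
    fix y assume y: "dist a y < \<delta>"
    have "Fc y = F y" using FcK[of a y] y \<delta>(2) by auto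
    moreover have "dist (F y) (F a) < \<eta>" using d(3)[of y] y \<delta>(3) by (simp add: dist_commute)
    ultimately show "\<bar>Fc y - F a\<bar> \<le> \<eta>" by (simp add: dist_real_def)
  qed
  moreover have "\<bar>?g b - F b\<bar> \<le> \<eta>"
  proof (rule conv_close[OF Fi \<rho>])
    fix y assume y: "dist b y < \<delta>"
    have "Fc y = F y" using FcK[of b y] y \<delta>(2) by auto
    moreover have "dist (F y) (F b) < \<eta>" using d(4)[of y] y \<delta>(4) by (simp add: dist_commute)
    ultimately show "\<bar>Fc y - F b\<bar> \<le> \<eta>" by (simp add: dist_real_def)
  qed
  ultimately have "\<bar>F a - F b\<bar> \<le> M * norm (a - b) + 2 * \<eta>"
    unfolding real_norm_def by linarith
  then show "\<bar>F a - F b\<bar> \<le> M * norm (a - b) + \<eta>'" by (simp add: \<eta>_def)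
qed

text \<open>The set of violations is open, and a nonempty open set is not null.\<close>

lemma AE_continuous_le:
  fixes f :: "real^'n \<Rightarrow> real"
  assumes \<Omega>: "open \<Omega>" and f: "continuous_on \<Omega> f" and ae: "AE x in lebesgue_on \<Omega>. f x \<le> c" and x: "x \<in> \<Omega>"
  shows "f x \<le> c"
proof (rule ccontr)
  assume "\<not> f x \<le> c"
  define V where "V = \<Omega> \<inter> f -` {c<..}"
  have V: "open V" unfolding V_def by (rule continuous_open_preimage[OF f \<Omega>]) simp
  have "x \<in> V" using x \<open>\<not> f x \<le> c\<close> by (simp add: V_def)
  have "AE x in lebesgue. x \<in> \<Omega> \<longrightarrow> f x \<le> c"
    using ae by (subst (asm) AE_restrict_space_iff) (simp_all add: open_in_lebesgue[OF \<Omega>])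
  then have "AE x in lebesgue. x \<notin> V"
    by (rule eventually_mono) (auto simp: V_def)
  then have "V \<in> null_sets lebesgue"
    using open_in_lebesgue[OF V] by (subst AE_iff_null_sets) auto
  then have "negligible V" by (simp add: negligible_iff_null_sets)
  then show False using open_not_negligible[OF V] \<open>x \<in> V\<close> by blast
qed

text \<open>\<open>\<Omega>\<close> need not be convex, so only segments inside it are controlled. A
  segment that leaves \<open>\<Omega>\<close> is followed up to its first exit point, where
  \<open>f\<close> vanishes; thus the constant \<open>M\<close> survives.\<close>

lemma lipschitz_zero_extension:
  fixes f :: "real^'n \<Rightarrow> real"
  assumes \<Omega>: "open \<Omega>" and f: "continuous_on (closure \<Omega>) f" and f0: "\<And>x. x \<in> frontier \<Omega> \<Longrightarrow> f x = 0"
    and seg: "\<And>a b. closed_segment a b \<subseteq> \<Omega> \<Longrightarrow> \<bar>f a - f b\<bar> \<le> M * norm (a - b)" and M: "M \<ge> 0"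
  shows "M-lipschitz_on UNIV (\<lambda>x. if x \<in> \<Omega> then f x else 0)"
proof -
  let ?Z = "\<lambda>x. if x \<in> \<Omega> then f x else 0"
  have out: "\<bar>f x\<bar> \<le> M * norm (x - y)" if x: "x \<in> \<Omega>" and y: "y \<notin> \<Omega>" for x y
  proof -
    define p where "p t = x + t *\<^sub>R (y - x)" for t
    have pc: "continuous_on UNIV p" unfolding p_def by (intro continuous_intros)
    \<comment> \<open>The parameters at which the path is outside \<open>\<Omega>\<close>; the least
      element of this compact set is the first exit.\<close>
    define S where "S = {0..1} \<inter> p -` (- \<Omega>)"
    have "closed (p -` (- \<Omega>))"
      using continuous_closed_vimage[of "- \<Omega>" p] \<Omega> pc
      by (simp add: closed_Compl continuous_on_eq_continuous_at)
    then have "compact S" unfolding S_def by (intro compact_Int_closed) auto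
    moreover have "1 \<in> S" using y by (simp add: S_def p_def)
    ultimately obtain s where s: "s \<in> S" "\<And>t. t \<in> S \<Longrightarrow> s \<le> t"
      using compact_attains_inf[of S] by blast
    have s01: "0 \<le> s" "s \<le> 1" "p s \<notin> \<Omega>" using s(1) by (auto simp: S_def)
    have before: "p t \<in> \<Omega>" if "0 \<le> t" "t < s" for t
    proof (rule ccontr)
      assume "p t \<notin> \<Omega>"
      then have "t \<in> S" using that s01 by (simp add: S_def)
      then show False using s(2)[of t] that by simp
    qed
    have "s \<noteq> 0" using s01(3) x by (auto simp: p_def)
    then have spos: "s > 0" using s01 by simp
    \<comment> \<open>The exit point itself is not in \<open>\<Omega>\<close>, so the estimate is
      applied just before it and passed to the limit.\<close>
    define t where "t n = s - s / real (Suc n)" for n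
    have t: "0 \<le> t n" "t n < s" for n using spos by (auto simp: t_def field_simps)
    have "t \<longlonglongrightarrow> s - 0"
      unfolding t_def by (intro tendsto_diff tendsto_const LIMSEQ_Suc[OF lim_const_over_n])
    then have tl: "t \<longlonglongrightarrow> s" by simp
    have pl: "(\<lambda>n. p (t n)) \<longlonglongrightarrow> p s"
      using continuous_on_tendsto_compose[OF pc tl] by simp
    have pin: "p (t n) \<in> \<Omega>" for n using before t by blast
    have pcl: "p s \<in> closure \<Omega>" 
      unfolding closure_sequential by (intro exI[of _ "\<lambda>n. p (t n)"] conjI allI pin pl)
    then have "p s \<in> frontier \<Omega>" using s01(3) \<Omega> by (simp add: frontier_def interior_open)
    then have fp: "f (p s) = 0" by (rule f0)
    have pin': "p (t n) \<in> closure \<Omega>" for n using pin closure_subset by blast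
    have "(\<lambda>n. f (p (t n))) \<longlonglongrightarrow> f (p s)"
      by (rule continuous_on_tendsto_compose[OF f pl pcl]) (simp add: pin')
    then have lim: "(\<lambda>n. \<bar>f x - f (p (t n))\<bar>) \<longlonglongrightarrow> \<bar>f x - 0\<bar>"
      unfolding fp by (intro tendsto_intros)
    have "\<bar>f x - f (p (t n))\<bar> \<le> M * norm (x - y)" for n
    proof -
      have "closed_segment x (p (t n)) \<subseteq> \<Omega>"
      proof
        fix z assume "z \<in> closed_segment x (p (t n))"
        then obtain u where u: "0 \<le> u" "u \<le> 1" "z = (1 - u) *\<^sub>R x + u *\<^sub>R p (t n)"
          unfolding closed_segment_def by blast
        have "z = p (u * t n)" unfolding u(3) p_def by (simp add: algebra_simps)
        moreover have "u * t n \<le> 1 * t n" using u t(1)[of n] by (intro mult_right_mono) auto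
        then have "0 \<le> u * t n" "u * t n < s" using u(1) t[of n] by auto
        ultimately show "z \<in> \<Omega>" using before by blast
      qed
      then have "\<bar>f x - f (p (t n))\<bar> \<le> M * norm (x - p (t n))" by (rule seg)
      also have "norm (x - p (t n)) = t n * norm (x - y)"
        using t(1)[of n] by (simp add: p_def norm_minus_commute)
      also have "M * (t n * norm (x - y)) \<le> M * (1 * norm (x - y))"
        using t(2)[of n] s01(2) M by (intro mult_left_mono mult_right_mono) auto
      finally show ?thesis by simp
    qed
    then have "\<bar>f x - 0\<bar> \<le> M * norm (x - y)"
      by (intro LIMSEQ_le_const2[OF lim]) blast
    then show ?thesis by simp
  qed
  show ?thesis
  proof (rule lipschitz_onI[OF _ M])
    fix x y
    consider (a) "x \<in> \<Omega>" "y \<in> \<Omega>" "closed_segment x y \<subseteq> \<Omega>" | (b) m where "x \<in> \<Omega>" "y \<in> \<Omega>" "m \<in> closed_segment x y" "m \<notin> \<Omega>"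
      | (c) "x \<in> \<Omega>" "y \<notin> \<Omega>" | (d) "x \<notin> \<Omega>" "y \<in> \<Omega>" | (e) "x \<notin> \<Omega>" "y \<notin> \<Omega>" by blast
    then show "dist (?Z x) (?Z y) \<le> M * dist x y"
    proof cases
      case a
      then show ?thesis using seg[of x y] by (simp add: dist_norm)
    next
      case b
      \<comment> \<open>A point outside \<open>\<Omega>\<close> on the segment splits the distance
        additively, so the two one-sided bounds add up to \<open>M\<close> times the full
        distance.\<close>
      have "norm (x - m) + norm (y - m) = norm (x - y)"
        using b(3) by (simp add: between_mem_segment[symmetric] between dist_norm norm_minus_commute)
      then have "M * norm (x - m) + M * norm (y - m) = M * norm (x - y)"
        by (metis distrib_left)
      then show ?thesis using out[OF b(1,4)] out[OF b(2,4)] b(1,2) by (simp add: dist_norm)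
    next
      case c
      then show ?thesis using out[OF c] by (simp add: dist_norm)
    next
      case d
      then show ?thesis using out[OF d(2,1)] by (simp add: dist_norm norm_minus_commute)
    qed (use M in simp)
  qed
qed

lemma W1_0_infty_lipschitz:
  fixes \<Omega> :: "(real^'n) set"
  assumes \<Omega>: "open \<Omega>" "C11_boundary \<Omega>" and w: "w \<in> W1_0 \<Omega> \<infinity>"
  shows "\<exists>Z M. M-lipschitz_on UNIV Z \<and> (\<forall>x. x \<notin> \<Omega> \<longrightarrow> Z x = 0) \<and> (AE x in lebesgue_on \<Omega>. Z x = w x)"
proof -
  have wW: "w \<in> W1 \<Omega> \<infinity>" and tr: "has_trace \<Omega> \<infinity> w (\<lambda>x. 0)" using w by (auto simp: W1_0_def)
  from tr obtain F :: "nat \<Rightarrow> real^'n \<Rightarrow> real" where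
    "(\<forall>k. F k \<in> W1 \<Omega> \<infinity> \<and> continuous_on (closure \<Omega>) (F k) \<and>
          F k - (\<lambda>x. 0) \<in> Lspace \<infinity> (surface_measure \<Omega>)) \<and>
     (\<lambda>k. W1_norm \<Omega> \<infinity> (F k - w)) \<longlonglongrightarrow> 0 \<and>
     (\<lambda>k. Lnorm \<infinity> (surface_measure \<Omega>) (F k - (\<lambda>x. 0))) \<longlonglongrightarrow> 0"
    unfolding has_trace_def by (elim exE)
  then have F: "\<And>k. F k \<in> W1 \<Omega> \<infinity>" "\<And>k. continuous_on (closure \<Omega>) (F k)"
    "\<And>k. F k \<in> Lspace \<infinity> (surface_measure \<Omega>)"
    "(\<lambda>k. W1_norm \<Omega> \<infinity> (F k - w)) \<longlonglongrightarrow> 0" "(\<lambda>k. Lnorm \<infinity> (surface_measure \<Omega>) (F k)) \<longlonglongrightarrow> 0"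
    by (simp_all add: fun_diff_def)
  define e where "e k = W1_norm \<Omega> \<infinity> (F k - w)" for k
  have el: "e \<longlonglongrightarrow> 0" using F(4) by (simp add: e_def[abs_def])
  have ae: "AE x in lebesgue_on \<Omega>. \<bar>F k x - w x\<bar> \<le> e k" for k
  proof -
    have "(\<lambda>x. 1 * F k x + (-1) * w x) \<in> W1 \<Omega> \<infinity>" by (rule W1_lincomb(1)[OF \<Omega>(1) F(1) wW])
    moreover have "(\<lambda>x. 1 * F k x + (-1) * w x) = F k - w" by (simp add: fun_eq_iff)
    ultimately have "F k - w \<in> W1 \<Omega> \<infinity>" by simp
    from W1_infty_AE_le(1)[OF this] show ?thesis by (simp add: e_def)
  qed
  \<comment> \<open>By continuity the bounds hold everywhere on the closure. Uniform convergence
    there is what carries the boundary values to the limit.\<close>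
  have FF: "\<bar>F k x - F l x\<bar> \<le> e k + e l" if x: "x \<in> closure \<Omega>" for k l x
  proof (rule continuous_le_on_closure[OF _ x])
    show "continuous_on (closure \<Omega>) (\<lambda>x. \<bar>F k x - F l x\<bar>)" by (intro continuous_intros F(2))
    fix z assume z: "z \<in> \<Omega>"
    show "\<bar>F k z - F l z\<bar> \<le> e k + e l"
    proof (rule AE_continuous_le[OF \<Omega>(1) _ _ z])
      show "continuous_on \<Omega> (\<lambda>x. \<bar>F k x - F l x\<bar>)"
        by (intro continuous_intros continuous_on_subset[OF F(2) closure_subset])
      show "AE x in lebesgue_on \<Omega>. \<bar>F k x - F l x\<bar> \<le> e k + e l"
        using ae[of k] ae[of l] by eventually_elim linarith
    qed
  qed
  have "uniformly_Cauchy_on (closure \<Omega>) F"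
    unfolding uniformly_Cauchy_on_def
  proof (intro allI impI)
    fix \<epsilon> :: real assume "\<epsilon> > 0"
    then have "\<forall>\<^sub>F k in sequentially. e k < \<epsilon> / 2" using el by (intro order_tendstoD(2)) auto
    then obtain N where N: "\<And>k. k \<ge> N \<Longrightarrow> e k < \<epsilon> / 2" unfolding eventually_sequentially by blast
    show "\<exists>M. \<forall>x\<in>closure \<Omega>. \<forall>m\<ge>M. \<forall>n\<ge>M. dist (F m x) (F n x) < \<epsilon>"
    proof (intro exI[of _ N] ballI allI impI)
      fix x m n assume "x \<in> closure \<Omega>" "N \<le> m" "N \<le> n"
      then show "dist (F m x) (F n x) < \<epsilon>"
        using FF[of x m n] N[of m] N[of n] by (simp add: dist_real_def)
    qed
  qed
  then have "uniformly_convergent_on (closure \<Omega>) F" by (rule Cauchy_uniformly_convergent)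
  then obtain f where f: "uniform_limit (closure \<Omega>) F f sequentially"
    unfolding uniformly_convergent_on_def by blast
  have fc: "continuous_on (closure \<Omega>) f"
    by (rule uniform_limit_theorem[OF _ f]) (simp_all add: F(2))
  have flim: "(\<lambda>k. F k x) \<longlonglongrightarrow> f x" if "x \<in> closure \<Omega>" for x
    by (rule tendsto_uniform_limitI[OF f that])
  have f0: "f x = 0" if x: "x \<in> frontier \<Omega>" for x
  proof -
    have "\<bar>F k x\<bar> \<le> Lnorm \<infinity> (surface_measure \<Omega>) (F k)" for k
      using Lnorm_infty_AE[OF F(3)[of k]]
      by (intro AE_surface_measure_continuous_le[OF \<Omega> F(2) _ x]) simp
    then have "(\<lambda>k. F k x) \<longlonglongrightarrow> 0"
      by (intro Lim_null_comparison[OF _ F(5)]) simp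
    moreover have "(\<lambda>k. F k x) \<longlonglongrightarrow> f x" using flim x by (simp add: frontier_def)
    ultimately show ?thesis using LIMSEQ_unique by blast
  qed
  have "AE x in lebesgue_on \<Omega>. \<forall>k. \<bar>F k x - w x\<bar> \<le> e k"
    by (intro AE_all_countable[THEN iffD2] allI ae)
  moreover have "AE x in lebesgue_on \<Omega>. x \<in> \<Omega>" by (rule AE_I2) simp
  ultimately have fw: "AE x in lebesgue_on \<Omega>. w x = f x"
  proof eventually_elim
    case (elim x)
    have "(\<lambda>k. F k x - w x) \<longlonglongrightarrow> 0"
      using elim(1) by (intro Lim_null_comparison[OF _ el]) simp
    then have "(\<lambda>k. F k x) \<longlonglongrightarrow> w x" using LIM_zero_iff by blast
    moreover have "(\<lambda>k. F k x) \<longlonglongrightarrow> f x" using flim elim(2) closure_subset by blast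
    ultimately show ?case by (rule LIMSEQ_unique)
  qed
  have fc\<Omega>: "continuous_on \<Omega> f" by (rule continuous_on_subset[OF fc closure_subset])
  have wg: "has_weak_grad \<Omega> f (wgrad \<Omega> w)"
    by (rule has_weak_grad_cong_AE[OF \<Omega>(1) W1_has_weak_grad[OF wW] fw loc_integrable_continuous_on[OF fc\<Omega>]])
  \<comment> \<open>The \<open>W\<^sup>1\<^sub>\<infinity>\<close> norm of \<open>w\<close>
    dominates the essential bound of its weak gradient.\<close>
  define M where "M = W1_norm \<Omega> \<infinity> w"
  have M: "M \<ge> 0" "AE x in lebesgue_on \<Omega>. norm (wgrad \<Omega> w x) \<le> M"
    unfolding M_def by (rule W1_norm_nonneg, rule W1_infty_AE_le(2)[OF wW])
  have "M-lipschitz_on UNIV (\<lambda>x. if x \<in> \<Omega> then f x else 0)"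
    by (rule lipschitz_zero_extension[OF \<Omega>(1) fc f0
          weak_grad_bound_imp_lipschitz_segment[OF \<Omega>(1) wg fc\<Omega> M(2,1)] M(1)])
  moreover have "AE x in lebesgue_on \<Omega>. (if x \<in> \<Omega> then f x else 0) = w x"
    using fw \<open>AE x in lebesgue_on \<Omega>. x \<in> \<Omega>\<close> by eventually_elim simp
  ultimately show ?thesis by (intro exI[of _ "\<lambda>x. if x \<in> \<Omega> then f x else 0"] exI[of _ M]) simp
qed

section \<open>Testing weak equations with Lipschitz functions\<close>

lemma norm_grad_le_of_lipschitz:
  fixes f :: "real^'n \<Rightarrow> real"
  assumes f: "(f has_derivative (\<lambda>h. v \<bullet> h)) (at x)" and lip: "\<And>y. \<bar>f y - f x\<bar> \<le> M * norm (y - x)"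
  shows "norm v \<le> M"
proof (cases "v = 0")
  case True
  \<comment> \<open>Evaluating the Lipschitz bound in an arbitrary coordinate direction shows that
    \<open>M\<close> is nonnegative.\<close>
  have "M * norm (axis undefined 1 :: real^'n) \<ge> 0"
    using order_trans[OF abs_ge_zero lip[of "x + axis undefined 1"]] by simp
  then show ?thesis using True by simp
next
  case False
  \<comment> \<open>The direction \<open>v\<close> realises the norm of the derivative, so
    difference quotients along it suffice.\<close>
  have 1: "((\<lambda>t::real. x + t *\<^sub>R v) has_derivative (\<lambda>t. t *\<^sub>R v)) (at 0)"
    by (auto intro!: derivative_eq_intros)
  have "((\<lambda>t. f (x + t *\<^sub>R v)) has_derivative (\<lambda>t. v \<bullet> (t *\<^sub>R v))) (at 0)"
    by (rule has_derivative_compose[OF 1]) (use f in simp)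
  then have "((\<lambda>t. f (x + t *\<^sub>R v)) has_real_derivative (v \<bullet> v)) (at 0)"
    by (simp add: has_field_derivative_def mult.commute[of _ "v \<bullet> v"])
  then have "((\<lambda>t. (f (x + t *\<^sub>R v) - f x) / t) \<longlongrightarrow> v \<bullet> v) (at 0)"
    by (simp add: DERIV_def)
  then have "((\<lambda>t. (f (x + t *\<^sub>R v) - f x) / t) \<longlongrightarrow> v \<bullet> v) (at_right 0)"
    by (rule tendsto_within_subset) simp
  moreover have "\<forall>\<^sub>F t in at_right 0. (f (x + t *\<^sub>R v) - f x) / t \<le> M * norm v"
  proof (rule eventually_at_rightI[of 0 1])
    fix t :: real assume t: "t \<in> {0<..<1}"
    have "f (x + t *\<^sub>R v) - f x \<le> M * (t * norm v)"
      using lip[of "x + t *\<^sub>R v"] t by simp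
    then show "(f (x + t *\<^sub>R v) - f x) / t \<le> M * norm v" using t by (simp add: field_simps)
  qed simp
  ultimately have "v \<bullet> v \<le> M * norm v"
    by (intro tendsto_upperbound) auto
  then have "norm v * norm v \<le> M * norm v" by (simp add: dot_square_norm power2_eq_square)
  then show ?thesis using False by simp
qed

text \<open>Shrinks \<open>s\<close> towards 0 by \<open>e\<close>. Discarding small values in this
  way is 1-Lipschitz, whereas setting them abruptly to 0 would create jumps.\<close>

definition soft_threshold :: "real \<Rightarrow> real \<Rightarrow> real" where
  "soft_threshold e s = max (s - e) 0 + min (s + e) 0"

lemma soft_threshold:
  assumes "e \<ge> 0"
  shows "\<bar>soft_threshold e s - soft_threshold e t\<bar> \<le> \<bar>s - t\<bar>"
    and "\<bar>soft_threshold e s - s\<bar> \<le> e"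
    and "\<bar>s\<bar> \<le> e \<Longrightarrow> soft_threshold e s = 0"
proof -
  show "\<bar>soft_threshold e s - soft_threshold e t\<bar> \<le> \<bar>s - t\<bar>" "\<bar>soft_threshold e s - s\<bar> \<le> e"
    using assms by (auto simp: soft_threshold_def max_def min_def abs_if)
  show "soft_threshold e s = 0" if "\<bar>s\<bar> \<le> e"
    using that unfolding soft_threshold_def by linarith
qed

text \<open>Truncating at height \<open>e\<close> makes the support a compact subset of \<open>\<Omega>\<close> without increasing
  the Lipschitz constant, after which one can mollify.\<close>

lemma lipschitz_zero_test_approx:
  fixes Z :: "real^'n \<Rightarrow> real"
  assumes \<Omega>: "open \<Omega>" "bounded \<Omega>" and Z: "M-lipschitz_on UNIV Z" "\<And>x. x \<notin> \<Omega> \<Longrightarrow> Z x = 0" and e: "e > 0"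
  shows "\<exists>\<psi>\<in>test_functions \<Omega>. (\<forall>x. norm (grad \<psi> x) \<le> M) \<and> (\<forall>x. \<bar>\<psi> x - Z x\<bar> \<le> 2 * e)"
proof -
  have M: "M \<ge> 0" using Z(1) by (rule lipschitz_on_nonneg)
  have Zc: "continuous_on UNIV Z" by (rule lipschitz_on_continuous_on[OF Z(1)])
  define T where "T x = soft_threshold e (Z x)" for x
  have Tlip: "\<bar>T x - T y\<bar> \<le> M * norm (x - y)" for x y
    using soft_threshold(1)[of e "Z x" "Z y"] lipschitz_on_normD[OF Z(1), of x y] e by (simp add: T_def)
  \<comment> \<open>As \<open>Z\<close> vanishes off the bounded set \<open>\<Omega>\<close>, this
    closed set is a compact subset of \<open>\<Omega>\<close>, and \<open>T\<close> vanishes outside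
    it.\<close>
  define K where "K = {x. e \<le> \<bar>Z x\<bar>}"
  have "closed K" unfolding K_def by (intro closed_Collect_le continuous_intros Zc)
  moreover have K\<Omega>: "K \<subseteq> \<Omega>" using Z(2) e by (force simp: K_def)
  ultimately have K: "compact K" using \<Omega>(2) bounded_subset compact_eq_bounded_closed by blast
  have T0: "T x = 0" if "x \<notin> K" for x
    using that e by (simp add: T_def K_def soft_threshold(3))
  have Tc: "continuous_on UNIV T"
    by (rule lipschitz_on_continuous_on[of M]) (use Tlip M in \<open>auto simp: lipschitz_on_def dist_norm\<close>)
  obtain d1 where d1: "d1 > 0" "(\<Union>x\<in>K. cball x d1) \<subseteq> \<Omega>"
    using compact_subset_open_imp_cball_epsilon_subset[OF K \<Omega>(1) K\<Omega>] by blast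
  \<comment> \<open>Mollifying at scale \<open>d\<close> moves \<open>T\<close> by at most
    \<open>M * d \<le> e\<close>; the summand 1 covers \<open>M = 0\<close>.\<close>
  define d where "d = min d1 (e / (M + 1))"
  have d: "d > 0" "d \<le> d1" "M * d \<le> e"
  proof -
    show "d > 0" "d \<le> d1" using d1(1) e M by (auto simp: d_def)
    have "M * d \<le> M * (e / (M + 1))" using M by (intro mult_left_mono) (auto simp: d_def)
    also have "\<dots> \<le> e" using M e by (simp add: field_simps)
    finally show "M * d \<le> e" .
  qed
  obtain \<rho> :: "real^'n \<Rightarrow> real" where \<rho>: "\<rho> \<in> test_functions UNIV" "\<And>x. \<rho> x \<ge> 0"
    "\<And>x. norm x \<ge> d \<Longrightarrow> \<rho> x = 0" "(\<integral>x. \<rho> x \<partial>lebesgue) = 1" "integrable lebesgue \<rho>"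
    using mollifier_exists[OF d(1)] by metis
  have Ti: "integrable lebesgue T"
  proof -
    have "integrable (lebesgue_on UNIV) T"
      by (rule loc_integrable_dominated[OF loc_integrable_continuous[OF Tc] K subset_UNIV open_UNIV, of _ 1])
        (use T0 Tc in \<open>auto intro: continuous_measurable_lebesgue\<close>)
    then show ?thesis by (simp add: lebesgue_on_UNIV_eq)
  qed
  let ?\<psi> = "conv T \<rho>"
  have \<psi>: "?\<psi> \<in> test_functions \<Omega>"
  proof (rule conv_test_function(1)[OF Ti \<rho>(1) K T0 \<rho>(3)])
    show "(\<Union>x\<in>K. cball x d) \<subseteq> \<Omega>" using d1(2) subset_cball[OF d(2)] by blast
  qed
  have close: "\<bar>?\<psi> x - Z x\<bar> \<le> 2 * e" for x
  proof -
    have "\<bar>?\<psi> x - T x\<bar> \<le> e"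
    proof (rule conv_close[OF Ti \<rho>])
      fix y assume "dist x y < d"
      then have "M * norm (y - x) \<le> M * d" using M by (intro mult_left_mono) (auto simp: dist_norm norm_minus_commute)
      then show "\<bar>T y - T x\<bar> \<le> e" using Tlip[of y x] d(3) by linarith
    qed
    moreover have "\<bar>T x - Z x\<bar> \<le> e" using soft_threshold(2)[of e "Z x"] e by (simp add: T_def)
    ultimately show ?thesis by linarith
  qed
  have \<rho>m[measurable]: "\<rho> \<in> borel_measurable borel" and Tm[measurable]: "T \<in> borel_measurable borel"
    using test_functions_continuous[OF \<rho>(1), of UNIV] Tc by (simp_all add: borel_measurable_continuous_onI)
  \<comment> \<open>With the shift moved from \<open>\<rho>\<close> to \<open>T\<close>, differences
    of the convolution inherit the Lipschitz bound of \<open>T\<close> with the same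
    constant.\<close>
  have conv_eq: "?\<psi> x = (\<integral>y. T (x - y) * \<rho> y \<partial>lebesgue)"
    and conv_int: "integrable lebesgue (\<lambda>y. T (x - y) * \<rho> y)" for x
  proof -
    have "(\<integral>y. (\<lambda>y. T (x - y) * \<rho> y) (x - y) \<partial>lebesgue) = (\<integral>y. T (x - y) * \<rho> y \<partial>lebesgue)"
      by (rule lebesgue_integral_reflect) measurable
    then show "?\<psi> x = (\<integral>y. T (x - y) * \<rho> y \<partial>lebesgue)" by (simp add: conv_def)
    have "continuous_on UNIV (\<lambda>y. T (x - y))"
      by (rule continuous_on_compose2[OF Tc]) (auto intro!: continuous_intros)
    from test_functions_integrable[OF \<rho>(1) open_UNIV loc_integrable_continuous[OF this]]
    show "integrable lebesgue (\<lambda>y. T (x - y) * \<rho> y)" by (simp add: lebesgue_on_UNIV_eq mult.commute)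
  qed
  have lip: "\<bar>?\<psi> y - ?\<psi> x\<bar> \<le> M * norm (y - x)" for x y
  proof -
    have "?\<psi> y - ?\<psi> x = (\<integral>z. T (y - z) * \<rho> z - T (x - z) * \<rho> z \<partial>lebesgue)"
      unfolding conv_eq by (rule Bochner_Integration.integral_diff[symmetric, OF conv_int conv_int])
    also have "\<bar>\<dots>\<bar> \<le> (\<integral>z. (M * norm (y - x)) * \<rho> z \<partial>lebesgue)"
    proof (rule integral_abs_bound_integral)
      show "integrable lebesgue (\<lambda>z. T (y - z) * \<rho> z - T (x - z) * \<rho> z)"
        by (rule Bochner_Integration.integrable_diff[OF conv_int conv_int])
      show "\<bar>T (y - z) * \<rho> z - T (x - z) * \<rho> z\<bar> \<le> M * norm (y - x) * \<rho> z" for z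
        using mult_right_mono[OF Tlip[of "y - z" "x - z"] \<rho>(2)[of z]] \<rho>(2)[of z]
        by (simp add: left_diff_distrib[symmetric] abs_mult)
    qed (use \<rho>(5) in simp)
    also have "\<dots> = M * norm (y - x)" using \<rho>(4) by simp
    finally show ?thesis .
  qed
  have "norm (grad ?\<psi> x) \<le> M" for x
    by (rule norm_grad_le_of_lipschitz[OF test_functions_has_derivative[OF \<psi>] lip])
  then show ?thesis using \<psi> close by blast
qed

text \<open>The product of the two is again a test function, and the integral of its derivative
  vanishes.\<close>

lemma integral_by_parts_test:
  assumes \<Omega>: "open \<Omega>" and \<psi>: "\<psi> \<in> test_functions \<Omega>" and \<phi>: "\<phi> \<in> test_functions \<Omega>"
  shows "(\<integral>x. \<phi> x * pd i \<psi> x \<partial>lebesgue_on \<Omega>) = - (\<integral>x. \<psi> x * pd i \<phi> x \<partial>lebesgue_on \<Omega>)"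
proof -
  have m: "(\<lambda>x. \<phi> x * \<psi> x) \<in> test_functions \<Omega>"
    by (rule test_functions_mult[OF \<psi> test_functions_Ck[OF \<phi>]])
  have pdm: "pd i (\<lambda>x. \<phi> x * \<psi> x) x = \<phi> x * pd i \<psi> x + \<psi> x * pd i \<phi> x" for x
  proof -
    have "((\<lambda>x. \<phi> x * \<psi> x) has_derivative (\<lambda>h. (\<phi> x *\<^sub>R grad \<psi> x + \<psi> x *\<^sub>R grad \<phi> x) \<bullet> h)) (at x)"
      using test_functions_has_derivative[OF \<psi>, of x] test_functions_has_derivative[OF \<phi>, of x]
      by (auto intro!: derivative_eq_intros simp: inner_add_left)
    from grad_eqI[OF this] show ?thesis by (simp add: pd_def)
  qed
  have i: "integrable (lebesgue_on \<Omega>) (\<lambda>x. \<phi> x * pd i \<psi> x)" "integrable (lebesgue_on \<Omega>) (\<lambda>x. \<psi> x * pd i \<phi> x)"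
    using test_functions_integrable[OF \<phi> \<Omega> loc_integrable_continuous[OF test_functions_continuous[OF test_functions_pd[OF \<psi>]]]]
      test_functions_integrable[OF \<psi> \<Omega> loc_integrable_continuous[OF test_functions_continuous[OF test_functions_pd[OF \<phi>]]]]
    by simp_all
  have "(\<integral>x. pd i (\<lambda>x. \<phi> x * \<psi> x) x \<partial>lebesgue_on \<Omega>) = (\<integral>x. pd i (\<lambda>x. \<phi> x * \<psi> x) x \<partial>lebesgue)"
  proof (rule integral_lebesgue_on_support[OF open_in_lebesgue[OF \<Omega>]])
    obtain L where L: "L \<subseteq> \<Omega>" "\<And>y. y \<notin> L \<Longrightarrow> grad (\<lambda>x. \<phi> x * \<psi> x) y = 0"
      using test_functions_support[OF m] by metis
    show "pd i (\<lambda>x. \<phi> x * \<psi> x) x = 0" if "x \<notin> \<Omega>" for x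
    proof -
      have "x \<notin> L" using L(1) that by blast
      from L(2)[OF this] show ?thesis by (simp add: pd_def)
    qed
  qed
  also have "\<dots> = 0"
    by (rule integral_pd_test_function) (use m test_functions_mono[of \<Omega> UNIV] in auto)
  finally show ?thesis
    unfolding pdm using i by (simp add: Bochner_Integration.integral_add)
qed

text \<open>Uniform convergence with bounded gradients gives weak convergence of the gradients. For
  a test function in place of \<open>f\<close> the derivative is shifted by parts; a general
  \<open>f\<close> is approximated in \<open>L\<^sup>1\<close>, and the gradient bound controls the
  error uniformly in \<open>k\<close>.\<close>

lemma tendsto_integral_pd:
  fixes Z :: "real^'n \<Rightarrow> real"
  assumes \<Omega>: "open \<Omega>" "bounded \<Omega>" and wg: "has_weak_grad \<Omega> Z G"
    and G: "AE x in lebesgue_on \<Omega>. norm (G x) \<le> M" and M: "M \<ge> 0"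
    and \<psi>: "\<And>k. \<psi> k \<in> test_functions \<Omega>" "\<And>k x. norm (grad (\<psi> k) x) \<le> M"
    and close: "\<And>k x. \<bar>\<psi> k x - Z x\<bar> \<le> c k" "c \<longlonglongrightarrow> 0"
    and f: "integrable (lebesgue_on \<Omega>) f"
  shows "(\<lambda>k. \<integral>x. f x * pd i (\<psi> k) x \<partial>lebesgue_on \<Omega>) \<longlonglongrightarrow> (\<integral>x. f x * G x $ i \<partial>lebesgue_on \<Omega>)"
proof (rule LIMSEQ_I)
  fix r :: real assume r: "r > 0"
  have l: "loc_integrable \<Omega> Z" using wg by (simp add: has_weak_grad_def)
  have Gm: "G \<in> borel_measurable (lebesgue_on \<Omega>)" by (rule has_weak_grad_measurable(2)[OF \<Omega>(1) wg])
  have Gim: "(\<lambda>x. G x $ i) \<in> borel_measurable (lebesgue_on \<Omega>)"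
    by (rule loc_integrable_measurable[OF loc_integrable_component \<Omega>(1)]) (use wg in \<open>simp add: has_weak_grad_def\<close>)
  have Gi: "AE x in lebesgue_on \<Omega>. \<bar>G x $ i\<bar> \<le> M"
    using G by eventually_elim (metis component_le_norm_cart order_trans)
  have pdM: "\<bar>pd i (\<psi> k) x\<bar> \<le> M" for k x
    using component_le_norm_cart[of "grad (\<psi> k) x" i] \<psi>(2)[of k x] by (simp add: pd_def)
  have pdm: "pd i (\<psi> k) \<in> borel_measurable (lebesgue_on \<Omega>)" for k
    by (intro continuous_measurable_lebesgue test_functions_continuous[OF test_functions_pd[OF \<psi>(1)]])
  \<comment> \<open>Replacing \<open>f\<close> by \<open>\<phi>\<close> costs at most
    \<open>M * e\<close> for \<open>pd i (\<psi> k)\<close> and again for \<open>G\<close>, together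
    at most half of \<open>r\<close>.\<close>
  define e where "e = r / (4 * (M + 1))"
  have e: "e > 0" "2 * M * e \<le> r / 2"
    using r M by (auto simp: e_def field_simps)
  obtain \<phi> where \<phi>: "\<phi> \<in> test_functions \<Omega>" "(\<integral>x. \<bar>f x - \<phi> x\<bar> \<partial>lebesgue_on \<Omega>) < e"
    using test_functions_dense_L1[OF \<Omega> f e(1)] by blast
  have \<phi>i: "integrable (lebesgue_on \<Omega>) \<phi>"
    using test_functions_integrable[OF \<phi>(1) \<Omega>(1) loc_integrable_continuous[of "\<lambda>x. 1::real"]] by simp
  have di: "integrable (lebesgue_on \<Omega>) (\<lambda>x. f x - \<phi> x)" using f \<phi>i by simp
  have small: "\<bar>\<integral>x. (f x - \<phi> x) * h x \<partial>lebesgue_on \<Omega>\<bar> \<le> M * e"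
    if h: "h \<in> borel_measurable (lebesgue_on \<Omega>)" "AE x in lebesgue_on \<Omega>. \<bar>h x\<bar> \<le> M" for h
  proof -
    have "\<bar>\<integral>x. (f x - \<phi> x) * h x \<partial>lebesgue_on \<Omega>\<bar> \<le> (\<integral>x. \<bar>(f x - \<phi> x) * h x\<bar> \<partial>lebesgue_on \<Omega>)"
      by (rule integral_abs_bound)
    also have "\<dots> \<le> (\<integral>x. M * \<bar>f x - \<phi> x\<bar> \<partial>lebesgue_on \<Omega>)"
    proof (rule integral_mono_AE)
      show "integrable (lebesgue_on \<Omega>) (\<lambda>x. \<bar>(f x - \<phi> x) * h x\<bar>)"
        by (intro integrable_abs integrable_mult_bounded[OF di h])
      show "AE x in lebesgue_on \<Omega>. \<bar>(f x - \<phi> x) * h x\<bar> \<le> M * \<bar>f x - \<phi> x\<bar>"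
        using h(2) by eventually_elim (simp add: abs_mult mult.commute mult_right_mono)
    qed (use di in simp)
    also have "\<dots> \<le> M * e" using \<phi>(2) M by (simp add: mult_left_mono)
    finally show ?thesis .
  qed
  have split: "(\<integral>x. f x * h x \<partial>lebesgue_on \<Omega>) = (\<integral>x. (f x - \<phi> x) * h x \<partial>lebesgue_on \<Omega>) + (\<integral>x. \<phi> x * h x \<partial>lebesgue_on \<Omega>)"
    if h: "h \<in> borel_measurable (lebesgue_on \<Omega>)" "AE x in lebesgue_on \<Omega>. \<bar>h x\<bar> \<le> M" for h
  proof -
    have "(\<integral>x. f x * h x \<partial>lebesgue_on \<Omega>) = (\<integral>x. (f x - \<phi> x) * h x + \<phi> x * h x \<partial>lebesgue_on \<Omega>)"
      by (simp add: algebra_simps)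
    also have "\<dots> = (\<integral>x. (f x - \<phi> x) * h x \<partial>lebesgue_on \<Omega>) + (\<integral>x. \<phi> x * h x \<partial>lebesgue_on \<Omega>)"
      by (intro Bochner_Integration.integral_add integrable_mult_bounded[OF di h] integrable_mult_bounded[OF \<phi>i h])
    finally show ?thesis .
  qed
  define I where "I = (\<integral>x. \<bar>pd i \<phi> x\<bar> \<partial>lebesgue_on \<Omega>)"
  have I: "I \<ge> 0" by (simp add: I_def)
  note pd\<phi> = test_functions_pd[OF \<phi>(1), of i]
  have pd\<phi>i: "integrable (lebesgue_on \<Omega>) (pd i \<phi>)"
    using test_functions_integrable[OF pd\<phi> \<Omega>(1) loc_integrable_continuous[of "\<lambda>x. 1::real"]] by simp
  have main: "\<bar>(\<integral>x. \<phi> x * pd i (\<psi> k) x \<partial>lebesgue_on \<Omega>) - (\<integral>x. \<phi> x * G x $ i \<partial>lebesgue_on \<Omega>)\<bar> \<le> c k * I" for k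
  proof -
    have "(\<integral>x. \<phi> x * pd i (\<psi> k) x \<partial>lebesgue_on \<Omega>) = - (\<integral>x. \<psi> k x * pd i \<phi> x \<partial>lebesgue_on \<Omega>)"
      by (rule integral_by_parts_test[OF \<Omega>(1) \<psi>(1) \<phi>(1)])
    moreover have "(\<integral>x. \<phi> x * G x $ i \<partial>lebesgue_on \<Omega>) = - (\<integral>x. Z x * pd i \<phi> x \<partial>lebesgue_on \<Omega>)"
      using has_weak_grad_component[OF \<Omega>(1) wg \<phi>(1), of i] by simp
    moreover have i1: "integrable (lebesgue_on \<Omega>) (\<lambda>x. Z x * pd i \<phi> x)"
      using test_functions_integrable[OF pd\<phi> \<Omega>(1) l] by (simp add: mult.commute)
    moreover have i2: "integrable (lebesgue_on \<Omega>) (\<lambda>x. \<psi> k x * pd i \<phi> x)"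
      using test_functions_integrable[OF pd\<phi> \<Omega>(1) loc_integrable_continuous[OF test_functions_continuous[OF \<psi>(1)]]]
      by (simp add: mult.commute)
    ultimately have "\<bar>(\<integral>x. \<phi> x * pd i (\<psi> k) x \<partial>lebesgue_on \<Omega>) - (\<integral>x. \<phi> x * G x $ i \<partial>lebesgue_on \<Omega>)\<bar>
      = \<bar>\<integral>x. \<psi> k x * pd i \<phi> x - Z x * pd i \<phi> x \<partial>lebesgue_on \<Omega>\<bar>"
      by (simp add: Bochner_Integration.integral_diff)
    also have "\<dots> \<le> (\<integral>x. c k * \<bar>pd i \<phi> x\<bar> \<partial>lebesgue_on \<Omega>)"
    proof (rule integral_abs_bound_integral)
      show "\<bar>\<psi> k x * pd i \<phi> x - Z x * pd i \<phi> x\<bar> \<le> c k * \<bar>pd i \<phi> x\<bar>" for x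
        using mult_right_mono[OF close(1)[of k x] abs_ge_zero[of "pd i \<phi> x"]]
        by (simp add: left_diff_distrib[symmetric] abs_mult)
    qed (use i1 i2 pd\<phi>i in auto)
    also have "\<dots> = c k * I" by (simp add: I_def)
    finally show ?thesis .
  qed
  have "(\<lambda>k. c k * I) \<longlonglongrightarrow> 0 * I" by (intro tendsto_intros close(2))
  then have "\<forall>\<^sub>F k in sequentially. c k * I < r / 2"
    using r by (intro order_tendstoD(2)) auto
  then obtain N where N: "\<And>k. k \<ge> N \<Longrightarrow> c k * I < r / 2" unfolding eventually_sequentially by blast
  show "\<exists>N. \<forall>k\<ge>N. norm ((\<integral>x. f x * pd i (\<psi> k) x \<partial>lebesgue_on \<Omega>) - (\<integral>x. f x * G x $ i \<partial>lebesgue_on \<Omega>)) < r"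
  proof (intro exI[of _ N] allI impI)
    fix k assume k: "N \<le> k"
    have p1: "AE x in lebesgue_on \<Omega>. \<bar>pd i (\<psi> k) x\<bar> \<le> M" using pdM by simp
    show "norm ((\<integral>x. f x * pd i (\<psi> k) x \<partial>lebesgue_on \<Omega>) - (\<integral>x. f x * G x $ i \<partial>lebesgue_on \<Omega>)) < r"
      using split[OF pdm p1] split[OF Gim Gi] small[OF pdm p1] small[OF Gim Gi] main[of k] N[OF k] e(2)
      unfolding real_norm_def by linarith
  qed
qed

lemma tendsto_integral_grad:
  fixes Z :: "real^'n \<Rightarrow> real"
  assumes \<Omega>: "open \<Omega>" "bounded \<Omega>" and wg: "has_weak_grad \<Omega> Z G"
    and G: "AE x in lebesgue_on \<Omega>. norm (G x) \<le> M" and M: "M \<ge> 0"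
    and \<psi>: "\<And>k. \<psi> k \<in> test_functions \<Omega>" "\<And>k x. norm (grad (\<psi> k) x) \<le> M"
    and close: "\<And>k x. \<bar>\<psi> k x - Z x\<bar> \<le> c k" "c \<longlonglongrightarrow> 0"
    and f: "integrable (lebesgue_on \<Omega>) \<Phi>"
  shows "(\<lambda>k. \<integral>x. \<Phi> x \<bullet> grad (\<psi> k) x \<partial>lebesgue_on \<Omega>) \<longlonglongrightarrow> (\<integral>x. \<Phi> x \<bullet> G x \<partial>lebesgue_on \<Omega>)"
proof -
  have fi: "integrable (lebesgue_on \<Omega>) (\<lambda>x. \<Phi> x $ i)" for i
    by (rule integrable_bounded_linear[OF bounded_linear_vec_nth f])
  have eq: "(\<integral>x. \<Phi> x \<bullet> h x \<partial>lebesgue_on \<Omega>) = (\<Sum>i\<in>UNIV. \<integral>x. \<Phi> x $ i * h x $ i \<partial>lebesgue_on \<Omega>)"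
    if h: "\<And>i. (\<lambda>x. h x $ i) \<in> borel_measurable (lebesgue_on \<Omega>)" "AE x in lebesgue_on \<Omega>. norm (h x) \<le> M" for h :: "real^'n \<Rightarrow> real^'n"
  proof -
    have "AE x in lebesgue_on \<Omega>. \<bar>h x $ i\<bar> \<le> M" for i
      using h(2) by eventually_elim (metis component_le_norm_cart order_trans)
    then have "integrable (lebesgue_on \<Omega>) (\<lambda>x. \<Phi> x $ i * h x $ i)" for i
      by (intro integrable_mult_bounded[OF fi h(1)])
    then show ?thesis by (simp add: inner_vec_def Bochner_Integration.integral_sum)
  qed
  have Gim: "(\<lambda>x. G x $ i) \<in> borel_measurable (lebesgue_on \<Omega>)" for i
    by (rule loc_integrable_measurable[OF loc_integrable_component \<Omega>(1)]) (use wg in \<open>simp add: has_weak_grad_def\<close>)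
  have pdm: "(\<lambda>x. grad (\<psi> k) x $ i) \<in> borel_measurable (lebesgue_on \<Omega>)" for k i
    using continuous_measurable_lebesgue[OF test_functions_continuous[OF test_functions_pd[OF \<psi>(1)]]]
    by (simp add: pd_def[abs_def])
  have "(\<lambda>k. \<Sum>i\<in>UNIV. \<integral>x. \<Phi> x $ i * pd i (\<psi> k) x \<partial>lebesgue_on \<Omega>) \<longlonglongrightarrow> (\<Sum>i\<in>UNIV. \<integral>x. \<Phi> x $ i * G x $ i \<partial>lebesgue_on \<Omega>)"
    by (intro tendsto_sum tendsto_integral_pd[OF \<Omega> wg G M \<psi> close fi])
  then show ?thesis
    using eq[OF Gim G] eq[OF pdm, of _ ] \<psi>(2) by (simp add: pd_def)
qed

text \<open>Only weak convergence of the gradients of the approximating test functions is available,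
  which suffices because the equation is linear in the test function.\<close>

lemma weak_equation_test_lipschitz:
  fixes Z :: "real^'n \<Rightarrow> real"
  assumes \<Omega>: "open \<Omega>" "bounded \<Omega>" and Z: "M0-lipschitz_on UNIV Z" "\<And>x. x \<notin> \<Omega> \<Longrightarrow> Z x = 0"
    and wg: "has_weak_grad \<Omega> Z G" and G: "AE x in lebesgue_on \<Omega>. norm (G x) \<le> M1"
    and \<Phi>: "integrable (lebesgue_on \<Omega>) \<Phi>" and g: "integrable (lebesgue_on \<Omega>) g"
    and eq: "\<And>\<psi>. \<psi> \<in> test_functions \<Omega> \<Longrightarrow> (\<integral>x. \<Phi> x \<bullet> grad \<psi> x \<partial>lebesgue_on \<Omega>) = (\<integral>x. g x * \<psi> x \<partial>lebesgue_on \<Omega>)"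
  shows "(\<integral>x. \<Phi> x \<bullet> G x \<partial>lebesgue_on \<Omega>) = (\<integral>x. g x * Z x \<partial>lebesgue_on \<Omega>)"
    and "(\<integral>x. (Z x)\<^sup>2 \<partial>lebesgue_on \<Omega>) = - 2 * (\<integral>x. x $ i * Z x * G x $ i \<partial>lebesgue_on \<Omega>)"
proof -
  define M where "M = max M0 M1"
  have M0: "M0 \<ge> 0" by (rule lipschitz_on_nonneg[OF Z(1)])
  then have M: "M \<ge> 0" by (simp add: M_def)
  have GM: "AE x in lebesgue_on \<Omega>. norm (G x) \<le> M" using G by eventually_elim (simp add: M_def)
  \<comment> \<open>\<open>lipschitz_zero_test_approx\<close> with
    \<open>e = 1 / real (Suc k)\<close> yields twice that distance.\<close>
  define c where "c k = 2 / real (Suc k)" for k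
  have cl: "c \<longlonglongrightarrow> 0" unfolding c_def by (rule LIMSEQ_Suc[OF lim_const_over_n])
  have "\<forall>k. \<exists>\<psi>. \<psi> \<in> test_functions \<Omega> \<and> (\<forall>x. norm (grad \<psi> x) \<le> M0) \<and> (\<forall>x. \<bar>\<psi> x - Z x\<bar> \<le> c k)"
  proof
    fix k
    have "1 / real (Suc k) > 0" by simp
    from lipschitz_zero_test_approx[OF \<Omega> Z this]
    show "\<exists>\<psi>. \<psi> \<in> test_functions \<Omega> \<and> (\<forall>x. norm (grad \<psi> x) \<le> M0) \<and> (\<forall>x. \<bar>\<psi> x - Z x\<bar> \<le> c k)"
      by (auto simp: c_def)
  qed
  from choice[OF this] obtain \<psi> where \<psi>': "\<forall>k. \<psi> k \<in> test_functions \<Omega> \<and> (\<forall>x. norm (grad (\<psi> k) x) \<le> M0) \<and> (\<forall>x. \<bar>\<psi> k x - Z x\<bar> \<le> c k)"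
    by (rule exE)
  have \<psi>: "\<psi> k \<in> test_functions \<Omega>" "norm (grad (\<psi> k) x) \<le> M" "\<bar>\<psi> k x - Z x\<bar> \<le> c k" for k x
  proof -
    show "\<psi> k \<in> test_functions \<Omega>" "\<bar>\<psi> k x - Z x\<bar> \<le> c k" using \<psi>' by simp_all
    have "norm (grad (\<psi> k) x) \<le> M0" using \<psi>' by simp
    then show "norm (grad (\<psi> k) x) \<le> M" by (simp add: M_def)
  qed
  interpret finite_measure "lebesgue_on \<Omega>"
    using \<Omega> by (intro finite_measure_lebesgue_on lmeasurable_open)
  have Zc: "continuous_on UNIV Z" by (rule lipschitz_on_continuous_on[OF Z(1)])
  have Zm: "Z \<in> borel_measurable (lebesgue_on \<Omega>)" by (rule continuous_measurable_lebesgue[OF Zc])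
  have "bounded (closure \<Omega>)" using \<Omega>(2) by (rule bounded_closure)
  then have "bounded (Z ` closure \<Omega>)"
    by (intro compact_imp_bounded compact_continuous_image continuous_on_subset[OF Zc]) (auto simp: compact_eq_bounded_closed intro: bounded_closure)
  then obtain B where B: "\<And>x. x \<in> closure \<Omega> \<Longrightarrow> \<bar>Z x\<bar> \<le> B" unfolding bounded_iff by auto
  have ZB: "AE x in lebesgue_on \<Omega>. \<bar>Z x\<bar> \<le> B" using B closure_subset by (intro AE_I2) auto
  have pass: "(\<lambda>k. \<integral>x. h x * \<psi> k x \<partial>lebesgue_on \<Omega>) \<longlonglongrightarrow> (\<integral>x. h x * Z x \<partial>lebesgue_on \<Omega>)"
    if h: "integrable (lebesgue_on \<Omega>) h" for h
  proof (rule LIM_zero_cancel, rule Lim_null_comparison)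
    define I where "I = (\<integral>x. \<bar>h x\<bar> \<partial>lebesgue_on \<Omega>)"
    have i1: "integrable (lebesgue_on \<Omega>) (\<lambda>x. h x * Z x)" by (rule integrable_mult_bounded[OF h Zm ZB])
    have i2: "integrable (lebesgue_on \<Omega>) (\<lambda>x. h x * \<psi> k x)" for k
    proof -
      obtain b where "\<And>x. \<bar>\<psi> k x\<bar> \<le> b" using test_functions_bounded[OF \<psi>(1)] by metis
      then show ?thesis
        by (intro integrable_mult_bounded[OF h, where B = b] continuous_measurable_lebesgue test_functions_continuous[OF \<psi>(1)]) simp
    qed
    show "\<forall>\<^sub>F k in sequentially. norm ((\<integral>x. h x * \<psi> k x \<partial>lebesgue_on \<Omega>) - (\<integral>x. h x * Z x \<partial>lebesgue_on \<Omega>)) \<le> c k * I"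
    proof (rule always_eventually, rule allI)
      fix k
      have "(\<integral>x. h x * \<psi> k x \<partial>lebesgue_on \<Omega>) - (\<integral>x. h x * Z x \<partial>lebesgue_on \<Omega>) = (\<integral>x. h x * \<psi> k x - h x * Z x \<partial>lebesgue_on \<Omega>)"
        by (rule Bochner_Integration.integral_diff[symmetric, OF i2 i1])
      also have "\<bar>\<dots>\<bar> \<le> (\<integral>x. c k * \<bar>h x\<bar> \<partial>lebesgue_on \<Omega>)"
      proof (rule integral_abs_bound_integral)
        fix x
        have "\<bar>h x * \<psi> k x - h x * Z x\<bar> = \<bar>\<psi> k x - Z x\<bar> * \<bar>h x\<bar>"
          by (simp add: right_diff_distrib[symmetric] abs_mult)
        also have "\<dots> \<le> c k * \<bar>h x\<bar>" by (rule mult_right_mono[OF \<psi>(3)]) simp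
        finally show "\<bar>h x * \<psi> k x - h x * Z x\<bar> \<le> c k * \<bar>h x\<bar>" .
      qed (use i1 i2 h in auto)
      finally show "norm ((\<integral>x. h x * \<psi> k x \<partial>lebesgue_on \<Omega>) - (\<integral>x. h x * Z x \<partial>lebesgue_on \<Omega>)) \<le> c k * I"
        by (simp add: I_def)
    qed
    show "(\<lambda>k. c k * I) \<longlonglongrightarrow> 0" using tendsto_mult_left_zero[OF cl] by simp
  qed
  have "(\<lambda>k. \<integral>x. \<Phi> x \<bullet> grad (\<psi> k) x \<partial>lebesgue_on \<Omega>) \<longlonglongrightarrow> (\<integral>x. \<Phi> x \<bullet> G x \<partial>lebesgue_on \<Omega>)"
    by (rule tendsto_integral_grad[OF \<Omega> wg GM M \<psi> cl \<Phi>])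
  moreover have "(\<lambda>k. \<integral>x. \<Phi> x \<bullet> grad (\<psi> k) x \<partial>lebesgue_on \<Omega>) \<longlonglongrightarrow> (\<integral>x. g x * Z x \<partial>lebesgue_on \<Omega>)"
    unfolding eq[OF \<psi>(1)] by (rule pass[OF g])
  ultimately show "(\<integral>x. \<Phi> x \<bullet> G x \<partial>lebesgue_on \<Omega>) = (\<integral>x. g x * Z x \<partial>lebesgue_on \<Omega>)"
    by (rule LIMSEQ_unique)
  obtain R where R: "\<And>x. x \<in> \<Omega> \<Longrightarrow> norm x \<le> R" using \<Omega>(2) unfolding bounded_iff by blast
  have RB: "AE x in lebesgue_on \<Omega>. \<bar>x $ i\<bar> \<le> R"
    using R by (intro AE_I2) (metis component_le_norm_cart order_trans space_lebesgue_on)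
  have xm: "(\<lambda>x. x $ i) \<in> borel_measurable (lebesgue_on \<Omega>)"
    by (intro continuous_measurable_lebesgue continuous_intros)
  have Zi: "integrable (lebesgue_on \<Omega>) Z"
    by (rule integrable_const_bound[of _ B]) (use ZB Zm in auto)
  have xZi: "integrable (lebesgue_on \<Omega>) (\<lambda>x. Z x * x $ i)"
    by (rule integrable_mult_bounded[OF Zi xm RB])
  have Gim: "(\<lambda>x. G x $ i) \<in> borel_measurable (lebesgue_on \<Omega>)"
    by (rule loc_integrable_measurable[OF loc_integrable_component \<Omega>(1)]) (use wg in \<open>simp add: has_weak_grad_def\<close>)
  have Gib: "AE x in lebesgue_on \<Omega>. \<bar>G x $ i\<bar> \<le> M"
    using GM by eventually_elim (metis component_le_norm_cart order_trans)
  have Gint: "integrable (lebesgue_on \<Omega>) (\<lambda>x. G x $ i)"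
    by (rule integrable_const_bound[of _ M]) (use Gib Gim in auto)
  have xGi: "integrable (lebesgue_on \<Omega>) (\<lambda>x. G x $ i * x $ i)"
    by (rule integrable_mult_bounded[OF Gint xm RB])
  \<comment> \<open>The weak gradient is tested with \<open>x $ i * \<psi> k x\<close>. In the limit
    the product rule contributes the square of \<open>Z\<close>, and the term with
    \<open>x $ i\<close> occurs on both sides, whence the factor 2.\<close>
  have step: "(\<integral>x. Z x * \<psi> k x \<partial>lebesgue_on \<Omega>) + (\<integral>x. (Z x * x $ i) * pd i (\<psi> k) x \<partial>lebesgue_on \<Omega>)
    = - (\<integral>x. (G x $ i * x $ i) * \<psi> k x \<partial>lebesgue_on \<Omega>)" for k
  proof -
    have t: "(\<lambda>x. x $ i * \<psi> k x) \<in> test_functions \<Omega>"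
      by (rule test_functions_mult[OF \<psi>(1) Ck_component])
    have pdt: "pd i (\<lambda>x. x $ i * \<psi> k x) x = \<psi> k x + x $ i * pd i (\<psi> k) x" for x
    proof -
      have "((\<lambda>x. x $ i) has_derivative (\<lambda>h. h $ i)) (at x)"
        by (rule bounded_linear_imp_has_derivative[OF bounded_linear_vec_nth])
      from has_derivative_mult[OF this test_functions_has_derivative[OF \<psi>(1)[of k], of x]]
      have "((\<lambda>x. x $ i * \<psi> k x) has_derivative (\<lambda>h. (x $ i *\<^sub>R grad (\<psi> k) x + \<psi> k x *\<^sub>R axis i 1) \<bullet> h)) (at x)"
        by (simp add: inner_add_left inner_axis' mult.commute)
      from grad_eqI[OF this] show ?thesis by (simp add: pd_def)
    qed
    have j1: "integrable (lebesgue_on \<Omega>) (\<lambda>x. Z x * \<psi> k x)"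
      using test_functions_integrable[OF \<psi>(1)[of k] \<Omega>(1) loc_integrable_continuous[OF Zc]] by (simp add: mult.commute)
    have "continuous_on UNIV (\<lambda>x. Z x * x $ i)" by (intro continuous_intros Zc)
    from test_functions_integrable[OF test_functions_pd[OF \<psi>(1)[of k], of i] \<Omega>(1) loc_integrable_continuous[OF this]]
    have j2: "integrable (lebesgue_on \<Omega>) (\<lambda>x. (Z x * x $ i) * pd i (\<psi> k) x)" by (simp add: mult.commute)
    have "(\<integral>x. Z x * \<psi> k x \<partial>lebesgue_on \<Omega>) + (\<integral>x. (Z x * x $ i) * pd i (\<psi> k) x \<partial>lebesgue_on \<Omega>)
      = (\<integral>x. Z x * pd i (\<lambda>x. x $ i * \<psi> k x) x \<partial>lebesgue_on \<Omega>)"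
      unfolding pdt Bochner_Integration.integral_add[OF j1 j2, symmetric]
      by (simp add: distrib_left mult.assoc)
    also have "\<dots> = - (\<integral>x. (x $ i * \<psi> k x) * G x $ i \<partial>lebesgue_on \<Omega>)"
      by (rule has_weak_grad_component[OF \<Omega>(1) wg t])
    finally show ?thesis by (simp add: mult.commute mult.left_commute)
  qed
  have "(\<lambda>k. (\<integral>x. Z x * \<psi> k x \<partial>lebesgue_on \<Omega>) + (\<integral>x. (Z x * x $ i) * pd i (\<psi> k) x \<partial>lebesgue_on \<Omega>))
    \<longlonglongrightarrow> (\<integral>x. Z x * Z x \<partial>lebesgue_on \<Omega>) + (\<integral>x. (Z x * x $ i) * G x $ i \<partial>lebesgue_on \<Omega>)"
    by (intro tendsto_add pass[OF Zi] tendsto_integral_pd[OF \<Omega> wg GM M \<psi> cl xZi])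
  moreover have "(\<lambda>k. (\<integral>x. Z x * \<psi> k x \<partial>lebesgue_on \<Omega>) + (\<integral>x. (Z x * x $ i) * pd i (\<psi> k) x \<partial>lebesgue_on \<Omega>))
    \<longlonglongrightarrow> - (\<integral>x. (G x $ i * x $ i) * Z x \<partial>lebesgue_on \<Omega>)"
    unfolding step by (intro tendsto_minus pass[OF xGi])
  ultimately have "(\<integral>x. Z x * Z x \<partial>lebesgue_on \<Omega>) + (\<integral>x. (Z x * x $ i) * G x $ i \<partial>lebesgue_on \<Omega>)
    = - (\<integral>x. (G x $ i * x $ i) * Z x \<partial>lebesgue_on \<Omega>)"
    by (rule LIMSEQ_unique)
  moreover have "(\<lambda>x. (Z x * x $ i) * G x $ i) = (\<lambda>x. x $ i * Z x * G x $ i)"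
    "(\<lambda>x. (G x $ i * x $ i) * Z x) = (\<lambda>x. x $ i * Z x * G x $ i)"
    by (simp_all add: fun_eq_iff)
  ultimately show "(\<integral>x. (Z x)\<^sup>2 \<partial>lebesgue_on \<Omega>) = - 2 * (\<integral>x. x $ i * Z x * G x $ i \<partial>lebesgue_on \<Omega>)"
    by (simp add: power2_eq_square)
qed

text \<open>Young's inequality applied to the identity obtained by testing the weak gradient of \<open>Z\<close>
  with \<open>x\<^sub>i Z\<close>; the coordinate \<open>i\<close> is arbitrary.\<close>

lemma poincare:
  fixes Z :: "real^'n \<Rightarrow> real"
  assumes \<Omega>: "open \<Omega>" "bounded \<Omega>" and R: "\<And>x. x \<in> \<Omega> \<Longrightarrow> norm x \<le> R"
    and Z: "M0-lipschitz_on UNIV Z" "\<And>x. x \<notin> \<Omega> \<Longrightarrow> Z x = 0"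
    and wg: "has_weak_grad \<Omega> Z G" and G: "AE x in lebesgue_on \<Omega>. norm (G x) \<le> M1"
  shows "(\<integral>x. (Z x)\<^sup>2 \<partial>lebesgue_on \<Omega>) \<le> 4 * R\<^sup>2 * (\<integral>x. (norm (G x))\<^sup>2 \<partial>lebesgue_on \<Omega>)"
proof -
  interpret finite_measure "lebesgue_on \<Omega>"
    using \<Omega> by (intro finite_measure_lebesgue_on lmeasurable_open)
  have Zc: "continuous_on UNIV Z" by (rule lipschitz_on_continuous_on[OF Z(1)])
  have Zm[measurable]: "Z \<in> borel_measurable (lebesgue_on \<Omega>)" by (rule continuous_measurable_lebesgue[OF Zc])
  have Gm[measurable]: "G \<in> borel_measurable (lebesgue_on \<Omega>)" by (rule has_weak_grad_measurable(2)[OF \<Omega>(1) wg])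
  have "bounded (Z ` closure \<Omega>)"
    using \<Omega>(2) by (intro compact_imp_bounded compact_continuous_image continuous_on_subset[OF Zc]) (auto simp: compact_eq_bounded_closed intro: bounded_closure)
  then obtain B where B: "\<And>x. x \<in> closure \<Omega> \<Longrightarrow> \<bar>Z x\<bar> \<le> B" unfolding bounded_iff by auto
  have Z2: "integrable (lebesgue_on \<Omega>) (\<lambda>x. (Z x)\<^sup>2)"
  proof (rule integrable_const_bound[of _ "B\<^sup>2"])
    show "AE x in lebesgue_on \<Omega>. norm ((Z x)\<^sup>2) \<le> B\<^sup>2"
    proof (rule AE_I2)
      fix x assume "x \<in> space (lebesgue_on \<Omega>)"
      then have "\<bar>Z x\<bar> \<le> B" using B closure_subset by auto
      from power_mono[OF this, of 2] show "norm ((Z x)\<^sup>2) \<le> B\<^sup>2" by simp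
    qed
  qed measurable
  have G2: "integrable (lebesgue_on \<Omega>) (\<lambda>x. (norm (G x))\<^sup>2)"
  proof (rule integrable_const_bound[of _ "M1\<^sup>2"])
    show "AE x in lebesgue_on \<Omega>. norm ((norm (G x))\<^sup>2) \<le> M1\<^sup>2"
      using G by eventually_elim (simp add: power_mono)
  qed measurable
  \<comment> \<open>Only the identity for \<open>Z\<close> is wanted, so the equation supplied is
    the trivial one with zero flux and zero source.\<close>
  have eq: "(\<integral>x. (Z x)\<^sup>2 \<partial>lebesgue_on \<Omega>) = - 2 * (\<integral>x. x $ i * Z x * G x $ i \<partial>lebesgue_on \<Omega>)" for i
    by (rule weak_equation_test_lipschitz(2)[OF \<Omega> Z wg G integrable_zero integrable_zero]) simp_all
  let ?i = "undefined :: 'n"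
  have "(\<integral>x. (Z x)\<^sup>2 \<partial>lebesgue_on \<Omega>) = (\<integral>x. - 2 * (x $ ?i * Z x * G x $ ?i) \<partial>lebesgue_on \<Omega>)"
    unfolding eq[of ?i] by simp
  also have "\<dots> \<le> (\<integral>x. (Z x)\<^sup>2 / 2 + 2 * R\<^sup>2 * (norm (G x))\<^sup>2 \<partial>lebesgue_on \<Omega>)"
  proof (rule integral_mono')
    show "integrable (lebesgue_on \<Omega>) (\<lambda>x. (Z x)\<^sup>2 / 2 + 2 * R\<^sup>2 * (norm (G x))\<^sup>2)" using Z2 G2 by simp
    fix x assume "x \<in> space (lebesgue_on \<Omega>)"
    then have x: "norm x \<le> R" using R by simp
    have R0: "0 \<le> R" using x norm_ge_zero order_trans by blast
    have "- 2 * (x $ ?i * Z x * G x $ ?i) \<le> \<bar>- 2 * (x $ ?i * Z x * G x $ ?i)\<bar>" by (rule abs_ge_self)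
    also have "\<dots> = 2 * (\<bar>Z x\<bar> * (\<bar>x $ ?i\<bar> * \<bar>G x $ ?i\<bar>))" by (simp add: abs_mult)
    also have "\<dots> \<le> 2 * (\<bar>Z x\<bar> * (R * norm (G x)))"
      using order_trans[OF component_le_norm_cart x] component_le_norm_cart[of "G x" ?i] R0
      by (intro mult_left_mono mult_mono) auto
    also have "\<dots> \<le> (Z x)\<^sup>2 / 2 + 2 * R\<^sup>2 * (norm (G x))\<^sup>2"
    proof -
      \<comment> \<open>The weights leave half of the left-hand side to be absorbed, which produces
        the constant \<open>4 * R\<^sup>2\<close>.\<close>
      have "0 \<le> (\<bar>Z x\<bar> - 2 * (R * norm (G x)))\<^sup>2" by simp
      then show ?thesis by (simp add: power2_eq_square algebra_simps)
    qed
    finally show "- 2 * (x $ ?i * Z x * G x $ ?i) \<le> (Z x)\<^sup>2 / 2 + 2 * R\<^sup>2 * (norm (G x))\<^sup>2" .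
    show "0 \<le> (Z x)\<^sup>2 / 2 + 2 * R\<^sup>2 * (norm (G x))\<^sup>2" by simp
  qed
  also have "\<dots> = (\<integral>x. (Z x)\<^sup>2 \<partial>lebesgue_on \<Omega>) / 2 + 2 * R\<^sup>2 * (\<integral>x. (norm (G x))\<^sup>2 \<partial>lebesgue_on \<Omega>)"
    using Z2 G2 by (simp add: Bochner_Integration.integral_add)
  finally show ?thesis by simp
qed

section \<open>The flux of the state equation and square integrable functions\<close>

text \<open>The nonlinearity of the mean curvature operator: applied to
  \<open>wgrad \<Omega> y x\<close> it is the vector field under the divergence in
  \<open>state_equation\<close>.\<close>

definition flux :: "real^'n \<Rightarrow> real^'n" where
  "flux a = (1 / sqrt (1 + (norm a)\<^sup>2)) *\<^sub>R a"

text \<open>The derivative of \<open>flux\<close> at \<open>a\<close> in direction \<open>b\<close>,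
  written without matrices; for \<open>a\<close> the gradient of \<open>y\<close> it is
  \<open>A_coeff\<close> applied to \<open>b\<close>.\<close>

definition dflux :: "real^'n \<Rightarrow> real^'n \<Rightarrow> real^'n" where
  "dflux a b = (1 / sqrt (1 + (norm a)\<^sup>2)) *\<^sub>R (b - ((a \<bullet> b) / (1 + (norm a)\<^sup>2)) *\<^sub>R a)"

lemma outer_mult_vec: "outer a b *v x = (b \<bullet> x) *\<^sub>R a"
  by (simp add: vec_eq_iff matrix_vector_mult_def outer_def inner_vec_def sum_distrib_left
      mult.commute mult.left_commute)

lemma A_coeff_mult_vec: "A_coeff \<Omega> y x *v b = dflux (wgrad \<Omega> y x) b"
proof -
  have q: "(Q \<Omega> y x)\<^sup>2 = 1 + (norm (wgrad \<Omega> y x))\<^sup>2" by (simp add: Q_def)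
  show ?thesis
    unfolding A_coeff_def dflux_def q
    by (simp add: scaleR_matrix_vector_assoc[symmetric] matrix_vector_mult_diff_rdistrib outer_mult_vec Q_def)
qed

lemma dflux_diff: "dflux a (b - c) = dflux a b - dflux a c"
  by (simp add: dflux_def inner_diff_right diff_divide_distrib scaleR_diff_left scaleR_diff_right)

lemma dflux_sym: "dflux a b \<bullet> c = b \<bullet> dflux a c"
  by (simp add: dflux_def inner_diff_left inner_diff_right inner_commute)

lemma norm_dflux_le: "norm (dflux a b) \<le> 2 * norm b"
proof -
  define s where "s = 1 + (norm a)\<^sup>2"
  have s: "s \<ge> 1" by (simp add: s_def)
  have sq: "1 / sqrt s \<le> 1" using s by simp
  have "norm (((a \<bullet> b) / s) *\<^sub>R a) = \<bar>a \<bullet> b\<bar> * norm a / s" using s by simp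
  also have "\<dots> \<le> (norm a * norm b) * norm a / s"
    using s by (intro divide_right_mono mult_right_mono Cauchy_Schwarz_ineq2) auto
  also have "\<dots> = norm b * ((norm a)\<^sup>2 / s)" by (simp add: power2_eq_square)
  also have "\<dots> \<le> norm b * 1"
  proof (intro mult_left_mono norm_ge_zero)
    have "(norm a)\<^sup>2 \<le> s" by (simp add: s_def)
    then show "(norm a)\<^sup>2 / s \<le> 1" using s by simp
  qed
  finally have "norm (b - ((a \<bullet> b) / s) *\<^sub>R a) \<le> 2 * norm b"
    using norm_triangle_ineq4[of b "((a \<bullet> b) / s) *\<^sub>R a"] by simp
  then have "(1 / sqrt s) * norm (b - ((a \<bullet> b) / s) *\<^sub>R a) \<le> 1 * (2 * norm b)"
    using sq s by (intro mult_mono) auto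
  then show ?thesis using s by (simp add: dflux_def s_def[symmetric])
qed

text \<open>The quadratic form is smallest in the direction of \<open>a\<close>, where the factor is
  \<open>(1 + (norm a)\<^sup>2)\<close> to the power -3/2; a bound on \<open>a\<close> keeps it away
  from zero.\<close>

lemma dflux_coercive:
  assumes "norm a \<le> M"
  shows "(norm b)\<^sup>2 / (sqrt (1 + M\<^sup>2)) ^ 3 \<le> dflux a b \<bullet> b"
proof -
  define s where "s = 1 + (norm a)\<^sup>2"
  have s: "s \<ge> 1" "s \<le> 1 + M\<^sup>2" using assms by (auto simp: s_def intro: power_mono)
  have e1: "dflux a b \<bullet> b = ((norm b)\<^sup>2 - (a \<bullet> b)\<^sup>2 / s) / sqrt s"
    unfolding dflux_def s_def[symmetric] power2_norm_eq_inner[of b] power2_eq_square[of "a \<bullet> b"]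
    by (simp add: inner_diff_left)
  have e2: "(norm b)\<^sup>2 - (a \<bullet> b)\<^sup>2 / s \<ge> (norm b)\<^sup>2 / s"
  proof -
    have "(a \<bullet> b)\<^sup>2 \<le> (norm a)\<^sup>2 * (norm b)\<^sup>2"
      using Cauchy_Schwarz_ineq2[of a b] power_mono[of "\<bar>a \<bullet> b\<bar>" "norm a * norm b" 2]
      by (simp add: power_mult_distrib)
    then have "(norm b)\<^sup>2 + (a \<bullet> b)\<^sup>2 \<le> s * (norm b)\<^sup>2" by (simp add: s_def algebra_simps)
    then have "((norm b)\<^sup>2 + (a \<bullet> b)\<^sup>2) / s \<le> (norm b)\<^sup>2" using s by (simp add: field_simps)
    then show ?thesis by (simp add: add_divide_distrib)
  qed
  have "((norm b)\<^sup>2 / s) / sqrt s \<le> dflux a b \<bullet> b"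
    unfolding e1 by (rule divide_right_mono[OF e2]) (use s in simp)
  moreover have "(norm b)\<^sup>2 / (sqrt (1 + M\<^sup>2)) ^ 3 \<le> (norm b)\<^sup>2 / s / sqrt s"
  proof -
    have "s * sqrt s = sqrt s ^ 3" using s by (simp add: power3_eq_cube)
    also have "\<dots> \<le> sqrt (1 + M\<^sup>2) ^ 3" using s by (intro power_mono) auto
    finally have "s * sqrt s \<le> sqrt (1 + M\<^sup>2) ^ 3" .
    moreover have "s * sqrt s > 0" using s by simp
    ultimately have "(norm b)\<^sup>2 / (sqrt (1 + M\<^sup>2)) ^ 3 \<le> (norm b)\<^sup>2 / (s * sqrt s)"
      by (intro frac_le) auto
    then show ?thesis by simp
  qed
  ultimately show ?thesis by linarith
qed

lemma flux_has_derivative: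
  fixes a :: "real^'n"
  shows "(flux has_derivative dflux a) (at a)"
proof -
  define s where "s = 1 + (norm a)\<^sup>2"
  have s: "s > 0" by (simp add: s_def add_pos_nonneg)
  have 1: "((\<lambda>a. 1 + a \<bullet> a) has_derivative (\<lambda>h. 2 * (a \<bullet> h))) (at a)"
    by (auto intro!: derivative_eq_intros simp: inner_commute)
  have "((\<lambda>t. 1 / sqrt t) has_real_derivative (- 1 / (2 * s * sqrt s))) (at s)"
    using s by (auto intro!: derivative_eq_intros simp: field_simps real_sqrt_mult_self)
  then have 2: "((\<lambda>t. 1 / sqrt t) has_derivative (\<lambda>h. (- 1 / (2 * s * sqrt s)) * h)) (at (1 + a \<bullet> a))"
    by (simp only: has_field_derivative_def s_def power2_norm_eq_inner)
  have 3: "((\<lambda>a. 1 / sqrt (1 + a \<bullet> a)) has_derivative (\<lambda>h. (- 1 / (2 * s * sqrt s)) * (2 * (a \<bullet> h)))) (at a)"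
    by (rule has_derivative_compose[OF 1 2])
  have "((\<lambda>a. (1 / sqrt (1 + a \<bullet> a)) *\<^sub>R a) has_derivative
      (\<lambda>h. (1 / sqrt (1 + a \<bullet> a)) *\<^sub>R h + ((- 1 / (2 * s * sqrt s)) * (2 * (a \<bullet> h))) *\<^sub>R a)) (at a)"
    by (rule has_derivative_scaleR[OF 3 has_derivative_ident])
  moreover have "(\<lambda>a::real^'n. (1 / sqrt (1 + a \<bullet> a)) *\<^sub>R a) = flux"
    by (simp add: fun_eq_iff flux_def power2_norm_eq_inner)
  moreover have "(1 / sqrt (1 + a \<bullet> a)) *\<^sub>R h + ((- 1 / (2 * s * sqrt s)) * (2 * (a \<bullet> h))) *\<^sub>R a = dflux a h" for h
    using s by (simp add: dflux_def s_def[symmetric] power2_norm_eq_inner[symmetric] scaleR_diff_right)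
  ultimately show ?thesis by simp
qed

lemma flux_lipschitz:
  fixes a b :: "real^'n"
  shows "norm (flux a - flux b) \<le> 2 * norm (a - b)"
proof (rule differentiable_bound[of UNIV])
  show "(flux has_derivative dflux z) (at z within UNIV)" for z :: "real^'n"
    by (rule flux_has_derivative)
  show "onorm (dflux z) \<le> 2" for z :: "real^'n"
    by (rule onorm_bound) (auto simp: norm_dflux_le)
qed auto

lemma continuous_flux: "continuous_on UNIV flux"
  using flux_has_derivative has_derivative_continuous by (blast intro: continuous_at_imp_continuous_on)

lemma continuous_dflux: "continuous_on UNIV (\<lambda>(a, b). dflux a b)"
  unfolding dflux_def case_prod_beta
  by (intro continuous_intros) (auto simp: add_pos_nonneg less_imp_neq[symmetric] add_nonneg_eq_0_iff)

lemma measurable_dflux: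
  assumes "f \<in> borel_measurable M" "g \<in> borel_measurable M"
  shows "(\<lambda>x. dflux (f x) (g x)) \<in> borel_measurable M"
  using borel_measurable_continuous_Pair[OF assms continuous_dflux[unfolded case_prod_beta]] by simp

section \<open>Convergence and completeness in the space of square integrable functions\<close>

lemma L2_inner_integrable:
  fixes f g :: "'a \<Rightarrow> 'b::euclidean_space"
  assumes "f \<in> borel_measurable M" "integrable M (\<lambda>x. (norm (f x))\<^sup>2)"
    "g \<in> borel_measurable M" "integrable M (\<lambda>x. (norm (g x))\<^sup>2)"
  shows "integrable M (\<lambda>x. f x \<bullet> g x)"
proof (rule Bochner_Integration.integrable_bound[of M "\<lambda>x. (norm (f x))\<^sup>2 + (norm (g x))\<^sup>2"])
  show "AE x in M. norm (f x \<bullet> g x) \<le> norm ((norm (f x))\<^sup>2 + (norm (g x))\<^sup>2)"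
  proof (rule AE_I2)
    fix x
    have "0 \<le> (norm (f x) - norm (g x))\<^sup>2 + norm (f x) * norm (g x)" by simp
    then have "norm (f x) * norm (g x) \<le> (norm (f x))\<^sup>2 + (norm (g x))\<^sup>2"
      by (simp add: power2_eq_square algebra_simps)
    then show "norm (f x \<bullet> g x) \<le> norm ((norm (f x))\<^sup>2 + (norm (g x))\<^sup>2)"
      using Cauchy_Schwarz_ineq2[of "f x" "g x"] by simp
  qed
qed (use assms in auto)

lemma L2_diff_integrable:
  fixes f g :: "'a \<Rightarrow> 'b::euclidean_space"
  assumes "f \<in> borel_measurable M" "integrable M (\<lambda>x. (norm (f x))\<^sup>2)"
    "g \<in> borel_measurable M" "integrable M (\<lambda>x. (norm (g x))\<^sup>2)"
  shows "integrable M (\<lambda>x. (norm (f x - g x))\<^sup>2)"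
proof -
  have "integrable M (\<lambda>x. (norm (f x))\<^sup>2 + (norm (g x))\<^sup>2 - 2 * (f x \<bullet> g x))"
    using assms L2_inner_integrable[OF assms] by simp
  then show ?thesis
    by (simp add: power2_norm_eq_inner inner_diff_left inner_diff_right inner_commute algebra_simps)
qed

text \<open>Young's inequality with a small weight \<open>e\<close> takes the place of the
  Cauchy-Schwarz inequality for integrals.\<close>

lemma L2_tendsto_inner:
  fixes f :: "'a \<Rightarrow> 'b::euclidean_space"
  assumes fk: "\<And>k. fk k \<in> borel_measurable M" "\<And>k. integrable M (\<lambda>x. (norm (fk k x))\<^sup>2)"
    and f: "f \<in> borel_measurable M" "integrable M (\<lambda>x. (norm (f x))\<^sup>2)"
    and lim: "(\<lambda>k. \<integral>x. (norm (fk k x - f x))\<^sup>2 \<partial>M) \<longlonglongrightarrow> 0"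
    and b: "b \<in> borel_measurable M" "integrable M (\<lambda>x. (norm (b x))\<^sup>2)"
  shows "(\<lambda>k. \<integral>x. fk k x \<bullet> b x \<partial>M) \<longlonglongrightarrow> (\<integral>x. f x \<bullet> b x \<partial>M)"
proof (rule LIMSEQ_I)
  fix r :: real assume r: "r > 0"
  define B where "B = (\<integral>x. (norm (b x))\<^sup>2 \<partial>M)"
  have B: "B \<ge> 0" by (simp add: B_def)
  \<comment> \<open>The second Young term becomes at most \<open>r / 2\<close>; the threshold
    \<open>r * e\<close> for the squared distance makes the other smaller than
    \<open>r / 2\<close>.\<close>
  define e where "e = r / (B + 1)"
  have e: "e > 0" "e * B \<le> r" using r B by (auto simp: e_def field_simps)
  have "\<forall>\<^sub>F k in sequentially. (\<integral>x. (norm (fk k x - f x))\<^sup>2 \<partial>M) < r * e"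
    using r e by (intro order_tendstoD(2)[OF lim]) auto
  then obtain N where N: "\<And>k. k \<ge> N \<Longrightarrow> (\<integral>x. (norm (fk k x - f x))\<^sup>2 \<partial>M) < r * e"
    unfolding eventually_sequentially by blast
  show "\<exists>N. \<forall>k\<ge>N. norm ((\<integral>x. fk k x \<bullet> b x \<partial>M) - (\<integral>x. f x \<bullet> b x \<partial>M)) < r"
  proof (intro exI[of _ N] allI impI)
    fix k assume k: "N \<le> k"
    have i1: "integrable M (\<lambda>x. fk k x \<bullet> b x)" by (rule L2_inner_integrable[OF fk b])
    have i2: "integrable M (\<lambda>x. f x \<bullet> b x)" by (rule L2_inner_integrable[OF f b])
    have i3: "integrable M (\<lambda>x. (norm (fk k x - f x))\<^sup>2)" by (rule L2_diff_integrable[OF fk f])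
    have "(\<integral>x. fk k x \<bullet> b x \<partial>M) - (\<integral>x. f x \<bullet> b x \<partial>M) = (\<integral>x. (fk k x - f x) \<bullet> b x \<partial>M)"
      using i1 i2 by (simp add: inner_diff_left Bochner_Integration.integral_diff)
    also have "\<bar>\<dots>\<bar> \<le> (\<integral>x. \<bar>(fk k x - f x) \<bullet> b x\<bar> \<partial>M)"
      by (rule integral_abs_bound)
    also have "\<dots> \<le> (\<integral>x. (norm (fk k x - f x))\<^sup>2 / (2 * e) + e / 2 * (norm (b x))\<^sup>2 \<partial>M)"
    proof (rule integral_mono')
      show "integrable M (\<lambda>x. (norm (fk k x - f x))\<^sup>2 / (2 * e) + e / 2 * (norm (b x))\<^sup>2)" using i3 b by simp
      fix x
      have "\<bar>(fk k x - f x) \<bullet> b x\<bar> \<le> norm (fk k x - f x) * norm (b x)" by (rule Cauchy_Schwarz_ineq2)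
      also have "\<dots> \<le> (norm (fk k x - f x))\<^sup>2 / (2 * e) + e / 2 * (norm (b x))\<^sup>2"
      proof -
        have "0 \<le> (norm (fk k x - f x) - e * norm (b x))\<^sup>2 / (2 * e)" using e by simp
        also have "\<dots> = (norm (fk k x - f x))\<^sup>2 / (2 * e) + e / 2 * (norm (b x))\<^sup>2 - norm (fk k x - f x) * norm (b x)"
          using e by (simp add: power2_eq_square field_simps)
        finally show ?thesis by simp
      qed
      finally show "\<bar>(fk k x - f x) \<bullet> b x\<bar> \<le> (norm (fk k x - f x))\<^sup>2 / (2 * e) + e / 2 * (norm (b x))\<^sup>2" .
      then show "0 \<le> (norm (fk k x - f x))\<^sup>2 / (2 * e) + e / 2 * (norm (b x))\<^sup>2" by (rule order_trans[OF abs_ge_zero])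
    qed
    also have "\<dots> = (\<integral>x. (norm (fk k x - f x))\<^sup>2 \<partial>M) / (2 * e) + e / 2 * B"
      using i3 b by (simp add: B_def Bochner_Integration.integral_add)
    also have "\<dots> < r * e / (2 * e) + r / 2"
      using N[OF k] e by (intro add_less_le_mono divide_strict_right_mono) auto
    also have "\<dots> = r" using e by simp
    finally show "norm ((\<integral>x. fk k x \<bullet> b x \<partial>M) - (\<integral>x. f x \<bullet> b x \<partial>M)) < r" by simp
  qed
qed

text \<open>The Riesz-Fischer theorem on a finite measure space: the sequence is also Cauchy in
  \<open>L\<^sup>1\<close>, hence has an almost everywhere convergent subsequence, and Fatou's lemma
  measures the distance to its limit.\<close>

lemma L2_complete:
  fixes f :: "nat \<Rightarrow> 'a \<Rightarrow> 'b::euclidean_space"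
  assumes fin: "finite_measure M"
    and f: "\<And>k. f k \<in> borel_measurable M" "\<And>k. integrable M (\<lambda>x. (norm (f k x))\<^sup>2)"
    and cau: "\<And>e. e > 0 \<Longrightarrow> \<exists>N. \<forall>k\<ge>N. \<forall>l\<ge>N. (\<integral>x. (norm (f k x - f l x))\<^sup>2 \<partial>M) < e"
  shows "\<exists>g. g \<in> borel_measurable M \<and> integrable M (\<lambda>x. (norm (g x))\<^sup>2) \<and>
    (\<lambda>k. \<integral>x. (norm (f k x - g x))\<^sup>2 \<partial>M) \<longlonglongrightarrow> 0"
proof -
  interpret finite_measure M by fact
  note [measurable] = f(1)
  have d2: "integrable M (\<lambda>x. (norm (f k x - f l x))\<^sup>2)" for k l
    by (rule L2_diff_integrable[OF f f])
  have bound1: "norm a \<le> e + (norm a)\<^sup>2 / e" if "e > 0" for a :: 'b and e :: real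
  proof (cases "norm a \<le> e")
    case True
    then show ?thesis using that by (simp add: add_increasing2)
  next
    case False
    then have "e * norm a \<le> norm a * norm a" by (intro mult_right_mono) auto
    then have "norm a \<le> (norm a)\<^sup>2 / e" using that by (simp add: power2_eq_square field_simps)
    then show ?thesis using that by simp
  qed
  have fi: "integrable M (f k)" for k
  proof (rule Bochner_Integration.integrable_bound[of M "\<lambda>x. 1 + (norm (f k x))\<^sup>2"])
    show "AE x in M. norm (f k x) \<le> norm (1 + (norm (f k x))\<^sup>2)"
      using bound1[of 1] by simp
  qed (use f in auto)
  define \<mu> where "\<mu> = measure M (space M)"
  have L1c: "\<exists>N. \<forall>i\<ge>N. \<forall>j\<ge>N. (LINT x|M. norm (f i x - f j x)) < \<epsilon>" if \<epsilon>: "\<epsilon> > 0" for \<epsilon>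
  proof -
    define e where "e = \<epsilon> / (2 * (\<mu> + 1))"
    have \<mu>: "\<mu> \<ge> 0" by (simp add: \<mu>_def)
    have e: "e > 0" "e * \<mu> \<le> \<epsilon> / 2" using \<epsilon> \<mu> by (auto simp: e_def field_simps)
    obtain N where N: "\<And>k l. k \<ge> N \<Longrightarrow> l \<ge> N \<Longrightarrow> (\<integral>x. (norm (f k x - f l x))\<^sup>2 \<partial>M) < e * (\<epsilon> / 2)"
      using cau[of "e * (\<epsilon> / 2)"] e \<epsilon> by auto
    show ?thesis
    proof (intro exI[of _ N] allI impI)
      fix i j assume ij: "N \<le> i" "N \<le> j"
      have "(LINT x|M. norm (f i x - f j x)) \<le> (LINT x|M. e + (norm (f i x - f j x))\<^sup>2 / e)"
        using bound1[OF e(1)] fi d2 by (intro integral_mono) auto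
      also have "\<dots> = e * \<mu> + (\<integral>x. (norm (f i x - f j x))\<^sup>2 \<partial>M) / e"
        using d2 by (simp add: Bochner_Integration.integral_add \<mu>_def)
      also have "\<dots> < \<epsilon> / 2 + \<epsilon> / 2"
        using e N[OF ij] by (intro add_le_less_mono) (auto simp: field_simps)
      finally show "(LINT x|M. norm (f i x - f j x)) < \<epsilon>" by simp
    qed
  qed
  obtain r :: "nat \<Rightarrow> nat" where r: "strict_mono r" "AE x in M. Cauchy (\<lambda>i. f (r i) x)"
    by (rule cauchy_L1_AE_cauchy_subseq[OF fi L1c])
  define g where "g x = lim (\<lambda>i. f (r i) x)" for x
  have gm[measurable]: "g \<in> borel_measurable M" unfolding g_def by measurable
  have conv: "AE x in M. (\<lambda>i. f (r i) x) \<longlonglongrightarrow> g x"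
    using r(2) by eventually_elim (simp add: g_def Cauchy_convergent_iff convergent_LIMSEQ_iff)
  \<comment> \<open>Fatou's lemma along the subsequence \<open>r\<close>, with \<open>k\<close>
    fixed; since \<open>k\<close> is arbitrary, the whole sequence is controlled.\<close>
  have est: "integrable M (\<lambda>x. (norm (f k x - g x))\<^sup>2) \<and> (\<integral>x. (norm (f k x - g x))\<^sup>2 \<partial>M) \<le> e"
    if e: "e > 0" and k: "\<And>l. l \<ge> N \<Longrightarrow> (\<integral>x. (norm (f k x - f l x))\<^sup>2 \<partial>M) < e" for e k N
  proof -
    have "(\<integral>\<^sup>+x. ennreal ((norm (f k x - g x))\<^sup>2) \<partial>M) = (\<integral>\<^sup>+x. liminf (\<lambda>i. ennreal ((norm (f k x - f (r i) x))\<^sup>2)) \<partial>M)"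
    proof (rule nn_integral_cong_AE)
      show "AE x in M. ennreal ((norm (f k x - g x))\<^sup>2) = liminf (\<lambda>i. ennreal ((norm (f k x - f (r i) x))\<^sup>2))"
        using conv
      proof eventually_elim
        case (elim x)
        have "(\<lambda>i. ennreal ((norm (f k x - f (r i) x))\<^sup>2)) \<longlonglongrightarrow> ennreal ((norm (f k x - g x))\<^sup>2)"
          by (intro tendsto_ennrealI tendsto_intros elim)
        from lim_imp_Liminf[OF sequentially_bot this] show ?case by (rule sym)
      qed
    qed
    also have "\<dots> \<le> liminf (\<lambda>i. \<integral>\<^sup>+x. ennreal ((norm (f k x - f (r i) x))\<^sup>2) \<partial>M)"
      by (rule nn_integral_liminf) measurable
    also have "\<dots> \<le> ennreal e"
    proof (rule Liminf_le)
      have "\<forall>\<^sub>F i in sequentially. (\<integral>\<^sup>+x. ennreal ((norm (f k x - f (r i) x))\<^sup>2) \<partial>M) \<le> ennreal e"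
        unfolding eventually_sequentially
      proof (intro exI[of _ N] allI impI)
        fix i assume "N \<le> i"
        then have "r i \<ge> N" using seq_suble[OF r(1), of i] by linarith
        then show "(\<integral>\<^sup>+x. ennreal ((norm (f k x - f (r i) x))\<^sup>2) \<partial>M) \<le> ennreal e"
          using k[of "r i"] by (subst nn_integral_eq_integral[OF d2]) (auto intro: ennreal_leI)
      qed
      then show "\<forall>\<^sub>F i in sequentially. (\<integral>\<^sup>+x. ennreal ((norm (f k x - f (r i) x))\<^sup>2) \<partial>M) \<le> ennreal e" .
    qed simp
    finally have le: "(\<integral>\<^sup>+x. ennreal ((norm (f k x - g x))\<^sup>2) \<partial>M) \<le> ennreal e" .
    have i: "integrable M (\<lambda>x. (norm (f k x - g x))\<^sup>2)"
    proof (rule integrableI_nonneg)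
      show "(\<integral>\<^sup>+x. ennreal ((norm (f k x - g x))\<^sup>2) \<partial>M) < \<infinity>"
        using le_less_trans[OF le, of \<infinity>] by simp
    qed auto
    then show ?thesis
      using le e by (simp add: nn_integral_eq_integral ennreal_le_iff)
  qed
  obtain N1 where N1: "\<And>k l. k \<ge> N1 \<Longrightarrow> l \<ge> N1 \<Longrightarrow> (\<integral>x. (norm (f k x - f l x))\<^sup>2 \<partial>M) < 1"
    using cau[of 1] by auto
  have "integrable M (\<lambda>x. (norm (f N1 x - g x))\<^sup>2)" using est[of 1 N1 N1] N1 by simp
  from L2_diff_integrable[OF f(1) f(2) _ this, of N1]
  have g2: "integrable M (\<lambda>x. (norm (g x))\<^sup>2)" by simp
  have "(\<lambda>k. \<integral>x. (norm (f k x - g x))\<^sup>2 \<partial>M) \<longlonglongrightarrow> 0"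
  proof (rule LIMSEQ_I)
    fix e :: real assume "e > 0"
    then obtain N where N: "\<And>k l. k \<ge> N \<Longrightarrow> l \<ge> N \<Longrightarrow> (\<integral>x. (norm (f k x - f l x))\<^sup>2 \<partial>M) < e / 2"
      using cau[of "e / 2"] by auto
    have "(\<integral>x. (norm (f k x - g x))\<^sup>2 \<partial>M) \<le> e / 2" if "k \<ge> N" for k
      using est[of "e / 2" N k] N[OF that] \<open>e > 0\<close> by simp
    then show "\<exists>N. \<forall>k\<ge>N. norm ((\<integral>x. (norm (f k x - g x))\<^sup>2 \<partial>M) - 0) < e"
      using \<open>e > 0\<close> by (intro exI[of _ N]) (fastforce simp: abs_of_nonneg)
  qed
  then show ?thesis using g2 gm by blast
qed

section \<open>The adjoint state\<close>

text \<open>Large values are replaced by 0, so the difference is either 0 or the negative of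
  \<open>g\<close> and the square of \<open>g\<close> is a majorant.\<close>

lemma tendsto_L2_cutoff:
  fixes g :: "'a \<Rightarrow> real"
  assumes [measurable]: "g \<in> borel_measurable M" and g: "integrable M (\<lambda>x. (g x)\<^sup>2)"
  shows "(\<lambda>k. \<integral>x. ((if \<bar>g x\<bar> \<le> real k then g x else 0) - g x)\<^sup>2 \<partial>M) \<longlonglongrightarrow> 0"
proof -
  have "(\<lambda>k. \<integral>x. ((if \<bar>g x\<bar> \<le> real k then g x else 0) - g x)\<^sup>2 \<partial>M) \<longlonglongrightarrow> (\<integral>x. 0 \<partial>M)"
  proof (rule integral_dominated_convergence[OF _ _ g])
    show "AE x in M. (\<lambda>k. ((if \<bar>g x\<bar> \<le> real k then g x else 0) - g x)\<^sup>2) \<longlonglongrightarrow> 0"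
    proof (rule AE_I2, rule tendsto_eventually)
      fix x
      show "\<forall>\<^sub>F k in sequentially. ((if \<bar>g x\<bar> \<le> real k then g x else 0) - g x)\<^sup>2 = 0"
        using eventually_ge_at_top[of "nat \<lceil>\<bar>g x\<bar>\<rceil>"]
        by eventually_elim (simp add: nat_ceiling_le_eq)
    qed
    show "AE x in M. norm (((if \<bar>g x\<bar> \<le> real k then g x else 0) - g x)\<^sup>2) \<le> (g x)\<^sup>2" for k
      by (rule AE_I2) simp
  qed measurable
  then show ?thesis by simp
qed

text \<open>The adjoint state is the \<open>H\<^sup>1\<close> limit of the solutions for the truncated right-hand sides,
  to which the given solution operator for the self-adjoint linearized equation applies.\<close>

lemma adjoint_state_exists:
  fixes \<Omega> :: "(real^'n) set" and P :: "(real^'n \<Rightarrow> real) set"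
  assumes \<Omega>: "open \<Omega>" "bounded \<Omega>"
    and a: "a \<in> borel_measurable (lebesgue_on \<Omega>)" "AE x in lebesgue_on \<Omega>. norm (a x) \<le> Ma"
    and P: "\<And>h. h \<in> Lspace \<infinity> (lebesgue_on \<Omega>) \<Longrightarrow> h \<in> P" "\<And>h. h \<in> P \<Longrightarrow> integrable (lebesgue_on \<Omega>) h"
    and Z: "\<And>h. h \<in> P \<Longrightarrow> (L h)-lipschitz_on UNIV (Z h)" "\<And>h x. h \<in> P \<Longrightarrow> x \<notin> \<Omega> \<Longrightarrow> Z h x = 0"
    and G: "\<And>h. h \<in> P \<Longrightarrow> has_weak_grad \<Omega> (Z h) (G h)"
      "\<And>h. h \<in> P \<Longrightarrow> AE x in lebesgue_on \<Omega>. norm (G h x) \<le> B h"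
    and eq: "\<And>h \<psi>. h \<in> P \<Longrightarrow> \<psi> \<in> test_functions \<Omega> \<Longrightarrow>
      (\<integral>x. dflux (a x) (G h x) \<bullet> grad \<psi> x \<partial>lebesgue_on \<Omega>) = (\<integral>x. h x * \<psi> x \<partial>lebesgue_on \<Omega>)"
    and g: "g \<in> borel_measurable (lebesgue_on \<Omega>)" "integrable (lebesgue_on \<Omega>) (\<lambda>x. (g x)\<^sup>2)"
  shows "\<exists>\<phi>\<in>W1_0 \<Omega> 2. (\<forall>\<psi>\<in>test_functions \<Omega>.
      (\<integral>x. dflux (a x) (wgrad \<Omega> \<phi> x) \<bullet> grad \<psi> x \<partial>lebesgue_on \<Omega>) = (\<integral>x. g x * \<psi> x \<partial>lebesgue_on \<Omega>)) \<and>
    integrable (lebesgue_on \<Omega>) (\<lambda>x. (\<phi> x)\<^sup>2) \<and>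
    (\<forall>h\<in>P. integrable (lebesgue_on \<Omega>) (\<lambda>x. (h x)\<^sup>2) \<longrightarrow>
      (\<integral>x. \<phi> x * h x \<partial>lebesgue_on \<Omega>) = (\<integral>x. g x * Z h x \<partial>lebesgue_on \<Omega>))"
proof -
  let ?M = "lebesgue_on \<Omega>"
  have fm: "finite_measure ?M" using \<Omega> by (intro finite_measure_lebesgue_on lmeasurable_open)
  interpret finite_measure ?M by fact
  note [measurable] = a(1) g(1)
  have Gm: "G h \<in> borel_measurable ?M" if "h \<in> P" for h
    by (rule has_weak_grad_measurable(2)[OF \<Omega>(1) G(1)[OF that]])
  have Zc: "continuous_on A (Z h)" if "h \<in> P" for h A
    using lipschitz_on_continuous_on[OF Z(1)[OF that]] continuous_on_subset by blast
  have Zm: "Z h \<in> borel_measurable ?M" if "h \<in> P" for h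
    by (rule continuous_measurable_lebesgue[OF Zc[OF that]])
  have bounded_L2: "integrable ?M (\<lambda>x. (norm (f x))\<^sup>2)"
    if "f \<in> borel_measurable ?M" "AE x in ?M. norm (f x) \<le> b" for f :: "real^'n \<Rightarrow> 'c::euclidean_space" and b
  proof (rule integrable_const_bound[of _ "b\<^sup>2"])
    show "AE x in ?M. norm ((norm (f x))\<^sup>2) \<le> b\<^sup>2"
      using that(2) by eventually_elim (simp add: power_mono)
  qed (use that(1) in measurable)
  have Zb: "\<exists>b. \<forall>x. \<bar>Z h x\<bar> \<le> b" if h: "h \<in> P" for h
  proof -
    have "bounded (Z h ` closure \<Omega>)"
      using \<Omega>(2) by (intro compact_imp_bounded compact_continuous_image Zc[OF h])
        (auto simp: compact_eq_bounded_closed intro: bounded_closure)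
    then obtain b where b: "\<And>x. x \<in> closure \<Omega> \<Longrightarrow> \<bar>Z h x\<bar> \<le> b" "b > 0" unfolding bounded_pos by auto
    have "\<bar>Z h x\<bar> \<le> b" for x
      using b(1)[of x] b(2) Z(2)[OF h, of x] closure_subset[of \<Omega>] by (cases "x \<in> \<Omega>") auto
    then show ?thesis by blast
  qed
  have Z2: "integrable ?M (\<lambda>x. (norm (Z h x))\<^sup>2)" if h: "h \<in> P" for h
  proof -
    obtain b where b: "\<forall>x. \<bar>Z h x\<bar> \<le> b" using Zb[OF h] by blast
    show ?thesis by (rule bounded_L2[OF Zm[OF h], of b]) (use b in simp)
  qed
  have G2: "integrable ?M (\<lambda>x. (norm (G h x))\<^sup>2)" if h: "h \<in> P" for h
    by (rule bounded_L2[OF Gm[OF h] G(2)[OF h]])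
  have AGi: "integrable ?M (\<lambda>x. dflux (a x) (G h x))" if h: "h \<in> P" for h
  proof (rule integrable_const_bound[of _ "2 * B h"])
    show "AE x in ?M. norm (dflux (a x) (G h x)) \<le> 2 * B h"
      using G(2)[OF h]
    proof eventually_elim
      case (elim x)
      then show ?case using norm_dflux_le[of "a x" "G h x"] by linarith
    qed
    show "(\<lambda>x. dflux (a x) (G h x)) \<in> borel_measurable ?M" by (rule measurable_dflux[OF a(1) Gm[OF h]])
  qed
  \<comment> \<open>Each equation is tested with the solution for the other right-hand side; with
    \<open>dflux_sym\<close> this is the self-adjointness behind \<open>dual\<close>.\<close>
  have cross: "(\<integral>x. dflux (a x) (G h x) \<bullet> G l x \<partial>?M) = (\<integral>x. h x * Z l x \<partial>?M)" if "h \<in> P" "l \<in> P" for h l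
    by (rule weak_equation_test_lipschitz(1)[OF \<Omega> Z[OF that(2)] G[OF that(2)] AGi[OF that(1)] P(2)[OF that(1)] eq[OF that(1)]])
  define gk where "gk k x = (if \<bar>g x\<bar> \<le> real k then g x else 0)" for k :: nat and x
  have gkm[measurable]: "gk k \<in> borel_measurable ?M" for k unfolding gk_def by measurable
  have gkb: "AE x in ?M. norm (gk k x) \<le> real k" for k by (rule AE_I2) (simp add: gk_def)
  have gkP: "gk k \<in> P" for k by (rule P(1)) (use gkb gkm Lspace_infty_iff in blast)
  have gk2: "integrable ?M (\<lambda>x. (norm (gk k x))\<^sup>2)" for k by (rule bounded_L2[OF gkm gkb])
  have g2: "integrable ?M (\<lambda>x. (norm (g x))\<^sup>2)" using g(2) by simp
  have gklim: "(\<lambda>k. \<integral>x. (norm (gk k x - g x))\<^sup>2 \<partial>?M) \<longlonglongrightarrow> 0"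
    using tendsto_L2_cutoff[OF g] by (simp add: gk_def)
  define \<phi> where "\<phi> k = Z (gk k)" for k
  define \<Gamma> where "\<Gamma> k = G (gk k)" for k
  note \<phi>m[measurable] = Zm[OF gkP, folded \<phi>_def] and \<Gamma>m[measurable] = Gm[OF gkP, folded \<Gamma>_def]
  note \<phi>2 = Z2[OF gkP, folded \<phi>_def] and \<Gamma>2 = G2[OF gkP, folded \<Gamma>_def]
  obtain R where R: "R > 0" "\<And>x. x \<in> \<Omega> \<Longrightarrow> norm x \<le> R" using \<Omega>(2) unfolding bounded_pos by blast
  \<comment> \<open>The ellipticity constant from \<open>dflux_coercive\<close> for gradients
    bounded by \<open>Ma\<close>.\<close>
  define c where "c = 1 / (sqrt (1 + Ma\<^sup>2)) ^ 3"
  have c: "c > 0" unfolding c_def by (simp add: add_pos_nonneg)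
  define d where "d k l = (\<integral>x. (gk k x - gk l x)\<^sup>2 \<partial>?M)" for k l
  have dn: "d k l \<ge> 0" for k l by (simp add: d_def)
  \<comment> \<open>By linearity the difference of two solutions solves the equation for the
    difference of the data. The Lipschitz and gradient bounds of the single solutions may grow with
    \<open>k\<close>, but they do not enter these constants.\<close>
  have diffP: "(\<integral>x. (norm (\<Gamma> k x - \<Gamma> l x))\<^sup>2 \<partial>?M) \<le> (4 * R\<^sup>2 / c\<^sup>2) * d k l \<and>
      (\<integral>x. (norm (\<phi> k x - \<phi> l x))\<^sup>2 \<partial>?M) \<le> (4 * R\<^sup>2) * ((4 * R\<^sup>2 / c\<^sup>2) * d k l)" for k l
  proof -
    define w where "w x = \<phi> k x - \<phi> l x" for x
    define \<Delta> where "\<Delta> x = \<Gamma> k x - \<Gamma> l x" for x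
    define h where "h x = gk k x - gk l x" for x
    have wl: "(L (gk k) + L (gk l))-lipschitz_on UNIV w"
      unfolding w_def \<phi>_def by (intro lipschitz_on_diff Z(1) gkP)
    have w0: "w x = 0" if "x \<notin> \<Omega>" for x using that by (simp add: w_def \<phi>_def Z(2)[OF gkP])
    have wg: "has_weak_grad \<Omega> w \<Delta>"
      using has_weak_grad_lincomb[OF \<Omega>(1) G(1)[OF gkP[of k]] G(1)[OF gkP[of l]], of 1 "-1"]
      by (simp add: w_def[abs_def] \<Delta>_def[abs_def] \<phi>_def \<Gamma>_def)
    have \<Delta>b: "AE x in ?M. norm (\<Delta> x) \<le> B (gk k) + B (gk l)"
      using G(2)[OF gkP[of k]] G(2)[OF gkP[of l]]
    proof eventually_elim
      case (elim x)
      then show ?case using norm_triangle_ineq4[of "\<Gamma> k x" "\<Gamma> l x"] by (simp add: \<Delta>_def \<Gamma>_def)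
    qed
    have Ai: "integrable ?M (\<lambda>x. dflux (a x) (\<Delta> x))"
      using Bochner_Integration.integrable_diff[OF AGi[OF gkP[of k]] AGi[OF gkP[of l]]]
      by (simp add: \<Delta>_def \<Gamma>_def dflux_diff)
    have hi: "integrable ?M h" unfolding h_def by (intro Bochner_Integration.integrable_diff P(2) gkP)
    have weq: "(\<integral>x. dflux (a x) (\<Delta> x) \<bullet> grad \<psi> x \<partial>?M) = (\<integral>x. h x * \<psi> x \<partial>?M)"
      if \<psi>: "\<psi> \<in> test_functions \<Omega>" for \<psi>
    proof -
      have i1: "integrable ?M (\<lambda>x. dflux (a x) (G (gk j) x) \<bullet> grad \<psi> x)" for j
        by (rule test_functions_integrable_inner[OF \<psi> \<Omega>(1) loc_integrable_integrable[OF AGi[OF gkP] \<Omega>(1)]])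
      have i2: "integrable ?M (\<lambda>x. gk j x * \<psi> x)" for j
        using test_functions_integrable[OF \<psi> \<Omega>(1) loc_integrable_integrable[OF P(2)[OF gkP] \<Omega>(1)]]
        by (simp add: mult.commute)
      have "(\<integral>x. dflux (a x) (\<Delta> x) \<bullet> grad \<psi> x \<partial>?M)
        = (\<integral>x. dflux (a x) (G (gk k) x) \<bullet> grad \<psi> x \<partial>?M) - (\<integral>x. dflux (a x) (G (gk l) x) \<bullet> grad \<psi> x \<partial>?M)"
        unfolding \<Delta>_def \<Gamma>_def dflux_diff inner_diff_left by (rule Bochner_Integration.integral_diff[OF i1 i1])
      also have "\<dots> = (\<integral>x. gk k x * \<psi> x \<partial>?M) - (\<integral>x. gk l x * \<psi> x \<partial>?M)"
        by (simp only: eq[OF gkP \<psi>])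
      also have "\<dots> = (\<integral>x. h x * \<psi> x \<partial>?M)"
        unfolding h_def left_diff_distrib by (rule Bochner_Integration.integral_diff[symmetric, OF i2 i2])
      finally show ?thesis .
    qed
    have en: "(\<integral>x. dflux (a x) (\<Delta> x) \<bullet> \<Delta> x \<partial>?M) = (\<integral>x. h x * w x \<partial>?M)"
      by (rule weak_equation_test_lipschitz(1)[OF \<Omega> wl w0 wg \<Delta>b Ai hi weq])
    have po: "(\<integral>x. (w x)\<^sup>2 \<partial>?M) \<le> 4 * R\<^sup>2 * (\<integral>x. (norm (\<Delta> x))\<^sup>2 \<partial>?M)"
      by (rule poincare[OF \<Omega> R(2) wl w0 wg \<Delta>b])
    have \<Delta>2: "integrable ?M (\<lambda>x. (norm (\<Delta> x))\<^sup>2)"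
      unfolding \<Delta>_def by (rule L2_diff_integrable[OF \<Gamma>m \<Gamma>2 \<Gamma>m \<Gamma>2])
    have w2: "integrable ?M (\<lambda>x. (w x)\<^sup>2)"
      using L2_diff_integrable[OF \<phi>m[of k] \<phi>2[of k] \<phi>m[of l] \<phi>2[of l]] by (simp add: w_def)
    have h2: "integrable ?M (\<lambda>x. (h x)\<^sup>2)"
      using L2_diff_integrable[OF gkm[of k] gk2[of k] gkm[of l] gk2[of l]] by (simp add: h_def)
    have \<Delta>m[measurable]: "\<Delta> \<in> borel_measurable ?M" unfolding \<Delta>_def[abs_def] by measurable
    have "c * (\<integral>x. (norm (\<Delta> x))\<^sup>2 \<partial>?M) = (\<integral>x. c * (norm (\<Delta> x))\<^sup>2 \<partial>?M)" by simp
    also have "\<dots> \<le> (\<integral>x. dflux (a x) (\<Delta> x) \<bullet> \<Delta> x \<partial>?M)"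
    proof (rule integral_mono_AE)
      show "integrable ?M (\<lambda>x. dflux (a x) (\<Delta> x) \<bullet> \<Delta> x)"
      proof (rule Bochner_Integration.integrable_bound[of _ "\<lambda>x. 2 * (norm (\<Delta> x))\<^sup>2"])
        show "AE x in ?M. norm (dflux (a x) (\<Delta> x) \<bullet> \<Delta> x) \<le> norm (2 * (norm (\<Delta> x))\<^sup>2)"
        proof (rule AE_I2)
          fix x
          have "\<bar>dflux (a x) (\<Delta> x) \<bullet> \<Delta> x\<bar> \<le> norm (dflux (a x) (\<Delta> x)) * norm (\<Delta> x)" by (rule Cauchy_Schwarz_ineq2)
          also have "\<dots> \<le> (2 * norm (\<Delta> x)) * norm (\<Delta> x)" by (intro mult_right_mono norm_dflux_le) simp
          finally show "norm (dflux (a x) (\<Delta> x) \<bullet> \<Delta> x) \<le> norm (2 * (norm (\<Delta> x))\<^sup>2)" by (simp add: power2_eq_square)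
        qed
        show "(\<lambda>x. dflux (a x) (\<Delta> x) \<bullet> \<Delta> x) \<in> borel_measurable ?M"
          by (intro borel_measurable_inner measurable_dflux a(1) \<Delta>m)
      qed (use \<Delta>2 in simp)
      show "AE x in ?M. c * (norm (\<Delta> x))\<^sup>2 \<le> dflux (a x) (\<Delta> x) \<bullet> \<Delta> x"
        using a(2)
      proof eventually_elim
        case (elim x)
        from dflux_coercive[OF this, of "\<Delta> x"] show ?case by (simp add: c_def)
      qed
    qed (use \<Delta>2 in simp)
    also have "\<dots> = (\<integral>x. h x * w x \<partial>?M)" by (rule en)
    also have "\<dots> \<le> (\<integral>x. 2 * R\<^sup>2 / c * (h x)\<^sup>2 + c / (8 * R\<^sup>2) * (w x)\<^sup>2 \<partial>?M)"
    proof (rule integral_mono')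
      fix x
      \<comment> \<open>Young's weight: after the Poincare inequality the term in \<open>w\<close>
        is at most half of the coercivity term and is absorbed.\<close>
      define s where "s = 2 * R\<^sup>2 / c"
      have s: "s > 0" "c / (8 * R\<^sup>2) = 1 / (4 * s)" using c R(1) by (auto simp: s_def field_simps)
      have "0 \<le> (2 * s * h x - w x)\<^sup>2 / (4 * s)" using s(1) by simp
      also have "\<dots> = s * (h x)\<^sup>2 + 1 / (4 * s) * (w x)\<^sup>2 - h x * w x"
        using s(1) by (simp add: power2_eq_square field_simps)
      finally show "h x * w x \<le> 2 * R\<^sup>2 / c * (h x)\<^sup>2 + c / (8 * R\<^sup>2) * (w x)\<^sup>2"
        unfolding s(2) s_def[symmetric] by simp
      show "0 \<le> 2 * R\<^sup>2 / c * (h x)\<^sup>2 + c / (8 * R\<^sup>2) * (w x)\<^sup>2" using c by simp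
    qed (use h2 w2 in simp)
    also have "\<dots> = 2 * R\<^sup>2 / c * d k l + c / (8 * R\<^sup>2) * (\<integral>x. (w x)\<^sup>2 \<partial>?M)"
      using h2 w2 by (simp add: Bochner_Integration.integral_add d_def h_def)
    also have "\<dots> \<le> 2 * R\<^sup>2 / c * d k l + c / (8 * R\<^sup>2) * (4 * R\<^sup>2 * (\<integral>x. (norm (\<Delta> x))\<^sup>2 \<partial>?M))"
      using po c by (intro add_left_mono mult_left_mono) auto
    also have "\<dots> = 2 * R\<^sup>2 / c * d k l + c / 2 * (\<integral>x. (norm (\<Delta> x))\<^sup>2 \<partial>?M)"
      using R(1) by (simp add: field_simps)
    finally have "c / 2 * (\<integral>x. (norm (\<Delta> x))\<^sup>2 \<partial>?M) \<le> 2 * R\<^sup>2 / c * d k l" by simp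
    then have e1: "(\<integral>x. (norm (\<Delta> x))\<^sup>2 \<partial>?M) \<le> (4 * R\<^sup>2 / c\<^sup>2) * d k l"
      using c by (simp add: field_simps power2_eq_square)
    then have "4 * R\<^sup>2 * (\<integral>x. (norm (\<Delta> x))\<^sup>2 \<partial>?M) \<le> (4 * R\<^sup>2) * ((4 * R\<^sup>2 / c\<^sup>2) * d k l)"
      by (intro mult_left_mono) auto
    then have "(\<integral>x. (w x)\<^sup>2 \<partial>?M) \<le> (4 * R\<^sup>2) * ((4 * R\<^sup>2 / c\<^sup>2) * d k l)" using po by linarith
    then show ?thesis using e1 by (simp add: w_def \<Delta>_def)
  qed
  have dcau: "\<exists>N. \<forall>k\<ge>N. \<forall>l\<ge>N. C * d k l < e" if "e > 0" "C > 0" for C e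
  proof -
    have "\<forall>\<^sub>F k in sequentially. (\<integral>x. (norm (gk k x - g x))\<^sup>2 \<partial>?M) < e / (4 * C)"
      using that by (intro order_tendstoD(2)[OF gklim]) auto
    then obtain N where N: "\<And>k. k \<ge> N \<Longrightarrow> (\<integral>x. (norm (gk k x - g x))\<^sup>2 \<partial>?M) < e / (4 * C)"
      unfolding eventually_sequentially by blast
    show ?thesis
    proof (intro exI[of _ N] allI impI)
      fix k l assume kl: "N \<le> k" "N \<le> l"
      have i: "integrable ?M (\<lambda>x. (norm (gk j x - g x))\<^sup>2)" for j
        by (rule L2_diff_integrable[OF gkm gk2 g(1) g2])
      have "d k l \<le> (\<integral>x. 2 * (norm (gk k x - g x))\<^sup>2 + 2 * (norm (gk l x - g x))\<^sup>2 \<partial>?M)"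
        unfolding d_def
      proof (rule integral_mono')
        fix x
        have "0 \<le> ((gk k x - g x) + (gk l x - g x))\<^sup>2" by simp
        then show "(gk k x - gk l x)\<^sup>2 \<le> 2 * (norm (gk k x - g x))\<^sup>2 + 2 * (norm (gk l x - g x))\<^sup>2"
          by (simp add: power2_eq_square algebra_simps)
      qed (use i in auto)
      also have "\<dots> = 2 * (\<integral>x. (norm (gk k x - g x))\<^sup>2 \<partial>?M) + 2 * (\<integral>x. (norm (gk l x - g x))\<^sup>2 \<partial>?M)"
        using i by (simp add: Bochner_Integration.integral_add)
      also have "\<dots> < 2 * (e / (4 * C)) + 2 * (e / (4 * C))"
        using N[OF kl(1)] N[OF kl(2)] by linarith
      finally have "d k l < e / C" by simp
      then show "C * d k l < e" using that(2) by (simp add: pos_less_divide_eq mult.commute)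
    qed
  qed
  have C1: "4 * R\<^sup>2 / c\<^sup>2 > 0" "(4 * R\<^sup>2) * (4 * R\<^sup>2 / c\<^sup>2) > 0" using R(1) c by auto
  have \<Gamma>c: "\<exists>N. \<forall>k\<ge>N. \<forall>l\<ge>N. (\<integral>x. (norm (\<Gamma> k x - \<Gamma> l x))\<^sup>2 \<partial>?M) < e" if "e > 0" for e
    using dcau[OF that C1(1)] diffP by (meson le_less_trans)
  have "\<exists>g. g \<in> borel_measurable ?M \<and> integrable ?M (\<lambda>x. (norm (g x))\<^sup>2) \<and>
    (\<lambda>k. \<integral>x. (norm (\<Gamma> k x - g x))\<^sup>2 \<partial>?M) \<longlonglongrightarrow> 0"
    by (rule L2_complete[OF fm \<Gamma>m \<Gamma>2]) (rule \<Gamma>c)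
  then obtain \<Gamma>' where
    "\<Gamma>' \<in> borel_measurable ?M \<and> integrable ?M (\<lambda>x. (norm (\<Gamma>' x))\<^sup>2) \<and>
     (\<lambda>k. \<integral>x. (norm (\<Gamma> k x - \<Gamma>' x))\<^sup>2 \<partial>?M) \<longlonglongrightarrow> 0" by (elim exE)
  then have \<Gamma>'m[measurable]: "\<Gamma>' \<in> borel_measurable ?M" and \<Gamma>'2: "integrable ?M (\<lambda>x. (norm (\<Gamma>' x))\<^sup>2)"
    and \<Gamma>'l: "(\<lambda>k. \<integral>x. (norm (\<Gamma> k x - \<Gamma>' x))\<^sup>2 \<partial>?M) \<longlonglongrightarrow> 0" by simp_all
  have \<phi>c: "\<exists>N. \<forall>k\<ge>N. \<forall>l\<ge>N. (\<integral>x. (norm (\<phi> k x - \<phi> l x))\<^sup>2 \<partial>?M) < e" if "e > 0" for e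
    using dcau[OF that C1(2)] diffP unfolding mult.assoc by (meson le_less_trans)
  have "\<exists>g. g \<in> borel_measurable ?M \<and> integrable ?M (\<lambda>x. (norm (g x))\<^sup>2) \<and>
    (\<lambda>k. \<integral>x. (norm (\<phi> k x - g x))\<^sup>2 \<partial>?M) \<longlonglongrightarrow> 0"
    by (rule L2_complete[OF fm \<phi>m \<phi>2]) (rule \<phi>c)
  then obtain \<phi>' where
    "\<phi>' \<in> borel_measurable ?M \<and> integrable ?M (\<lambda>x. (norm (\<phi>' x))\<^sup>2) \<and>
     (\<lambda>k. \<integral>x. (norm (\<phi> k x - \<phi>' x))\<^sup>2 \<partial>?M) \<longlonglongrightarrow> 0" by (elim exE)
  then have \<phi>'m[measurable]: "\<phi>' \<in> borel_measurable ?M" and \<phi>'2: "integrable ?M (\<lambda>x. (norm (\<phi>' x))\<^sup>2)"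
    and \<phi>'l: "(\<lambda>k. \<integral>x. (norm (\<phi> k x - \<phi>' x))\<^sup>2 \<partial>?M) \<longlonglongrightarrow> 0" by simp_all
  note lim\<Gamma> = L2_tendsto_inner[OF \<Gamma>m \<Gamma>2 \<Gamma>'m \<Gamma>'2 \<Gamma>'l]
  note lim\<phi> = L2_tendsto_inner[OF \<phi>m \<phi>2 \<phi>'m \<phi>'2 \<phi>'l, unfolded inner_real_def]
  note limg = L2_tendsto_inner[OF gkm gk2 g(1) g2 gklim, unfolded inner_real_def]
  have L2i: "integrable ?M f" if "f \<in> borel_measurable ?M" "integrable ?M (\<lambda>x. (norm (f x))\<^sup>2)"
    for f :: "real^'n \<Rightarrow> 'c::euclidean_space"
    by (rule Lspace_integrable[OF fm, of 2]) (use that in \<open>simp_all add: Lspace_2_iff\<close>)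
  have test2: "\<psi> \<in> borel_measurable ?M" "integrable ?M (\<lambda>x. (norm (\<psi> x))\<^sup>2)"
    if \<psi>t: "\<psi> \<in> test_functions \<Omega>" for \<psi>
  proof -
    show m: "\<psi> \<in> borel_measurable ?M"
      by (intro continuous_measurable_lebesgue test_functions_continuous[OF \<psi>t])
    obtain b where "\<And>x. \<bar>\<psi> x\<bar> \<le> b" using test_functions_bounded[OF \<psi>t] by metis
    then show "integrable ?M (\<lambda>x. (norm (\<psi> x))\<^sup>2)" by (intro bounded_L2[OF m, of b]) simp
  qed
  have wg: "has_weak_grad \<Omega> \<phi>' \<Gamma>'"
  proof (rule has_weak_gradI_component[OF \<Omega>(1)])
    show "loc_integrable \<Omega> \<phi>'" "loc_integrable \<Omega> \<Gamma>'"
      by (intro loc_integrable_integrable[OF L2i \<Omega>(1)] \<phi>'m \<phi>'2 \<Gamma>'m \<Gamma>'2)+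
    fix \<psi> i assume \<psi>: "\<psi> \<in> test_functions \<Omega>"
    have 1: "(\<lambda>k. \<integral>x. \<phi> k x * pd i \<psi> x \<partial>?M) \<longlonglongrightarrow> (\<integral>x. \<phi>' x * pd i \<psi> x \<partial>?M)"
      by (rule lim\<phi>[OF test2[OF test_functions_pd[OF \<psi>]]])
    have v: "(\<lambda>x. \<psi> x *\<^sub>R axis i (1::real)) \<in> borel_measurable ?M"
      "integrable ?M (\<lambda>x. (norm (\<psi> x *\<^sub>R axis i (1::real)))\<^sup>2)"
      using test2[OF \<psi>] by (simp_all add: power_mult_distrib)
    have "(\<lambda>k. \<integral>x. \<Gamma> k x \<bullet> (\<psi> x *\<^sub>R axis i 1) \<partial>?M) \<longlonglongrightarrow> (\<integral>x. \<Gamma>' x \<bullet> (\<psi> x *\<^sub>R axis i 1) \<partial>?M)"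
      by (rule lim\<Gamma>[OF v])
    then have 2: "(\<lambda>k. \<integral>x. \<psi> x * \<Gamma> k x $ i \<partial>?M) \<longlonglongrightarrow> (\<integral>x. \<psi> x * \<Gamma>' x $ i \<partial>?M)"
      by (simp add: inner_axis)
    have 3: "(\<integral>x. \<phi> k x * pd i \<psi> x \<partial>?M) = - (\<integral>x. \<psi> x * \<Gamma> k x $ i \<partial>?M)" for k
      unfolding \<phi>_def \<Gamma>_def by (rule has_weak_grad_component[OF \<Omega>(1) G(1)[OF gkP] \<psi>])
    show "(\<integral>x. \<phi>' x * pd i \<psi> x \<partial>?M) = - (\<integral>x. \<psi> x * \<Gamma>' x $ i \<partial>?M)"
      by (rule LIMSEQ_unique[OF 1]) (unfold 3, intro tendsto_minus 2)
  qed
  note wa = wgrad_AE_eq[OF \<Omega>(1) wg]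
  have wm[measurable]: "wgrad \<Omega> \<phi>' \<in> borel_measurable ?M"
    by (rule has_weak_grad_measurable(2)[OF \<Omega>(1) has_weak_grad_wgrad[OF wg]])
  have Lsp2: "f \<in> Lspace 2 ?M" if "f \<in> borel_measurable ?M" "integrable ?M (\<lambda>x. (norm (f x))\<^sup>2)"
    for f :: "real^'n \<Rightarrow> 'c::euclidean_space"
    using that by (simp add: Lspace_2_iff)
  have W1I: "f \<in> W1 \<Omega> 2" if "has_weak_grad \<Omega> f F" "f \<in> borel_measurable ?M" "integrable ?M (\<lambda>x. (norm (f x))\<^sup>2)"
    "F \<in> borel_measurable ?M" "integrable ?M (\<lambda>x. (norm (F x))\<^sup>2)" for f F
  proof -
    have "wgrad \<Omega> f \<in> Lspace 2 ?M"
      by (rule Lspace_cong_AE[OF Lsp2[OF that(4,5)]])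
        (use wgrad_AE_eq[OF \<Omega>(1) that(1)] has_weak_grad_measurable(2)[OF \<Omega>(1) has_weak_grad_wgrad[OF that(1)]]
          in \<open>auto elim: eventually_mono\<close>)
    then show ?thesis using Lsp2[OF that(2,3)] that(1) unfolding W1_def by blast
  qed
  have \<phi>'W: "\<phi>' \<in> W1 \<Omega> 2" by (rule W1I[OF wg \<phi>'m \<phi>'2 \<Gamma>'m \<Gamma>'2])
  have \<phi>W: "\<phi> k \<in> W1 \<Omega> 2" for k
    unfolding \<phi>_def
    by (rule W1I[OF G(1)[OF gkP] Zm[OF gkP] Z2[OF gkP] Gm[OF gkP] G2[OF gkP]])
  have normlim: "(\<lambda>k. W1_norm \<Omega> 2 (\<phi> k - \<phi>')) \<longlonglongrightarrow> 0"
  proof -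
    have ae: "AE x in ?M. wgrad \<Omega> (\<phi> k - \<phi>') x = \<Gamma> k x - \<Gamma>' x"
      and wmk: "wgrad \<Omega> (\<phi> k - \<phi>') \<in> borel_measurable ?M" for k
    proof -
      have w: "has_weak_grad \<Omega> (\<phi> k - \<phi>') (\<lambda>x. \<Gamma> k x - \<Gamma>' x)"
        using has_weak_grad_lincomb[OF \<Omega>(1) G(1)[OF gkP[of k]] wg, of 1 "-1"]
        by (simp add: fun_diff_def \<phi>_def \<Gamma>_def)
      show "AE x in ?M. wgrad \<Omega> (\<phi> k - \<phi>') x = \<Gamma> k x - \<Gamma>' x" by (rule wgrad_AE_eq[OF \<Omega>(1) w])
      show "wgrad \<Omega> (\<phi> k - \<phi>') \<in> borel_measurable ?M"
        by (rule has_weak_grad_measurable(2)[OF \<Omega>(1) has_weak_grad_wgrad[OF w]])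
    qed
    have "W1_norm \<Omega> 2 (\<phi> k - \<phi>') = sqrt (\<integral>x. (norm (\<phi> k x - \<phi>' x))\<^sup>2 \<partial>?M) + sqrt (\<integral>x. (norm (\<Gamma> k x - \<Gamma>' x))\<^sup>2 \<partial>?M)" for k
    proof -
      have "(\<integral>x. (norm (wgrad \<Omega> (\<phi> k - \<phi>') x))\<^sup>2 \<partial>?M) = (\<integral>x. (norm (\<Gamma> k x - \<Gamma>' x))\<^sup>2 \<partial>?M)"
      proof (rule integral_cong_AE)
        show "AE x in ?M. (norm (wgrad \<Omega> (\<phi> k - \<phi>') x))\<^sup>2 = (norm (\<Gamma> k x - \<Gamma>' x))\<^sup>2"
          using ae[of k] by eventually_elim simp
        show "(\<lambda>x. (norm (wgrad \<Omega> (\<phi> k - \<phi>') x))\<^sup>2) \<in> borel_measurable ?M"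
          using wmk[of k] by measurable
      qed measurable
      then show ?thesis by (simp add: W1_norm_def Lnorm_2)
    qed
    moreover have "(\<lambda>k. sqrt (\<integral>x. (norm (\<phi> k x - \<phi>' x))\<^sup>2 \<partial>?M) + sqrt (\<integral>x. (norm (\<Gamma> k x - \<Gamma>' x))\<^sup>2 \<partial>?M)) \<longlonglongrightarrow> sqrt 0 + sqrt 0"
      by (intro tendsto_add tendsto_real_sqrt \<phi>'l \<Gamma>'l)
    ultimately show ?thesis by simp
  qed
  \<comment> \<open>The approximants \<open>\<phi> k\<close> are continuous and vanish on the whole
    frontier, so they witness the zero trace with boundary norms equal to 0.\<close>
  have tr: "has_trace \<Omega> 2 \<phi>' (\<lambda>x. 0)"
    unfolding has_trace_def
  proof (intro exI[of _ \<phi>] conjI allI normlim \<phi>W)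
    have fr0: "\<phi> k x = 0" if "x \<in> frontier \<Omega>" for k x
    proof -
      have "x \<notin> \<Omega>" using that \<Omega>(1) by (simp add: frontier_def interior_open)
      then show ?thesis by (simp add: \<phi>_def Z(2)[OF gkP])
    qed
    have sp: "space (surface_measure \<Omega>) = frontier \<Omega>"
      by (simp add: surface_measure_def space_restrict_space space_hausdorff_measure)
    show "continuous_on (closure \<Omega>) (\<phi> k)" for k unfolding \<phi>_def by (rule Zc[OF gkP])
    have i0: "integrable (surface_measure \<Omega>) (\<lambda>x. (norm (\<phi> k x))\<^sup>2)" for k
      by (rule Bochner_Integration.integrable_cong[THEN iffD2, OF refl _ integrable_zero]) (simp add: sp fr0)
    have "\<phi> k \<in> borel_measurable (surface_measure \<Omega>)" for k
      by (rule measurable_cong[THEN iffD2, of _ _ "\<lambda>x. 0"]) (simp_all add: sp fr0)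
    then show "\<phi> k - (\<lambda>x. 0) \<in> Lspace 2 (surface_measure \<Omega>)" for k
      unfolding fun_diff_def using i0[of k] by (simp add: Lspace_2_iff)
    have "Lnorm 2 (surface_measure \<Omega>) (\<phi> k - (\<lambda>x. 0)) = 0" for k
    proof -
      have "(\<integral>x. (norm ((\<phi> k - (\<lambda>x. 0)) x))\<^sup>2 \<partial>surface_measure \<Omega>) = (\<integral>x. 0 \<partial>surface_measure \<Omega>)"
        by (rule Bochner_Integration.integral_cong) (simp_all add: sp fr0)
      then show ?thesis unfolding Lnorm_2 by simp
    qed
    then show "(\<lambda>k. Lnorm 2 (surface_measure \<Omega>) (\<phi> k - (\<lambda>x. 0))) \<longlonglongrightarrow> 0" by simp
  qed
  have \<phi>'0: "\<phi>' \<in> W1_0 \<Omega> 2" using \<phi>'W tr by (simp add: W1_0_def)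
  have adj: "(\<integral>x. dflux (a x) (wgrad \<Omega> \<phi>' x) \<bullet> grad \<psi> x \<partial>?M) = (\<integral>x. g x * \<psi> x \<partial>?M)"
    if \<psi>: "\<psi> \<in> test_functions \<Omega>" for \<psi>
  proof -
    have gm[measurable]: "grad \<psi> \<in> borel_measurable ?M"
      by (intro continuous_measurable_lebesgue test_functions_grad_continuous[OF \<psi>])
    obtain b where b: "\<And>x. norm (grad \<psi> x) \<le> b" using test_functions_bounded[OF \<psi>] by metis
    have bm: "(\<lambda>x. dflux (a x) (grad \<psi> x)) \<in> borel_measurable ?M" by (rule measurable_dflux[OF a(1) gm])
    have bb: "AE x in ?M. norm (dflux (a x) (grad \<psi> x)) \<le> 2 * b"
    proof (rule AE_I2)
      fix x show "norm (dflux (a x) (grad \<psi> x)) \<le> 2 * b" using norm_dflux_le[of "a x" "grad \<psi> x"] b[of x] by linarith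
    qed
    \<comment> \<open>Symmetry moves the coefficient onto the test function; only the pairing with a
      fixed square integrable function has to pass to the limit.\<close>
    have "(\<integral>x. dflux (a x) (wgrad \<Omega> \<phi>' x) \<bullet> grad \<psi> x \<partial>?M) = (\<integral>x. \<Gamma>' x \<bullet> dflux (a x) (grad \<psi> x) \<partial>?M)"
    proof (rule integral_cong_AE)
      show "AE x in ?M. dflux (a x) (wgrad \<Omega> \<phi>' x) \<bullet> grad \<psi> x = \<Gamma>' x \<bullet> dflux (a x) (grad \<psi> x)"
        using wa by eventually_elim (simp add: dflux_sym)
    qed (intro borel_measurable_inner measurable_dflux a(1) wm gm \<Gamma>'m)+
    moreover have "(\<lambda>k. \<integral>x. \<Gamma> k x \<bullet> dflux (a x) (grad \<psi> x) \<partial>?M) \<longlonglongrightarrow> (\<integral>x. \<Gamma>' x \<bullet> dflux (a x) (grad \<psi> x) \<partial>?M)"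
      by (rule lim\<Gamma>[OF bm bounded_L2[OF bm bb]])
    moreover have "(\<integral>x. \<Gamma> k x \<bullet> dflux (a x) (grad \<psi> x) \<partial>?M) = (\<integral>x. gk k x * \<psi> x \<partial>?M)" for k
      using eq[OF gkP \<psi>, of k] by (simp add: dflux_sym \<Gamma>_def)
    moreover have "(\<lambda>k. \<integral>x. gk k x * \<psi> x \<partial>?M) \<longlonglongrightarrow> (\<integral>x. g x * \<psi> x \<partial>?M)"
      by (rule limg[OF test2[OF \<psi>]])
    ultimately show ?thesis using LIMSEQ_unique by simp
  qed
  \<comment> \<open>Square integrability of \<open>h\<close> makes its pairing with the
    \<open>L\<^sup>2\<close> limit of the \<open>\<phi> k\<close> converge; membership in
    \<open>P\<close> alone provides only integrability.\<close>
  have dual: "(\<integral>x. \<phi>' x * h x \<partial>?M) = (\<integral>x. g x * Z h x \<partial>?M)"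
    if h: "h \<in> P" "integrable ?M (\<lambda>x. (h x)\<^sup>2)" for h
  proof -
    have hm: "h \<in> borel_measurable ?M" using P(2)[OF h(1)] by (rule borel_measurable_integrable)
    have 1: "(\<lambda>k. \<integral>x. \<phi> k x * h x \<partial>?M) \<longlonglongrightarrow> (\<integral>x. \<phi>' x * h x \<partial>?M)"
      by (rule lim\<phi>[OF hm]) (use h(2) in simp)
    have 2: "(\<lambda>k. \<integral>x. gk k x * Z h x \<partial>?M) \<longlonglongrightarrow> (\<integral>x. g x * Z h x \<partial>?M)"
      by (rule limg[OF Zm[OF h(1)] Z2[OF h(1)]])
    have "(\<integral>x. \<phi> k x * h x \<partial>?M) = (\<integral>x. gk k x * Z h x \<partial>?M)" for k
    proof -
      have "(\<integral>x. \<phi> k x * h x \<partial>?M) = (\<integral>x. dflux (a x) (G h x) \<bullet> \<Gamma> k x \<partial>?M)"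
        unfolding \<Gamma>_def cross[OF h(1) gkP] \<phi>_def by (simp add: mult.commute)
      also have "\<dots> = (\<integral>x. dflux (a x) (\<Gamma> k x) \<bullet> G h x \<partial>?M)"
        by (intro Bochner_Integration.integral_cong refl) (metis dflux_sym inner_commute)
      also have "\<dots> = (\<integral>x. gk k x * Z h x \<partial>?M)"
        unfolding \<Gamma>_def by (rule cross[OF gkP h(1)])
      finally show ?thesis .
    qed
    then show ?thesis using LIMSEQ_unique[OF 1] 2 by simp
  qed
  show ?thesis
    using \<phi>'0 adj dual \<phi>'2 by (intro bexI[of _ \<phi>'] conjI ballI impI) simp_all
qed

section \<open>The linearized state equation\<close>

text \<open>The Frechet estimate in \<open>W\<^sup>2\<^sub>p\<close> becomes, through the embedding,
  a first-order expansion of the state and of its gradient with an error that is uniform almost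
  everywhere; this permits pointwise arguments later.\<close>

lemma state_expansion:
  fixes \<Omega> :: "(real^'n) set"
  assumes \<Omega>: "open \<Omega>" and p: "p > 0"
    and U3: "open_subset_of (Lp \<Omega> p) (Lp_norm \<Omega> p) U3"
    and S: "control_to_state \<Omega> p v U3 S DS"
    and embedding: "\<forall>y\<in>W2p \<Omega> p. y \<in> W1 \<Omega> \<infinity> \<and> W1_norm \<Omega> \<infinity> y \<le> CS * W2p_norm \<Omega> p y"
    and u: "u \<in> U3" and h: "h \<in> Lp \<Omega> p" and \<epsilon>: "\<epsilon> > 0"
  shows "\<exists>t0>0. \<forall>t. 0 < t \<and> t < t0 \<longrightarrow> (\<lambda>x. u x + t * h x) \<in> U3 \<and>
    (AE x in lebesgue_on \<Omega>. \<bar>S (\<lambda>x. u x + t * h x) x - S u x - t * DS u h x\<bar> \<le> \<epsilon> * t) \<and>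
    (AE x in lebesgue_on \<Omega>. norm (wgrad \<Omega> (S (\<lambda>x. u x + t * h x)) x - wgrad \<Omega> (S u) x - t *\<^sub>R wgrad \<Omega> (DS u h) x) \<le> \<epsilon> * t)"
proof -
  have uLp: "u \<in> Lp \<Omega> p" and op: "\<exists>\<delta>>0. \<forall>w\<in>Lp \<Omega> p. Lp_norm \<Omega> p (w - u) < \<delta> \<longrightarrow> w \<in> U3"
    using U3 u by (auto simp: open_subset_of_def)
  have SY: "S w \<in> W2p \<Omega> p" if "w \<in> U3" for w
    using S that by (simp add: control_to_state_def Y_def)
  have fd: "has_fderiv_at U3 (Lp \<Omega> p) (Lp_norm \<Omega> p) (Y_dir \<Omega> p) (W2p_norm \<Omega> p) S u (DS u)"
    using S u by (simp add: control_to_state_def C2_map_def)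
  then have bl: "bounded_lin_op (Lp \<Omega> p) (Lp_norm \<Omega> p) (Y_dir \<Omega> p) (W2p_norm \<Omega> p) (DS u)"
    by (simp add: has_fderiv_at_def)
  have DY: "DS u k \<in> W2p \<Omega> p" if "k \<in> Lp \<Omega> p" for k
    using bl that by (simp add: bounded_lin_op_def Y_dir_def)
  have hom: "W2p_norm \<Omega> p (DS u (\<lambda>x. c * h x) - (\<lambda>x. c * DS u h x)) = 0" for c
    using bl h by (simp add: bounded_lin_op_def)
  define N where "N = Lp_norm \<Omega> p h"
  have N: "N \<ge> 0" by (simp add: N_def Lnorm_nonneg)
  \<comment> \<open>Scaled so that the embedding constant and the norm of \<open>h\<close> bring the
    final error to at most \<open>\<epsilon>\<close> per unit of \<open>t\<close>. The modulus
    covers any sign of \<open>CS\<close>, the summand 1 a vanishing product.\<close>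
  define e where "e = \<epsilon> / (\<bar>CS\<bar> * N + 1)"
  have e: "e > 0" "\<bar>CS\<bar> * (e * N) \<le> \<epsilon>"
  proof -
    have pos: "\<bar>CS\<bar> * N + 1 > 0" using N by (simp add: add_nonneg_pos)
    then show "e > 0" using \<epsilon> by (simp add: e_def)
    have "\<bar>CS\<bar> * (e * N) = e * (\<bar>CS\<bar> * N)" by simp
    also have "\<dots> \<le> e * (\<bar>CS\<bar> * N + 1)" using \<open>e > 0\<close> by (intro mult_left_mono) auto
    also have "\<dots> = \<epsilon>" using pos by (simp add: e_def)
    finally show "\<bar>CS\<bar> * (e * N) \<le> \<epsilon>" .
  qed
  obtain \<delta>1 where \<delta>1: "\<delta>1 > 0" "\<And>w. w \<in> Lp \<Omega> p \<Longrightarrow> Lp_norm \<Omega> p (w - u) < \<delta>1 \<Longrightarrow> w \<in> U3"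
    using op by blast
  obtain \<delta>2 where \<delta>2: "\<delta>2 > 0" "\<And>w. w \<in> U3 \<Longrightarrow> Lp_norm \<Omega> p (w - u) < \<delta>2 \<Longrightarrow>
      W2p_norm \<Omega> p (S w - S u - DS u (w - u)) \<le> e * Lp_norm \<Omega> p (w - u)"
    using fd e(1) unfolding has_fderiv_at_def by blast
  \<comment> \<open>Small enough for the perturbed control to stay in \<open>U3\<close> and for the
    derivative estimate to apply.\<close>
  define t0 where "t0 = min \<delta>1 \<delta>2 / (N + 1)"
  have t0: "t0 > 0" using \<delta>1(1) \<delta>2(1) N by (simp add: t0_def)
  show ?thesis
  proof (intro exI[of _ t0] conjI t0 allI impI)
    fix t assume "0 < t \<and> t < t0"
    then have t: "0 < t" "t < t0" by auto
    let ?w = "\<lambda>x. u x + t * h x"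
    have wu: "?w - u = (\<lambda>x. t * h x)" by (simp add: fun_eq_iff)
    have nw: "Lp_norm \<Omega> p (?w - u) = t * N"
      unfolding wu N_def using Lnorm_scale[OF p, of "lebesgue_on \<Omega>" t h] t(1) by simp
    have "t * N \<le> t * (N + 1)" using t(1) by simp
    also have "\<dots> < t0 * (N + 1)" using t(2) N by (intro mult_strict_right_mono) auto
    also have "\<dots> = min \<delta>1 \<delta>2" using N by (simp add: t0_def)
    finally have tN: "t * N < \<delta>1" "t * N < \<delta>2" by auto
    have "(\<lambda>x. 1 *\<^sub>R u x + t *\<^sub>R h x) \<in> Lp \<Omega> p" by (rule Lspace_lincomb[OF uLp h])
    then have wLp: "?w \<in> Lp \<Omega> p" by simp
    have th: "(\<lambda>x. t * h x) \<in> Lp \<Omega> p"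
      using Lspace_lincomb[OF h h, of t 0] by simp
    show w: "?w \<in> U3" using \<delta>1(2)[OF wLp] nw tN(1) by simp
    \<comment> \<open>\<open>DS u\<close> is homogeneous only up to functions of norm zero, so the
      remainder is split into the Frechet remainder \<open>r\<close> and the defect
      \<open>d\<close>, which vanishes almost everywhere together with its gradient.\<close>
    define r where "r x = S ?w x - S u x - DS u (\<lambda>x. t * h x) x" for x
    define d where "d x = DS u (\<lambda>x. t * h x) x - t * DS u h x" for x
    have SS: "(\<lambda>x. 1 * S ?w x + (-1) * S u x) \<in> W2p \<Omega> p"
      by (rule W2_lincomb[OF \<Omega> SY[OF w] SY[OF u]])
    have rW: "(\<lambda>x. 1 * (1 * S ?w x + (-1) * S u x) + (-1) * DS u (\<lambda>x. t * h x) x) \<in> W2p \<Omega> p"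
      by (rule W2_lincomb[OF \<Omega> SS DY[OF th]])
    have dW: "(\<lambda>x. 1 * DS u (\<lambda>x. t * h x) x + (-t) * DS u h x) \<in> W2p \<Omega> p"
      by (rule W2_lincomb[OF \<Omega> DY[OF th] DY[OF h]])
    have reqn: "r = (\<lambda>x. 1 * (1 * S ?w x + (-1) * S u x) + (-1) * DS u (\<lambda>x. t * h x) x)"
      by (simp add: r_def[abs_def])
    have deqn: "d = (\<lambda>x. 1 * DS u (\<lambda>x. t * h x) x + (-t) * DS u h x)"
      by (simp add: d_def[abs_def])
    have W2W1: "y \<in> W1 \<Omega> (ennreal p)" if "y \<in> W2p \<Omega> p" for y using that by (simp add: W2_def)
    have "W2p_norm \<Omega> p r \<le> e * (t * N)"
    proof -
      have "S ?w - S u - DS u (?w - u) = r" by (simp add: fun_eq_iff wu r_def)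
      then show ?thesis using \<delta>2(2)[OF w] nw tN(2) by simp
    qed
    then have "CS * W2p_norm \<Omega> p r \<le> \<bar>CS\<bar> * (e * (t * N))"
      by (intro mult_mono) (auto simp: W2_norm_nonneg)
    also have "\<dots> = (\<bar>CS\<bar> * (e * N)) * t" by simp
    also have "\<dots> \<le> \<epsilon> * t" using e(2) t(1) by (intro mult_right_mono) auto
    finally have rn: "W1_norm \<Omega> \<infinity> r \<le> \<epsilon> * t" and r1: "r \<in> W1 \<Omega> \<infinity>"
      using embedding rW unfolding reqn by (auto intro: order_trans)
    have "W2p_norm \<Omega> p d = 0"
    proof -
      have "DS u (\<lambda>x. t * h x) - (\<lambda>x. t * DS u h x) = d" by (simp add: fun_eq_iff d_def)
      then show ?thesis using hom[of t] by simp
    qed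
    then have dn: "W1_norm \<Omega> \<infinity> d \<le> 0" and d1: "d \<in> W1 \<Omega> \<infinity>"
      using embedding dW unfolding deqn by auto
    have dz: "AE x in lebesgue_on \<Omega>. d x = 0" "AE x in lebesgue_on \<Omega>. wgrad \<Omega> d x = 0"
    proof -
      show "AE x in lebesgue_on \<Omega>. d x = 0"
        using W1_infty_AE_le(1)[OF d1] by eventually_elim (use dn in simp)
      show "AE x in lebesgue_on \<Omega>. wgrad \<Omega> d x = 0"
        using W1_infty_AE_le(2)[OF d1]
      proof eventually_elim
        case (elim x)
        then have "norm (wgrad \<Omega> d x) \<le> 0" using dn by (rule order_trans)
        then show ?case by simp
      qed
    qed
    show "AE x in lebesgue_on \<Omega>. \<bar>S ?w x - S u x - t * DS u h x\<bar> \<le> \<epsilon> * t"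
      using W1_infty_AE_le(1)[OF r1] dz(1)
    proof eventually_elim
      case (elim x)
      then show ?case using rn by (simp add: r_def d_def)
    qed
    show "AE x in lebesgue_on \<Omega>. norm (wgrad \<Omega> (S ?w) x - wgrad \<Omega> (S u) x - t *\<^sub>R wgrad \<Omega> (DS u h) x) \<le> \<epsilon> * t"
      using W1_infty_AE_le(2)[OF r1] dz(2)
        W1_lincomb(2)[OF \<Omega> W2W1[OF SY[OF w]] W2W1[OF SY[OF u]], of 1 "-1"]
        W1_lincomb(2)[OF \<Omega> W2W1[OF SS] W2W1[OF DY[OF th]], of 1 "-1", folded reqn]
        W1_lincomb(2)[OF \<Omega> W2W1[OF DY[OF th]] W2W1[OF DY[OF h]], of 1 "-t", folded deqn]
    proof eventually_elim
      case (elim x)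
      have "wgrad \<Omega> (S ?w) x - wgrad \<Omega> (S u) x - t *\<^sub>R wgrad \<Omega> (DS u h) x = wgrad \<Omega> r x + wgrad \<Omega> d x"
        unfolding elim(3,4,5) by simp
      then show ?case using elim(1,2) rn by simp
    qed
  qed
qed

text \<open>The weak state equations at \<open>u + t h\<close> and at \<open>u\<close> are
  subtracted and divided by \<open>t\<close>; dominated convergence yields the derivative of
  \<open>flux\<close> under the integral.\<close>

lemma linearized_state_equation:
  fixes \<Omega> :: "(real^'n) set"
  assumes \<Omega>: "open \<Omega>" "bounded \<Omega>" and p: "p \<ge> 1"
    and U3: "open_subset_of (Lp \<Omega> p) (Lp_norm \<Omega> p) U3"
    and S: "control_to_state \<Omega> p v U3 S DS"
    and embedding: "\<forall>y\<in>W2p \<Omega> p. y \<in> W1 \<Omega> \<infinity> \<and> W1_norm \<Omega> \<infinity> y \<le> CS * W2p_norm \<Omega> p y"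
    and u: "u \<in> U3" and h: "h \<in> Lp \<Omega> p" and \<psi>: "\<psi> \<in> test_functions \<Omega>"
  shows "(\<integral>x. dflux (wgrad \<Omega> (S u) x) (wgrad \<Omega> (DS u h) x) \<bullet> grad \<psi> x \<partial>lebesgue_on \<Omega>)
    = (\<integral>x. h x * \<psi> x \<partial>lebesgue_on \<Omega>)"
proof -
  let ?M = "lebesgue_on \<Omega>"
  have fm: "finite_measure ?M" using \<Omega> by (intro finite_measure_lebesgue_on lmeasurable_open)
  interpret finite_measure ?M by fact
  have p0: "p > 0" using p by simp
  have SY: "S w \<in> W2p \<Omega> p" if "w \<in> U3" for w
    using S that by (simp add: control_to_state_def Y_def)
  have "DS u h \<in> W2p \<Omega> p"
    using S u h by (simp add: control_to_state_def C2_map_def has_fderiv_at_def bounded_lin_op_def Y_dir_def)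
  then have zW: "DS u h \<in> W1 \<Omega> \<infinity>" using embedding by blast
  define \<zeta> where "\<zeta> = wgrad \<Omega> (DS u h)"
  define a where "a = wgrad \<Omega> (S u)"
  note wm = W1_wgrad_measurable
  have am[measurable]: "a \<in> borel_measurable ?M"
    unfolding a_def by (rule wm) (use SY[OF u] in \<open>simp add: W2_def; blast\<close>)
  have \<zeta>m[measurable]: "\<zeta> \<in> borel_measurable ?M" unfolding \<zeta>_def by (rule wm[OF zW])
  define Zb where "Zb = W1_norm \<Omega> \<infinity> (DS u h)"
  have \<zeta>b: "AE x in ?M. norm (\<zeta> x) \<le> Zb" unfolding \<zeta>_def Zb_def by (rule W1_infty_AE_le(2)[OF zW])
  \<comment> \<open>Taking \<open>1 / real (Suc n)\<close> both as error bound and as bound for the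
    step makes the gradient remainder \<open>o(t n)\<close>, uniformly almost everywhere, along a
    null sequence of steps.\<close>
  have "\<forall>n. \<exists>t. 0 < t \<and> t < 1 / real (Suc n) \<and> (\<lambda>x. u x + t * h x) \<in> U3 \<and>
    (AE x in ?M. norm (wgrad \<Omega> (S (\<lambda>x. u x + t * h x)) x - a x - t *\<^sub>R \<zeta> x) \<le> 1 / real (Suc n) * t)"
  proof
    fix n :: nat
    have "1 / real (Suc n) > 0" by simp
    from state_expansion[OF \<Omega>(1) p0 U3 S embedding u h this] obtain t0 where "t0 > 0" and
      t0: "\<And>t. 0 < t \<and> t < t0 \<Longrightarrow> (\<lambda>x. u x + t * h x) \<in> U3 \<and>
        (AE x in ?M. norm (wgrad \<Omega> (S (\<lambda>x. u x + t * h x)) x - a x - t *\<^sub>R \<zeta> x) \<le> 1 / real (Suc n) * t)"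
      unfolding a_def \<zeta>_def by blast
    define t where "t = min t0 (1 / real (Suc n)) / 2"
    have "0 < t" "t < t0" "t < 1 / real (Suc n)" using \<open>t0 > 0\<close> by (auto simp: t_def min_def field_simps)
    then show "\<exists>t. 0 < t \<and> t < 1 / real (Suc n) \<and> (\<lambda>x. u x + t * h x) \<in> U3 \<and>
      (AE x in ?M. norm (wgrad \<Omega> (S (\<lambda>x. u x + t * h x)) x - a x - t *\<^sub>R \<zeta> x) \<le> 1 / real (Suc n) * t)"
      using t0[of t] by blast
  qed
  from choice[OF this] obtain t where t': "\<forall>n. 0 < t n \<and> t n < 1 / real (Suc n) \<and> (\<lambda>x. u x + t n * h x) \<in> U3 \<and>
    (AE x in ?M. norm (wgrad \<Omega> (S (\<lambda>x. u x + t n * h x)) x - a x - t n *\<^sub>R \<zeta> x) \<le> 1 / real (Suc n) * t n)"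
    by (rule exE)
  define b where "b n = wgrad \<Omega> (S (\<lambda>x. u x + t n * h x))" for n
  have t: "0 < t n" "t n < 1 / real (Suc n)" "(\<lambda>x. u x + t n * h x) \<in> U3"
    "AE x in ?M. norm (b n x - a x - t n *\<^sub>R \<zeta> x) \<le> 1 / real (Suc n) * t n" for n
    using t' by (simp_all add: b_def)
  have bm[measurable]: "b n \<in> borel_measurable ?M" for n
    unfolding b_def by (rule wm) (use SY[OF t(3)] in \<open>simp add: W2_def; blast\<close>)
  have tl: "t \<longlonglongrightarrow> 0"
  proof (rule Lim_null_comparison)
    show "\<forall>\<^sub>F n in sequentially. norm (t n) \<le> 1 / real (Suc n)" using t(1,2) by (simp add: less_imp_le)
    show "(\<lambda>n. 1 / real (Suc n)) \<longlonglongrightarrow> 0" by (rule LIMSEQ_Suc[OF lim_const_over_n])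
  qed
  have gm[measurable]: "grad \<psi> \<in> borel_measurable ?M"
    by (intro continuous_measurable_lebesgue test_functions_grad_continuous[OF \<psi>])
  obtain B where B: "B > 0" "\<And>x. norm (grad \<psi> x) \<le> B" using test_functions_bounded[OF \<psi>] by metis
  have flux_m: "(\<lambda>x. flux (f x)) \<in> borel_measurable ?M" if "f \<in> borel_measurable ?M" for f :: "real^'n \<Rightarrow> real^'n"
    using measurable_compose[OF that borel_measurable_continuous_onI[OF continuous_flux]] .
  have st: "(\<integral>x. flux (wgrad \<Omega> (S w) x) \<bullet> grad \<psi> x \<partial>?M) = (\<integral>x. w x * \<psi> x \<partial>?M)"
    and si: "integrable ?M (\<lambda>x. flux (wgrad \<Omega> (S w) x) \<bullet> grad \<psi> x)" if "w \<in> U3" for w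
  proof -
    have "state_equation \<Omega> w (S w)" using S that by (simp add: control_to_state_def)
    moreover have "(\<lambda>x. (1 / Q \<Omega> (S w) x) *\<^sub>R wgrad \<Omega> (S w) x) = (\<lambda>x. flux (wgrad \<Omega> (S w) x))"
      by (simp add: fun_eq_iff Q_def flux_def)
    ultimately have wd: "has_weak_div \<Omega> (\<lambda>x. flux (wgrad \<Omega> (S w) x)) (\<lambda>x. - w x)"
      by (simp add: state_equation_def)
    then have "(\<integral>x. flux (wgrad \<Omega> (S w) x) \<bullet> grad \<psi> x \<partial>?M) = - (\<integral>x. - w x * \<psi> x \<partial>?M)"
      using \<psi> by (simp add: has_weak_div_def)
    then show "(\<integral>x. flux (wgrad \<Omega> (S w) x) \<bullet> grad \<psi> x \<partial>?M) = (\<integral>x. w x * \<psi> x \<partial>?M)" by simp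
    show "integrable ?M (\<lambda>x. flux (wgrad \<Omega> (S w) x) \<bullet> grad \<psi> x)"
      by (rule test_functions_integrable_inner[OF \<psi> \<Omega>(1)]) (use wd in \<open>simp add: has_weak_div_def\<close>)
  qed
  have Lpi: "integrable ?M (\<lambda>x. w x * \<psi> x)" if "w \<in> Lp \<Omega> p" for w
    using test_functions_integrable[OF \<psi> \<Omega>(1) loc_integrable_integrable[OF Lspace_integrable[OF fm p that] \<Omega>(1)]]
    by (simp add: mult.commute)
  have uLp: "u \<in> Lp \<Omega> p" using U3 u by (auto simp: open_subset_of_def)
  define q where "q n x = ((flux (b n x) - flux (a x)) \<bullet> grad \<psi> x) / t n" for n x
  \<comment> \<open>The right-hand side of the state equation is linear in the control, so the
    integrated difference quotient is the same for every \<open>n\<close>.\<close>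
  have qi: "(\<integral>x. q n x \<partial>?M) = (\<integral>x. h x * \<psi> x \<partial>?M)" for n
  proof -
    have "(\<integral>x. q n x \<partial>?M) = ((\<integral>x. flux (b n x) \<bullet> grad \<psi> x \<partial>?M) - (\<integral>x. flux (a x) \<bullet> grad \<psi> x \<partial>?M)) / t n"
      unfolding q_def inner_diff_left a_def b_def
      using Bochner_Integration.integral_diff[OF si[OF t(3)[of n]] si[OF u]] by simp
    also have "\<dots> = ((\<integral>x. (u x + t n * h x) * \<psi> x \<partial>?M) - (\<integral>x. u x * \<psi> x \<partial>?M)) / t n"
      unfolding a_def b_def st[OF u] st[OF t(3)] by simp
    also have "(\<integral>x. (u x + t n * h x) * \<psi> x \<partial>?M) = (\<integral>x. u x * \<psi> x + t n * (h x * \<psi> x) \<partial>?M)"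
      by (simp add: algebra_simps)
    also have "\<dots> = (\<integral>x. u x * \<psi> x \<partial>?M) + t n * (\<integral>x. h x * \<psi> x \<partial>?M)"
      using Lpi[OF uLp] Lpi[OF h] by (simp add: Bochner_Integration.integral_add)
    finally show ?thesis using t(1)[of n] by simp
  qed
  have ball: "AE x in ?M. \<forall>n. norm (b n x - a x - t n *\<^sub>R \<zeta> x) \<le> 1 / real (Suc n) * t n"
    by (intro AE_all_countable[THEN iffD2] allI t(4))
  have "(\<lambda>n. \<integral>x. q n x \<partial>?M) \<longlonglongrightarrow> (\<integral>x. dflux (a x) (\<zeta> x) \<bullet> grad \<psi> x \<partial>?M)"
  \<comment> \<open>\<open>flux\<close> is Lipschitz with constant 2, \<open>Zb + 1\<close> bounds
    the difference quotients of the gradients, and \<open>B\<close> bounds the gradient of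
    \<open>\<psi>\<close>.\<close>
  proof (rule integral_dominated_convergence[where w = "\<lambda>x. 2 * (Zb + 1) * B"])
    show "(\<lambda>x. dflux (a x) (\<zeta> x) \<bullet> grad \<psi> x) \<in> borel_measurable ?M"
      by (intro borel_measurable_inner measurable_dflux am \<zeta>m gm)
    show "q n \<in> borel_measurable ?M" for n
      unfolding q_def[abs_def]
      by (intro borel_measurable_divide borel_measurable_inner borel_measurable_diff flux_m am bm gm) simp
    show "AE x in ?M. (\<lambda>n. q n x) \<longlonglongrightarrow> dflux (a x) (\<zeta> x) \<bullet> grad \<psi> x"
      using ball
    proof eventually_elim
      case (elim x)
      have 1: "((\<lambda>s::real. a x + s *\<^sub>R \<zeta> x) has_derivative (\<lambda>s. s *\<^sub>R \<zeta> x)) (at 0)"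
        by (auto intro!: derivative_eq_intros)
      have "(flux has_derivative dflux (a x)) (at (a x + 0 *\<^sub>R \<zeta> x))" using flux_has_derivative[of "a x"] by simp
      from has_derivative_compose[OF 1 this]
      have "((\<lambda>s. flux (a x + s *\<^sub>R \<zeta> x)) has_derivative (\<lambda>s. dflux (a x) (s *\<^sub>R \<zeta> x))) (at 0)" .
      from has_derivative_inner_left[OF this, of "grad \<psi> x"]
      have D: "((\<lambda>s. flux (a x + s *\<^sub>R \<zeta> x) \<bullet> grad \<psi> x) has_derivative (\<lambda>s. dflux (a x) (s *\<^sub>R \<zeta> x) \<bullet> grad \<psi> x)) (at 0)" .
      have "(\<lambda>s. dflux (a x) (s *\<^sub>R \<zeta> x) \<bullet> grad \<psi> x) = (*) (dflux (a x) (\<zeta> x) \<bullet> grad \<psi> x)"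
        by (simp add: fun_eq_iff mult.commute
            linear_scale[OF bounded_linear.linear[OF has_derivative_bounded_linear[OF flux_has_derivative]]])
      with D have "((\<lambda>s. flux (a x + s *\<^sub>R \<zeta> x) \<bullet> grad \<psi> x) has_real_derivative dflux (a x) (\<zeta> x) \<bullet> grad \<psi> x) (at 0)"
        unfolding has_field_derivative_def by (simp only:)
      then have "((\<lambda>s. (flux (a x + s *\<^sub>R \<zeta> x) \<bullet> grad \<psi> x - flux (a x) \<bullet> grad \<psi> x) / s) \<longlongrightarrow> dflux (a x) (\<zeta> x) \<bullet> grad \<psi> x) (at 0)"
        by (simp add: DERIV_def)
      moreover have "filterlim t (at 0) sequentially"
        using tl t(1) by (intro filterlim_atI) (auto simp: less_imp_neq[symmetric])
      ultimately have main: "(\<lambda>n. (flux (a x + t n *\<^sub>R \<zeta> x) \<bullet> grad \<psi> x - flux (a x) \<bullet> grad \<psi> x) / t n) \<longlonglongrightarrow> dflux (a x) (\<zeta> x) \<bullet> grad \<psi> x"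
        by (rule filterlim_compose)
      \<comment> \<open>Replacing the gradient of the perturbed state by its first-order expansion
        changes the quotient by at most \<open>2 * B / real (Suc n)\<close>.\<close>
      have "(\<lambda>n. q n x - (flux (a x + t n *\<^sub>R \<zeta> x) \<bullet> grad \<psi> x - flux (a x) \<bullet> grad \<psi> x) / t n) \<longlonglongrightarrow> 0"
      proof (rule Lim_null_comparison)
        show "\<forall>\<^sub>F n in sequentially. norm (q n x - (flux (a x + t n *\<^sub>R \<zeta> x) \<bullet> grad \<psi> x - flux (a x) \<bullet> grad \<psi> x) / t n) \<le> 2 * B / real (Suc n)"
        proof (rule always_eventually, rule allI)
          fix n
          have "q n x - (flux (a x + t n *\<^sub>R \<zeta> x) \<bullet> grad \<psi> x - flux (a x) \<bullet> grad \<psi> x) / t n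
            = ((flux (b n x) - flux (a x + t n *\<^sub>R \<zeta> x)) \<bullet> grad \<psi> x) / t n"
            by (simp add: q_def inner_diff_left diff_divide_distrib)
          also have "norm \<dots> = \<bar>(flux (b n x) - flux (a x + t n *\<^sub>R \<zeta> x)) \<bullet> grad \<psi> x\<bar> / t n"
            using t(1)[of n] by simp
          also have "\<dots> \<le> (norm (flux (b n x) - flux (a x + t n *\<^sub>R \<zeta> x)) * norm (grad \<psi> x)) / t n"
            using t(1)[of n] by (intro divide_right_mono Cauchy_Schwarz_ineq2) simp
          also have "\<dots> \<le> ((2 * norm (b n x - (a x + t n *\<^sub>R \<zeta> x))) * B) / t n"
            using t(1)[of n] B by (intro divide_right_mono mult_mono flux_lipschitz) auto
          also have "\<dots> \<le> ((2 * (1 / real (Suc n) * t n)) * B) / t n"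
          proof -
            have "b n x - (a x + t n *\<^sub>R \<zeta> x) = b n x - a x - t n *\<^sub>R \<zeta> x" by simp
            then have "norm (b n x - (a x + t n *\<^sub>R \<zeta> x)) \<le> 1 / real (Suc n) * t n" using elim by metis
            then show ?thesis using t(1)[of n] B(1) by (intro divide_right_mono mult_right_mono mult_left_mono) auto
          qed
          also have "\<dots> = 2 * B / real (Suc n)" using t(1)[of n] by simp
          finally show "norm (q n x - (flux (a x + t n *\<^sub>R \<zeta> x) \<bullet> grad \<psi> x - flux (a x) \<bullet> grad \<psi> x) / t n) \<le> 2 * B / real (Suc n)" .
        qed
        show "(\<lambda>n. 2 * B / real (Suc n)) \<longlonglongrightarrow> 0" by (rule LIMSEQ_Suc[OF lim_const_over_n])
      qed
      from tendsto_add[OF this main] show ?case by simp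
    qed
    show "AE x in ?M. norm (q n x) \<le> 2 * (Zb + 1) * B" for n
      using t(4)[of n] \<zeta>b
    proof eventually_elim
      case (elim x)
      have "norm (b n x - a x) \<le> norm (b n x - a x - t n *\<^sub>R \<zeta> x) + norm (t n *\<^sub>R \<zeta> x)"
        using norm_triangle_ineq[of "b n x - a x - t n *\<^sub>R \<zeta> x" "t n *\<^sub>R \<zeta> x"] by simp
      also have "\<dots> \<le> 1 * t n + t n * Zb"
      proof (intro add_mono)
        have "1 / real (Suc n) * t n \<le> 1 * t n" using t(1)[of n] by (intro mult_right_mono) auto
        then show "norm (b n x - a x - t n *\<^sub>R \<zeta> x) \<le> 1 * t n" using elim(1) by linarith
        show "norm (t n *\<^sub>R \<zeta> x) \<le> t n * Zb" using t(1)[of n] elim(2) by simp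
      qed
      finally have ba: "norm (b n x - a x) \<le> t n * (Zb + 1)" by (simp add: algebra_simps)
      have "norm (q n x) = \<bar>(flux (b n x) - flux (a x)) \<bullet> grad \<psi> x\<bar> / t n" using t(1)[of n] by (simp add: q_def)
      also have "\<dots> \<le> (norm (flux (b n x) - flux (a x)) * norm (grad \<psi> x)) / t n"
        using t(1)[of n] by (intro divide_right_mono Cauchy_Schwarz_ineq2) simp
      also have "\<dots> \<le> ((2 * norm (b n x - a x)) * B) / t n"
        using t(1)[of n] B by (intro divide_right_mono mult_mono flux_lipschitz) auto
      also have "\<dots> \<le> ((2 * (t n * (Zb + 1))) * B) / t n"
        using t(1)[of n] B(1) ba by (intro divide_right_mono mult_right_mono mult_left_mono) auto
      also have "\<dots> = 2 * (Zb + 1) * B" using t(1)[of n] by simp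
      finally show ?case .
    qed
  qed simp
  then show ?thesis unfolding qi a_def \<zeta>_def by (simp add: LIMSEQ_const_iff)
qed

section \<open>The optimality conditions\<close>

text \<open>Convexity on the open half-line extends to the endpoint 0, because
  \<open>s powr p \<le> s\<close> for \<open>s\<close> between 0 and 1.\<close>

lemma powr_convex_nonneg:
  fixes x y :: real
  assumes p: "p \<ge> 1" and xy: "0 \<le> x" "0 \<le> y" and t: "0 \<le> t" "t \<le> 1"
  shows "((1 - t) * x + t * y) powr p \<le> (1 - t) * x powr p + t * y powr p"
proof -
  have scale: "(s * y) powr p \<le> s * y powr p" if "0 \<le> s" "s \<le> 1" "0 \<le> y" for s y :: real
  proof -
    have "s powr p \<le> s powr 1" using that p by (intro powr_mono') auto
    then have "s powr p * y powr p \<le> s * y powr p" using that by (intro mult_right_mono) auto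
    then show ?thesis by (simp add: powr_mult)
  qed
  consider "x = 0" | "y = 0" | "x > 0" "y > 0" using xy by linarith
  then show ?thesis
  proof cases
    case 1
    then show ?thesis using scale[OF t xy(2)] p by simp
  next
    case 2
    then show ?thesis using scale[of "1 - t" x] xy t p by simp
  next
    case 3
    then show ?thesis using convex_onD[OF powr_convex[OF p] t] by simp
  qed
qed

lemma Lp_norm_le_iff:
  assumes "p > 0" "\<theta> \<ge> 0"
  shows "Lnorm (ennreal p) M f \<le> \<theta> \<longleftrightarrow> (\<integral>x. norm (f x) powr p \<partial>M) \<le> \<theta> powr p"
proof -
  define I where "I = (\<integral>x. norm (f x) powr p \<partial>M)"
  have I: "I \<ge> 0" by (simp add: I_def)
  have "I powr (1 / p) \<le> \<theta> \<longleftrightarrow> I \<le> \<theta> powr p"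
  proof
    assume "I powr (1 / p) \<le> \<theta>"
    then have "(I powr (1 / p)) powr p \<le> \<theta> powr p" using assms by (intro powr_mono2) auto
    then show "I \<le> \<theta> powr p" using assms(1) I by (simp add: powr_powr)
  next
    assume "I \<le> \<theta> powr p"
    then have "I powr (1 / p) \<le> (\<theta> powr p) powr (1 / p)" using assms I by (intro powr_mono2) auto
    then show "I powr (1 / p) \<le> \<theta>" using assms by (simp add: powr_powr)
  qed
  then show ?thesis using assms(1) by (simp add: Lnorm_finite I_def)
qed

text \<open>Convexity of the \<open>p\<close>-th power under the integral replaces Minkowski's
  inequality in the bound on the norm.\<close>

lemma U_ad_convex:
  assumes p: "p \<ge> 1" and \<theta>: "\<theta> \<ge> 0" and u: "u \<in> U_ad \<Omega> p \<theta>" and w: "w \<in> U_ad \<Omega> p \<theta>" and t: "0 \<le> t" "t \<le> 1"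
  shows "(\<lambda>x. u x + t * (w x - u x)) \<in> U_ad \<Omega> p \<theta>"
proof -
  let ?M = "lebesgue_on \<Omega>"
  let ?c = "\<lambda>x. u x + t * (w x - u x)"
  have c: "?c = (\<lambda>x. (1 - t) *\<^sub>R u x + t *\<^sub>R w x)" by (simp add: fun_eq_iff algebra_simps)
  have up: "u \<in> Lp \<Omega> p" "w \<in> Lp \<Omega> p" and u2: "u \<in> Lp \<Omega> 2" "w \<in> Lp \<Omega> 2"
    and un: "Lp_norm \<Omega> p u \<le> \<theta>" "Lp_norm \<Omega> p w \<le> \<theta>" using u w by (auto simp: U_ad_def)
  have cp: "?c \<in> Lp \<Omega> p" "?c \<in> Lp \<Omega> 2" unfolding c by (intro Lspace_lincomb up u2)+
  have p0: "p > 0" "p \<ge> 0" using p by auto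
  have i: "integrable ?M (\<lambda>x. norm (u x) powr p)" "integrable ?M (\<lambda>x. norm (w x) powr p)"
    "integrable ?M (\<lambda>x. norm (?c x) powr p)"
    using up cp(1) p0 by (simp_all add: Lspace_finite_iff)
  have "(\<integral>x. norm (?c x) powr p \<partial>?M) \<le> (\<integral>x. (1 - t) * norm (u x) powr p + t * norm (w x) powr p \<partial>?M)"
  proof (rule integral_mono[OF i(3)])
    show "integrable ?M (\<lambda>x. (1 - t) * norm (u x) powr p + t * norm (w x) powr p)"
      using i(1,2) by (intro Bochner_Integration.integrable_add integrable_mult_right)
    fix x
    have "norm (?c x) \<le> (1 - t) * norm (u x) + t * norm (w x)"
    proof -
      have "?c x = (1 - t) * u x + t * w x" by (simp add: algebra_simps)
      moreover have "norm ((1 - t) * u x) = (1 - t) * norm (u x)" "norm (t * w x) = t * norm (w x)"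
        using t by (simp_all add: abs_mult)
      ultimately show ?thesis using norm_triangle_ineq[of "(1 - t) * u x" "t * w x"] by (simp only:)
    qed
    then have "norm (?c x) powr p \<le> ((1 - t) * norm (u x) + t * norm (w x)) powr p"
      using p0 by (intro powr_mono2) auto
    also have "\<dots> \<le> (1 - t) * norm (u x) powr p + t * norm (w x) powr p"
      by (intro powr_convex_nonneg p t) auto
    finally show "norm (?c x) powr p \<le> (1 - t) * norm (u x) powr p + t * norm (w x) powr p" .
  qed
  also have "\<dots> = (1 - t) * (\<integral>x. norm (u x) powr p \<partial>?M) + t * (\<integral>x. norm (w x) powr p \<partial>?M)"
    using Bochner_Integration.integral_add[OF integrable_mult_right[of "1 - t", OF i(1)] integrable_mult_right[of t, OF i(2)]]
    by simp
  also have "\<dots> \<le> (1 - t) * \<theta> powr p + t * \<theta> powr p"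
    using un t p0(1) \<theta> by (intro add_mono mult_left_mono) (auto simp: Lp_norm_le_iff)
  also have "\<dots> = \<theta> powr p" by (simp add: algebra_simps)
  finally have "Lp_norm \<Omega> p ?c \<le> \<theta>" using Lp_norm_le_iff[OF p0(1) \<theta>] by blast
  then show ?thesis using cp by (simp add: U_ad_def)
qed

theorem theorem2p4:
  fixes \<Omega> :: "(real^'n) set"
    and p \<alpha> \<theta> B1 B2 B3 C\<Omega> CS :: real
    and v yd ub :: "real^'n \<Rightarrow> real"
    and U3 U :: "(real^'n \<Rightarrow> real) set"
    and S :: "(real^'n \<Rightarrow> real) \<Rightarrow> real^'n \<Rightarrow> real"
    and DS :: "(real^'n \<Rightarrow> real) \<Rightarrow> (real^'n \<Rightarrow> real) \<Rightarrow> real^'n \<Rightarrow> real"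
    and T :: "(real^'n \<Rightarrow> real) \<Rightarrow> (real^'n \<Rightarrow> real) \<Rightarrow> real^'n \<Rightarrow> real"
  assumes domain: "open \<Omega>" "bounded \<Omega>" "C11_boundary \<Omega>"
    and p: "p > real CARD('n)"
    and v: "v \<in> W2p \<Omega> p"
    and yd: "yd \<in> Lp \<Omega> 2"
    and \<alpha>: "\<alpha> > 0"
    and U3: "open_subset_of (Lp \<Omega> p) (Lp_norm \<Omega> p) U3" "(\<lambda>x. 0) \<in> U3"
    and S: "control_to_state \<Omega> p v U3 S DS"
    and S_unique: "\<And>S' DS'. control_to_state \<Omega> p v U3 S' DS' \<Longrightarrow>
          \<forall>u\<in>U3. AE x in lebesgue_on \<Omega>. S' u x = S u x"
    and DS: "\<forall>u\<in>U3. implicit_derivative \<Omega> p v u (S u) (DS u)"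
    and embedding: "\<forall>y\<in>W2p \<Omega> p. y \<in> W1 \<Omega> \<infinity> \<and> W1_norm \<Omega> \<infinity> y \<le> CS * W2p_norm \<Omega> p y"
    and constants: "B1 > 1" "B2 > 0" "B3 > 0" "C\<Omega> > 0"
    and T: "\<forall>u\<in>Lp \<Omega> p. \<forall>y\<in>BB \<Omega> p v B1. T u y \<in> Y \<Omega> p v \<and> T_equation \<Omega> u y (T u y)"
    and small: "\<forall>u\<in>Lp \<Omega> p. cond_a \<Omega> p v B1 C\<Omega> B2 u \<and> cond_b \<Omega> p v B3 u \<longrightarrow>
          contraction_of_BB \<Omega> p v B1 (T u) \<and>
          (\<forall>y\<in>BB \<Omega> p v B1. state_equation \<Omega> u y \<longrightarrow>
             CS * W2p_norm \<Omega> p y \<le> 1 / (B1 * sqrt (1 + CS\<^sup>2 * B1\<^sup>2)))"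
    and U: "U = {u \<in> Lp \<Omega> p. cond_a \<Omega> p v B1 C\<Omega> B2 u \<and> cond_b \<Omega> p v B3 u} \<inter> U3"
    and \<theta>: "\<theta> > 0" "U_ad \<Omega> p \<theta> \<subseteq> U"
    and opt: "local_optimal \<Omega> p S yd \<alpha> \<theta> ub"
  shows "S ub \<in> Y \<Omega> p v \<and> state_equation \<Omega> ub (S ub) \<and>
    (\<exists>\<phi>\<in>W1_0 \<Omega> 2. adjoint_equation \<Omega> (S ub) yd \<phi> \<and>
       (\<forall>u\<in>U_ad \<Omega> p \<theta>.
          (\<integral>x. (\<phi> x + \<alpha> * ub x) * (u x - ub x) \<partial>lebesgue_on \<Omega>) \<ge> 0))"
proof -
  let ?M = "lebesgue_on \<Omega>"
  note \<Omega> = domain(1,2)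
  have fm: "finite_measure ?M" using \<Omega> by (intro finite_measure_lebesgue_on lmeasurable_open)
  interpret finite_measure ?M by fact
  have "1 \<le> CARD('n)" by (simp add: Suc_leI)
  then have "1 \<le> real CARD('n)" by simp
  then have p1: "p \<ge> 1" and p0: "p > 0" using p by linarith+
  have ubad: "ub \<in> U_ad \<Omega> p \<theta>" using opt by (simp add: local_optimal_def)
  have adU3: "u \<in> U3" if "u \<in> U_ad \<Omega> p \<theta>" for u using that \<theta>(2) U by blast
  note ub3 = adU3[OF ubad]
  have SY: "S u \<in> Y \<Omega> p v" "state_equation \<Omega> u (S u)" if "u \<in> U3" for u
    using S that by (simp_all add: control_to_state_def)
  have SW: "S u \<in> W1 \<Omega> \<infinity>" if "u \<in> U3" for u
    using SY(1)[OF that] embedding by (simp add: Y_def)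
  have L2_2: "f \<in> borel_measurable ?M" "integrable ?M (\<lambda>x. (norm (f x))\<^sup>2)" if "f \<in> Lp \<Omega> 2" for f
    using that by (simp_all add: Lspace_2_iff)
  have binf: "f \<in> Lp \<Omega> 2" if "f \<in> W1 \<Omega> \<infinity>" for f
    by (rule Lspace_infty_subset[OF fm]) (use that in \<open>simp add: W1_def\<close>)
  have Lp2diff: "(\<lambda>x. f x - g x) \<in> Lp \<Omega> 2" if "f \<in> Lp \<Omega> 2" "g \<in> Lp \<Omega> 2" for f g
    using Lspace_lincomb[OF that, of 1 "-1"] by simp
  have DY: "DS ub h \<in> Y_dir \<Omega> p" if "h \<in> Lp \<Omega> p" for h
    using S ub3 that by (simp add: control_to_state_def C2_map_def has_fderiv_at_def bounded_lin_op_def)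
  have DW: "DS ub h \<in> W1 \<Omega> \<infinity>" and D0: "DS ub h \<in> W1_0 \<Omega> \<infinity>" if "h \<in> Lp \<Omega> p" for h
    using DY[OF that] embedding by (simp_all add: Y_dir_def)
  \<comment> \<open>A Lipschitz representative of each derivative, extended by zero, is what may
    serve as a test function; it is selected as a function of \<open>h\<close>.\<close>
  have "\<forall>h\<in>Lp \<Omega> p. \<exists>Z. \<exists>M. M-lipschitz_on UNIV Z \<and> (\<forall>x. x \<notin> \<Omega> \<longrightarrow> Z x = 0) \<and> (AE x in ?M. Z x = DS ub h x)"
    using W1_0_infty_lipschitz[OF domain(1,3) D0] by blast
  from bchoice[OF this] obtain Z where
    "\<forall>h\<in>Lp \<Omega> p. \<exists>M. M-lipschitz_on UNIV (Z h) \<and> (\<forall>x. x \<notin> \<Omega> \<longrightarrow> Z h x = 0) \<and> (AE x in ?M. Z h x = DS ub h x)"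
    by (rule exE)
  from bchoice[OF this] obtain L where
    "\<forall>h\<in>Lp \<Omega> p. (L h)-lipschitz_on UNIV (Z h) \<and> (\<forall>x. x \<notin> \<Omega> \<longrightarrow> Z h x = 0) \<and> (AE x in ?M. Z h x = DS ub h x)"
    by (rule exE)
  then have Z: "\<And>h. h \<in> Lp \<Omega> p \<Longrightarrow> (L h)-lipschitz_on UNIV (Z h)" "\<And>h x. h \<in> Lp \<Omega> p \<Longrightarrow> x \<notin> \<Omega> \<Longrightarrow> Z h x = 0"
    "\<And>h. h \<in> Lp \<Omega> p \<Longrightarrow> AE x in ?M. Z h x = DS ub h x" by simp_all
  have wg: "has_weak_grad \<Omega> (Z h) (wgrad \<Omega> (DS ub h))" if h: "h \<in> Lp \<Omega> p" for h
  proof (rule has_weak_grad_cong_AE[OF \<Omega>(1) W1_has_weak_grad[OF DW[OF h]]])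
    show "AE x in ?M. DS ub h x = Z h x" using Z(3)[OF h] by eventually_elim simp
    show "loc_integrable \<Omega> (Z h)"
      by (rule loc_integrable_continuous[OF lipschitz_on_continuous_on[OF Z(1)[OF h]]])
  qed
  define g where "g x = S ub x - yd x" for x
  have gL: "g \<in> Lp \<Omega> 2" unfolding g_def[abs_def] by (rule Lp2diff[OF binf[OF SW[OF ub3]] yd])
  have gm: "g \<in> borel_measurable ?M" and g2: "integrable ?M (\<lambda>x. (g x)\<^sup>2)"
    using L2_2[OF gL] by simp_all
  define a where "a = wgrad \<Omega> (S ub)"
  have am: "a \<in> borel_measurable ?M" unfolding a_def by (rule W1_wgrad_measurable[OF SW[OF ub3]])
  have ab: "AE x in ?M. norm (a x) \<le> W1_norm \<Omega> \<infinity> (S ub)"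
    unfolding a_def by (rule W1_infty_AE_le(2)[OF SW[OF ub3]])
  have "\<exists>\<phi>\<in>W1_0 \<Omega> 2. (\<forall>\<psi>\<in>test_functions \<Omega>.
      (\<integral>x. dflux (a x) (wgrad \<Omega> \<phi> x) \<bullet> grad \<psi> x \<partial>?M) = (\<integral>x. g x * \<psi> x \<partial>?M)) \<and>
    integrable ?M (\<lambda>x. (\<phi> x)\<^sup>2) \<and>
    (\<forall>h\<in>Lp \<Omega> p. integrable ?M (\<lambda>x. (h x)\<^sup>2) \<longrightarrow> (\<integral>x. \<phi> x * h x \<partial>?M) = (\<integral>x. g x * Z h x \<partial>?M))"
  \<comment> \<open>Here \<open>P\<close> is \<open>L\<^sup>p\<close>, and the weak gradient of
    \<open>Z h\<close> is represented by that of \<open>DS ub h\<close>.\<close>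
  proof (rule adjoint_state_exists[OF \<Omega> am ab _ _ Z(1,2) wg _ _ gm g2])
    show "h \<in> Lp \<Omega> p" if "h \<in> Lspace \<infinity> ?M" for h by (rule Lspace_infty_subset[OF fm that])
    show "integrable ?M h" if "h \<in> Lp \<Omega> p" for h by (rule Lspace_integrable[OF fm p1 that])
    show "AE x in ?M. norm (wgrad \<Omega> (DS ub h) x) \<le> W1_norm \<Omega> \<infinity> (DS ub h)" if "h \<in> Lp \<Omega> p" for h
      by (rule W1_infty_AE_le(2)[OF DW[OF that]])
    show "(\<integral>x. dflux (a x) (wgrad \<Omega> (DS ub h) x) \<bullet> grad \<psi> x \<partial>?M) = (\<integral>x. h x * \<psi> x \<partial>?M)"
      if "h \<in> Lp \<Omega> p" "\<psi> \<in> test_functions \<Omega>" for h \<psi>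
      unfolding a_def by (rule linearized_state_equation[OF \<Omega> p1 U3(1) S embedding ub3 that])
  qed
  then obtain \<phi> where \<phi>0: "\<phi> \<in> W1_0 \<Omega> 2"
    and \<phi>eq: "\<forall>\<psi>\<in>test_functions \<Omega>. (\<integral>x. dflux (a x) (wgrad \<Omega> \<phi> x) \<bullet> grad \<psi> x \<partial>?M) = (\<integral>x. g x * \<psi> x \<partial>?M)"
    and \<phi>2: "integrable ?M (\<lambda>x. (\<phi> x)\<^sup>2)"
    and dual: "\<forall>h\<in>Lp \<Omega> p. integrable ?M (\<lambda>x. (h x)\<^sup>2) \<longrightarrow> (\<integral>x. \<phi> x * h x \<partial>?M) = (\<integral>x. g x * Z h x \<partial>?M)"
    by blast
  have \<phi>m: "\<phi> \<in> borel_measurable ?M" and wL: "wgrad \<Omega> \<phi> \<in> Lspace 2 ?M"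
    using \<phi>0 unfolding W1_0_def W1_def by (blast intro: Lspace_measurable)+
  have adj: "adjoint_equation \<Omega> (S ub) yd \<phi>"
    unfolding adjoint_equation_def has_weak_div_def A_coeff_mult_vec a_def[symmetric]
  proof (intro conjI ballI)
    have wi: "integrable ?M (wgrad \<Omega> \<phi>)"
      by (rule Lspace_integrable[OF fm, of 2]) (use wL in simp_all)
    have "integrable ?M (\<lambda>x. dflux (a x) (wgrad \<Omega> \<phi> x))"
    proof (rule Bochner_Integration.integrable_bound[of _ "\<lambda>x. 2 *\<^sub>R wgrad \<Omega> \<phi> x"])
      show "AE x in ?M. norm (dflux (a x) (wgrad \<Omega> \<phi> x)) \<le> norm (2 *\<^sub>R wgrad \<Omega> \<phi> x)"
        by (rule AE_I2) (simp add: norm_dflux_le)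
      show "(\<lambda>x. dflux (a x) (wgrad \<Omega> \<phi> x)) \<in> borel_measurable ?M"
        by (rule measurable_dflux[OF am Lspace_measurable[OF wL]])
    qed (use wi in simp)
    then show "loc_integrable \<Omega> (\<lambda>x. dflux (a x) (wgrad \<Omega> \<phi> x))"
      by (rule loc_integrable_integrable[OF _ \<Omega>(1)])
    have gi: "integrable ?M g"
      by (rule Lspace_integrable[OF fm, of 2]) (use gL in simp_all)
    show "loc_integrable \<Omega> (\<lambda>x. - (S ub x - yd x))"
      by (rule loc_integrable_integrable[OF Bochner_Integration.integrable_minus[OF gi, unfolded g_def] \<Omega>(1)])
    show "(\<integral>x. dflux (a x) (wgrad \<Omega> \<phi> x) \<bullet> grad \<psi> x \<partial>?M) = - (\<integral>x. - (S ub x - yd x) * \<psi> x \<partial>?M)"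
      if "\<psi> \<in> test_functions \<Omega>" for \<psi>
    proof -
      have "(\<integral>x. - (S ub x - yd x) * \<psi> x \<partial>?M) = (\<integral>x. - (g x * \<psi> x) \<partial>?M)"
        by (simp add: g_def algebra_simps)
      then show ?thesis using \<phi>eq that by simp
    qed
  qed
  have vi: "(\<integral>x. (\<phi> x + \<alpha> * ub x) * (u x - ub x) \<partial>?M) \<ge> 0" if u: "u \<in> U_ad \<Omega> p \<theta>" for u
  proof -
    define h where "h x = u x - ub x" for x
    have uL: "u \<in> Lp \<Omega> p" "u \<in> Lp \<Omega> 2" "ub \<in> Lp \<Omega> p" "ub \<in> Lp \<Omega> 2"
      using u ubad by (auto simp: U_ad_def)
    have hp: "h \<in> Lp \<Omega> p" using Lspace_lincomb[OF uL(1,3), of 1 "-1"] by (simp add: h_def[abs_def])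
    have hL: "h \<in> Lp \<Omega> 2" unfolding h_def[abs_def] by (rule Lp2diff[OF uL(2,4)])
    note hm = L2_2(1)[OF hL] and ubm = L2_2(1)[OF uL(4)]
    have h2: "integrable ?M (\<lambda>x. (h x)\<^sup>2)" and ub2: "integrable ?M (\<lambda>x. (ub x)\<^sup>2)"
      using L2_2(2)[OF hL] L2_2(2)[OF uL(4)] by simp_all
    have prod: "integrable ?M (\<lambda>x. f x * k x)" if "f \<in> Lp \<Omega> 2" "k \<in> Lp \<Omega> 2" for f k
      using L2_inner_integrable[OF L2_2[OF that(1)] L2_2[OF that(2)]] by simp
    define z where "z = DS ub h"
    have zW: "z \<in> W1 \<Omega> \<infinity>" unfolding z_def by (rule DW[OF hp])
    have zL: "z \<in> Lp \<Omega> 2" by (rule binf[OF zW])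
    define Zb where "Zb = W1_norm \<Omega> \<infinity> z"
    have zb: "AE x in ?M. \<bar>z x\<bar> \<le> Zb" unfolding Zb_def by (rule W1_infty_AE_le(1)[OF zW])
    have gi: "integrable ?M (\<lambda>x. \<bar>g x\<bar>)"
      using Lspace_integrable[OF fm, of 2 g] gL by (intro integrable_abs) simp
    \<comment> \<open>The directional derivative of the reduced cost at \<open>ub\<close> in
      direction \<open>h\<close>, still expressed by the linearized state \<open>z\<close>.\<close>
    define I where "I = (\<integral>x. g x * z x \<partial>?M) + \<alpha> * (\<integral>x. ub x * h x \<partial>?M)"
    define G1 where "G1 = (\<integral>x. \<bar>g x\<bar> \<partial>?M)"
    define H where "H = (\<integral>x. (h x)\<^sup>2 \<partial>?M)"
    \<comment> \<open>Coefficient of the terms quadratic in \<open>t\<close>, from the change of the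
      state and from the change of the control.\<close>
    define K where "K = ((Zb + 1)\<^sup>2 * measure ?M (space ?M) + \<alpha> * H) / 2"
    have G1: "G1 \<ge> 0" by (simp add: G1_def)
    have K: "K \<ge> 0" using \<alpha> by (simp add: K_def H_def)
    obtain \<epsilon>1 where \<epsilon>1: "\<epsilon>1 > 0" "\<And>w. w \<in> U_ad \<Omega> p \<theta> \<Longrightarrow> Lp_norm \<Omega> p (w - ub) \<le> \<epsilon>1 \<Longrightarrow> J \<Omega> S yd \<alpha> w \<ge> J \<Omega> S yd \<alpha> ub"
      using opt unfolding local_optimal_def by blast
    define N where "N = Lp_norm \<Omega> p h"
    have N: "N \<ge> 0" by (simp add: N_def Lnorm_nonneg)
    \<comment> \<open>\<open>\<epsilon>\<close> bounds both the linearization error per unit step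
      and the step itself. Dividing the optimality inequality by the step leaves the derivative plus
      an error of order \<open>\<epsilon>\<close>.\<close>
    have key: "0 \<le> I + \<epsilon> * (G1 + K)" if \<epsilon>: "0 < \<epsilon>" "\<epsilon> < 1" for \<epsilon>
    proof -
      from state_expansion[OF \<Omega>(1) p0 U3(1) S embedding ub3 hp \<epsilon>(1)] obtain t0 where t0: "t0 > 0"
        "\<And>t. 0 < t \<and> t < t0 \<Longrightarrow> (\<lambda>x. ub x + t * h x) \<in> U3 \<and>
          (AE x in ?M. \<bar>S (\<lambda>x. ub x + t * h x) x - S ub x - t * z x\<bar> \<le> \<epsilon> * t)"
        unfolding z_def by blast
      \<comment> \<open>Small enough for the expansion, for the quadratic terms and for the
        neighbourhood of optimality; \<open>t \<le> \<epsilon> < 1\<close> also makes the convexity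
        of the admissible set applicable.\<close>
      define t where "t = min (t0 / 2) (min \<epsilon> (\<epsilon>1 / (N + 1)))"
      have t: "0 < t" "t < t0" "t \<le> \<epsilon>" "t \<le> 1" "t * N \<le> \<epsilon>1"
      proof -
        show tp: "0 < t" using t0(1) \<epsilon> \<epsilon>1(1) N by (simp add: t_def)
        show "t < t0" using t0(1) unfolding t_def by linarith
        show te: "t \<le> \<epsilon>" unfolding t_def by linarith
        then show "t \<le> 1" using \<epsilon> by linarith
        have "t * N \<le> t * (N + 1)" using tp by simp
        also have "\<dots> \<le> \<epsilon>1 / (N + 1) * (N + 1)" using N by (intro mult_right_mono) (auto simp: t_def)
        also have "\<dots> = \<epsilon>1" using N by simp
        finally show "t * N \<le> \<epsilon>1" .
      qed
      let ?w = "\<lambda>x. ub x + t * h x"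
      have wad: "?w \<in> U_ad \<Omega> p \<theta>"
        using U_ad_convex[OF p1 _ ubad u, of t] \<theta>(1) t(1,4) by (simp add: h_def)
      have w3: "?w \<in> U3" by (rule adU3[OF wad])
      have r: "AE x in ?M. \<bar>S ?w x - S ub x - t * z x\<bar> \<le> \<epsilon> * t" using t0(2)[of t] t(1,2) by blast
      have "?w - ub = (\<lambda>x. t * h x)" by (simp add: fun_eq_iff)
      then have "Lp_norm \<Omega> p (?w - ub) = t * N"
        using Lnorm_scale[OF p0, of ?M t h] t(1) by (simp add: N_def)
      then have Jle: "J \<Omega> S yd \<alpha> ub \<le> J \<Omega> S yd \<alpha> ?w" using \<epsilon>1(2)[OF wad] t(5) by simp
      have sq: "(Lp_norm \<Omega> 2 f)\<^sup>2 = (\<integral>x. (f x)\<^sup>2 \<partial>?M)" for f :: "real^'n \<Rightarrow> real"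
        by (simp add: Lnorm_2)
      have Jf: "J \<Omega> S yd \<alpha> w = 1 / 2 * (\<integral>x. (S w x - yd x)\<^sup>2 \<partial>?M) + \<alpha> / 2 * (\<integral>x. (w x)\<^sup>2 \<partial>?M)" for w
        unfolding J_def sq by simp
      have fL: "(\<lambda>x. S ?w x - yd x) \<in> Lp \<Omega> 2" by (rule Lp2diff[OF binf[OF SW[OF w3]] yd])
      have f2: "integrable ?M (\<lambda>x. (S ?w x - yd x)\<^sup>2)" using L2_2(2)[OF fL] by simp
      have gz: "integrable ?M (\<lambda>x. g x * z x)" by (rule prod[OF gL zL])
      have bi: "integrable ?M (\<lambda>x. (g x)\<^sup>2 + 2 * t * (g x * z x) + 2 * t * \<epsilon> * \<bar>g x\<bar> + t\<^sup>2 * (Zb + 1)\<^sup>2)"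
        using g2 gz gi by simp
      have "(\<integral>x. (S ?w x - yd x)\<^sup>2 \<partial>?M)
        \<le> (\<integral>x. (g x)\<^sup>2 + 2 * t * (g x * z x) + 2 * t * \<epsilon> * \<bar>g x\<bar> + t\<^sup>2 * (Zb + 1)\<^sup>2 \<partial>?M)"
      proof (rule integral_mono_AE[OF f2 bi])
        show "AE x in ?M. (S ?w x - yd x)\<^sup>2 \<le> (g x)\<^sup>2 + 2 * t * (g x * z x) + 2 * t * \<epsilon> * \<bar>g x\<bar> + t\<^sup>2 * (Zb + 1)\<^sup>2"
          using r zb
        proof eventually_elim
          case (elim x)
          \<comment> \<open>The linearization error. In the product with \<open>g\<close> its bound
            \<open>\<epsilon> * t\<close> is kept, while in the square the cruder bound
            \<open>t\<close> is enough.\<close>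
          define \<rho> where "\<rho> = S ?w x - S ub x - t * z x"
          have \<rho>: "\<bar>\<rho>\<bar> \<le> \<epsilon> * t" using elim(1) by (simp add: \<rho>_def)
          have e: "S ?w x - yd x = g x + (t * z x + \<rho>)" by (simp add: \<rho>_def g_def)
          have "\<bar>t * z x + \<rho>\<bar> \<le> \<bar>t * z x\<bar> + \<bar>\<rho>\<bar>" by (rule abs_triangle_ineq)
          also have "\<dots> \<le> t * Zb + 1 * t"
          proof (intro add_mono)
            show "\<bar>t * z x\<bar> \<le> t * Zb" using elim(2) t(1) by (simp add: abs_mult)
            have "\<epsilon> * t \<le> 1 * t" using \<epsilon> t(1) by (intro mult_right_mono) auto
            then show "\<bar>\<rho>\<bar> \<le> 1 * t" using \<rho> by linarith
          qed
          finally have "\<bar>t * z x + \<rho>\<bar> \<le> t * (Zb + 1)" by (simp add: algebra_simps)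
          then have "(t * z x + \<rho>)\<^sup>2 \<le> (t * (Zb + 1))\<^sup>2"
            using power_mono[of "\<bar>t * z x + \<rho>\<bar>" "t * (Zb + 1)" 2] by simp
          moreover have "g x * \<rho> \<le> \<bar>g x\<bar> * (\<epsilon> * t)"
            using mult_left_mono[OF \<rho> abs_ge_zero[of "g x"]] abs_ge_self[of "g x * \<rho>"] by (simp add: abs_mult)
          ultimately show ?case
            unfolding e by (simp add: power2_eq_square algebra_simps)
        qed
      qed
      also have "\<dots> = (\<integral>x. (g x)\<^sup>2 \<partial>?M) + 2 * t * (\<integral>x. g x * z x \<partial>?M) + 2 * t * \<epsilon> * G1 + t\<^sup>2 * (Zb + 1)\<^sup>2 * measure ?M (space ?M)"
        using g2 gz gi by (simp add: G1_def Bochner_Integration.integral_add)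
      finally have est1: "(\<integral>x. (S ?w x - yd x)\<^sup>2 \<partial>?M)
        \<le> (\<integral>x. (g x)\<^sup>2 \<partial>?M) + 2 * t * (\<integral>x. g x * z x \<partial>?M) + 2 * t * \<epsilon> * G1 + t\<^sup>2 * (Zb + 1)\<^sup>2 * measure ?M (space ?M)" .
      have ubh: "integrable ?M (\<lambda>x. ub x * h x)" by (rule prod[OF uL(4) hL])
      have "(\<integral>x. (?w x)\<^sup>2 \<partial>?M) = (\<integral>x. (ub x)\<^sup>2 + 2 * t * (ub x * h x) + t\<^sup>2 * (h x)\<^sup>2 \<partial>?M)"
        by (intro Bochner_Integration.integral_cong refl) (simp add: power2_eq_square algebra_simps)
      also have "\<dots> = (\<integral>x. (ub x)\<^sup>2 \<partial>?M) + 2 * t * (\<integral>x. ub x * h x \<partial>?M) + t\<^sup>2 * H"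
        using ub2 ubh h2 by (simp add: H_def Bochner_Integration.integral_add)
      finally have est2: "(\<integral>x. (?w x)\<^sup>2 \<partial>?M) = (\<integral>x. (ub x)\<^sup>2 \<partial>?M) + 2 * t * (\<integral>x. ub x * h x \<partial>?M) + t\<^sup>2 * H" .
      have "1 / 2 * (\<integral>x. (g x)\<^sup>2 \<partial>?M) + \<alpha> / 2 * (\<integral>x. (ub x)\<^sup>2 \<partial>?M)
        \<le> 1 / 2 * (\<integral>x. (S ?w x - yd x)\<^sup>2 \<partial>?M) + \<alpha> / 2 * (\<integral>x. (?w x)\<^sup>2 \<partial>?M)"
        using Jle unfolding Jf g_def .
      also have "\<dots> \<le> 1 / 2 * ((\<integral>x. (g x)\<^sup>2 \<partial>?M) + 2 * t * (\<integral>x. g x * z x \<partial>?M) + 2 * t * \<epsilon> * G1 + t\<^sup>2 * (Zb + 1)\<^sup>2 * measure ?M (space ?M))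
          + \<alpha> / 2 * ((\<integral>x. (ub x)\<^sup>2 \<partial>?M) + 2 * t * (\<integral>x. ub x * h x \<partial>?M) + t\<^sup>2 * H)"
        unfolding est2 using est1 by (intro add_right_mono mult_left_mono) auto
      finally have "0 \<le> t * (I + \<epsilon> * G1 + t * K)"
        by (simp add: I_def K_def power2_eq_square algebra_simps add_divide_distrib)
      then have "0 \<le> I + \<epsilon> * G1 + t * K" using t(1) by (simp add: zero_le_mult_iff)
      also have "\<dots> \<le> I + \<epsilon> * G1 + \<epsilon> * K" using t(3) K by (intro add_left_mono mult_right_mono)
      finally show ?thesis by (simp add: algebra_simps)
    qed
    have "I \<ge> 0"
    proof (rule ccontr)
      assume "\<not> I \<ge> 0"
      then have I: "I < 0" by simp
      \<comment> \<open>The error in \<open>key\<close> then stays below half of \<open>- I\<close>,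
        contradicting its nonnegativity; 1/2 keeps \<open>\<epsilon>\<close> below 1.\<close>
      define \<epsilon> where "\<epsilon> = min (1 / 2) (- I / (2 * (G1 + K + 1)))"
      have pos: "G1 + K + 1 > 0" using G1 K by simp
      have "0 < - I / (2 * (G1 + K + 1))" using I pos by (intro divide_pos_pos) auto
      then have \<epsilon>: "0 < \<epsilon>" "\<epsilon> < 1" unfolding \<epsilon>_def by linarith+
      have "\<epsilon> * (G1 + K) \<le> \<epsilon> * (G1 + K + 1)" using \<epsilon> by simp
      also have "\<dots> \<le> - I / (2 * (G1 + K + 1)) * (G1 + K + 1)" using pos by (intro mult_right_mono) (auto simp: \<epsilon>_def)
      also have "\<dots> = - I / 2" using pos by (simp add: field_simps)
      finally show False using key[OF \<epsilon>] I by linarith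
    qed
    moreover have "(\<integral>x. (\<phi> x + \<alpha> * ub x) * (u x - ub x) \<partial>?M) = I"
    proof -
      have \<phi>L: "\<phi> \<in> Lp \<Omega> 2" using \<phi>m \<phi>2 by (simp add: Lspace_2_iff)
      have "(\<integral>x. (\<phi> x + \<alpha> * ub x) * (u x - ub x) \<partial>?M) = (\<integral>x. \<phi> x * h x + \<alpha> * (ub x * h x) \<partial>?M)"
        by (intro Bochner_Integration.integral_cong refl) (simp add: h_def algebra_simps)
      also have "\<dots> = (\<integral>x. \<phi> x * h x \<partial>?M) + \<alpha> * (\<integral>x. ub x * h x \<partial>?M)"
        using prod[OF \<phi>L hL] prod[OF uL(4) hL] by (simp add: Bochner_Integration.integral_add)
      also have "(\<integral>x. \<phi> x * h x \<partial>?M) = (\<integral>x. g x * Z h x \<partial>?M)" using dual hp h2 by blast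
      \<comment> \<open>The duality relation speaks of the continuous representative
        \<open>Z h\<close>, which is exchanged for \<open>z\<close> almost everywhere.\<close>
      also have "\<dots> = (\<integral>x. g x * z x \<partial>?M)"
      proof (rule integral_cong_AE)
        show "(\<lambda>x. g x * Z h x) \<in> borel_measurable ?M"
          by (intro borel_measurable_times gm has_weak_grad_measurable(1)[OF \<Omega>(1) wg[OF hp]])
        show "(\<lambda>x. g x * z x) \<in> borel_measurable ?M"
          by (intro borel_measurable_times gm L2_2(1)[OF zL])
        show "AE x in ?M. g x * Z h x = g x * z x"
          using Z(3)[OF hp] by eventually_elim (simp add: z_def)
      qed
      finally show ?thesis by (simp add: I_def)
    qed
    ultimately show ?thesis by simp
  qed
  show ?thesis using SY[OF ub3] \<phi>0 adj vi by blast
qed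

end
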